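(* Let $\Sigma\subset \mathrm{GL}_d(\mathbb{R})$ be a compact subset, let $\mu_0\in\mathrm{Prob}(\Sigma)$ and assume that $L_1(\mu_0)>L_2(\mu_0)$. (1) If $\mu_0$ is quasi-irreducible, then $\mu\mapsto L_1(\mu)$ is real analytic with respect to the total variation norm in a neighbourhood of $\mu_0$. (2) If $\mathrm{supp}(\mu_0)=\Sigma$, then $\mu\mapsto L_1(\mu)$ is real analytic with respect to the total variation norm in a neighbourhood of $\mu_0$. In both items, real analyticity in a neighbourhood of $\mu_0$ means: there exist an open neighbourhood $V$ of $\mu_0$ in $\mathcal{M}_1(\Sigma)$ (for the total variation norm) and a holomorphic function $F:V\to\mathbb{C}$ such that $F(\mu)=L_1(\mu)$ for every $\mu\in V\cap\mathrm{Prob}(\Sigma)$.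
   Context: $\mathrm{Prob}(\Sigma)$ is the set of Borel probability measures on $\Sigma$. For $\mu\in\mathrm{Prob}(\Sigma)$ let $g_0,g_1,\dots$ be i.i.d. random matrices with law $\mu$. The Lyapunov exponents $L_1(\mu)\ge\dots\ge L_d(\mu)$ are the almost sure limits $L_i(\mu)=\lim_{n}\frac1n\log s_i(g_{n-1}\cdots g_0)$, where $s_1\ge\dots\ge s_d$ are singular values; in particular $L_1(\mu)=\lim_n\frac1n\log\|g_{n-1}\cdots g_0\|$. A linear subspace $V\subset\mathbb{R}^d$ is $\mu$-invariant if $gV=V$ for $\mu$-a.e. $g$; for such $V\ne\{0\}$, $L_1(\mu|_V)$ is the a.s. limit of $\frac1n\log\|(g_{n-1}\cdots g_0)|_V\|$. The measure $\mu$ is quasi-irreducible if there is no proper $\mu$-invariant subspace $V$ ($\{0\}\ne V\subsetneq\mathbb{R}^d$) with $L_1(\mu|_V)<L_1(\mu)$. $\mathcal{M}(\Sigma)$ is the complex Banach space of complex Borel measures of bounded variation on $\Sigma$ with the total variation norm $\|\mu\|=|\mu|(\Sigma)$. $\mathcal{M}_0(\Sigma)=\{\nu\in\mathcal{M}(\Sigma):\nu(\Sigma)=0\}$ is a closed subspace, and $\mathcal{M}_1(\Sigma)=\{\nu\in\mathcal{M}(\Sigma):\nu(\Sigma)=1\}=\mu_0+\mathcal{M}_0(\Sigma)$ is the corresponding affine Banach space. A function $f:U\to N$ from an open subset $U$ of a complex Banach space $M$ to a complex Banach space $N$ is holomorphic if for each $a\in U$ there are $r>0$ and continuous symmetric $n$-linear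 maps $T_n:M^n\to N$ ($T_0$ a constant) with $f(x)=\sum_{n\ge0}T_n(x-a,\dots,x-a)$ for all $x\in B(a,r)\subset U$. A function on an open subset of an affine Banach space $V_0=v_0+V$ is holomorphic if it becomes holomorphic on an open subset of $V$ after translation by $-v_0$. *)

theory Defs
  imports "HOL-Probability.Probability" "HOL-Library.Function_Algebras"
begin

section \<open>Lyapunov exponents of random matrix products\<close>

abbreviation borel_of :: "'a::topological_space set \<Rightarrow> 'a measure" where
  "borel_of \<Sigma> \<equiv> restrict_space borel \<Sigma>"

definition Prob :: "'a::topological_space set \<Rightarrow> 'a measure set" where
  "Prob \<Sigma> = {\<mu>. prob_space \<mu> \<and> sets \<mu> = sets (borel_of \<Sigma>)}"

definition supp :: "'a::topological_space measure \<Rightarrow> 'a set" where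
  "supp \<mu> = {x \<in> space \<mu>. \<forall>U. open U \<longrightarrow> x \<in> U \<longrightarrow> emeasure \<mu> (U \<inter> space \<mu>) > 0}"

text \<open>The singular values of \<open>A\<close> are the square roots of the eigenvalues of \<open>A\<^sup>T A\<close>, listed in
  nonincreasing order and repeated according to multiplicity. Since \<open>A\<^sup>T A\<close> is symmetric, the
  multiplicity of an eigenvalue is the dimension of its eigenspace.\<close>

definition right_singular_space :: "real^'n^'n \<Rightarrow> real \<Rightarrow> (real^'n) set" where
  "right_singular_space A s = {x. (transpose A ** A) *v x = s\<^sup>2 *\<^sub>R x}"

definition singular_values :: "real^'n^'n \<Rightarrow> real list" where
  "singular_values A =
     concat (map (\<lambda>s. replicate (dim (right_singular_space A s)) s)
       (rev (sorted_list_of_set {s. 0 \<le> s \<and> (\<exists>x\<in>right_singular_space A s. x \<noteq> 0)})))"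

text \<open>Indices start at 1, so that \<open>singular_value 1 A\<close> is the largest singular value.\<close>

definition singular_value :: "nat \<Rightarrow> real^'n^'n \<Rightarrow> real" where
  "singular_value i A = singular_values A ! (i - 1)"

text \<open>\<open>mat_prod g n\<close> is the product of \<open>g (n - 1), \<dots>, g 0\<close>, in this order.\<close>

primrec mat_prod :: "(nat \<Rightarrow> real^'n^'n) \<Rightarrow> nat \<Rightarrow> real^'n^'n" where
  "mat_prod g 0 = mat 1"
| "mat_prod g (Suc n) = g n ** mat_prod g n"

text \<open>The coordinates of the following space are i.i.d. with law \<open>\<mu>\<close>.\<close>

definition iid_space :: "'a measure \<Rightarrow> (nat \<Rightarrow> 'a) measure" where
  "iid_space \<mu> = PiM UNIV (\<lambda>_. \<mu>)"

definition lyapunov :: "nat \<Rightarrow> (real^'n^'n) measure \<Rightarrow> real" where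
  "lyapunov i \<mu> =
     (THE l. AE g in iid_space \<mu>. (\<lambda>n. ln (singular_value i (mat_prod g n)) / real n) \<longlonglongrightarrow> l)"

definition invariant_subspace :: "(real^'n^'n) measure \<Rightarrow> (real^'n) set \<Rightarrow> bool" where
  "invariant_subspace \<mu> V \<longleftrightarrow> subspace V \<and> (AE g in \<mu>. (\<lambda>x. g *v x) ` V = V)"

text \<open>Operator norm of the restriction of \<open>A\<close> to the subspace \<open>V\<close>, written as in the library
  definition of \<^term>\<open>onorm\<close>; the vector \<open>0\<close> contributes the value \<open>0 / 0 = 0\<close>.\<close>

definition onorm_restr :: "(real^'n) set \<Rightarrow> real^'n^'n \<Rightarrow> real" where
  "onorm_restr V A = (SUP x\<in>V. norm (A *v x) / norm x)"

definition lyapunov_restr :: "(real^'n) set \<Rightarrow> (real^'n^'n) measure \<Rightarrow> real" where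
  "lyapunov_restr V \<mu> =
     (THE l. AE g in iid_space \<mu>. (\<lambda>n. ln (onorm_restr V (mat_prod g n)) / real n) \<longlonglongrightarrow> l)"

definition quasi_irreducible :: "(real^'n^'n) measure \<Rightarrow> bool" where
  "quasi_irreducible \<mu> \<longleftrightarrow>
     \<not> (\<exists>V. invariant_subspace \<mu> V \<and> V \<noteq> {0} \<and> V \<noteq> UNIV \<and> lyapunov_restr V \<mu> < lyapunov 1 \<mu>)"

section \<open>Complex measures and the total variation norm\<close>

text \<open>A complex measure is a set function that is normalised to be \<open>0\<close> on nonmeasurable sets, so
  that equality and the vector space operations (both pointwise) are the usual ones.\<close>

definition total_variation :: "'a measure \<Rightarrow> ('a set \<Rightarrow> complex) \<Rightarrow> ennreal" where
  "total_variation M \<nu> =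
     (SUP P\<in>{P. finite P \<and> partition_on (space M) P \<and> P \<subseteq> sets M}. \<Sum>A\<in>P. ennreal (cmod (\<nu> A)))"

definition complex_measures :: "'a measure \<Rightarrow> ('a set \<Rightarrow> complex) set" where
  "complex_measures M =
     {\<nu>. (\<forall>A. A \<notin> sets M \<longrightarrow> \<nu> A = 0) \<and> \<nu> {} = 0 \<and>
         (\<forall>A::nat \<Rightarrow> 'a set. range A \<subseteq> sets M \<longrightarrow> disjoint_family A \<longrightarrow>
            (\<lambda>n. \<nu> (A n)) sums \<nu> (\<Union>n. A n)) \<and>
         total_variation M \<nu> < \<infinity>}"

definition tv_norm :: "'a measure \<Rightarrow> ('a set \<Rightarrow> complex) \<Rightarrow> real" where
  "tv_norm M \<nu> = enn2real (total_variation M \<nu>)"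

definition cmeas :: "'a::topological_space set \<Rightarrow> ('a set \<Rightarrow> complex) set" where
  "cmeas \<Sigma> = complex_measures (borel_of \<Sigma>)"

definition cmeas0 :: "'a::topological_space set \<Rightarrow> ('a set \<Rightarrow> complex) set" where
  "cmeas0 \<Sigma> = {\<nu> \<in> cmeas \<Sigma>. \<nu> \<Sigma> = 0}"

definition cmeas1 :: "'a::topological_space set \<Rightarrow> ('a set \<Rightarrow> complex) set" where
  "cmeas1 \<Sigma> = {\<nu> \<in> cmeas \<Sigma>. \<nu> \<Sigma> = 1}"

abbreviation tv :: "'a::topological_space set \<Rightarrow> ('a set \<Rightarrow> complex) \<Rightarrow> real" where
  "tv \<Sigma> \<equiv> tv_norm (borel_of \<Sigma>)"

text \<open>The inclusion of positive finite measures; \<^term>\<open>measure \<mu>\<close> vanishes on nonmeasurable sets.\<close>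

definition cm_of :: "'a measure \<Rightarrow> 'a set \<Rightarrow> complex" where
  "cm_of \<mu> = (\<lambda>A. of_real (measure \<mu> A))"

section \<open>Holomorphic functions on Banach spaces of complex-valued functions\<close>

text \<open>The complex vector space \<open>E\<close> is a carrier set of complex-valued functions with pointwise
  operations, and \<open>N\<close> is its norm.\<close>

definition norm_dist :: "(('b \<Rightarrow> complex) \<Rightarrow> real) \<Rightarrow> ('b \<Rightarrow> complex) \<Rightarrow> ('b \<Rightarrow> complex) \<Rightarrow> real" where
  "norm_dist N x y = N (x - y)"

definition norm_topology ::
  "('b \<Rightarrow> complex) set \<Rightarrow> (('b \<Rightarrow> complex) \<Rightarrow> real) \<Rightarrow> ('b \<Rightarrow> complex) topology" where
  "norm_topology E N = Metric_space.mtopology E (norm_dist N)"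

text \<open>Elements of \<open>E\<^sup>n\<close> are the extensional functions in \<open>{..<n} \<rightarrow>\<^sub>E E\<close>. For \<open>n = 0\<close> this is a
  singleton, and the condition below is void.\<close>

definition cont_sym_multilinear ::
  "('b \<Rightarrow> complex) set \<Rightarrow> (('b \<Rightarrow> complex) \<Rightarrow> real) \<Rightarrow> nat \<Rightarrow> ((nat \<Rightarrow> 'b \<Rightarrow> complex) \<Rightarrow> complex) \<Rightarrow> bool"
where
  "cont_sym_multilinear E N n T \<longleftrightarrow>
     (\<forall>v \<in> {..<n} \<rightarrow>\<^sub>E E. \<forall>i<n.
        (\<forall>x\<in>E. \<forall>y\<in>E. T (v(i := x + y)) = T (v(i := x)) + T (v(i := y))) \<and>
        (\<forall>x\<in>E. \<forall>c. T (v(i := (\<lambda>b. c * x b))) = c * T (v(i := x)))) \<and>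
     (\<forall>v \<in> {..<n} \<rightarrow>\<^sub>E E. \<forall>p. p permutes {..<n} \<longrightarrow> T (v \<circ> p) = T v) \<and>
     continuous_map (product_topology (\<lambda>_. norm_topology E N) {..<n}) euclidean T"

definition holomorphic_in ::
  "('b \<Rightarrow> complex) set \<Rightarrow> (('b \<Rightarrow> complex) \<Rightarrow> real) \<Rightarrow> ('b \<Rightarrow> complex) set \<Rightarrow>
     (('b \<Rightarrow> complex) \<Rightarrow> complex) \<Rightarrow> bool" where
  "holomorphic_in E N U f \<longleftrightarrow>
     openin (norm_topology E N) U \<and>
     (\<forall>a\<in>U. \<exists>r>0. \<exists>T.
        Metric_space.mball E (norm_dist N) a r \<subseteq> U \<and>
        (\<forall>n. cont_sym_multilinear E N n (T n)) \<and>
        (\<forall>x \<in> Metric_space.mball E (norm_dist N) a r.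
           (\<lambda>n. T n (\<lambda>i\<in>{..<n}. x - a)) sums f x))"

text \<open>The affine space here is \<open>v0 + E\<close>.\<close>

definition holomorphic_in_affine ::
  "('b \<Rightarrow> complex) \<Rightarrow> ('b \<Rightarrow> complex) set \<Rightarrow> (('b \<Rightarrow> complex) \<Rightarrow> real) \<Rightarrow> ('b \<Rightarrow> complex) set \<Rightarrow>
     (('b \<Rightarrow> complex) \<Rightarrow> complex) \<Rightarrow> bool" where
  "holomorphic_in_affine v0 E N V F \<longleftrightarrow>
     holomorphic_in E N ((\<lambda>x. x - v0) ` V) (\<lambda>y. F (v0 + y))"

definition real_analytic_near ::
  "'a::topological_space set \<Rightarrow> 'a measure \<Rightarrow> ('a measure \<Rightarrow> real) \<Rightarrow> bool" where
  "real_analytic_near \<Sigma> \<mu>0 \<Phi> \<longleftrightarrow>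
     (\<exists>V F. openin (norm_topology (cmeas1 \<Sigma>) (tv \<Sigma>)) V \<and> cm_of \<mu>0 \<in> V \<and>
            holomorphic_in_affine (cm_of \<mu>0) (cmeas0 \<Sigma>) (tv \<Sigma>) V F \<and>
            (\<forall>\<mu>\<in>Prob \<Sigma>. cm_of \<mu> \<in> V \<longrightarrow> F (cm_of \<mu>) = of_real (\<Phi> \<mu>)))"

section \<open>Basic facts\<close>

lemma variation_sum_le:
  assumes "finite P" "partition_on (space M) P" "P \<subseteq> sets M"
  shows "(\<Sum>A\<in>P. ennreal (cmod (\<nu> A))) \<le> total_variation M \<nu>"
  unfolding total_variation_def by (rule SUP_upper) (use assms in auto)

lemma total_variation_zero: "total_variation M 0 = 0"
proof -
  have "total_variation M 0 \<le> 0"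
    unfolding total_variation_def by (rule SUP_least) simp
  then show ?thesis by simp
qed

lemma total_variation_diff:
  "total_variation M (\<nu> - \<kappa>) \<le> total_variation M \<nu> + total_variation M \<kappa>"
  unfolding total_variation_def[of M "\<nu> - \<kappa>"]
proof (rule SUP_least)
  fix P assume "P \<in> {P. finite P \<and> partition_on (space M) P \<and> P \<subseteq> sets M}"
  then have P: "finite P" "partition_on (space M) P" "P \<subseteq> sets M" by auto
  have "(\<Sum>A\<in>P. ennreal (cmod ((\<nu> - \<kappa>) A)))
      \<le> (\<Sum>A\<in>P. ennreal (cmod (\<nu> A)) + ennreal (cmod (\<kappa> A)))"
    by (rule sum_mono) (simp add: norm_triangle_ineq4 flip: ennreal_plus)
  also have "\<dots> \<le> total_variation M \<nu> + total_variation M \<kappa>"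
    unfolding sum.distrib by (intro add_mono variation_sum_le P)
  finally show "(\<Sum>A\<in>P. ennreal (cmod ((\<nu> - \<kappa>) A)))
      \<le> total_variation M \<nu> + total_variation M \<kappa>" .
qed

lemma total_variation_minus_commute:
  "total_variation M (\<nu> - \<kappa>) = total_variation M (\<kappa> - \<nu>)"
  by (simp add: total_variation_def norm_minus_commute)

lemma cmod_le_total_variation:
  assumes "A \<in> sets M" "A \<noteq> {}"
  shows "ennreal (cmod (\<nu> A)) \<le> total_variation M \<nu>"
proof -
  define P where "P = {A, space M - A} - {{}}"
  have sub: "A \<subseteq> space M" using assms sets.sets_into_space by blast
  have "ennreal (cmod (\<nu> A)) = (\<Sum>B\<in>{A}. ennreal (cmod (\<nu> B)))" by simp
  also have "\<dots> \<le> (\<Sum>B\<in>P. ennreal (cmod (\<nu> B)))"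
    by (rule sum_mono2) (use assms in \<open>auto simp: P_def\<close>)
  also have "\<dots> \<le> total_variation M \<nu>"
    by (rule variation_sum_le)
      (use assms sub in \<open>auto simp: P_def partition_on_def disjoint_def\<close>)
  finally show ?thesis .
qed

lemma diff_in_complex_measures:
  assumes "\<nu> \<in> complex_measures M" "\<kappa> \<in> complex_measures M"
  shows "\<nu> - \<kappa> \<in> complex_measures M"
proof -
  have "total_variation M (\<nu> - \<kappa>) < \<infinity>"
    using total_variation_diff[of M \<nu> \<kappa>] assms
    by (auto simp: complex_measures_def intro: le_less_trans)
  moreover have "(\<lambda>n. (\<nu> - \<kappa>) (A n)) sums (\<nu> - \<kappa>) (\<Union>n. A n)"
    if "range A \<subseteq> sets M" "disjoint_family A" for A :: "nat \<Rightarrow> 'a set"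
  proof -
    have "(\<lambda>n. \<nu> (A n)) sums \<nu> (\<Union>n. A n)" "(\<lambda>n. \<kappa> (A n)) sums \<kappa> (\<Union>n. A n)"
      using assms that unfolding complex_measures_def by blast+
    from sums_diff[OF this] show ?thesis by simp
  qed
  moreover have "\<forall>A. A \<notin> sets M \<longrightarrow> (\<nu> - \<kappa>) A = 0" "(\<nu> - \<kappa>) {} = 0"
    using assms by (simp_all add: complex_measures_def)
  ultimately show ?thesis
    unfolding complex_measures_def by blast
qed

lemma Metric_space_tv: "Metric_space (complex_measures M) (norm_dist (tv_norm M))"
proof
  fix x y :: "'a set \<Rightarrow> complex"
  show "0 \<le> norm_dist (tv_norm M) x y" by (simp add: norm_dist_def tv_norm_def)
  show "norm_dist (tv_norm M) x y = norm_dist (tv_norm M) y x"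
    by (simp add: norm_dist_def tv_norm_def total_variation_minus_commute[of M x y])
next
  fix x y assume x: "x \<in> complex_measures M" and y: "y \<in> complex_measures M"
  have fin: "total_variation M (x - y) < \<infinity>"
    using diff_in_complex_measures[OF x y] by (simp add: complex_measures_def)
  show "norm_dist (tv_norm M) x y = 0 \<longleftrightarrow> x = y"
  proof
    assume "norm_dist (tv_norm M) x y = 0"
    with fin have tv0: "total_variation M (x - y) = 0"
      by (auto simp: norm_dist_def tv_norm_def enn2real_eq_0_iff)
    show "x = y"
    proof
      fix A
      show "x A = y A"
      proof (cases "A \<in> sets M \<and> A \<noteq> {}")
        case True
        then show ?thesis
          using cmod_le_total_variation[of A M "x - y"] tv0 by (simp add: ennreal_eq_0_iff)
      qed (use x y in \<open>auto simp: complex_measures_def\<close>)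
    qed
  qed (simp add: norm_dist_def tv_norm_def total_variation_zero)
next
  fix x y z
  assume x: "x \<in> complex_measures M" and y: "y \<in> complex_measures M"
    and z: "z \<in> complex_measures M"
  have fin: "total_variation M (x - y) < \<infinity>" "total_variation M (z - y) < \<infinity>"
    using diff_in_complex_measures[OF x y] diff_in_complex_measures[OF z y]
    by (simp_all add: complex_measures_def)
  have "total_variation M (x - z) \<le> total_variation M (x - y) + total_variation M (z - y)"
    using total_variation_diff[of M "x - y" "z - y"] by simp
  then have "tv_norm M (x - z) \<le> tv_norm M (x - y) + tv_norm M (z - y)"
    unfolding tv_norm_def using fin
    by (subst enn2real_plus[symmetric]) (auto intro!: enn2real_mono)
  then show "norm_dist (tv_norm M) x z \<le> norm_dist (tv_norm M) x y + norm_dist (tv_norm M) y z"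
    by (simp add: norm_dist_def tv_norm_def total_variation_minus_commute[of M z y])
qed

lemma Metric_space_cmeas0: "Metric_space (cmeas0 \<Sigma>) (norm_dist (tv \<Sigma>))"
  by (rule Metric_space.subspace[OF Metric_space_tv]) (auto simp: cmeas0_def cmeas_def)

lemma Metric_space_cmeas1: "Metric_space (cmeas1 \<Sigma>) (norm_dist (tv \<Sigma>))"
  by (rule Metric_space.subspace[OF Metric_space_tv]) (auto simp: cmeas1_def cmeas_def)

lemma cm_of_in_cmeas1:
  assumes "\<mu> \<in> Prob \<Sigma>"
  shows "cm_of \<mu> \<in> cmeas1 \<Sigma>"
proof -
  have "prob_space \<mu>" and sets: "sets \<mu> = sets (borel_of \<Sigma>)" using assms by (auto simp: Prob_def)
  then interpret prob_space \<mu> by simp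
  have sp: "space \<mu> = space (borel_of \<Sigma>)" using sets by (rule sets_eq_imp_space_eq)
  have tot: "total_variation (borel_of \<Sigma>) (cm_of \<mu>) \<le> 1"
    unfolding total_variation_def
  proof (rule SUP_least)
    fix P assume "P \<in> {P. finite P \<and> partition_on (space (borel_of \<Sigma>)) P \<and> P \<subseteq> sets (borel_of \<Sigma>)}"
    then have P: "finite P" "partition_on (space \<mu>) P" "P \<subseteq> sets \<mu>" by (auto simp: sets sp)
    have "(\<Sum>A\<in>P. ennreal (cmod (cm_of \<mu> A))) = ennreal (\<Sum>A\<in>P. measure \<mu> A)"
      by (simp add: cm_of_def)
    also have "(\<Sum>A\<in>P. measure \<mu> A) = measure \<mu> (\<Union>A\<in>P. A)"
      by (rule finite_measure_finite_Union[symmetric])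
        (use P in \<open>auto simp: partition_on_def disjoint_def disjoint_family_on_def\<close>)
    also have "ennreal \<dots> \<le> 1" by (simp add: ennreal_le_1)
    finally show "(\<Sum>A\<in>P. ennreal (cmod (cm_of \<mu> A))) \<le> 1" .
  qed
  have "cm_of \<mu> \<in> complex_measures (borel_of \<Sigma>)"
    unfolding complex_measures_def
  proof (intro CollectI conjI allI impI)
    fix A assume "A \<notin> sets (borel_of \<Sigma>)"
    then show "cm_of \<mu> A = 0" by (simp add: cm_of_def measure_notin_sets sets)
  next
    fix A :: "nat \<Rightarrow> 'a set" assume "range A \<subseteq> sets (borel_of \<Sigma>)" "disjoint_family A"
    then show "(\<lambda>n. cm_of \<mu> (A n)) sums cm_of \<mu> (\<Union>n. A n)"
      unfolding cm_of_def sums_of_real_iff using sets by (intro finite_measure_UNION) auto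
  next
    show "total_variation (borel_of \<Sigma>) (cm_of \<mu>) < \<infinity>"
      using tot by (rule le_less_trans) simp
  qed (simp add: cm_of_def)
  moreover have "cm_of \<mu> \<Sigma> = 1"
    using prob_space by (simp add: cm_of_def sp space_restrict_space)
  ultimately show ?thesis by (simp add: cmeas1_def cmeas_def)
qed

lemma diff_in_cmeas0:
  assumes "\<nu> \<in> cmeas1 \<Sigma>" "\<kappa> \<in> cmeas1 \<Sigma>"
  shows "\<nu> - \<kappa> \<in> cmeas0 \<Sigma>"
  using assms by (auto simp: cmeas0_def cmeas1_def cmeas_def intro: diff_in_complex_measures)

end

theory Submission
  imports Defs
begin

text \<open>
  Let \<open>V\<close> be the largest almost surely invariant subspace on which the growth rate is smaller than
  \<open>L\<^sub>1(\<mu>0)\<close>. Either hypothesis makes \<open>V\<close> invariant under every \<open>g \<in> \<Sigma>\<close>: quasi-irreducibility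
  forces \<open>V = {0}\<close>, and \<open>supp \<mu>0 = \<Sigma>\<close> upgrades almost every \<open>g\<close> to every \<open>g\<close>. Every vector outside
  \<open>V\<close> grows at rate \<open>L\<^sub>1\<close> in the quotient by \<open>V\<close>, uniformly in expectation. With the gap
  \<open>L\<^sub>1 > L\<^sub>2\<close> this makes the action on directions contract on average a power of the distance between
  directions, up to passing to an equivalent adapted function \<open>\<rho>\<close>. The Markov operator
  \<open>\<phi> \<mapsto> \<integral>\<phi>(g u) d\<mu>(g)\<close> is then a contraction modulo constants for functions that are Lipschitz with respect
  to \<open>\<rho>\<close>; this persists for complex measures near \<open>\<mu>0\<close>, and the invariant functional, hence the top rate
  \<open>F(\<mu>)\<close> in the quotient, is a convergent power series in \<open>\<mu> - \<mu>0\<close>. Finally \<open>F(\<mu>)\<close> equals \<open>L\<^sub>1(\<mu>)\<close> for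
  probability measures near \<open>\<mu>0\<close>, because small moments of the product on \<open>V\<close> still grow more slowly.
\<close>

subsection \<open>Independent sequences\<close>

text \<open>Two obstacles shape the proof. A measure close to \<mu>0 may charge any part of
  \<Sigma>, so a property of \<mu>0-almost every g does not survive perturbation; only a subspace
  preserved by all of \<Sigma> is stable. And nearby complex measures have no positivity and no
  almost sure statements; so whatever must persist is first turned into a one-step averaged
  inequality, which tolerates an error proportional to the variation of \<nu> - \<mu>0. There are
  two adapted functions for this, one on pairs of directions and one on \<open>V\<close>.

  Small powers enter because exp (s Y) has mean below 1 for small s > 0 when Y is bounded with
  negative mean: bounds on mean logarithms become bounds on moments.

  Analyticity rests on an identity comparing the invariant functionals of two measures. Substituted
  into itself it produces a geometrically convergent series of multilinear terms, with no spectral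
  theory of operators. The rate F so obtained ignores \<open>V\<close>, where another measure might
  grow faster; the moment bounds on \<open>V\<close> exclude this.\<close>

definition seq_shift :: "nat \<Rightarrow> (nat \<Rightarrow> 'a) \<Rightarrow> nat \<Rightarrow> 'a" where
  "seq_shift k \<omega> = (\<lambda>i. \<omega> (i + k))"

lemma seq_shift_comb_seq [simp]: "seq_shift k (comb_seq k \<omega> \<omega>') = \<omega>'"
  by (simp add: seq_shift_def comb_seq_add)

lemma seq_shift_0 [simp]: "seq_shift 0 = id"
  by (simp add: seq_shift_def fun_eq_iff)

lemma seq_shift_add: "seq_shift k (seq_shift j \<omega>) = seq_shift (k + j) \<omega>"
  by (simp add: seq_shift_def add.assoc)

lemma seq_shift_funpow: "(seq_shift k ^^ j) \<omega> = seq_shift (k * j) \<omega>"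
  by (induction j) (simp_all add: seq_shift_add)

context sequence_space
begin

lemma measurable_seq_shift [measurable]: "seq_shift k \<in> measurable S S"
  by (rule measurable_PiM_single')
    (auto simp: seq_shift_def space_PiM PiE_iff intro!: measurable_component_singleton)

lemma AE_all_coordinates:
  assumes "AE x in M. Q x"
  shows "AE \<omega> in S. \<forall>n. Q (\<omega> n)"
  unfolding AE_all_countable using assms by (intro allI AE_component) auto

lemma nn_integral_comb_seq:
  assumes [measurable]: "f \<in> borel_measurable S"
  shows "(\<integral>\<^sup>+\<omega>. f \<omega> \<partial>S) = (\<integral>\<^sup>+\<omega>. \<integral>\<^sup>+\<omega>'. f (comb_seq k \<omega> \<omega>') \<partial>S \<partial>S)"
proof -
  have "(\<integral>\<^sup>+\<omega>. f \<omega> \<partial>S) = (\<integral>\<^sup>+\<omega>. f \<omega> \<partial>distr (S \<Otimes>\<^sub>M S) S (\<lambda>(\<omega>, \<omega>'). comb_seq k \<omega> \<omega>'))"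
    by (simp add: PiM_comb_seq)
  also have "\<dots> = (\<integral>\<^sup>+z. f (comb_seq k (fst z) (snd z)) \<partial>(S \<Otimes>\<^sub>M S))"
    by (subst nn_integral_distr) (simp_all add: case_prod_beta)
  also have "\<dots> = (\<integral>\<^sup>+\<omega>. \<integral>\<^sup>+\<omega>'. f (comb_seq k \<omega> \<omega>') \<partial>S \<partial>S)"
    by (subst P.nn_integral_fst[symmetric]) (simp_all add: case_prod_beta)
  finally show ?thesis .
qed

lemma nn_integral_case_nat:
  assumes [measurable]: "f \<in> borel_measurable S"
  shows "(\<integral>\<^sup>+\<omega>. f \<omega> \<partial>S) = (\<integral>\<^sup>+x. \<integral>\<^sup>+\<omega>. f (case_nat x \<omega>) \<partial>S \<partial>M)"
proof -
  have "(\<integral>\<^sup>+\<omega>. f \<omega> \<partial>S) = (\<integral>\<^sup>+\<omega>. f \<omega> \<partial>distr (M \<Otimes>\<^sub>M S) S (\<lambda>(x, \<omega>). case_nat x \<omega>))"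
    by (simp add: PiM_iter)
  also have "\<dots> = (\<integral>\<^sup>+z. f (case_nat (fst z) (snd z)) \<partial>(M \<Otimes>\<^sub>M S))"
    by (subst nn_integral_distr) (simp_all add: case_prod_beta)
  also have "\<dots> = (\<integral>\<^sup>+x. \<integral>\<^sup>+\<omega>. f (case_nat x \<omega>) \<partial>S \<partial>M)"
    by (subst P.nn_integral_fst[symmetric]) (simp_all add: case_prod_beta)
  finally show ?thesis .
qed

lemma integral_case_nat:
  fixes f :: "(nat \<Rightarrow> 'a) \<Rightarrow> real"
  assumes f: "integrable S f"
  shows "(\<integral>\<omega>. f \<omega> \<partial>S) = (\<integral>x. \<integral>\<omega>. f (case_nat x \<omega>) \<partial>S \<partial>M)"
proof -
  have [measurable]: "f \<in> borel_measurable S" using f by auto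
  have i: "integrable (M \<Otimes>\<^sub>M S) (\<lambda>z. f (case_nat (fst z) (snd z)))"
    using f by (subst (asm) PiM_iter[symmetric], subst (asm) integrable_distr_eq)
      (simp_all add: case_prod_beta)
  have "(\<integral>\<omega>. f \<omega> \<partial>S) = (\<integral>\<omega>. f \<omega> \<partial>distr (M \<Otimes>\<^sub>M S) S (\<lambda>(x, \<omega>). case_nat x \<omega>))"
    by (simp add: PiM_iter)
  also have "\<dots> = (\<integral>z. f (case_nat (fst z) (snd z)) \<partial>(M \<Otimes>\<^sub>M S))"
    by (subst integral_distr) (simp_all add: case_prod_beta)
  also have "\<dots> = (\<integral>x. \<integral>\<omega>. f (case_nat x \<omega>) \<partial>S \<partial>M)"
  proof -
    interpret pair_sigma_finite M S ..
    show ?thesis using integral_fst'[OF i] by simp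
  qed
  finally show ?thesis .
qed

lemma AE_comb_seq:
  assumes "AE \<omega> in S. Q \<omega>"
  shows "AE \<omega> in S. AE \<omega>' in S. Q (comb_seq k \<omega> \<omega>')"
proof -
  obtain N where N: "N \<in> null_sets S" "{\<omega>\<in>space S. \<not> Q \<omega>} \<subseteq> N"
    using assms unfolding eventually_ae_filter by auto
  have [measurable]: "N \<in> sets S" using N by auto
  have "0 = (\<integral>\<^sup>+\<omega>. indicator N \<omega> \<partial>S)" using N by (simp add: null_setsD1)
  also have "\<dots> = (\<integral>\<^sup>+\<omega>. \<integral>\<^sup>+\<omega>'. indicator N (comb_seq k \<omega> \<omega>') \<partial>S \<partial>S)"
    by (rule nn_integral_comb_seq) simp
  finally have "AE \<omega> in S. (\<integral>\<^sup>+\<omega>'. indicator N (comb_seq k \<omega> \<omega>') \<partial>S) = 0"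
    by (subst (asm) eq_commute, subst (asm) nn_integral_0_iff_AE) auto
  with AE_space show ?thesis
  proof eventually_elim
    case (elim \<omega>)
    have [measurable]: "\<omega> \<in> space S" by fact
    have "AE \<omega>' in S. indicator N (comb_seq k \<omega> \<omega>') = (0::ennreal)"
      using elim(2) by (subst (asm) nn_integral_0_iff_AE) auto
    with AE_space show ?case
    proof eventually_elim
      case (elim \<omega>')
      have "comb_seq k \<omega> \<omega>' \<in> space S"
        using elim(1) \<open>\<omega> \<in> space S\<close> by (auto simp: space_PiM PiE_iff split: split_comb_seq)
      then show ?case using elim(2) N(2) by (auto simp: indicator_def split: if_splits)
    qed
  qed
qed

lemma distr_seq_shift: "distr S S (seq_shift k) = S"
proof (rule measure_eqI)
  fix A assume "A \<in> sets (distr S S (seq_shift k))"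
  then have A[measurable]: "A \<in> sets S" by simp
  have "emeasure (distr S S (seq_shift k)) A = (\<integral>\<^sup>+\<omega>. indicator A \<omega> \<partial>distr S S (seq_shift k))"
    by simp
  also have "\<dots> = (\<integral>\<^sup>+\<omega>. indicator A (seq_shift k \<omega>) \<partial>S)"
    by (rule nn_integral_distr) auto
  also have "\<dots> = (\<integral>\<^sup>+\<omega>. \<integral>\<^sup>+\<omega>'. indicator A (seq_shift k (comb_seq k \<omega> \<omega>')) \<partial>S \<partial>S)"
    by (rule nn_integral_comb_seq) measurable
  also have "\<dots> = emeasure S A" by (simp add: P.emeasure_space_1)
  finally show "emeasure (distr S S (seq_shift k)) A = emeasure S A" .
qed simp

lemma emeasure_comb_seq:
  assumes [measurable]: "A \<in> sets S"
  shows "emeasure S A = (\<integral>\<^sup>+\<omega>. emeasure S {\<omega>'\<in>space S. comb_seq k \<omega> \<omega>' \<in> A} \<partial>S)"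
proof -
  have "emeasure S A = (\<integral>\<^sup>+\<omega>. indicator A \<omega> \<partial>S)" by simp
  also have "\<dots> = (\<integral>\<^sup>+\<omega>. \<integral>\<^sup>+\<omega>'. indicator A (comb_seq k \<omega> \<omega>') \<partial>S \<partial>S)"
    by (rule nn_integral_comb_seq) simp
  also have "\<dots> = (\<integral>\<^sup>+\<omega>. emeasure S {\<omega>'\<in>space S. comb_seq k \<omega> \<omega>' \<in> A} \<partial>S)"
  proof (rule nn_integral_cong)
    fix \<omega> assume [measurable]: "\<omega> \<in> space S"
    have "(\<integral>\<^sup>+\<omega>'. indicator A (comb_seq k \<omega> \<omega>') \<partial>S)
        = (\<integral>\<^sup>+\<omega>'. indicator {\<omega>'\<in>space S. comb_seq k \<omega> \<omega>' \<in> A} \<omega>' \<partial>S)"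
      by (rule nn_integral_cong) (auto simp: indicator_def)
    then show "(\<integral>\<^sup>+\<omega>'. indicator A (comb_seq k \<omega> \<omega>') \<partial>S) = emeasure S {\<omega>'\<in>space S. comb_seq k \<omega> \<omega>' \<in> A}"
      by simp
  qed
  finally show ?thesis .
qed

text \<open>\<open>A\<close> is independent of the first \<open>k\<close> coordinates for arbitrarily large \<open>k\<close>, hence of itself.\<close>

lemma zero_one_law:
  assumes A[measurable]: "A \<in> sets S"
    and inv: "\<And>n. \<exists>k\<ge>n. AE \<omega> in S. emeasure S {\<omega>'\<in>space S. comb_seq k \<omega> \<omega>' \<in> A} = emeasure S A"
  shows "emeasure S A = 0 \<or> emeasure S A = 1"
proof -
  let ?Q = "scale_measure (emeasure S A) S"
  \<comment> \<open>Restricting the measure to \<open>A\<close> has the same effect as scaling it by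
    the probability of \<open>A\<close>: this is independence of \<open>A\<close> from every event,
    and it suffices to check it on cylinders. Evaluated at \<open>A\<close> itself it reads p = p *
    p.\<close>
  have "density S (indicator A) = ?Q"
  proof (rule measure_eqI_PiM_infinite)
    fix E and J :: "nat set"
    assume J: "finite J" "J \<subseteq> UNIV" and E: "\<And>i. i \<in> J \<Longrightarrow> E i \<in> sets M"
    define B where "B = prod_emb UNIV (\<lambda>_. M) J (Pi\<^sub>E J E)"
    have B[measurable]: "B \<in> sets S" unfolding B_def using J E by (intro sets_PiM_I) auto
    obtain n where "J \<subseteq> {..<n}" using J(1) finite_nat_iff_bounded by blast
    then have n: "i < n" if "i \<in> J" for i using that by auto
    obtain k where k: "k \<ge> n"
      "AE \<omega> in S. emeasure S {\<omega>'\<in>space S. comb_seq k \<omega> \<omega>' \<in> A} = emeasure S A"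
      using inv by blast
    have cB: "comb_seq k \<omega> \<omega>' \<in> B \<longleftrightarrow> \<omega> \<in> B" if "\<omega> \<in> space S" "\<omega>' \<in> space S" for \<omega> \<omega>'
    proof -
      have "i < k" if "i \<in> J" for i using n[OF that] k by simp
      then have "(\<forall>i\<in>J. comb_seq k \<omega> \<omega>' i \<in> E i) \<longleftrightarrow> (\<forall>i\<in>J. \<omega> i \<in> E i)"
        by (simp add: comb_seq_less)
      moreover have "comb_seq k \<omega> \<omega>' \<in> space S"
        using that by (auto simp: space_PiM PiE_iff split: split_comb_seq)
      ultimately show ?thesis
        using that by (simp add: B_def prod_emb_iff restrict_PiE_iff space_PiM PiE_iff)
    qed
    have "emeasure (density S (indicator A)) B = (\<integral>\<^sup>+\<omega>. indicator A \<omega> * indicator B \<omega> \<partial>S)"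
      by (simp add: emeasure_density)
    also have "\<dots> = (\<integral>\<^sup>+\<omega>. \<integral>\<^sup>+\<omega>'. indicator A (comb_seq k \<omega> \<omega>') * indicator B (comb_seq k \<omega> \<omega>') \<partial>S \<partial>S)"
      by (rule nn_integral_comb_seq) simp
    also have "\<dots> = (\<integral>\<^sup>+\<omega>. emeasure S A * indicator B \<omega> \<partial>S)"
    proof (rule nn_integral_cong_AE)
      from k(2) AE_space
      show "AE \<omega> in S. (\<integral>\<^sup>+\<omega>'. indicator A (comb_seq k \<omega> \<omega>') * indicator B (comb_seq k \<omega> \<omega>') \<partial>S)
          = emeasure S A * indicator B \<omega>"
      proof eventually_elim
        case (elim \<omega>)
        have [measurable]: "\<omega> \<in> space S" by fact
        have "(\<integral>\<^sup>+\<omega>'. indicator A (comb_seq k \<omega> \<omega>') * indicator B (comb_seq k \<omega> \<omega>') \<partial>S)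
          = (\<integral>\<^sup>+\<omega>'. indicator {\<omega>'\<in>space S. comb_seq k \<omega> \<omega>' \<in> A} \<omega>' * indicator B \<omega> \<partial>S)"
          by (rule nn_integral_cong) (auto simp: indicator_def cB elim)
        also have "\<dots> = emeasure S {\<omega>'\<in>space S. comb_seq k \<omega> \<omega>' \<in> A} * indicator B \<omega>"
          by (subst nn_integral_multc) auto
        finally show ?case using elim(1) by simp
      qed
    qed
    also have "\<dots> = emeasure ?Q B"
      by (subst nn_integral_cmult) auto
    finally show "emeasure (density S (indicator A)) (prod_emb UNIV (\<lambda>_. M) J (Pi\<^sub>E J E))
        = emeasure ?Q (prod_emb UNIV (\<lambda>_. M) J (Pi\<^sub>E J E))" by (simp add: B_def)
  next
    show "finite_measure (density S (indicator A))"
      by standard (simp add: emeasure_density_const emeasure_density)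
  qed simp_all
  then have "emeasure (density S (indicator A)) A = emeasure ?Q A" by simp
  then have "emeasure S A = emeasure S A * emeasure S A"
    by (simp add: emeasure_density indicator_inter_arith[symmetric])
  then have "measure S A = measure S A * measure S A"
    by (metis P.emeasure_eq_measure ennreal_mult' measure_nonneg ennreal_inj mult_nonneg_nonneg)
  then have "measure S A = 0 \<or> measure S A = 1" by simp
  then show ?thesis by (auto simp: P.emeasure_eq_measure)
qed

end

text \<open>Walk along the orbit. At a time whose point has a block length j \<le> N with average at
  most c, jump j steps; at any other (bad) time advance one step at cost C. Each bad time pays the
  surplus C - c, and the last incomplete block, of length at most N, pays N * (C - c).
  \<open>T\<close> and \<open>Y\<close> are arbitrary because the bound serves twice: for shifts,
  and in \<open>uniform_expansion\<close> for a skew product over directions.\<close>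

lemma subadditive_orbit_bound:
  fixes f :: "nat \<Rightarrow> 's \<Rightarrow> real"
  assumes inv: "\<And>s. s \<in> Y \<Longrightarrow> T s \<in> Y"
    and sub: "\<And>n m s. s \<in> Y \<Longrightarrow> f (n + m) s \<le> f n s + f m ((T ^^ n) s)"
    and bnd: "\<And>n s. s \<in> Y \<Longrightarrow> f n s \<le> C * real n"
    and cC: "c \<le> C" and s: "s \<in> Y"
  shows "f n s \<le> c * real n
     + (C - c) * real (card {i. i < n \<and> \<not> (\<exists>j\<in>{1..N}. f j ((T ^^ i) s) \<le> real j * c)}) + real N * (C - c)"
    (is "_ \<le> _ + _ * real (card (?bad n s)) + _")
  using s
proof (induction n arbitrary: s rule: less_induct)
  case (less n)
  have fin: "finite (?bad n s)" for n s by simp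
  have step: "card (?bad (n - j) ((T ^^ j) s)) \<le> card (?bad n s - {0})" if "j \<ge> 1" "j \<le> n" for j
  proof (rule card_inj_on_le[of "\<lambda>i. i + j"])
    show "(\<lambda>i. i + j) ` ?bad (n - j) ((T ^^ j) s) \<subseteq> ?bad n s - {0}"
      using that by (auto simp: funpow_add)
  qed auto
  have TY: "(T ^^ j) s \<in> Y" for j using less.prems inv by (induction j) auto
  have small: "f n s \<le> c * real n + real N * (C - c)" if "n \<le> N"
  proof -
    have "f n s \<le> C * real n" using bnd less.prems by simp
    also have "\<dots> = c * real n + real n * (C - c)" by (simp add: algebra_simps)
    also have "\<dots> \<le> c * real n + real N * (C - c)"
      using that cC by (intro add_mono mult_right_mono) auto
    finally show ?thesis .
  qed
  show ?case
  proof (cases "n \<le> N")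
    case True
    then have "f n s \<le> c * real n + real N * (C - c)" by (rule small)
    then show ?thesis using cC by (smt (verit) mult_nonneg_nonneg of_nat_0_le_iff)
  next
    case big: False
    show ?thesis
    proof (cases "\<exists>j\<in>{1..N}. f j s \<le> real j * c")
      case True
      then obtain j where j: "1 \<le> j" "j \<le> N" "f j s \<le> real j * c" by auto
      have jn: "j \<le> n" using j big by simp
      have le: "real (card (?bad (n - j) ((T ^^ j) s))) \<le> real (card (?bad n s))"
        using order_trans[OF step[OF j(1) jn] card_mono[OF fin Diff_subset]] by (rule of_nat_mono)
      have "f n s \<le> f j s + f (n - j) ((T ^^ j) s)" using sub[of s j "n - j"] less.prems jn by simp
      also have "\<dots> \<le> real j * c + (c * real (n - j) + (C - c) * real (card (?bad (n - j) ((T ^^ j) s))) + real N * (C - c))"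
        using j jn by (intro add_mono less.IH TY) auto
      also have "\<dots> \<le> real j * c + (c * real (n - j) + (C - c) * real (card (?bad n s)) + real N * (C - c))"
        using le cC by (intro add_mono mult_left_mono order_refl) simp_all
      finally show ?thesis using jn by (simp add: of_nat_diff algebra_simps)
    next
      case False
      have n1: "n \<ge> 1" using big by simp
      have zero: "0 \<in> ?bad n s" using False n1 by auto
      \<comment> \<open>Time 0 is bad and drops out when the orbit is advanced by one, so its
        surplus C - c pays for the single step of cost C.\<close>
      then have card: "card (?bad n s) = Suc (card (?bad n s - {0}))" by (intro card.remove) auto
      have "f n s \<le> f 1 s + f (n - 1) ((T ^^ 1) s)" using sub[of s 1 "n - 1"] less.prems n1 by simp
      also have "\<dots> \<le> C + (c * real (n - 1) + (C - c) * real (card (?bad (n - 1) ((T ^^ 1) s))) + real N * (C - c))"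
        using bnd[of s 1] less.prems n1 by (intro add_mono less.IH TY) auto
      also have "\<dots> \<le> C + (c * real (n - 1) + (C - c) * real (card (?bad n s - {0})) + real N * (C - c))"
        using of_nat_mono[OF step[OF order_refl n1], where 'a=real] cC
        by (intro add_mono mult_left_mono order_refl) simp_all
      moreover have "real (card (?bad n s)) = 1 + real (card (?bad n s - {0}))"
        using card by linarith
      moreover have "real (n - 1) = real n - 1" using n1 by simp
      ultimately show ?thesis by (simp only:) (simp only: algebra_simps)
    qed
  qed
qed

subsection \<open>The subadditive ergodic theorem\<close>

text \<open>Failure of every lower bound of slope c. Natural numbers D keep the event measurable by
  countable operations, and admitting every constant D makes it insensitive to bounded errors, hence
  shift invariant (\<open>deep_shift\<close>).\<close>

definition deep :: "(nat \<Rightarrow> 's \<Rightarrow> real) \<Rightarrow> real \<Rightarrow> 's \<Rightarrow> bool" where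
  "deep f c s \<longleftrightarrow> (\<forall>D::nat. \<exists>n. f n s < real n * c - real D)"

lemma not_deep: "\<not> deep f c s \<longleftrightarrow> (\<exists>D::nat. \<forall>n. f n s \<ge> real n * c - real D)"
  by (simp add: deep_def not_less)

lemma deep_shift:
  assumes "\<And>n. \<bar>f (k + n) s - f n s'\<bar> \<le> B" "\<And>n. n < k \<Longrightarrow> f n s \<ge> - B"
  shows "deep f c s \<longleftrightarrow> deep f c s'"
proof -
  \<comment> \<open>One integer absorbs both errors: the bounded discrepancy \<open>B\<close> and
    the change of the linear term when the index is shifted by k.\<close>
  obtain E :: nat where E: "real E \<ge> B + real k * \<bar>c\<bar>" using real_arch_simple by blast
  show ?thesis
  proof
    assume d: "deep f c s"
    show "deep f c s'" unfolding deep_def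
    proof
      fix D :: nat
      obtain n where n: "f n s < real n * c - real (D + E)" using d unfolding deep_def by blast
      have "n \<ge> k"
      proof (rule ccontr)
        assume "\<not> n \<ge> k"
        then have "real n * c \<le> real k * \<bar>c\<bar>"
          by (intro order_trans[OF mult_left_mono[OF abs_ge_self] mult_right_mono]) auto
        then show False using assms(2)[of n] n E \<open>\<not> n \<ge> k\<close> by simp
      qed
      then obtain m where m: "n = k + m" using le_Suc_ex by blast
      have "f m s' < real (k + m) * c - real (D + E) + B" using assms(1)[of m] n m by simp
      also have "\<dots> \<le> real m * c - real D"
        using E mult_left_mono[OF abs_ge_self[of c], of "real k"] by (simp add: algebra_simps)
      finally show "\<exists>n. f n s' < real n * c - real D" by blast
    qed
  next
    assume d: "deep f c s'"
    show "deep f c s" unfolding deep_def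
    proof
      fix D :: nat
      obtain m where m: "f m s' < real m * c - real (D + E)" using d unfolding deep_def by blast
      have "f (k + m) s < real m * c - real (D + E) + B" using assms(1)[of m] m by simp
      also have "\<dots> \<le> real (k + m) * c - real D"
        using E mult_left_mono[OF abs_ge_minus_self[of c], of "real k"] by (simp add: algebra_simps)
      finally show "\<exists>n. f n s < real n * c - real D" by blast
    qed
  qed
qed

lemma distr_funpow:
  assumes [measurable]: "T \<in> measurable M M" and T: "distr M M T = M"
  shows "distr M M (T ^^ i) = M"
proof (induction i)
  case 0
  then show ?case by (simp add: id_def distr_id)
next
  case (Suc i)
  have "distr M M (T ^^ Suc i) = distr (distr M M (T ^^ i)) M T"
    by (subst distr_distr) simp_all
  then show ?case unfolding Suc.IH T .
qed

text \<open>By the zero-one alternative, failure means that almost every point has some n with f n <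
  n c. For large N the points with no such n \<le> N are then rare, and integrating
  \<open>subadditive_orbit_bound\<close> gives a mean growth below \<gamma>, a
  contradiction.\<close>

lemma (in prob_space) subadditive_lower_bound:
  fixes f :: "nat \<Rightarrow> 'a \<Rightarrow> real"
  assumes T[measurable]: "T \<in> measurable M M" and distr: "distr M M T = M"
    and Y: "Y \<subseteq> space M" "AE s in M. s \<in> Y" "\<And>s. s \<in> Y \<Longrightarrow> T s \<in> Y"
    and f[measurable]: "\<And>n. f n \<in> borel_measurable M"
    and sub: "\<And>n m s. s \<in> Y \<Longrightarrow> f (n + m) s \<le> f n s + f m ((T ^^ n) s)"
    and bnd: "\<And>n s. s \<in> Y \<Longrightarrow> \<bar>f n s\<bar> \<le> C * real n"
    and zo: "emeasure M {s\<in>space M. deep f c s} = 0 \<or> emeasure M {s\<in>space M. deep f c s} = 1"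
    and E: "\<And>n. n \<ge> 1 \<Longrightarrow> real n * \<gamma> \<le> expectation (f n)"
    and c: "c < \<gamma>"
  shows "AE s in M. \<not> deep f c s"
proof (rule ccontr)
  assume nae: "\<not> ?thesis"
  have meas[measurable]: "Measurable.pred M (deep f c)" unfolding deep_def by measurable
  have "emeasure M {s\<in>space M. deep f c s} \<noteq> 0"
    using nae by (subst (asm) AE_iff_measurable[OF _ refl]) auto
  then have "emeasure M {s\<in>space M. deep f c s} = 1" using zo by auto
  then have aed: "AE s in M. deep f c s"
    by (subst (asm) emeasure_eq_measure) (simp add: prob_Collect_eq_1[OF meas[THEN predE]])
  define B where "B N = {s\<in>space M. \<not> (\<exists>j\<in>{1..N}. f j s \<le> real j * c)}" for N
  have B[measurable]: "B N \<in> sets M" for N unfolding B_def by measurable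
  have dec: "decseq B" unfolding B_def decseq_def by force
  have "(\<lambda>N. emeasure M (B N)) \<longlonglongrightarrow> emeasure M (\<Inter>N. B N)"
    by (rule Lim_emeasure_decseq) (use dec in \<open>auto simp: emeasure_eq_measure\<close>)
  moreover have "emeasure M (\<Inter>N. B N) = 0"
  proof -
    have "AE s in M. s \<notin> (\<Inter>N. B N)"
      using aed Y(2)
    proof eventually_elim
      case (elim s)
      obtain n where n: "f n s < real n * c"
        using elim(1) unfolding deep_def by (metis diff_zero of_nat_0)
      have "n \<noteq> 0" using bnd[OF elim(2), of 0] n by (cases n) auto
      then have "s \<notin> B n" using n by (auto simp: B_def intro!: bexI[of _ n])
      then show ?case by auto
    qed
    then have "(\<Inter>N. B N) \<in> null_sets M" by (subst AE_iff_null_sets) auto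
    then show ?thesis by (rule null_setsD1)
  qed
  ultimately have lim: "(\<lambda>N. emeasure M (B N)) \<longlonglongrightarrow> 0" by simp
  define C' where "C' = max C \<bar>c\<bar> + 1"
  have C': "C' - c > 0" "C' \<ge> C" by (auto simp: C'_def)
  define \<eta> where "\<eta> = (\<gamma> - c) / 2 / (C' - c)"
  have \<eta>: "\<eta> > 0" using c C' by (simp add: \<eta>_def)
  have "eventually (\<lambda>N. emeasure M (B N) < ennreal \<eta>) sequentially"
    using order_tendstoD(2)[OF lim] \<eta> by simp
  then obtain N where "emeasure M (B N) < ennreal \<eta>" by (auto simp: eventually_sequentially)
  then have N: "prob (B N) < \<eta>" by (simp add: emeasure_eq_measure ennreal_less_iff)
  have bnd': "f n s \<le> C' * real n" if "s \<in> Y" for n s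
    using bnd[OF that, of n] C' mult_right_mono[OF C'(2), of "real n"] by linarith
  have int: "integrable M (f n)" for n
    by (rule integrable_const_bound[of _ "C * real n"]) (use Y(2) bnd in \<open>auto elim!: eventually_mono\<close>)
  have pr: "prob ((T ^^ i) -` B N \<inter> space M) = prob (B N)" for i
    using measure_distr[of "T ^^ i" M M "B N"] distr_funpow[OF T distr] by simp
  have bound: "expectation (f n) \<le> c * real n + (C' - c) * (real n * \<eta>) + real N * (C' - c)" for n
  proof -
    define g where "g s = (\<Sum>i<n. indicator ((T ^^ i) -` B N \<inter> space M) s :: real)" for s
    have g: "integrable M g" unfolding g_def
      by (intro Bochner_Integration.integrable_sum) (auto simp: integrable_indicator_iff emeasure_eq_measure)
    have Eg: "expectation g = real n * prob (B N)"
      unfolding g_def by (subst Bochner_Integration.integral_sum)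
        (auto simp: integrable_indicator_iff emeasure_eq_measure pr)
    have "expectation (f n) \<le> expectation (\<lambda>s. c * real n + (C' - c) * g s + real N * (C' - c))"
    proof (rule integral_mono_AE[OF int])
      show "integrable M (\<lambda>s. c * real n + (C' - c) * g s + real N * (C' - c))" using g by auto
      show "AE s in M. f n s \<le> c * real n + (C' - c) * g s + real N * (C' - c)"
        using Y(2)
      proof eventually_elim
        case (elim s)
        have TY: "(T ^^ i) s \<in> Y" for i using elim Y(3) by (induction i) auto
        have "{i. i < n \<and> \<not> (\<exists>j\<in>{1..N}. f j ((T ^^ i) s) \<le> real j * c)}
            = {i\<in>{..<n}. s \<in> (T ^^ i) -` B N \<inter> space M}"
          using TY Y(1) elim by (auto simp: B_def)
        then have "real (card {i. i < n \<and> \<not> (\<exists>j\<in>{1..N}. f j ((T ^^ i) s) \<le> real j * c)}) = g s"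
          by (simp add: g_def indicator_def sum.If_cases Int_def)
        then show ?case
          using subadditive_orbit_bound[of Y T f C' c s n N, OF Y(3) sub bnd' _ elim] C' by simp
      qed
    qed
    also have "\<dots> = c * real n + (C' - c) * (real n * prob (B N)) + real N * (C' - c)"
      using g by (simp add: Eg prob_space)
    also have "\<dots> \<le> c * real n + (C' - c) * (real n * \<eta>) + real N * (C' - c)"
      using N C' by (intro order_refl add_mono mult_left_mono) auto
    finally show ?thesis .
  qed
  have "real n * ((\<gamma> - c) / 2) \<le> real N * (C' - c)" if "n \<ge> 1" for n
  proof -
    have "d * (x / 2 / d) = x / 2" if "d \<noteq> 0" for d x :: real using that by simp
    then have "(C' - c) * \<eta> = (\<gamma> - c) / 2" using C'(1) unfolding \<eta>_def by (metis less_numeral_extra(3))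
    then have "(C' - c) * (real n * \<eta>) = real n * ((\<gamma> - c) / 2)" by (metis mult.left_commute)
    then show ?thesis using E[OF that] bound[of n] by (simp add: algebra_simps field_simps)
  qed
  moreover obtain n :: nat where "real n * ((\<gamma> - c) / 2) > real N * (C' - c)"
    using reals_Archimedean3[of "(\<gamma> - c) / 2"] c by (meson diff_gt_0_iff_gt half_gt_zero)
  moreover have "n \<noteq> 0" using calculation(2) C' by (cases n) (auto simp: mult_less_0_iff)
  ultimately show False by (meson le_less_trans less_irrefl not_less_eq_eq One_nat_def less_one not_le)
qed

lemma tendsto_div_of_linear_bounds:
  fixes x :: "nat \<Rightarrow> real"
  assumes lo: "\<And>j::nat. \<exists>D. \<forall>n. x n \<ge> real n * (\<gamma> - 1 / Suc j) - D"
    and up: "\<And>j::nat. \<exists>D. \<forall>n. x n \<le> real n * (\<gamma> + 1 / Suc j) + D"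
  shows "(\<lambda>n. x n / real n) \<longlonglongrightarrow> \<gamma>"
proof (rule LIMSEQ_I)
  fix r :: real assume r: "0 < r"
  obtain j :: nat where j: "1 / Suc j < r / 2" using r nat_approx_posE[of "r/2"] by auto
  define e where "e = 1 / real (Suc j)"
  obtain D1 D2 where D: "\<And>n. x n \<ge> real n * (\<gamma> - e) - D1" "\<And>n. x n \<le> real n * (\<gamma> + e) + D2"
    using lo[of j] up[of j] unfolding e_def by auto
  obtain N :: nat where N: "real N > (\<bar>D1\<bar> + \<bar>D2\<bar>) / (r / 2)" using reals_Archimedean2 by blast
  show "\<exists>no. \<forall>n\<ge>no. norm (x n / real n - \<gamma>) < r"
  proof (intro exI allI impI)
    fix n assume n: "n \<ge> Suc N"
    then have n0: "real n > 0" by simp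
    have "(\<bar>D1\<bar> + \<bar>D2\<bar>) / (r / 2) < real n" using N n by linarith
    then have "\<bar>D1\<bar> + \<bar>D2\<bar> < real n * (r / 2)" using r by (simp add: field_simps)
    moreover have "real n * e < real n * (r / 2)"
      using j n0 unfolding e_def by (intro mult_strict_left_mono)
    ultimately have "x n - real n * \<gamma> < real n * r \<and> real n * \<gamma> - x n < real n * r"
      using D(1)[of n] D(2)[of n] unfolding right_diff_distrib distrib_left by (auto simp: abs_if split: if_splits)
    then have "\<bar>x n - real n * \<gamma>\<bar> < r * real n" by (simp add: abs_less_iff mult.commute)
    then have "\<bar>(x n - real n * \<gamma>) / real n\<bar> < r" using n0 by (simp add: abs_divide divide_less_eq)
    moreover have "x n / real n - \<gamma> = (x n - real n * \<gamma>) / real n" using n0 by (simp add: field_simps)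
    ultimately show "norm (x n / real n - \<gamma>) < r" by simp
  qed
qed

context sequence_space
begin

text \<open>Invariance is asked only for arbitrarily large shifts, because the block sums in
  \<open>kingman\<close> are compatible only with shifts by multiples of the block length.\<close>

lemma zero_one_law_shift:
  assumes A[measurable]: "Measurable.pred S A"
    and inv: "\<And>n. \<exists>k\<ge>n. AE \<omega> in S. A \<omega> \<longleftrightarrow> A (seq_shift k \<omega>)"
  shows "emeasure S {\<omega>\<in>space S. A \<omega>} = 0 \<or> emeasure S {\<omega>\<in>space S. A \<omega>} = 1"
proof (rule zero_one_law)
  fix n
  obtain k where k: "k \<ge> n" "AE \<omega> in S. A \<omega> \<longleftrightarrow> A (seq_shift k \<omega>)" using inv by blast
  have "AE \<omega> in S. emeasure S {\<omega>'\<in>space S. comb_seq k \<omega> \<omega>' \<in> {\<omega>\<in>space S. A \<omega>}} = emeasure S {\<omega>\<in>space S. A \<omega>}"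
    using AE_comb_seq[OF k(2), of k] AE_space
  proof eventually_elim
    case (elim \<omega>)
    have [measurable]: "\<omega> \<in> space S" by fact
    show ?case
    proof (rule emeasure_eq_AE)
      show "AE \<omega>' in S. \<omega>' \<in> {\<omega>'\<in>space S. comb_seq k \<omega> \<omega>' \<in> {\<omega>\<in>space S. A \<omega>}} \<longleftrightarrow> \<omega>' \<in> {\<omega>\<in>space S. A \<omega>}"
        using elim(1) AE_space
      proof eventually_elim
        case (elim \<omega>')
        have "comb_seq k \<omega> \<omega>' \<in> space S"
          using elim(2) \<open>\<omega> \<in> space S\<close> by (auto simp: space_PiM PiE_iff split: split_comb_seq)
        then show ?case using elim by simp
      qed
    qed auto
  qed
  then show "\<exists>k\<ge>n. AE \<omega> in S. emeasure S {\<omega>'\<in>space S. comb_seq k \<omega> \<omega>' \<in> {\<omega>\<in>space S. A \<omega>}} = emeasure S {\<omega>\<in>space S. A \<omega>}"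
    using k(1) by blast
qed auto

text \<open>Both inequalities come from \<open>subadditive_lower_bound\<close>: applied to f it
  gives the lower one; applied to negated sums of f m over blocks of length m it gives the upper
  one, since f is dominated by such sums. The assumption \<open>sup\<close> limits how much f can
  increase when the first n steps are dropped; this makes the event \<open>deep\<close> shift
  invariant.\<close>

theorem kingman:
  fixes f :: "nat \<Rightarrow> (nat \<Rightarrow> 'a) \<Rightarrow> real"
  assumes Y: "Y \<subseteq> space S" "AE \<omega> in S. \<omega> \<in> Y" "\<And>\<omega> k. \<omega> \<in> Y \<Longrightarrow> seq_shift k \<omega> \<in> Y"
    and f[measurable]: "\<And>n. f n \<in> borel_measurable S"
    and sub: "\<And>n m \<omega>. \<omega> \<in> Y \<Longrightarrow> f (n + m) \<omega> \<le> f n \<omega> + f m (seq_shift n \<omega>)"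
    and sup: "\<And>n m \<omega>. \<omega> \<in> Y \<Longrightarrow> f m (seq_shift n \<omega>) \<le> f (n + m) \<omega> + C * real n"
    and bnd: "\<And>n \<omega>. \<omega> \<in> Y \<Longrightarrow> \<bar>f n \<omega>\<bar> \<le> C * real n"
  obtains \<gamma> where "AE \<omega> in S. (\<lambda>n. f n \<omega> / real n) \<longlonglongrightarrow> \<gamma>"
    and "(\<lambda>n. P.expectation (f n) / real n) \<longlonglongrightarrow> \<gamma>"
    and "\<And>n. real n * \<gamma> \<le> P.expectation (f n)"
proof -
  define \<gamma> where "\<gamma> = (INF n\<in>{1..}. P.expectation (f n) / real n)"
  obtain \<omega>0 where "\<omega>0 \<in> Y" using Y(2) P.AE_contr by (metis (mono_tags, lifting) eventually_mono)
  then have C0: "C \<ge> 0" using bnd[of \<omega>0 1] by simp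
  have int: "integrable S (f n)" for n
    by (rule P.integrable_const_bound[of _ "C * real n"]) (use Y(2) bnd in \<open>auto elim!: eventually_mono\<close>)
  have Eb: "\<bar>P.expectation (f n)\<bar> \<le> C * real n" for n
  proof -
    have "\<bar>P.expectation (f n)\<bar> \<le> P.expectation (\<lambda>\<omega>. \<bar>f n \<omega>\<bar>)" by (rule integral_abs_bound)
    also have "\<dots> \<le> P.expectation (\<lambda>_. C * real n)"
      by (rule integral_mono_AE) (use int Y(2) bnd in \<open>auto elim!: eventually_mono\<close>)
    finally show ?thesis by (simp add: P.prob_space)
  qed
  have bdd: "bdd_below ((\<lambda>n. P.expectation (f n) / real n) ` {1..})"
  proof (rule bdd_belowI2)
    fix n :: nat assume "n \<in> {1..}"
    then show "- C \<le> P.expectation (f n) / real n" using Eb[of n] by (auto simp: field_simps abs_le_iff)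
  qed
  have E: "real n * \<gamma> \<le> P.expectation (f n)" for n
  proof (cases "n = 0")
    case True then show ?thesis using Eb[of 0] by simp
  next
    case False
    then have "\<gamma> \<le> P.expectation (f n) / real n" unfolding \<gamma>_def by (intro cINF_lower bdd) auto
    then show ?thesis using False by (simp add: field_simps)
  qed
  have funpow: "(seq_shift 1 ^^ n) = (seq_shift n :: (nat \<Rightarrow> 'a) \<Rightarrow> _)" for n
    by (rule ext) (simp add: seq_shift_funpow del: One_nat_def)
  have lower: "AE \<omega> in S. \<not> deep f c \<omega>" if "c < \<gamma>" for c
  proof (rule P.subadditive_lower_bound[OF measurable_seq_shift[of 1] distr_seq_shift Y(1,2) Y(3) f _ bnd _ _ that])
    show "f (n + m) \<omega> \<le> f n \<omega> + f m ((seq_shift 1 ^^ n) \<omega>)" if "\<omega> \<in> Y" for n m \<omega>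
      using sub[OF that] unfolding funpow .
    show "emeasure S {s\<in>space S. deep f c s} = 0 \<or> emeasure S {s\<in>space S. deep f c s} = 1"
    proof (rule zero_one_law_shift)
      show "\<exists>k\<ge>n. AE \<omega> in S. deep f c \<omega> \<longleftrightarrow> deep f c (seq_shift k \<omega>)" for n
      proof (intro exI[of _ n] conjI order_refl)
        show "AE \<omega> in S. deep f c \<omega> \<longleftrightarrow> deep f c (seq_shift n \<omega>)"
          using Y(2)
        proof eventually_elim
          case (elim \<omega>)
          show ?case
          proof (rule deep_shift[where B = "C * real n" and k = n])
            show "\<bar>f (n + m) \<omega> - f m (seq_shift n \<omega>)\<bar> \<le> C * real n" for m
              using sub[OF elim, of n m] sup[OF elim, of m n] bnd[OF elim, of n] by linarith
            show "- (C * real n) \<le> f m \<omega>" if "m < n" for m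
              using bnd[OF elim, of m] mult_left_mono[OF _ C0, of "real m" "real n"] that by force
          qed
        qed
      qed
    qed (unfold deep_def, measurable)
  qed (use E in auto)
  have upper: "AE \<omega> in S. \<exists>D. \<forall>n. f n \<omega> \<le> real n * c + D" if "c > \<gamma>" for c
  proof -
    obtain m where m: "m \<ge> 1" "P.expectation (f m) / real m < c"
      using \<open>c > \<gamma>\<close> unfolding \<gamma>_def by (subst (asm) cINF_less_iff[OF _ bdd]) auto
    \<comment> \<open>The negated Birkhoff sum of f m over blocks of length m. It is additive, and a
      lower bound of slope - m c for it is an upper bound of slope c for f.\<close>
    define h where "h j \<omega> = - (\<Sum>i<j. f m (seq_shift (m * i) \<omega>))" for j \<omega>
    have h[measurable]: "h j \<in> borel_measurable S" for j unfolding h_def by measurable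
    have hadd: "h (k + j) \<omega> = h k \<omega> + h j (seq_shift (m * k) \<omega>)" for j k \<omega>
      by (induction j) (simp_all add: h_def seq_shift_add algebra_simps)
    have hb: "\<bar>h j \<omega>\<bar> \<le> C * real m * real j" if "\<omega> \<in> Y" for j \<omega>
    proof -
      have "\<bar>h j \<omega>\<bar> \<le> (\<Sum>i<j. C * real m)"
        unfolding h_def abs_minus_cancel by (rule order_trans[OF sum_abs]) (intro sum_mono bnd Y(3) that)
      then show ?thesis by (simp add: mult.commute)
    qed
    have hE: "P.expectation (h j) = real j * (- P.expectation (f m))" for j
    proof -
      have "integrable S (\<lambda>\<omega>. f m (seq_shift i \<omega>))" for i
        using int[of m] by (subst (asm) distr_seq_shift[of i, symmetric], subst (asm) integrable_distr_eq) auto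
      moreover have "P.expectation (\<lambda>\<omega>. f m (seq_shift i \<omega>)) = P.expectation (f m)" for i
        by (subst (2) distr_seq_shift[of i, symmetric], subst integral_distr) auto
      ultimately show ?thesis unfolding h_def by simp
    qed
    have Y3: "seq_shift m \<omega> \<in> Y" if "\<omega> \<in> Y" for \<omega> using Y(3) that .
    have "AE \<omega> in S. \<not> deep h (real m * (- c)) \<omega>"
    proof (rule P.subadditive_lower_bound[OF measurable_seq_shift[of m] distr_seq_shift Y(1,2) Y3 h _ hb])
      show "h (n + j) \<omega> \<le> h n \<omega> + h j ((seq_shift m ^^ n) \<omega>)" for n j \<omega>
        by (simp add: hadd seq_shift_funpow)
      show "real n * (- P.expectation (f m)) \<le> P.expectation (h n)" for n by (simp add: hE)
      show "real m * (- c) < - P.expectation (f m)" using m by (simp add: field_simps)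
      show "emeasure S {s\<in>space S. deep h (real m * (- c)) s} = 0 \<or> emeasure S {s\<in>space S. deep h (real m * (- c)) s} = 1"
      proof (rule zero_one_law_shift)
        show "\<exists>k\<ge>n. AE \<omega> in S. deep h (real m * (- c)) \<omega> \<longleftrightarrow> deep h (real m * (- c)) (seq_shift k \<omega>)" for n
        proof (intro exI[of _ "m * n"] conjI)
          show "m * n \<ge> n" using m by simp
          show "AE \<omega> in S. deep h (real m * (- c)) \<omega> \<longleftrightarrow> deep h (real m * (- c)) (seq_shift (m * n) \<omega>)"
            using Y(2)
          proof eventually_elim
            case (elim \<omega>)
            show ?case
            proof (rule deep_shift[where B = "C * real m * real n" and k = n])
              show "\<bar>h (n + j) \<omega> - h j (seq_shift (m * n) \<omega>)\<bar> \<le> C * real m * real n" for j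
                using hb[OF elim, of n] by (simp add: hadd)
              show "- (C * real m * real n) \<le> h j \<omega>" if "j < n" for j
              proof -
                have "C * real m * real j \<le> C * real m * real n" using that C0 by (intro mult_left_mono) auto
                then show ?thesis using hb[OF elim, of j] by linarith
              qed
            qed
          qed
        qed
      qed (unfold deep_def, measurable)
    qed
    then show ?thesis using Y(2)
    proof eventually_elim
      case (elim \<omega>)
      obtain D where D: "\<And>j. h j \<omega> \<ge> real j * (real m * (- c)) - real D"
        using elim(1) unfolding not_deep by blast
      have fm: "f (m * j) \<omega> \<le> - h j \<omega>" for j
      proof (induction j)
        case 0 then show ?case using bnd[OF elim(2), of 0] by (simp add: h_def)
      next
        case (Suc j)
        have "f (m * Suc j) \<omega> \<le> f (m * j) \<omega> + f m (seq_shift (m * j) \<omega>)"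
          using sub[OF elim(2), of "m * j" m] by (simp add: add.commute)
        then show ?case using Suc by (simp add: h_def)
      qed
      have "f n \<omega> \<le> real n * c + (real D + C * real m + real m * \<bar>c\<bar>)" for n
      proof -
        define j r where "j = n div m" and "r = n mod m"
        have n: "n = m * j + r" and r: "r < m" using m by (auto simp: j_def r_def)
        have 1: "f n \<omega> \<le> f (m * j) \<omega> + f r (seq_shift (m * j) \<omega>)" using sub[OF elim(2)] n by simp
        have "f r (seq_shift (m * j) \<omega>) \<le> C * real r" using bnd[OF Y(3)[OF elim(2)]] by (simp add: abs_le_iff)
        also have "C * real r \<le> C * real m" using r C0 by (intro mult_left_mono) auto
        finally have 2: "f r (seq_shift (m * j) \<omega>) \<le> C * real m" .
        have 3: "f (m * j) \<omega> \<le> real j * (real m * c) + real D" using fm[of j] D[of j] by simp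
        have 4: "real j * (real m * c) = real n * c - real r * c" by (simp add: n algebra_simps)
        have "- (real r * c) \<le> real r * \<bar>c\<bar>"
          using mult_left_mono[OF abs_ge_minus_self[of c], of "real r"] by simp
        also have "\<dots> \<le> real m * \<bar>c\<bar>" using r by (intro mult_right_mono) auto
        finally show ?thesis using 1 2 3 4 by linarith
      qed
      then show ?case by blast
    qed
  qed
  have conv: "AE \<omega> in S. (\<lambda>n. f n \<omega> / real n) \<longlonglongrightarrow> \<gamma>"
  proof -
    have "AE \<omega> in S. \<forall>j. \<not> deep f (\<gamma> - 1 / Suc j) \<omega>"
      unfolding AE_all_countable by (intro allI lower) simp
    moreover have "AE \<omega> in S. \<forall>j. \<exists>D. \<forall>n. f n \<omega> \<le> real n * (\<gamma> + 1 / Suc j) + D"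
      unfolding AE_all_countable by (intro allI upper) simp
    ultimately show ?thesis
      by eventually_elim (rule tendsto_div_of_linear_bounds; unfold not_deep; blast)
  qed
  moreover have "(\<lambda>n. P.expectation (f n) / real n) \<longlonglongrightarrow> \<gamma>"
  proof -
    have "(\<lambda>n. P.expectation (\<lambda>\<omega>. f n \<omega> / real n)) \<longlonglongrightarrow> P.expectation (\<lambda>\<omega>. \<gamma>)"
    proof (rule integral_dominated_convergence[where w = "\<lambda>_. C"])
      show "AE \<omega> in S. norm (f n \<omega> / real n) \<le> C" for n
        using Y(2)
      proof eventually_elim
        case (elim \<omega>)
        then show ?case using bnd[OF elim, of n] C0 by (cases "n = 0") (auto simp: field_simps)
      qed
    qed (use conv in auto)
    then show ?thesis by (simp add: P.prob_space)
  qed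
  ultimately show ?thesis using E by (rule that)
qed

end

subsection \<open>Orthogonal projections along a subspace\<close>

definition onb :: "'a::euclidean_space set \<Rightarrow> 'a set" where
  "onb V = (SOME B. B \<subseteq> V \<and> pairwise orthogonal B \<and> (\<forall>b\<in>B. norm b = 1) \<and> finite B \<and> span B = V)"

lemma onb:
  assumes "subspace V"
  shows "onb V \<subseteq> V" "pairwise orthogonal (onb V)" "\<And>b. b \<in> onb V \<Longrightarrow> norm b = 1"
    "finite (onb V)" "span (onb V) = V"
proof -
  obtain B where B: "B \<subseteq> V" "pairwise orthogonal B" "\<And>x. x \<in> B \<Longrightarrow> norm x = 1" "independent B" "span B = V"
    using orthonormal_basis_subspace[OF assms] by metis
  have "finite B" using B(4) by (rule independent_imp_finite)
  with B have "\<exists>B. B \<subseteq> V \<and> pairwise orthogonal B \<and> (\<forall>b\<in>B. norm b = 1) \<and> finite B \<and> span B = V" by blast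
  from someI_ex[OF this] show "onb V \<subseteq> V" "pairwise orthogonal (onb V)"
    "\<And>b. b \<in> onb V \<Longrightarrow> norm b = 1" "finite (onb V)" "span (onb V) = V"
    unfolding onb_def by blast+
qed

text \<open>The orthogonal projection onto the complement of \<open>V\<close>, so its norm is the
  norm of the class of x in the quotient by \<open>V\<close>. Quotient actions are thus studied
  inside the ambient space, and \<open>V\<close> = {0} recovers the ambient norm.\<close>

definition qproj :: "'a::euclidean_space set \<Rightarrow> 'a \<Rightarrow> 'a" where
  "qproj V x = x - (\<Sum>b\<in>onb V. (x \<bullet> b) *\<^sub>R b)"

lemma linear_qproj: "linear (qproj V)"
proof (rule linearI)
  fix x y and c :: real
  have 1: "(\<Sum>b\<in>onb V. ((x + y) \<bullet> b) *\<^sub>R b) = (\<Sum>b\<in>onb V. (x \<bullet> b) *\<^sub>R b) + (\<Sum>b\<in>onb V. (y \<bullet> b) *\<^sub>R b)"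
    by (simp only: inner_add_left scaleR_add_left sum.distrib)
  show "qproj V (x + y) = qproj V x + qproj V y" unfolding qproj_def 1 by (rule add_diff_add)
  have 2: "(\<Sum>b\<in>onb V. ((c *\<^sub>R x) \<bullet> b) *\<^sub>R b) = c *\<^sub>R (\<Sum>b\<in>onb V. (x \<bullet> b) *\<^sub>R b)"
    by (simp only: inner_scaleR_left scaleR_sum_right scaleR_scaleR)
  show "qproj V (c *\<^sub>R x) = c *\<^sub>R qproj V x" unfolding qproj_def 2 by (rule scaleR_diff_right[symmetric])
qed

lemmas qproj_add = linear_add[OF linear_qproj]
lemmas qproj_scale = linear_scale[OF linear_qproj]
lemmas qproj_diff = linear_diff[OF linear_qproj]
lemmas qproj_0 [simp] = linear_0[OF linear_qproj]

lemma continuous_on_qproj [continuous_intros]: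
  "continuous_on S f \<Longrightarrow> continuous_on S (\<lambda>x. qproj V (f x))"
  by (rule bounded_linear.continuous_on[OF linear_conv_bounded_linear[THEN iffD1, OF linear_qproj]])

lemma measurable_qproj [measurable]: "qproj V \<in> borel_measurable borel"
  by (intro borel_measurable_continuous_onI continuous_intros)

lemma qproj_inner:
  assumes V: "subspace V" and v: "v \<in> V"
  shows "qproj V x \<bullet> v = 0"
proof -
  note B = onb[OF V]
  have b: "orthogonal (qproj V x) b" if "b \<in> onb V" for b
  proof -
    have "(\<Sum>c\<in>onb V. (x \<bullet> c) * (c \<bullet> b)) = (\<Sum>c\<in>onb V. if c = b then x \<bullet> b else 0)"
      using B(2,3) that
      by (intro sum.cong refl) (auto simp: pairwise_def orthogonal_def power2_norm_eq_inner[symmetric])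
    also have "\<dots> = x \<bullet> b" using that B(4) by simp
    finally show ?thesis by (simp add: orthogonal_def qproj_def inner_diff_left inner_sum_left)
  qed
  have "orthogonal (qproj V x) v"
    using b v B(5) by (intro orthogonal_to_span[of v "onb V"]) auto
  then show ?thesis by (simp add: orthogonal_def)
qed

lemma diff_qproj_mem: "subspace V \<Longrightarrow> x - qproj V x \<in> V"
  unfolding qproj_def using onb[of V] by (auto intro!: subspace_sum subspace_scale)

lemma qproj_eq_0_iff:
  assumes "subspace V"
  shows "qproj V x = 0 \<longleftrightarrow> x \<in> V"
proof
  assume "qproj V x = 0" then show "x \<in> V" using diff_qproj_mem[OF assms, of x] by simp
next
  assume "x \<in> V"
  then have "qproj V x \<in> V"
    using diff_qproj_mem[OF assms, of x] subspace_diff[OF assms, of x "x - qproj V x"] by simp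
  from qproj_inner[OF assms this, of x] show "qproj V x = 0" by simp
qed

lemma norm_qproj_le:
  assumes "subspace V"
  shows "norm (qproj V x) \<le> norm x"
proof -
  have "(norm x)\<^sup>2 = (norm (qproj V x + (x - qproj V x)))\<^sup>2" by simp
  also have "\<dots> = (norm (qproj V x))\<^sup>2 + (norm (x - qproj V x))\<^sup>2"
    using qproj_inner[OF assms diff_qproj_mem[OF assms], of x x]
    by (intro norm_add_Pythagorean) (simp add: orthogonal_def)
  finally have "(norm (qproj V x))\<^sup>2 \<le> (norm x)\<^sup>2" by simp
  then show ?thesis by (rule power2_le_imp_le) simp
qed

lemma qproj_cong:
  assumes "subspace V" "x - y \<in> V"
  shows "qproj V x = qproj V y"
  using qproj_eq_0_iff[OF assms(1), of "x - y"] assms(2) by (simp add: qproj_diff)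

lemma qproj_idem: "subspace V \<Longrightarrow> qproj V (qproj V x) = qproj V x"
  by (rule qproj_cong) (auto simp: diff_qproj_mem subspace_neg[of V "x - qproj V x", simplified])

lemma qproj_trivial [simp]: "qproj {0} x = x"
  using diff_qproj_mem[of "{0}" x] by simp

lemma linear_mv: "linear (\<lambda>x. A *v (x::real^'n))"
  by (simp add: matrix_vector_mul_linear)

text \<open>x and its projection differ by an element of \<open>V\<close>, which A keeps in
  \<open>V\<close>; so A acts on classes modulo \<open>V\<close>.\<close>

lemma qproj_mv_qproj:
  fixes A :: "real^'n^'n"
  assumes "subspace V" "(*v) A ` V = V"
  shows "qproj V (A *v qproj V x) = qproj V (A *v x)"
proof (rule qproj_cong[OF assms(1)])
  have "qproj V x - x \<in> V"
    using subspace_neg[OF assms(1) diff_qproj_mem[OF assms(1), of x]] by simp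
  then have "A *v (qproj V x - x) \<in> V" using assms(2) by blast
  then show "A *v qproj V x - A *v x \<in> V" by (simp only: matrix_vector_mult_diff_distrib)
qed

subsection \<open>Suprema of quotients\<close>

text \<open>An index with k i = 0 contributes x / 0 = 0 to the supremum, and there F i \<le> B * 0
  forces F i = 0. So the supremum is the least nonnegative constant c with F \<le> c * k, as it
  should be. Both matrix gauges below have this form.\<close>

lemma sup_ratio:
  fixes F k :: "'i \<Rightarrow> real"
  assumes "I \<noteq> {}" "\<And>i. i \<in> I \<Longrightarrow> 0 \<le> F i" "\<And>i. i \<in> I \<Longrightarrow> 0 \<le> k i" "\<And>i. i \<in> I \<Longrightarrow> F i \<le> B * k i"
  shows "i \<in> I \<Longrightarrow> F i \<le> (SUP i\<in>I. F i / k i) * k i"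
    and "0 \<le> (SUP i\<in>I. F i / k i)"
    and "(SUP i\<in>I. F i / k i) \<le> c \<longleftrightarrow> 0 \<le> c \<and> (\<forall>i\<in>I. F i \<le> c * k i)"
proof -
  have bdd: "bdd_above ((\<lambda>i. F i / k i) ` I)"
  proof (rule bdd_aboveI2)
    fix i assume i: "i \<in> I"
    show "F i / k i \<le> \<bar>B\<bar>"
    proof (cases "k i = 0")
      case False
      then have "k i > 0" using assms(3)[OF i] by simp
      then show ?thesis using assms(4)[OF i]
        by (simp add: pos_divide_le_eq) (meson abs_ge_self mult_right_mono less_imp_le order_trans)
    qed simp
  qed
  have 1: "F i \<le> (SUP i\<in>I. F i / k i) * k i" if i: "i \<in> I" for i
  proof (cases "k i = 0")
    case True then show ?thesis using assms(4)[OF i] by simp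
  next
    case False
    then have "k i > 0" using assms(3)[OF i] by simp
    moreover have "F i / k i \<le> (SUP i\<in>I. F i / k i)" using i bdd by (rule cSUP_upper)
    ultimately show ?thesis by (simp add: pos_divide_le_eq)
  qed
  then show "i \<in> I \<Longrightarrow> F i \<le> (SUP i\<in>I. F i / k i) * k i" .
  obtain j where j: "j \<in> I" using assms(1) by blast
  have "0 \<le> F j / k j" using assms(2,3)[OF j] by simp
  also have "\<dots> \<le> (SUP i\<in>I. F i / k i)" using j bdd by (rule cSUP_upper)
  finally show 2: "0 \<le> (SUP i\<in>I. F i / k i)" .
  show "(SUP i\<in>I. F i / k i) \<le> c \<longleftrightarrow> 0 \<le> c \<and> (\<forall>i\<in>I. F i \<le> c * k i)"
  proof
    assume c: "(SUP i\<in>I. F i / k i) \<le> c"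
    then have "F i \<le> c * k i" if "i \<in> I" for i
      using 1[OF that] mult_right_mono[OF c assms(3)[OF that]] by linarith
    then show "0 \<le> c \<and> (\<forall>i\<in>I. F i \<le> c * k i)" using c 2 by auto
  next
    assume c: "0 \<le> c \<and> (\<forall>i\<in>I. F i \<le> c * k i)"
    show "(SUP i\<in>I. F i / k i) \<le> c"
    proof (rule cSUP_least[OF assms(1)])
      fix i assume i: "i \<in> I"
      show "F i / k i \<le> c"
        using c i assms(3)[OF i] by (cases "k i = 0") (auto simp: divide_le_eq)
    qed
  qed
qed

text \<open>For invariant subspaces V \<subseteq> W this is the operator norm of the map induced on
  W / V, because every class in W has its shortest representative in W.\<close>

definition quot_norm :: "(real^'n) set \<Rightarrow> (real^'n) set \<Rightarrow> real^'n^'n \<Rightarrow> real" where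
  "quot_norm V W A = (SUP x\<in>W. norm (qproj V (A *v x)) / norm x)"

lemma quot_norm_trivial: "quot_norm {0} W A = onorm_restr W A"
  by (simp add: quot_norm_def onorm_restr_def)

lemma norm_mv_le_onorm: "norm (A *v x) \<le> onorm ((*v) A) * norm (x::real^'n)"
  by (rule onorm) (simp add: matrix_vector_mul_bounded_linear)

lemma quot_norm:
  assumes V: "subspace V" and W: "subspace W"
  shows "x \<in> W \<Longrightarrow> norm (qproj V (A *v x)) \<le> quot_norm V W A * norm x"
    and "0 \<le> quot_norm V W A"
    and "quot_norm V W A \<le> c \<longleftrightarrow> 0 \<le> c \<and> (\<forall>x\<in>W. norm (qproj V (A *v x)) \<le> c * norm x)"
  unfolding quot_norm_def
  using subspace_0[OF W] order_trans[OF norm_qproj_le[OF V] norm_mv_le_onorm]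
  by (intro sup_ratio[where B = "onorm ((*v) A)"]; force)+

subsection \<open>Areas of parallelograms\<close>

text \<open>The norm of the bivector u wedge v, written as the root of a Gram determinant, so that
  exterior powers need not be constructed.\<close>

definition area :: "'a::real_inner \<Rightarrow> 'a \<Rightarrow> real" where
  "area u v = sqrt ((norm u)\<^sup>2 * (norm v)\<^sup>2 - (u \<bullet> v)\<^sup>2)"

lemma area_square: "(area u v)\<^sup>2 = (norm u)\<^sup>2 * (norm v)\<^sup>2 - (u \<bullet> v)\<^sup>2"
  using Cauchy_Schwarz_ineq[of u v]
  by (simp add: area_def power2_norm_eq_inner)

lemma area_nonneg [simp]: "0 \<le> area u v"
  using Cauchy_Schwarz_ineq[of u v] by (simp add: area_def power2_norm_eq_inner)

lemma area_commute: "area u v = area v u"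
  by (simp add: area_def inner_commute mult.commute)

lemma area_le: "area u v \<le> norm u * norm v"
  by (rule power2_le_imp_le) (simp_all add: area_square power_mult_distrib)

lemma area_orthogonal: "u \<bullet> v = 0 \<Longrightarrow> area u v = norm u * norm v"
  by (simp add: area_def real_sqrt_mult)

lemma area_zero [simp]: "area 0 v = 0" "area u 0 = 0"
  by (simp_all add: area_def)

lemma area_same [simp]: "area u u = 0"
  unfolding area_def power2_norm_eq_inner by (simp add: power2_eq_square)

lemma area_combination: "area u (a *\<^sub>R u + b *\<^sub>R v) = \<bar>b\<bar> * area u v"
proof (rule power2_eq_imp_eq)
  have n: "(a *\<^sub>R u + b *\<^sub>R v) \<bullet> (a *\<^sub>R u + b *\<^sub>R v)
      = a\<^sup>2 * (u \<bullet> u) + 2 * a * b * (u \<bullet> v) + b\<^sup>2 * (v \<bullet> v)"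
    by (simp add: inner_add_left inner_add_right inner_commute[of v u] power2_eq_square algebra_simps)
  have m: "u \<bullet> (a *\<^sub>R u + b *\<^sub>R v) = a * (u \<bullet> u) + b * (u \<bullet> v)"
    by (simp add: inner_add_right)
  show "(area u (a *\<^sub>R u + b *\<^sub>R v))\<^sup>2 = (\<bar>b\<bar> * area u v)\<^sup>2"
    unfolding area_square power_mult_distrib power2_norm_eq_inner n m power2_abs by algebra
qed simp_all

lemma area_scale: "area (a *\<^sub>R u) (b *\<^sub>R v) = \<bar>a\<bar> * \<bar>b\<bar> * area u v"
  using area_combination[of "a *\<^sub>R u" 0 b v] area_combination[of v 0 a u]
  by (simp add: area_commute)

text \<open>Replacing w by its component orthogonal to p changes neither area, and an orthogonal
  parallelogram has the product of its sides as area. Only the stretch of p itself is bounded by B1,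
  which is how the second singular value enters later.\<close>

lemma area_linear_le:
  assumes f: "linear f" and p: "norm (f p) \<le> B1 * norm p" and B: "\<And>x. norm (f x) \<le> B2 * norm x"
  shows "area (f p) (f w) \<le> B1 * B2 * area p w"
proof (cases "p = 0")
  case True
  then show ?thesis by (simp add: linear_0[OF f])
next
  case False
  define c where "c = (p \<bullet> w) / (p \<bullet> p)"
  define w' where "w' = (- c) *\<^sub>R p + 1 *\<^sub>R w"
  have orth: "p \<bullet> w' = 0" using False by (simp add: w'_def c_def inner_diff_right)
  have "area (f p) (f w) = area (f p) (f w')"
    unfolding w'_def linear_add[OF f] linear_scale[OF f] area_combination by simp
  also have "\<dots> \<le> norm (f p) * norm (f w')" by (rule area_le)
  also have "\<dots> \<le> (B1 * norm p) * (B2 * norm w')"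
    using p B[of w'] by (intro mult_mono) (auto intro: order_trans[OF norm_ge_zero])
  also have "\<dots> = B1 * B2 * (norm p * norm w')" by simp
  also have "norm p * norm w' = area p w'" by (simp add: area_orthogonal[OF orth])
  also have "area p w' = area p w" unfolding w'_def area_combination by simp
  finally show ?thesis .
qed

text \<open>With t the cosine of the angle, the squared distances are 2 - 2 t and 2 + 2 t, and 1 -
  |t| \<le> 1 - t^2. The sine therefore controls the distance between unit vectors up to a
  sign.\<close>

lemma area_eq_0_unit:
  assumes "norm u = 1" "norm v = 1"
  shows "(norm (u - v))\<^sup>2 \<le> 2 * (area u v)\<^sup>2 \<or> (norm (u + v))\<^sup>2 \<le> 2 * (area u v)\<^sup>2"
proof -
  define t where "t = u \<bullet> v"
  have t: "\<bar>t\<bar> \<le> 1" using Cauchy_Schwarz_ineq2[of u v] assms by (simp add: t_def)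
  have a: "(area u v)\<^sup>2 = 1 - t\<^sup>2" using assms by (simp add: area_square t_def)
  have m: "(norm (u - v))\<^sup>2 = 2 - 2 * t" "(norm (u + v))\<^sup>2 = 2 + 2 * t"
    using assms by (simp_all add: power2_norm_eq_inner norm_eq_1 inner_diff_left inner_diff_right
      inner_add_left inner_add_right inner_commute[of v u] t_def)
  show ?thesis
  proof (cases "t \<ge> 0")
    case True
    then have "t\<^sup>2 \<le> t" using t by (simp add: power2_eq_square mult_left_le_one_le)
    then show ?thesis unfolding a m by simp
  next
    case False
    then have "t\<^sup>2 \<le> - t" using t mult_left_le_one_le[of "-t" "-t"] by (simp add: power2_eq_square)
    then show ?thesis unfolding a m by simp
  qed
qed

text \<open>The norm of the second exterior power of A, which \<open>singular_values_1_2\<close>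
  identifies with the product of the two largest singular values.\<close>

definition area_norm :: "real^'n^'n \<Rightarrow> real" where
  "area_norm A = (SUP p. area (A *v fst p) (A *v snd p) / area (fst p) (snd p))"

lemma area_norm:
  shows "area (A *v u) (A *v v) \<le> area_norm A * area u v"
    and "0 \<le> area_norm A"
    and "area_norm A \<le> c \<longleftrightarrow> 0 \<le> c \<and> (\<forall>u v. area (A *v u) (A *v v) \<le> c * area u v)"
proof -
  have b: "area (A *v fst p) (A *v snd p) \<le> onorm ((*v) A) * onorm ((*v) A) * area (fst p) (snd p)" for p
    by (rule area_linear_le[OF linear_mv norm_mv_le_onorm norm_mv_le_onorm])
  note s = sup_ratio[of UNIV "\<lambda>p. area (A *v fst p) (A *v snd p)" "\<lambda>p. area (fst p) (snd p)", OF _ _ _ b,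
      folded area_norm_def, simplified]
  show "area (A *v u) (A *v v) \<le> area_norm A * area u v" using s(1)[of "(u, v)"] by simp
  show "0 \<le> area_norm A" by (rule s(2))
  show "area_norm A \<le> c \<longleftrightarrow> 0 \<le> c \<and> (\<forall>u v. area (A *v u) (A *v v) \<le> c * area u v)"
    using s(3)[of c] by simp
qed

subsection \<open>Singular values\<close>

lemma ata_inner: "((transpose A ** A) *v x) \<bullet> y = (A *v x) \<bullet> (A *v (y::real^'n))"
  by (simp add: matrix_vector_mul_assoc[symmetric] dot_lmul_matrix)

lemma ata_sym: "((transpose A ** A) *v x) \<bullet> y = x \<bullet> ((transpose A ** A) *v (y::real^'n))"
  by (metis ata_inner inner_commute)

text \<open>The vector \<open>e\<close> maximises the Rayleigh quotient of \<open>A\<^sup>T A\<close> on \<open>U\<close>.\<close>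

lemma exists_top_eigenvector:
  fixes A :: "real^'n^'n"
  assumes U: "subspace U" "U \<noteq> {0}" and inv: "\<And>x. x \<in> U \<Longrightarrow> (transpose A ** A) *v x \<in> U"
  obtains e where "e \<in> U" "norm e = 1" "e \<in> right_singular_space A (norm (A *v e))"
    "\<And>x. x \<in> U \<Longrightarrow> norm (A *v x) \<le> norm (A *v e) * norm x"
proof -
  let ?K = "sphere 0 1 \<inter> U"
  have K: "compact ?K" by (intro compact_Int_closed closed_subspace U) auto
  obtain x where x: "x \<in> U" "x \<noteq> 0" using U subspace_0[OF U(1)] by blast
  then have "(1 / norm x) *\<^sub>R x \<in> ?K" by (auto intro: subspace_scale U)
  then have "?K \<noteq> {}" by blast
  moreover have "continuous_on ?K (\<lambda>x. norm (A *v x))"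
    by (intro continuous_intros linear_continuous_on) (simp add: matrix_vector_mul_bounded_linear)
  ultimately obtain e where e: "e \<in> ?K" and max: "\<And>y. y \<in> ?K \<Longrightarrow> norm (A *v y) \<le> norm (A *v e)"
    using continuous_attains_sup[OF K] by metis
  define s where "s = norm (A *v e)"
  have bound: "norm (A *v x) \<le> s * norm x" if "x \<in> U" for x
  proof (cases "x = 0")
    case False
    have "norm (A *v ((1 / norm x) *\<^sub>R x)) \<le> s"
      unfolding s_def using that False by (intro max) (auto intro: subspace_scale U)
    then show ?thesis using False by (simp add: matrix_vector_mult_scaleR field_simps)
  qed simp
  define r where "r = (transpose A ** A) *v e - s\<^sup>2 *\<^sub>R e"
  have rU: "r \<in> U" unfolding r_def using e by (intro subspace_diff subspace_scale U inv) auto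
  have expand: "(x + t *\<^sub>R y) \<bullet> (x + t *\<^sub>R y) = x \<bullet> x + 2 * t * (x \<bullet> y) + t\<^sup>2 * (y \<bullet> y)"
    for x y :: "real^'n" and t
    by (simp add: inner_add_left inner_add_right inner_commute[of y x] power2_eq_square algebra_simps)
  \<comment> \<open>Maximality of e tested at e + t r, with the residual r itself as direction: the
    terms linear in t combine to 2 t times the squared norm of r, and the rest is quadratic in t. A
    small positive t then forces r = 0.\<close>
  have quad: "t * (2 * (r \<bullet> r)) \<le> t\<^sup>2 * (s\<^sup>2 * (norm r)\<^sup>2)" for t :: real
  proof -
    have q1: "(norm (A *v (e + t *\<^sub>R r)))\<^sup>2 \<le> s\<^sup>2 * (norm (e + t *\<^sub>R r))\<^sup>2"
      unfolding power_mult_distrib[symmetric]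
      using e rU by (intro power_mono bound subspace_add subspace_scale U) auto
    have q2: "(norm (A *v (e + t *\<^sub>R r)))\<^sup>2 = s\<^sup>2 + 2 * t * (((transpose A ** A) *v e) \<bullet> r) + t\<^sup>2 * (norm (A *v r))\<^sup>2"
      unfolding ata_inner s_def power2_norm_eq_inner
      unfolding matrix_vector_right_distrib matrix_vector_mult_scaleR by (rule expand)
    have q3: "(norm (e + t *\<^sub>R r))\<^sup>2 = 1 + 2 * t * (e \<bullet> r) + t\<^sup>2 * (norm r)\<^sup>2"
      using e unfolding power2_norm_eq_inner expand by (simp add: norm_eq_1)
    have q4: "t * (2 * (r \<bullet> r)) = 2 * t * (((transpose A ** A) *v e) \<bullet> r) - s\<^sup>2 * (2 * t * (e \<bullet> r))"
      by (subst (1) r_def) (simp add: inner_diff_left algebra_simps)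
    have q5: "0 \<le> t\<^sup>2 * (norm (A *v r))\<^sup>2" by simp
    show ?thesis using q1[unfolded q2 q3 distrib_left mult_1_right] q4 q5
        mult.left_commute[of "t\<^sup>2" "s\<^sup>2" "(norm r)\<^sup>2"] by linarith
  qed
  have "r = 0"
  proof (rule ccontr)
    assume "r \<noteq> 0"
    then have pos: "r \<bullet> r > 0" by simp
    define c where "c = s\<^sup>2 * (norm r)\<^sup>2 + 1"
    have c: "c > 0" unfolding c_def by (intro add_nonneg_pos) auto
    define t where "t = (r \<bullet> r) / c"
    have t: "t > 0" using pos c by (simp add: t_def)
    have "t * (2 * (r \<bullet> r)) \<le> t\<^sup>2 * (s\<^sup>2 * (norm r)\<^sup>2)" by (rule quad)
    also have "\<dots> \<le> t\<^sup>2 * c" unfolding c_def by (intro mult_left_mono) auto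
    also have "\<dots> = t * (t * c)" by (simp add: power2_eq_square)
    also have "t * c = r \<bullet> r" using c by (simp add: t_def)
    finally show False using t pos by simp
  qed
  then have "e \<in> right_singular_space A s" by (simp add: right_singular_space_def r_def)
  then show ?thesis using that[of e] e bound by (auto simp: s_def)
qed

lemma sorted_list_of_set_Max:
  assumes "finite E" "E \<noteq> {}"
  shows "sorted_list_of_set E = sorted_list_of_set (E - {Max E}) @ [Max E]"
proof (rule sorted_distinct_set_unique)
  show "sorted (sorted_list_of_set (E - {Max E}) @ [Max E])"
    using assms by (auto simp: sorted_append)
  show "set (sorted_list_of_set E) = set (sorted_list_of_set (E - {Max E}) @ [Max E])"
    using assms by (simp add: insert_absorb)
qed (use assms in auto)

lemma subspace_rss: "subspace (right_singular_space A s)"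
  unfolding right_singular_space_def
  by (auto simp: subspace_def matrix_vector_right_distrib matrix_vector_mult_scaleR scaleR_right_distrib)

text \<open>The definition lists eigenvalues with multiplicity, while the proof needs extremal
  characterisations. Let e1 maximise the norm of A x on the unit sphere, and e2 on its part
  orthogonal to e1. The list begins with these two maxima, and their product bounds the growth of
  areas because every plane contains a nonzero vector orthogonal to e1.\<close>

lemma singular_values_1_2:
  fixes A :: "real^'n^'n"
  assumes n: "2 \<le> CARD('n)"
  shows "singular_value 1 A = onorm_restr UNIV A"
    and "singular_value 1 A * singular_value 2 A = area_norm A"
proof -
  let ?T = "\<lambda>x. (transpose A ** A) *v x"
  have "(UNIV :: (real^'n) set) \<noteq> {0}" using UNIV_not_singleton by metis
  then obtain e1 where e1: "norm e1 = 1" "e1 \<in> right_singular_space A (norm (A *v e1))"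
    and max1: "\<And>x. norm (A *v x) \<le> norm (A *v e1) * norm x"
    using exists_top_eigenvector[of "UNIV :: (real^'n) set" A] by auto
  define s1 where "s1 = norm (A *v e1)"
  have Te1: "?T e1 = s1\<^sup>2 *\<^sub>R e1" using e1(2) by (simp add: right_singular_space_def s1_def)
  define U where "U = {x. e1 \<bullet> x = 0}"
  have U: "subspace U" unfolding U_def by (rule subspace_hyperplane)
  have "dim U = DIM(real^'n) - 1" unfolding U_def using e1 by (intro dim_hyperplane) auto
  then have "dim U \<ge> 1" using n by simp
  then have U0: "U \<noteq> {0}" by auto
  have invU: "?T x \<in> U" if "x \<in> U" for x
    using that by (simp add: U_def ata_sym[symmetric] Te1 inner_commute[of e1])
      (metis ata_sym Te1 inner_commute inner_scaleR_left mult_zero_right)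
  obtain e2 where e2: "e2 \<in> U" "norm e2 = 1" "e2 \<in> right_singular_space A (norm (A *v e2))"
    and max2: "\<And>x. x \<in> U \<Longrightarrow> norm (A *v x) \<le> norm (A *v e2) * norm x"
    using exists_top_eigenvector[OF U U0 invU] by metis
  define s2 where "s2 = norm (A *v e2)"
  define E where "E = {s. 0 \<le> s \<and> (\<exists>x\<in>right_singular_space A s. x \<noteq> 0)}"
  have orth: "x \<bullet> y = 0" if "x \<in> right_singular_space A s" "y \<in> right_singular_space A t" "0 \<le> s" "0 \<le> t" "s \<noteq> t"
    for x y s t
  proof -
    have "s\<^sup>2 * (x \<bullet> y) = t\<^sup>2 * (x \<bullet> y)"
      using ata_sym[of A x y] that by (simp add: right_singular_space_def)
    moreover have "s\<^sup>2 \<noteq> t\<^sup>2" using that by (simp add: power2_eq_iff_nonneg)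
    ultimately show ?thesis by simp
  qed
  have normA: "norm (A *v x) = s * norm x" if "x \<in> right_singular_space A s" "0 \<le> s" for x s
  proof (rule power2_eq_imp_eq)
    have "?T x = s\<^sup>2 *\<^sub>R x" using that by (simp add: right_singular_space_def)
    then show "(norm (A *v x))\<^sup>2 = (s * norm x)\<^sup>2"
      using ata_inner[of A x x] by (simp add: power_mult_distrib power2_norm_eq_inner)
  qed (use that in auto)
  \<comment> \<open>Eigenvectors for distinct values are orthogonal, hence independent, so only
    finitely many values occur. For an infinite set \<open>sorted_list_of_set\<close> would return
    the empty list.\<close>
  have finE: "finite E"
  proof -
    define g where "g s = (SOME x. x \<in> right_singular_space A s \<and> x \<noteq> 0)" for s
    have g: "g s \<in> right_singular_space A s" "g s \<noteq> 0" if "s \<in> E" for s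
      using that someI_ex[of "\<lambda>x. x \<in> right_singular_space A s \<and> x \<noteq> 0"] by (auto simp: E_def g_def)
    have go: "g s \<bullet> g t = 0" if "s \<in> E" "t \<in> E" "s \<noteq> t" for s t
      using orth[OF g(1)[OF that(1)] g(1)[OF that(2)]] that by (simp add: E_def)
    have "inj_on g E" by (rule inj_onI) (metis go g(2) inner_eq_zero_iff)
    moreover have "pairwise orthogonal (g ` E)"
      using go by (auto simp: pairwise_def orthogonal_def)
    moreover have "0 \<notin> g ` E" using g by auto
    ultimately have "finite (g ` E)"
      using pairwise_orthogonal_independent independent_imp_finite by blast
    then show ?thesis using \<open>inj_on g E\<close> finite_imageD by blast
  qed
  have s1E: "s1 \<in> E" using e1 by (auto simp: E_def s1_def intro!: bexI[of _ e1])
  have s2E: "s2 \<in> E" using e2 by (auto simp: E_def s2_def intro!: bexI[of _ e2])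
  have le1: "s \<le> s1" if sE: "s \<in> E" for s
  proof -
    obtain x where x: "x \<in> right_singular_space A s" "x \<noteq> 0" "0 \<le> s" using sE by (auto simp: E_def)
    then show ?thesis using max1[of x] normA[of x s] by (simp add: s1_def)
  qed
  have Max1: "Max E = s1" using finE s1E le1 by (intro Max_eqI) auto
  have dimpos: "dim (right_singular_space A s) \<ge> 1" if "s \<in> E" for s
    using that by (auto simp: E_def Suc_le_eq dim_eq_0 simp flip: neq0_conv)
  have list1: "singular_values A = replicate (dim (right_singular_space A s1)) s1
      @ concat (map (\<lambda>s. replicate (dim (right_singular_space A s)) s) (rev (sorted_list_of_set (E - {s1}))))"
    unfolding singular_values_def E_def[symmetric] using s1E
    by (subst sorted_list_of_set_Max[OF finE]) (auto simp: Max1)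
  have sv1: "singular_value 1 A = s1"
    using dimpos[OF s1E] by (simp add: singular_value_def list1 nth_append)
  have s21: "s2 \<le> s1" using le1[OF s2E] .
  have sv2: "singular_value 2 A = s2"
  \<comment> \<open>If the top eigenspace has dimension at least 2, the list repeats s1, and a top
    eigenvector orthogonal to e1 forces s2 = s1. Otherwise s2 is the next smaller value.\<close>
  proof (cases "dim (right_singular_space A s1) \<ge> 2")
    case True
    have "\<exists>x\<in>right_singular_space A s1. x \<in> U \<and> x \<noteq> 0"
    proof (rule ccontr)
      assume c: "\<not> ?thesis"
      have "right_singular_space A s1 \<subseteq> span {e1}"
      proof
        fix x assume x: "x \<in> right_singular_space A s1"
        have "x - (e1 \<bullet> x) *\<^sub>R e1 \<in> right_singular_space A s1"
          using x e1 by (intro subspace_diff subspace_scale subspace_rss) (auto simp: s1_def)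
        moreover have "x - (e1 \<bullet> x) *\<^sub>R e1 \<in> U" using e1 by (simp add: U_def inner_diff_right norm_eq_1)
        ultimately have "x = (e1 \<bullet> x) *\<^sub>R e1" using c by auto
        then show "x \<in> span {e1}" by (metis span_base span_scale singletonI)
      qed
      then have "dim (right_singular_space A s1) \<le> card {e1}" by (intro dim_le_card) auto
      then show False using True by simp
    qed
    then obtain x where x: "x \<in> right_singular_space A s1" "x \<in> U" "x \<noteq> 0" by blast
    have "s1 * norm x \<le> s2 * norm x"
      using max2[OF x(2)] normA[OF x(1)] by (simp add: s1_def s2_def)
    then have "s1 = s2" using x s21 by simp
    then show ?thesis using True by (simp add: singular_value_def list1 nth_append)
  next
    case False
    then have d1: "dim (right_singular_space A s1) = 1" using dimpos[OF s1E] by simp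
    have ne: "s2 \<noteq> s1"
    proof
      assume eq: "s2 = s1"
      have "pairwise orthogonal {e1, e2}" "0 \<notin> {e1, e2}" "e1 \<noteq> e2"
        using e1 e2 by (auto simp: pairwise_def orthogonal_def U_def inner_commute)
      then have "independent {e1, e2}" "card {e1, e2} = 2"
        using pairwise_orthogonal_independent by auto
      moreover have "{e1, e2} \<subseteq> right_singular_space A s1" using e1 e2 eq by (auto simp: s1_def s2_def)
      ultimately have "2 \<le> dim (right_singular_space A s1)" using independent_card_le_dim by metis
      then show False using d1 by simp
    qed
    have ne': "E - {s1} \<noteq> {}" using ne s2E by auto
    have Max2: "Max (E - {s1}) = s2"
    proof (rule Max_eqI)
      fix s assume s: "s \<in> E - {s1}"
      then obtain x where x: "x \<in> right_singular_space A s" "x \<noteq> 0" "0 \<le> s" by (auto simp: E_def)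
      have "e1 \<bullet> x = 0" using orth[of e1 s1 x s] x s e1 by (auto simp: s1_def)
      then show "s \<le> s2" using max2[of x] normA[of x s] x by (simp add: U_def s2_def)
    qed (use finE ne s2E in auto)
    have list2: "singular_values A = s1 # replicate (dim (right_singular_space A s2)) s2
        @ concat (map (\<lambda>s. replicate (dim (right_singular_space A s)) s) (rev (sorted_list_of_set (E - {s1} - {s2}))))"
      unfolding list1 d1 using finE
      by (subst sorted_list_of_set_Max[OF _ ne']) (auto simp: Max2)
    show ?thesis using dimpos[OF s2E] by (simp add: singular_value_def list2 nth_append)
  qed
  have s10: "0 \<le> s1" and s20: "0 \<le> s2" by (simp_all add: s1_def s2_def)
  have on: "onorm_restr UNIV A = s1"
    unfolding quot_norm_trivial[symmetric]
  proof (rule antisym)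
    show "quot_norm {0} UNIV A \<le> s1"
      using max1 s10 by (subst quot_norm(3)) (auto simp: s1_def)
    show "s1 \<le> quot_norm {0} UNIV A"
      using quot_norm(1)[of "{0}" UNIV e1 A] e1 by (simp add: s1_def)
  qed
  show "singular_value 1 A = onorm_restr UNIV A" unfolding sv1 on ..
  have key: "area (A *v p) (A *v w) \<le> s1 * s2 * area p w" if "p \<in> U" for p w
  proof -
    have "area (A *v p) (A *v w) \<le> s2 * s1 * area p w"
      using max1 max2[OF that] unfolding s1_def s2_def by (intro area_linear_le linear_mv)
    then show ?thesis by (simp add: mult.commute)
  qed
  have an: "area_norm A \<le> s1 * s2"
    unfolding area_norm(3)
  proof (intro conjI allI)
    fix u v
    \<comment> \<open>Chosen so that p = a u + b v is orthogonal to e1. Passing from the pair u, v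
      to the pair u, p multiplies both areas by |b|, so the estimate for p carries over; b = 0 means
      that u itself is orthogonal to e1.\<close>
    define a b where "a = e1 \<bullet> v" and "b = - (e1 \<bullet> u)"
    define p where "p = a *\<^sub>R u + b *\<^sub>R v"
    have p: "p \<in> U" by (simp add: p_def U_def inner_diff_right a_def b_def)
    have Ap: "A *v p = a *\<^sub>R (A *v u) + b *\<^sub>R (A *v v)"
      by (simp add: p_def matrix_vector_right_distrib matrix_vector_mult_scaleR)
    show "area (A *v u) (A *v v) \<le> s1 * s2 * area u v"
    proof (cases "b = 0")
      case True
      then have "u \<in> U" by (simp add: U_def b_def)
      then show ?thesis by (rule key)
    next
      case False
      have "area (A *v p) (A *v u) \<le> s1 * s2 * area p u" using p by (rule key)
      moreover have "area p u = \<bar>b\<bar> * area u v" unfolding p_def by (subst area_commute) (rule area_combination)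
      moreover have "area (A *v p) (A *v u) = \<bar>b\<bar> * area (A *v u) (A *v v)"
        unfolding Ap by (subst area_commute) (rule area_combination)
      ultimately have "\<bar>b\<bar> * area (A *v u) (A *v v) \<le> \<bar>b\<bar> * (s1 * s2 * area u v)" by (simp add: algebra_simps)
      then show ?thesis using False by simp
    qed
  qed (use s10 s20 in simp)
  have "(A *v e1) \<bullet> (A *v e2) = 0"
    using e2(1) by (simp add: ata_inner[symmetric] Te1 U_def)
  then have "s1 * s2 = area (A *v e1) (A *v e2)" by (simp add: area_orthogonal s1_def s2_def)
  also have "\<dots> \<le> area_norm A * area e1 e2" by (rule area_norm(1))
  also have "area e1 e2 = 1" using e1 e2 by (simp add: area_orthogonal U_def)
  finally show "singular_value 1 A * singular_value 2 A = area_norm A"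
    unfolding sv1 sv2 using an by simp
qed

subsection \<open>Growth rates of random products\<close>

lemma continuous_on_mv [continuous_intros]:
  fixes f :: "'a::topological_space \<Rightarrow> real^'n^'m"
  shows "continuous_on S f \<Longrightarrow> continuous_on S g \<Longrightarrow> continuous_on S (\<lambda>x. f x *v g x)"
  unfolding matrix_vector_mult_def by (intro continuous_intros)

lemma continuous_on_mm [continuous_intros]:
  fixes f :: "'a::topological_space \<Rightarrow> real^'n^'m"
  shows "continuous_on S f \<Longrightarrow> continuous_on S g \<Longrightarrow> continuous_on S (\<lambda>x. f x ** g x)"
  unfolding matrix_matrix_mult_def by (intro continuous_intros)

lemma borel_measurable_mv [measurable]:
  fixes f :: "'a \<Rightarrow> real^'n^'m"
  assumes "f \<in> borel_measurable M" "g \<in> borel_measurable M"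
  shows "(\<lambda>x. f x *v g x) \<in> borel_measurable M"
  using assms by (rule borel_measurable_continuous_Pair) (intro continuous_intros)

lemma borel_measurable_mm [measurable]:
  fixes f :: "'a \<Rightarrow> real^'n^'m" and g :: "'a \<Rightarrow> real^'k^'n"
  assumes "f \<in> borel_measurable M" "g \<in> borel_measurable M"
  shows "(\<lambda>x. f x ** g x) \<in> borel_measurable M"
  using assms by (rule borel_measurable_continuous_Pair) (intro continuous_intros)

text \<open>The gauges are suprema over uncountably many vectors; their sublevel sets are
  nevertheless closed, as intersections of closed sets.\<close>

lemma borel_measurable_closed_sublevel:
  fixes N :: "'a::topological_space \<Rightarrow> real"
  assumes "\<And>c. closed {A. N A \<le> c}"
  shows "N \<in> borel_measurable borel"
  unfolding borel_measurable_iff_le using assms by (auto intro: borel_closed)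

lemma measurable_quot_norm [measurable]:
  assumes V: "subspace V" and W: "subspace W"
  shows "quot_norm V W \<in> borel_measurable borel"
proof (rule borel_measurable_closed_sublevel)
  fix c
  have "{A. quot_norm V W A \<le> c} = (if 0 \<le> c then (\<Inter>x\<in>W. {A. norm (qproj V (A *v x)) \<le> c * norm x}) else {})"
    using quot_norm(3)[OF V W] by auto
  also have "closed \<dots>"
    by (auto intro!: closed_INT closed_Collect_le continuous_intros)
  finally show "closed {A. quot_norm V W A \<le> c}" .
qed

lemma measurable_area_norm [measurable]: "area_norm \<in> borel_measurable borel"
proof (rule borel_measurable_closed_sublevel)
  fix c
  have "{A :: real^'n^'n. area_norm A \<le> c}
      = (if 0 \<le> c then (\<Inter>u. \<Inter>v. {A. area (A *v u) (A *v v) \<le> c * area u v}) else {})"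
    using area_norm(3) by auto
  also have "closed \<dots>"
    by (auto intro!: closed_INT closed_Collect_le continuous_intros simp: area_def)
  finally show "closed {A :: real^'n^'n. area_norm A \<le> c}" .
qed

section \<open>Invertible matrices and products along a sequence\<close>

lemma invertible_mv_eq_0:
  fixes A :: "real^'n^'n"
  assumes "invertible A"
  shows "A *v x = 0 \<longleftrightarrow> x = 0"
proof -
  obtain B where "B ** A = mat 1" using assms by (auto simp: invertible_def)
  then show ?thesis using matrix_left_invertible_ker by (metis matrix_vector_mult_0_right)
qed

lemma invertible_mat: "invertible (mat 1 :: real^'n^'n)"
  unfolding invertible_def by (intro exI[of _ "mat 1"]) simp

lemma matrix_inv_right:
  fixes A :: "real^'n^'n"
  assumes "invertible A"
  shows "A ** matrix_inv A = mat 1"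
  using someI_ex[OF assms[unfolded invertible_def]] by (simp add: matrix_inv_def)

lemma invertible_mv_mem:
  fixes A :: "real^'n^'n"
  assumes "invertible A" "(*v) A ` V = V"
  shows "A *v x \<in> V \<longleftrightarrow> x \<in> V"
proof
  assume "A *v x \<in> V"
  then obtain y where y: "y \<in> V" "A *v x = A *v y" using assms(2) by (metis imageE)
  then have "A *v (x - y) = 0" by (simp add: matrix_vector_mult_diff_distrib)
  then show "x \<in> V" using invertible_mv_eq_0[OF assms(1)] y by simp
qed (use assms in blast)

lemma mat_prod_add: "mat_prod \<omega> (n + m) = mat_prod (seq_shift n \<omega>) m ** mat_prod \<omega> n"
  by (induction m) (simp_all add: seq_shift_def matrix_mul_assoc add.commute)

lemma mat_prod_cong: "(\<And>i. i < n \<Longrightarrow> \<omega> i = \<omega>' i) \<Longrightarrow> mat_prod \<omega> n = mat_prod \<omega>' n"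
  by (induction n) simp_all

lemma mat_prod_comb_seq: "mat_prod (comb_seq n \<omega> \<omega>') (n + m) = mat_prod \<omega>' m ** mat_prod \<omega> n"
proof -
  have "mat_prod (comb_seq n \<omega> \<omega>') n = mat_prod \<omega> n"
    by (rule mat_prod_cong) (simp add: comb_seq_less)
  then show ?thesis by (simp add: mat_prod_add)
qed

lemma mat_prod_case_nat: "mat_prod (case_nat g \<omega>) (Suc n) = mat_prod \<omega> n ** g"
  by (induction n) (simp_all add: matrix_mul_assoc)

locale compact_gl =
  fixes \<Sigma> :: "(real^'n^'n) set"
  assumes compact: "compact \<Sigma>" and invertible: "\<Sigma> \<subseteq> {g. invertible g}"
begin

lemma distortion_exists: "\<exists>K\<ge>1. \<forall>g\<in>\<Sigma>. \<forall>x. norm (g *v x) \<le> K * norm x \<and> norm x \<le> K * norm (g *v x)"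
proof (cases "\<Sigma> = {}")
  case False
  let ?f = "\<lambda>p. norm (fst p *v snd p :: real^'n)"
  have K: "compact (\<Sigma> \<times> sphere 0 1 :: ((real^'n^'n) \<times> (real^'n)) set)"
    by (intro compact_Times compact) auto
  have ne: "\<Sigma> \<times> (sphere 0 1 :: (real^'n) set) \<noteq> {}"
    using False vector_choose_size[of 1] by (auto simp: sphere_def)
  have c: "continuous_on (\<Sigma> \<times> sphere 0 1) ?f" by (intro continuous_intros)
  obtain p where p: "p \<in> \<Sigma> \<times> sphere 0 1" "\<And>q. q \<in> \<Sigma> \<times> sphere 0 1 \<Longrightarrow> ?f q \<le> ?f p"
    using continuous_attains_sup[OF K ne c] by blast
  obtain q where q: "q \<in> \<Sigma> \<times> sphere 0 1" "\<And>r. r \<in> \<Sigma> \<times> sphere 0 1 \<Longrightarrow> ?f q \<le> ?f r"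
    using continuous_attains_inf[OF K ne c] by blast
  define m where "m = ?f q"
  have "snd q \<noteq> 0" "Finite_Cartesian_Product.invertible (fst q)" using q(1) invertible by auto
  then have m: "m > 0" unfolding m_def using invertible_mv_eq_0 by auto
  define K where "K = max 1 (max (?f p) (1 / m))"
  have K: "K \<ge> 1" "K \<ge> ?f p" "K \<ge> 1 / m" by (auto simp: K_def)
  have "norm (g *v x) \<le> K * norm x \<and> norm x \<le> K * norm (g *v x)" if g: "g \<in> \<Sigma>" for g x
  proof (cases "x = 0")
    case False
    define y where "y = (1 / norm x) *\<^sub>R x"
    have y: "(g, y) \<in> \<Sigma> \<times> sphere 0 1" using g False by (simp add: y_def)
    have "norm (g *v y) \<le> K" using p(2)[OF y] K by simp
    moreover have "m \<le> norm (g *v y)" using q(2)[OF y] by (simp add: m_def)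
    moreover have gy: "norm (g *v y) = norm (g *v x) / norm x"
      by (simp add: y_def matrix_vector_mult_scaleR)
    ultimately have 1: "norm (g *v x) \<le> K * norm x" "m * norm x \<le> norm (g *v x)"
      using False by (simp_all add: field_simps)
    have "norm x \<le> (1 / m) * norm (g *v x)" using 1(2) m by (simp add: field_simps)
    also have "\<dots> \<le> K * norm (g *v x)" using K by (intro mult_right_mono) auto
    finally show ?thesis using 1 by simp
  qed simp
  then show ?thesis using K by blast
qed auto

text \<open>A common bound for all g in \<Sigma> and for their inverses. Logarithms of norms along a
  product of n factors are therefore bounded by multiples of n * ln KK, which is why every process
  below is bounded rather than merely integrable.\<close>

definition KK :: real where
  "KK = (SOME K. K \<ge> 1 \<and> (\<forall>g\<in>\<Sigma>. \<forall>x. norm (g *v x) \<le> K * norm x \<and> norm x \<le> K * norm (g *v x)))"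

lemma KK: "KK \<ge> 1" "g \<in> \<Sigma> \<Longrightarrow> norm (g *v x) \<le> KK * norm x" "g \<in> \<Sigma> \<Longrightarrow> norm x \<le> KK * norm (g *v x)"
  using someI_ex[OF distortion_exists, folded KK_def] by auto

lemma KK_pos: "KK > 0" using KK(1) by simp

lemma matrix_inv_mult: "g \<in> \<Sigma> \<Longrightarrow> g *v (matrix_inv g *v x) = x"
  using invertible by (auto simp: matrix_vector_mul_assoc matrix_inv_right)

lemma norm_matrix_inv: "g \<in> \<Sigma> \<Longrightarrow> norm (matrix_inv g *v x) \<le> KK * norm x"
  using KK(3)[of g "matrix_inv g *v x"] matrix_inv_mult[of g x] by simp

end

section \<open>Almost sure growth rates of matrix gauges\<close>

locale random_product = compact_gl \<Sigma> for \<Sigma> :: "(real^'n^'n) set" +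
  fixes \<mu> :: "(real^'n^'n) measure"
  assumes \<mu>: "\<mu> \<in> Prob \<Sigma>"

sublocale random_product \<subseteq> sequence_space \<mu>
proof -
  interpret prob_space \<mu> using \<mu> by (simp add: Prob_def)
  show "sequence_space \<mu>" by unfold_locales
qed

context random_product
begin

lemma space_mu: "space \<mu> = \<Sigma>"
proof -
  have "sets \<mu> = sets (restrict_space borel \<Sigma>)" using \<mu> by (simp add: Prob_def)
  then have "space \<mu> = space (restrict_space borel \<Sigma>)" by (rule sets_eq_imp_space_eq)
  then show ?thesis by (simp add: space_restrict_space)
qed

lemma sets_mu: "sets \<mu> = sets (restrict_space borel \<Sigma>)"
  using \<mu> by (simp add: Prob_def)

lemma measurable_borel_mu: "f \<in> measurable borel N \<Longrightarrow> f \<in> measurable \<mu> N"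
  by (subst measurable_cong_sets[OF sets_mu refl]) (rule measurable_restrict_space1)

lemma measurable_ident_mu [measurable]: "(\<lambda>g. g) \<in> borel_measurable \<mu>"
  by (rule measurable_borel_mu) simp

lemma measurable_mat_prod [measurable]: "(\<lambda>\<omega>. mat_prod \<omega> n) \<in> borel_measurable S"
  by (induction n) simp_all

lemma space_S: "\<omega> \<in> space S \<longleftrightarrow> (\<forall>n. \<omega> n \<in> \<Sigma>)"
  by (simp add: space_PiM PiE_iff space_mu)

lemma seq_shift_space: "\<omega> \<in> space S \<Longrightarrow> seq_shift k \<omega> \<in> space S"
  by (simp add: space_S seq_shift_def)

lemma invertible_mat_prod: "\<omega> \<in> space S \<Longrightarrow> Finite_Cartesian_Product.invertible (mat_prod \<omega> n)"
proof (induction n)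
  case (Suc n)
  then show ?case using invertible by (auto simp: space_S intro: invertible_mult)
qed (simp add: invertible_mat)

lemma norm_mat_prod:
  assumes "\<omega> \<in> space S"
  shows "norm (mat_prod \<omega> n *v x) \<le> KK ^ n * norm x" "norm x \<le> KK ^ n * norm (mat_prod \<omega> n *v x)"
proof (induction n)
  case (Suc n)
  have g: "\<omega> n \<in> \<Sigma>" using assms by (simp add: space_S)
  {
    case 1
    have "norm (\<omega> n *v (mat_prod \<omega> n *v x)) \<le> KK * (KK ^ n * norm x)"
      using KK(1) by (intro order_trans[OF KK(2)[OF g]] mult_left_mono Suc.IH) auto
    then show ?case by (simp add: matrix_vector_mul_assoc mult.assoc)
  next
    case 2
    have "norm x \<le> KK ^ n * norm (mat_prod \<omega> n *v x)" by (rule Suc.IH)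
    also have "\<dots> \<le> KK ^ n * (KK * norm (\<omega> n *v (mat_prod \<omega> n *v x)))"
      using KK(1) by (intro mult_left_mono KK(3)[OF g]) auto
    finally show ?case by (simp add: matrix_vector_mul_assoc mult_ac)
  }
qed simp_all

text \<open>The whole output of \<open>kingman\<close>. The limit in mean is recorded besides the
  almost sure one because it supplies a finite time at which the expectation is already close to its
  asymptotic value.\<close>

definition growth :: "(real^'n^'n \<Rightarrow> real) \<Rightarrow> real \<Rightarrow> bool" where
  "growth N \<gamma> \<longleftrightarrow> (AE \<omega> in S. (\<lambda>n. ln (N (mat_prod \<omega> n)) / real n) \<longlonglongrightarrow> \<gamma>)
     \<and> (\<lambda>n. P.expectation (\<lambda>\<omega>. ln (N (mat_prod \<omega> n))) / real n) \<longlonglongrightarrow> \<gamma>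
     \<and> (\<forall>n\<ge>1. real n * \<gamma> \<le> P.expectation (\<lambda>\<omega>. ln (N (mat_prod \<omega> n))))
     \<and> (\<forall>n. integrable S (\<lambda>\<omega>. ln (N (mat_prod \<omega> n))))"

lemma AE_limit_unique:
  assumes "AE \<omega> in S. X \<omega> \<longlonglongrightarrow> (a::real)" "AE \<omega> in S. X \<omega> \<longlonglongrightarrow> b"
  shows "a = b"
proof -
  have "AE \<omega> in S. a = b" using assms by eventually_elim (rule LIMSEQ_unique)
  then show ?thesis by (simp add: P.AE_const)
qed

lemma lyapunov_eqI:
  assumes "AE \<omega> in S. (\<lambda>n. ln (singular_value i (mat_prod \<omega> n)) / real n) \<longlonglongrightarrow> l"
  shows "lyapunov i \<mu> = l"
  unfolding lyapunov_def iid_space_def using assms by (intro the_equality) (auto intro: AE_limit_unique)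

lemma lyapunov_restr_eqI:
  assumes "growth (quot_norm {0} V) l"
  shows "lyapunov_restr V \<mu> = l"
  unfolding lyapunov_restr_def iid_space_def using assms
  by (intro the_equality) (auto intro: AE_limit_unique simp: growth_def quot_norm_trivial)

text \<open>Submultiplicativity makes ln N subadditive. The last assumption says that multiplication
  by g on the right shrinks N at most by the factor c; the right factor is the one applied first, so
  this is the near-invariance under the shift that \<open>kingman\<close> asks for. \<open>G\<close>
  collects the matrices with the almost sure invariance properties under which N is a gauge.\<close>

lemma gauge_growth:
  fixes N :: "real^'n^'n \<Rightarrow> real"
  assumes N[measurable]: "N \<in> borel_measurable borel"
    and G: "AE g in \<mu>. g \<in> G" "mat 1 \<in> G" "\<And>A B. A \<in> G \<Longrightarrow> B \<in> G \<Longrightarrow> A ** B \<in> G"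
    and pos: "\<And>A. A \<in> G \<Longrightarrow> 0 < N A"
    and sub: "\<And>A B. A \<in> G \<Longrightarrow> B \<in> G \<Longrightarrow> N (A ** B) \<le> N A * N B"
    and c: "c \<ge> 1" "\<And>g. g \<in> G \<Longrightarrow> g \<in> \<Sigma> \<Longrightarrow> N g \<le> c"
      "\<And>A g. A \<in> G \<Longrightarrow> g \<in> G \<Longrightarrow> g \<in> \<Sigma> \<Longrightarrow> N A \<le> c * N (A ** g)"
  obtains \<gamma> where "growth N \<gamma>"
proof -
  \<comment> \<open>The value at n = 0 is set to 0 because \<open>kingman\<close> requires |f 0|
    \<le> C * 0, while for the unit matrix only N \<ge> 1 is available.\<close>
  define f where "f n \<omega> = (if n = 0 then 0 else ln (N (mat_prod \<omega> n)))" for n \<omega>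
  define Y where "Y = {\<omega>\<in>space S. \<forall>n. \<omega> n \<in> G}"
  have f[measurable]: "f n \<in> borel_measurable S" for n
    unfolding f_def by (cases "n = 0") simp_all
  have AEY: "AE \<omega> in S. \<omega> \<in> Y"
    using AE_all_coordinates[OF G(1)] AE_space by eventually_elim (simp add: Y_def)
  have shiftY: "seq_shift k \<omega> \<in> Y" if "\<omega> \<in> Y" for k \<omega>
    using that seq_shift_space by (auto simp: Y_def seq_shift_def)
  have prodG: "mat_prod \<omega> n \<in> G" if "\<omega> \<in> Y" for n \<omega>
    using that G by (induction n) (auto simp: Y_def)
  have YS: "\<omega> n \<in> G" "\<omega> n \<in> \<Sigma>" if "\<omega> \<in> Y" for n \<omega>
    using that by (auto simp: Y_def space_S)
  have right: "N A \<le> c ^ n * N (A ** mat_prod \<omega> n)" if "\<omega> \<in> Y" "A \<in> G" for A n \<omega>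
    using that(2)
  proof (induction n arbitrary: A)
    case (Suc n)
    have "N A \<le> c * N (A ** \<omega> n)" using c(3) Suc YS[OF that(1)] by simp
    also have "\<dots> \<le> c * (c ^ n * N (A ** \<omega> n ** mat_prod \<omega> n))"
      using c(1) Suc G(3) YS[OF that(1)] by (intro mult_left_mono Suc.IH) auto
    finally show ?case by (simp add: matrix_mul_assoc mult.assoc)
  qed simp
  have N1: "1 \<le> N (mat 1)"
    using sub[OF G(2) G(2)] pos[OF G(2)] by simp
  have upper: "N (mat_prod \<omega> n) \<le> c ^ n" if "\<omega> \<in> Y" "n \<ge> 1" for n \<omega>
    using that(2)
  proof (induction n rule: dec_induct)
    case base
    then show ?case using c(2) YS[OF that(1)] by simp
  next
    case (step n)
    have "N (\<omega> n ** mat_prod \<omega> n) \<le> N (\<omega> n) * N (mat_prod \<omega> n)"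
      using sub YS prodG that by blast
    also have "\<dots> \<le> c * c ^ n"
      using step c YS[OF that(1)] pos[OF prodG[OF that(1)]] by (intro mult_mono) (auto intro: less_imp_le)
    finally show ?case by simp
  qed
  have lnc: "0 \<le> ln c" using c(1) by simp
  have lnpow: "ln (c ^ n) = ln c * real n" for n using c(1) by (simp add: ln_realpow mult.commute)
  have bnd: "\<bar>f n \<omega>\<bar> \<le> ln c * real n" if "\<omega> \<in> Y" for n \<omega>
  proof (cases "n = 0")
    case False
    have p: "0 < N (mat_prod \<omega> n)" using pos prodG that by blast
    have "ln (N (mat_prod \<omega> n)) \<le> ln (c ^ n)" using upper[OF that] p False c(1) by simp
    moreover have "- ln (c ^ n) \<le> ln (N (mat_prod \<omega> n))"
    proof -
      have "1 \<le> c ^ n * N (mat_prod \<omega> n)" using right[OF that G(2), of n] N1 by simp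
      then have "0 \<le> ln (c ^ n * N (mat_prod \<omega> n))" by simp
      also have "\<dots> = ln (c ^ n) + ln (N (mat_prod \<omega> n))" using p c(1) by (intro ln_mult_pos) auto
      finally show ?thesis by simp
    qed
    ultimately show ?thesis using False by (simp add: f_def lnpow abs_le_iff)
  qed (simp add: f_def)
  have sub': "f (n + m) \<omega> \<le> f n \<omega> + f m (seq_shift n \<omega>)" if "\<omega> \<in> Y" for n m \<omega>
  proof (cases "n = 0 \<or> m = 0")
    case False
    have p: "0 < N (mat_prod \<omega> n)" "0 < N (mat_prod (seq_shift n \<omega>) m)" "0 < N (mat_prod \<omega> (n + m))"
      using pos prodG that shiftY by blast+
    have "ln (N (mat_prod \<omega> (n + m))) \<le> ln (N (mat_prod (seq_shift n \<omega>) m) * N (mat_prod \<omega> n))"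
      using p sub[OF prodG[OF shiftY[OF that]] prodG[OF that], of n m n] by (simp add: mat_prod_add)
    also have "\<dots> = ln (N (mat_prod (seq_shift n \<omega>) m)) + ln (N (mat_prod \<omega> n))"
      using p by (intro ln_mult_pos) auto
    finally show ?thesis using False by (simp add: f_def)
  qed (auto simp: f_def)
  have sup': "f m (seq_shift n \<omega>) \<le> f (n + m) \<omega> + ln c * real n" if "\<omega> \<in> Y" for n m \<omega>
  proof (cases "n = 0 \<or> m = 0")
    case True
    then show ?thesis using bnd[OF that, of n] by (auto simp: f_def abs_le_iff)
  next
    case False
    have p: "0 < N (mat_prod (seq_shift n \<omega>) m)" "0 < N (mat_prod \<omega> (n + m))"
      using pos prodG that shiftY by blast+
    have "ln (N (mat_prod (seq_shift n \<omega>) m)) \<le> ln (c ^ n * N (mat_prod \<omega> (n + m)))"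
      using p right[OF that prodG[OF shiftY[OF that]], of n m n] c(1) by (simp add: mat_prod_add)
    also have "\<dots> = ln (c ^ n) + ln (N (mat_prod \<omega> (n + m)))"
      using p c(1) by (intro ln_mult_pos) auto
    finally show ?thesis using False by (simp add: f_def lnpow)
  qed
  obtain \<gamma> where \<gamma>: "AE \<omega> in S. (\<lambda>n. f n \<omega> / real n) \<longlonglongrightarrow> \<gamma>"
      "(\<lambda>n. P.expectation (f n) / real n) \<longlonglongrightarrow> \<gamma>" "\<And>n. real n * \<gamma> \<le> P.expectation (f n)"
    using kingman[of Y f "ln c", OF _ AEY shiftY f sub' sup' bnd] by (auto simp: Y_def)
  have f0: "f n \<omega> / real n = ln (N (mat_prod \<omega> n)) / real n" for n \<omega>
    by (simp add: f_def)
  have f1: "f n = (\<lambda>\<omega>. ln (N (mat_prod \<omega> n)))" if "n \<ge> 1" for n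
    using that by (simp add: f_def fun_eq_iff)
  have fE: "P.expectation (f n) / real n = P.expectation (\<lambda>\<omega>. ln (N (mat_prod \<omega> n))) / real n" for n
  proof (cases "n = 0")
    case False
    then have "f n = (\<lambda>\<omega>. ln (N (mat_prod \<omega> n)))" by (intro f1) simp
    then show ?thesis by simp
  qed simp
  have "real n * \<gamma> \<le> P.expectation (\<lambda>\<omega>. ln (N (mat_prod \<omega> n)))" if "n \<ge> 1" for n
    using \<gamma>(3)[of n] unfolding f1[OF that] .
  moreover have "integrable S (\<lambda>\<omega>. ln (N (mat_prod \<omega> n)))" for n
  proof (cases "n = 0")
    case False
    have "integrable S (f n)"
      by (rule P.integrable_const_bound[of _ "ln c * real n"])
        (use AEY bnd in \<open>auto elim!: eventually_mono\<close>)
    then show ?thesis using f1[of n] False by simp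
  qed simp
  ultimately have "growth N \<gamma>" using \<gamma>(1,2) unfolding growth_def f0 fE by blast
  then show ?thesis by (rule that)
qed

lemma quot_norm_growth:
  assumes V: "subspace V" and W: "subspace W" and VW: "V \<subseteq> W" "V \<noteq> W"
    and inv: "AE g in \<mu>. (*v) g ` V = V \<and> (*v) g ` W = W"
  obtains \<gamma> where "growth (quot_norm V W) \<gamma>"
proof (rule gauge_growth[where G = "{A. Finite_Cartesian_Product.invertible A \<and> (*v) A ` V = V \<and> (*v) A ` W = W}"
      and N = "quot_norm V W" and c = KK])
  let ?G = "{A. Finite_Cartesian_Product.invertible A \<and> (*v) A ` V = V \<and> (*v) A ` W = W}"
  note N = quot_norm[OF V W]
  show "quot_norm V W \<in> borel_measurable borel" using V W by simp
  show "AE g in \<mu>. g \<in> ?G"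
    using inv AE_space by eventually_elim (use invertible space_mu in auto)
  show "mat 1 \<in> ?G" by (simp add: invertible_mat)
  show "A ** B \<in> ?G" if "A \<in> ?G" "B \<in> ?G" for A B
  proof -
    have "(*v) (A ** B) ` V = (*v) A ` ((*v) B ` V)" "(*v) (A ** B) ` W = (*v) A ` ((*v) B ` W)"
      by (simp_all add: image_image matrix_vector_mul_assoc)
    then show ?thesis using that by (simp add: invertible_mult)
  qed
  show "0 < quot_norm V W A" if "A \<in> ?G" for A
  proof -
    obtain w where w: "w \<in> W" "w \<notin> V" using VW by blast
    then have "A *v w \<notin> V" using that invertible_mv_mem by blast
    then have "0 < norm (qproj V (A *v w))" using qproj_eq_0_iff[OF V] by simp
    also have "\<dots> \<le> quot_norm V W A * norm w" by (rule N(1)[OF w(1)])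
    finally show ?thesis using N(2)[of A] by (metis less_eq_real_def mult_zero_left order_less_irrefl)
  qed
  show "quot_norm V W (A ** B) \<le> quot_norm V W A * quot_norm V W B" if "A \<in> ?G" "B \<in> ?G" for A B
    unfolding N(3)
  proof (intro conjI ballI mult_nonneg_nonneg N(2))
    fix x assume x: "x \<in> W"
    have "qproj V (B *v x) = B *v x - (B *v x - qproj V (B *v x))" by simp
    moreover have "B *v x \<in> W" using that x by blast
    moreover have "B *v x - qproj V (B *v x) \<in> W" using diff_qproj_mem[OF V] VW by blast
    ultimately have q: "qproj V (B *v x) \<in> W" using W by (metis subspace_diff)
    have "norm (qproj V ((A ** B) *v x)) = norm (qproj V (A *v qproj V (B *v x)))"
      using that V by (simp add: qproj_mv_qproj matrix_vector_mul_assoc)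
    also have "\<dots> \<le> quot_norm V W A * norm (qproj V (B *v x))" by (rule N(1)[OF q])
    also have "\<dots> \<le> quot_norm V W A * (quot_norm V W B * norm x)"
      by (intro mult_left_mono N x)
    finally show "norm (qproj V ((A ** B) *v x)) \<le> quot_norm V W A * quot_norm V W B * norm x" by simp
  qed
  show "KK \<ge> 1" by (rule KK)
  show "quot_norm V W g \<le> KK" if "g \<in> ?G" "g \<in> \<Sigma>" for g
    unfolding N(3) using KK_pos order_trans[OF norm_qproj_le[OF V] KK(2)[OF that(2)]] by auto
  \<comment> \<open>Since g maps W onto W, every x in W is the image of some y in W, and passing to
    y costs at most the factor \<open>KK\<close>.\<close>
  show "quot_norm V W A \<le> KK * quot_norm V W (A ** g)" if "A \<in> ?G" "g \<in> ?G" "g \<in> \<Sigma>" for A g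
    unfolding N(3)
  proof (intro conjI ballI mult_nonneg_nonneg N(2))
    fix x assume x: "x \<in> W"
    have "x \<in> (*v) g ` W" using x that(2) by simp
    then obtain y where y: "y \<in> W" "x = g *v y" by (rule imageE)
    have "norm (qproj V (A *v x)) = norm (qproj V ((A ** g) *v y))" by (simp add: y matrix_vector_mul_assoc)
    also have "\<dots> \<le> quot_norm V W (A ** g) * norm y" by (rule N(1)[OF y(1)])
    also have "\<dots> \<le> quot_norm V W (A ** g) * (KK * norm x)"
      unfolding y(2) by (intro mult_left_mono N KK that)
    finally show "norm (qproj V (A *v x)) \<le> KK * quot_norm V W (A ** g) * norm x" by (simp add: mult_ac)
  qed (use KK_pos in auto)
qed

lemma area_norm_growth:
  assumes n: "2 \<le> CARD('n)"
  obtains \<gamma> where "growth area_norm \<gamma>"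
    and "\<And>\<omega> n. \<omega> \<in> space S \<Longrightarrow> 0 < area_norm (mat_prod \<omega> n)"
proof -
  let ?G = "{A. Finite_Cartesian_Product.invertible (A :: real^'n^'n)}"
  \<comment> \<open>Two coordinate vectors span a parallelogram of area 1, the image under A of
    another one. This is where dimension at least 2 enters.\<close>
  have pos: "0 < area_norm A" if "A \<in> ?G" for A
  proof -
    obtain i j :: 'n where ij: "i \<noteq> j"
      using n by (metis (full_types) card_2_iff' ex_card UNIV_I)
    define e :: "'n \<Rightarrow> real^'n" where "e k = axis k 1" for k
    have "area (e i) (e j) = 1" using ij by (simp add: area_orthogonal e_def inner_axis_axis)
    moreover have "e k = A *v (matrix_inv A *v e k)" for k
      using that by (simp add: matrix_vector_mul_assoc matrix_inv_right)
    ultimately have "1 \<le> area_norm A * area (matrix_inv A *v e i) (matrix_inv A *v e j)"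
      by (metis area_norm(1))
    then show ?thesis using area_norm(2)[of A] by (metis less_eq_real_def mult_zero_left not_one_le_zero)
  qed
  have "0 < area_norm (mat_prod \<omega> n)" if "\<omega> \<in> space S" for \<omega> n
    using pos invertible_mat_prod[OF that] by simp
  moreover obtain \<gamma> where "growth area_norm \<gamma>"
  proof (rule gauge_growth[where G = ?G and N = area_norm and c = "KK * KK"])
    show "AE g in \<mu>. g \<in> ?G" using AE_space by eventually_elim (use invertible space_mu in auto)
    show "area_norm (A ** B) \<le> area_norm A * area_norm B" for A B :: "real^'n^'n"
      unfolding area_norm(3)
    proof (intro conjI allI mult_nonneg_nonneg area_norm(2))
      fix u v
      have "area ((A ** B) *v u) ((A ** B) *v v) \<le> area_norm A * area (B *v u) (B *v v)"
        using area_norm(1) by (metis matrix_vector_mul_assoc)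
      also have "\<dots> \<le> area_norm A * (area_norm B * area u v)" by (intro mult_left_mono area_norm)
      finally show "area ((A ** B) *v u) ((A ** B) *v v) \<le> area_norm A * area_norm B * area u v" by simp
    qed
    show "area_norm g \<le> KK * KK" if "g \<in> \<Sigma>" for g
      unfolding area_norm(3) using KK KK_pos that by (auto intro!: area_linear_le linear_mv)
    show "area_norm A \<le> KK * KK * area_norm (A ** g)" if "g \<in> \<Sigma>" for A g
      unfolding area_norm(3)
    proof (intro conjI allI mult_nonneg_nonneg area_norm(2))
      fix u v
      let ?h = "\<lambda>x. matrix_inv g *v x"
      have "area (A *v u) (A *v v) = area ((A ** g) *v ?h u) ((A ** g) *v ?h v)"
        using matrix_inv_mult[OF that] by (simp add: matrix_vector_mul_assoc[symmetric])
      also have "\<dots> \<le> area_norm (A ** g) * area (?h u) (?h v)" by (rule area_norm(1))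
      also have "\<dots> \<le> area_norm (A ** g) * (KK * KK * area u v)"
        by (intro mult_left_mono area_norm area_linear_le linear_mv norm_matrix_inv that)
      finally show "area (A *v u) (A *v v) \<le> KK * KK * area_norm (A ** g) * area u v" by (simp add: mult_ac)
    qed (use KK_pos in auto)
    show "1 \<le> KK * KK" using KK(1) mult_mono[of 1 KK 1 KK] by simp
  qed (auto intro: pos invertible_mult simp: invertible_mat)
  ultimately show ?thesis using that by blast
qed

lemma onorm_growth:
  assumes n: "2 \<le> CARD('n)"
  shows "growth (quot_norm {0} UNIV) (lyapunov 1 \<mu>)"
proof -
  have "AE g in \<mu>. (*v) g ` {0} = {0} \<and> (*v) g ` UNIV = UNIV"
    using AE_space
  proof eventually_elim
    case (elim g)
    then have "surj ((*v) g)" using matrix_inv_mult space_mu by (metis surjI)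
    then show ?case by simp
  qed
  moreover have "{0} \<noteq> (UNIV :: (real^'n) set)" using UNIV_not_singleton by metis
  ultimately obtain \<gamma> where \<gamma>: "growth (quot_norm {0} UNIV) \<gamma>"
    using quot_norm_growth[of "{0}" UNIV] by auto
  moreover have "lyapunov 1 \<mu> = \<gamma>"
    by (rule lyapunov_eqI, unfold singular_values_1_2(1)[OF n])
      (use \<gamma> in \<open>simp add: quot_norm_trivial growth_def\<close>)
  ultimately show ?thesis by simp
qed

text \<open>As s1 * s2 is \<open>area_norm\<close>, the almost sure limit of ln s2 / n that defines
  the second exponent is the difference of the rates of \<open>area_norm\<close> and of the operator
  norm.\<close>

lemma area_growth:
  assumes n: "2 \<le> CARD('n)"
  shows "growth area_norm (lyapunov 1 \<mu> + lyapunov 2 \<mu>)"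
proof -
  obtain \<gamma> where \<gamma>: "growth area_norm \<gamma>" and pos: "\<And>\<omega> n. \<omega> \<in> space S \<Longrightarrow> 0 < area_norm (mat_prod \<omega> n)"
    using area_norm_growth[OF n] by blast
  have "AE \<omega> in S. (\<lambda>n. ln (area_norm (mat_prod \<omega> n)) / real n) \<longlonglongrightarrow> \<gamma>" using \<gamma> by (simp add: growth_def)
  moreover have "AE \<omega> in S. (\<lambda>n. ln (singular_value 1 (mat_prod \<omega> n)) / real n) \<longlonglongrightarrow> lyapunov 1 \<mu>"
    using onorm_growth[OF n] unfolding growth_def singular_values_1_2(1)[OF n] quot_norm_trivial by blast
  ultimately have "AE \<omega> in S. (\<lambda>n. ln (singular_value 2 (mat_prod \<omega> n)) / real n) \<longlonglongrightarrow> \<gamma> - lyapunov 1 \<mu>"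
    using AE_space
  proof eventually_elim
    case (elim \<omega>)
    have "ln (singular_value 2 (mat_prod \<omega> n)) = ln (area_norm (mat_prod \<omega> n)) - ln (singular_value 1 (mat_prod \<omega> n))" for n
    proof -
      have p: "0 < singular_value 1 (mat_prod \<omega> n) * singular_value 2 (mat_prod \<omega> n)"
        unfolding singular_values_1_2(2)[OF n] by (rule pos[OF elim(3)])
      moreover have "0 \<le> singular_value 1 (mat_prod \<omega> n)"
        unfolding singular_values_1_2(1)[OF n] quot_norm_trivial[symmetric] by (intro quot_norm(2)) auto
      ultimately have "0 < singular_value 1 (mat_prod \<omega> n)" "0 < singular_value 2 (mat_prod \<omega> n)"
        by (auto simp: zero_less_mult_iff)
      then show ?thesis unfolding singular_values_1_2(2)[OF n, symmetric] by (simp add: ln_mult)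
    qed
    then show ?case using tendsto_diff[OF elim(1,2)] by (simp add: diff_divide_distrib)
  qed
  then have "lyapunov 2 \<mu> = \<gamma> - lyapunov 1 \<mu>" by (rule lyapunov_eqI)
  then show ?thesis using \<gamma> by simp
qed

end

subsection \<open>Slow vectors\<close>

text \<open>A function that never exceeds its mean is almost surely constant. Applied to conditional
  probabilities, it turns maximality into invariance.\<close>

lemma (in prob_space) AE_eq_of_nn_integral_eq:
  assumes [measurable]: "f \<in> borel_measurable M" and le: "AE x in M. f x \<le> c"
    and c: "c < \<infinity>" and eq: "(\<integral>\<^sup>+x. f x \<partial>M) = c"
  shows "AE x in M. f x = c"
proof -
  have "(\<integral>\<^sup>+x. c - f x \<partial>M) = (\<integral>\<^sup>+x. c \<partial>M) - (\<integral>\<^sup>+x. f x \<partial>M)"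
    using le c eq by (intro nn_integral_diff) auto
  also have "\<dots> = 0" using eq c by (simp add: emeasure_space_1)
  finally have "AE x in M. c - f x = 0" by (subst (asm) nn_integral_0_iff_AE) auto
  with le show ?thesis
    by eventually_elim (metis antisym c diff_eq_0_iff_ennreal infinity_ennreal_def order_less_irrefl)
qed

lemma (in sequence_space) emeasure_case_nat:
  assumes [measurable]: "A \<in> sets S"
  shows "emeasure S A = (\<integral>\<^sup>+x. emeasure S {\<omega>\<in>space S. case_nat x \<omega> \<in> A} \<partial>M)"
proof -
  have "emeasure S A = (\<integral>\<^sup>+\<omega>. indicator A \<omega> \<partial>S)" by simp
  also have "\<dots> = (\<integral>\<^sup>+x. \<integral>\<^sup>+\<omega>. indicator A (case_nat x \<omega>) \<partial>S \<partial>M)"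
    by (rule nn_integral_case_nat) simp
  also have "\<dots> = (\<integral>\<^sup>+x. emeasure S {\<omega>\<in>space S. case_nat x \<omega> \<in> A} \<partial>M)"
  proof (rule nn_integral_cong)
    fix x assume [measurable]: "x \<in> space M"
    have "(\<integral>\<^sup>+\<omega>. indicator A (case_nat x \<omega>) \<partial>S)
        = (\<integral>\<^sup>+\<omega>. indicator {\<omega>\<in>space S. case_nat x \<omega> \<in> A} \<omega> \<partial>S)"
      by (rule nn_integral_cong) (auto simp: indicator_def)
    then show "(\<integral>\<^sup>+\<omega>. indicator A (case_nat x \<omega>) \<partial>S) = emeasure S {\<omega>\<in>space S. case_nat x \<omega> \<in> A}"
      by simp
  qed
  finally show ?thesis .
qed

text \<open>Invariance is required for every g in \<Sigma>, so that the same \<open>V\<close> can be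
  used for any other probability measure on \<Sigma>. With \<open>V\<close> = {0} the locale
  describes the action on the whole space, and it is interpreted in this way as well.\<close>

locale quotient_product = random_product \<Sigma> \<mu> for \<Sigma> :: "(real^'n^'n) set" and \<mu> +
  fixes V :: "(real^'n) set"
  assumes V: "subspace V" and inv_V: "\<And>g. g \<in> \<Sigma> \<Longrightarrow> (*v) g ` V = V"
begin

abbreviation pn :: "real^'n \<Rightarrow> real" where
  "pn u \<equiv> norm (qproj V u)"

lemma pn_pos: "u \<notin> V \<Longrightarrow> 0 < pn u"
  using qproj_eq_0_iff[OF V] by simp

lemma inv_V_mat_prod: "\<omega> \<in> space S \<Longrightarrow> (*v) (mat_prod \<omega> n) ` V = V"
proof (induction n)
  case (Suc n)
  have "(*v) (\<omega> n ** mat_prod \<omega> n) ` V = (*v) (\<omega> n) ` ((*v) (mat_prod \<omega> n) ` V)"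
    by (simp add: image_image matrix_vector_mul_assoc)
  then show ?case using Suc inv_V by (simp add: space_S)
qed simp

lemma mat_prod_mem_V: "\<omega> \<in> space S \<Longrightarrow> mat_prod \<omega> n *v u \<in> V \<longleftrightarrow> u \<in> V"
  using invertible_mv_mem[OF invertible_mat_prod inv_V_mat_prod] .

lemma mv_mem_V: "g \<in> \<Sigma> \<Longrightarrow> g *v u \<in> V \<longleftrightarrow> u \<in> V"
  using invertible_mv_mem[OF _ inv_V] invertible by auto

lemma qproj_mat_prod:
  "\<omega> \<in> space S \<Longrightarrow> qproj V (mat_prod \<omega> n *v qproj V u) = qproj V (mat_prod \<omega> n *v u)"
  by (rule qproj_mv_qproj[OF V inv_V_mat_prod])

lemma pn_bounds:
  assumes "(*v) A ` V = V" "\<And>x. norm (A *v x) \<le> K * norm x" "\<And>x. norm x \<le> K * norm (A *v x)" "K > 0"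
  shows "pn (A *v u) \<le> K * pn u" "pn u \<le> K * pn (A *v u)"
proof -
  have "pn (A *v u) = pn (A *v qproj V u)" using qproj_mv_qproj[OF V assms(1)] by simp
  also have "\<dots> \<le> norm (A *v qproj V u)" by (rule norm_qproj_le[OF V])
  also have "\<dots> \<le> K * pn u" by (rule assms)
  finally show "pn (A *v u) \<le> K * pn u" .
  have "A *v u - qproj V (A *v u) \<in> (*v) A ` V" using diff_qproj_mem[OF V] assms(1) by simp
  then obtain v where v: "v \<in> V" "A *v u - qproj V (A *v u) = A *v v" by (rule imageE)
  then have "qproj V (A *v u) = A *v (u - v)" by (simp add: matrix_vector_mult_diff_distrib algebra_simps)
  moreover have "qproj V u = qproj V (u - v)" using v by (intro qproj_cong V) simp
  ultimately show "pn u \<le> K * pn (A *v u)"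
    using norm_qproj_le[OF V, of "u - v"] assms(3)[of "u - v"] by simp
qed

lemma pn_mv: "g \<in> \<Sigma> \<Longrightarrow> pn (g *v u) \<le> KK * pn u" "g \<in> \<Sigma> \<Longrightarrow> pn u \<le> KK * pn (g *v u)"
  using pn_bounds[OF inv_V] KK KK_pos by blast+

lemma pn_mat_prod:
  assumes "\<omega> \<in> space S"
  shows "pn (mat_prod \<omega> n *v u) \<le> KK ^ n * pn u" "pn u \<le> KK ^ n * pn (mat_prod \<omega> n *v u)"
  using pn_bounds[OF inv_V_mat_prod[OF assms]] norm_mat_prod[OF assms] KK_pos by simp_all

text \<open>Growth in the quotient at some exponential rate strictly below L. The rate and the
  constant range over countable sets to make the event measurable.\<close>

definition slow :: "real \<Rightarrow> (nat \<Rightarrow> real^'n^'n) \<Rightarrow> real^'n \<Rightarrow> bool" where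
  "slow L \<omega> u \<longleftrightarrow> (\<exists>k D::nat. \<forall>m. pn (mat_prod \<omega> m *v u) \<le> real D * exp (real m * (L - 1 / real (Suc k))))"

lemma slowI:
  assumes "a < L" "\<And>m. pn (mat_prod \<omega> m *v u) \<le> D * exp (real m * a)"
  shows "slow L \<omega> u"
proof -
  obtain k :: nat where k: "1 / real (Suc k) < L - a" using assms(1) nat_approx_posE[of "L - a"] by auto
  obtain D' :: nat where D': "D \<le> real D'" using real_arch_simple by blast
  have "pn (mat_prod \<omega> m *v u) \<le> real D' * exp (real m * (L - 1 / real (Suc k)))" for m
  proof -
    have "D * exp (real m * a) \<le> real D' * exp (real m * a)" using D' by simp
    also have "\<dots> \<le> real D' * exp (real m * (L - 1 / real (Suc k)))"
      using k by (simp add: mult_left_mono)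
    finally show ?thesis using assms(2)[of m] by linarith
  qed
  then show ?thesis unfolding slow_def by blast
qed

lemma slowE:
  assumes "slow L \<omega> u"
  obtains a D where "a < L" "D \<ge> 0" "\<And>m. pn (mat_prod \<omega> m *v u) \<le> D * exp (real m * a)"
proof -
  obtain k D where "\<forall>m. pn (mat_prod \<omega> m *v u) \<le> real D * exp (real m * (L - 1 / real (Suc k)))"
    using assms unfolding slow_def by blast
  then show ?thesis using that[of "L - 1 / real (Suc k)" "real D"] by simp
qed

lemma slow_0: "slow L \<omega> 0"
  by (rule slowI[of "L - 1" _ _ _ 0]) simp_all

lemma subspace_slow: "subspace {u. slow L \<omega> u}"
  unfolding subspace_def
proof (intro conjI ballI allI; clarsimp?)
  show "slow L \<omega> 0" by (rule slow_0)
next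
  fix u v assume "slow L \<omega> u" "slow L \<omega> v"
  then obtain a D b E where h: "a < L" "D \<ge> 0" "\<And>m. pn (mat_prod \<omega> m *v u) \<le> D * exp (real m * a)"
    "b < L" "E \<ge> 0" "\<And>m. pn (mat_prod \<omega> m *v v) \<le> E * exp (real m * b)"
    by (metis slowE)
  show "slow L \<omega> (u + v)"
  proof (rule slowI)
    show "max a b < L" using h by simp
    fix m
    have "pn (mat_prod \<omega> m *v (u + v)) \<le> pn (mat_prod \<omega> m *v u) + pn (mat_prod \<omega> m *v v)"
      by (simp add: matrix_vector_right_distrib qproj_add norm_triangle_ineq)
    also have "\<dots> \<le> D * exp (real m * max a b) + E * exp (real m * max a b)"
      using h(2,5) by (intro add_mono order_trans[OF h(3)] order_trans[OF h(6)] mult_left_mono) (auto intro: mult_left_mono)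
    finally show "pn (mat_prod \<omega> m *v (u + v)) \<le> (D + E) * exp (real m * max a b)"
      by (simp add: distrib_right)
  qed
next
  fix c u assume "slow L \<omega> u"
  then obtain a D where h: "a < L" "D \<ge> 0" "\<And>m. pn (mat_prod \<omega> m *v u) \<le> D * exp (real m * a)"
    by (metis slowE)
  show "slow L \<omega> (c *\<^sub>R u)"
  proof (rule slowI[OF h(1)])
    fix m
    have "pn (mat_prod \<omega> m *v (c *\<^sub>R u)) = \<bar>c\<bar> * pn (mat_prod \<omega> m *v u)"
      by (simp add: matrix_vector_mult_scaleR qproj_scale)
    also have "\<dots> \<le> \<bar>c\<bar> * (D * exp (real m * a))" by (intro mult_left_mono h) simp
    finally show "pn (mat_prod \<omega> m *v (c *\<^sub>R u)) \<le> (\<bar>c\<bar> * D) * exp (real m * a)" by simp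
  qed
qed

lemma measurable_slow [measurable]: "Measurable.pred S (\<lambda>\<omega>. slow L \<omega> u)"
  unfolding slow_def by measurable

lemma slow_shift:
  assumes \<omega>: "\<omega> \<in> space S"
  shows "slow L \<omega> u \<longleftrightarrow> slow L (seq_shift n \<omega>) (mat_prod \<omega> n *v u)"
proof
  assume "slow L \<omega> u"
  then obtain a D where h: "a < L" "D \<ge> 0" "\<And>m. pn (mat_prod \<omega> m *v u) \<le> D * exp (real m * a)"
    by (metis slowE)
  show "slow L (seq_shift n \<omega>) (mat_prod \<omega> n *v u)"
  proof (rule slowI[OF h(1)])
    fix m
    have "pn (mat_prod (seq_shift n \<omega>) m *v (mat_prod \<omega> n *v u)) = pn (mat_prod \<omega> (n + m) *v u)"
      by (simp add: mat_prod_add matrix_vector_mul_assoc)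
    also have "\<dots> \<le> D * exp (real (n + m) * a)" by (rule h)
    also have "\<dots> = (D * exp (real n * a)) * exp (real m * a)" by (simp add: distrib_right exp_add)
    finally show "pn (mat_prod (seq_shift n \<omega>) m *v (mat_prod \<omega> n *v u)) \<le> (D * exp (real n * a)) * exp (real m * a)" .
  qed
next
  assume "slow L (seq_shift n \<omega>) (mat_prod \<omega> n *v u)"
  then obtain a D where h: "a < L" "D \<ge> 0"
    "\<And>m. pn (mat_prod (seq_shift n \<omega>) m *v (mat_prod \<omega> n *v u)) \<le> D * exp (real m * a)"
    by (metis slowE)
  \<comment> \<open>Covers the finitely many times m < n that the shifted sequence does not
    see.\<close>
  define E where "E = (\<Sum>m<n. pn (mat_prod \<omega> m *v u) * exp (- (real m * a)))"
  show "slow L \<omega> u"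
  proof (rule slowI[OF h(1)])
    fix m
    have E0: "E \<ge> 0" unfolding E_def by (intro sum_nonneg) simp
    show "pn (mat_prod \<omega> m *v u) \<le> (D * exp (- (real n * a)) + E) * exp (real m * a)"
    proof (cases "m < n")
      case True
      have "pn (mat_prod \<omega> m *v u) * exp (- (real m * a)) \<le> E"
        unfolding E_def using True by (intro member_le_sum) auto
      then have "pn (mat_prod \<omega> m *v u) * exp (- (real m * a)) * exp (real m * a) \<le> E * exp (real m * a)"
        by (intro mult_right_mono) auto
      then have "pn (mat_prod \<omega> m *v u) \<le> E * exp (real m * a)" by (simp add: mult.assoc flip: exp_add)
      also have "\<dots> \<le> (D * exp (- (real n * a)) + E) * exp (real m * a)" using h(2) by simp
      finally show ?thesis .
    next
      case False
      then obtain j where j: "m = n + j" using le_Suc_ex not_less by blast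
      have "pn (mat_prod \<omega> m *v u) \<le> D * exp (real j * a)"
        using h(3)[of j] by (simp add: j mat_prod_add matrix_vector_mul_assoc)
      also have "\<dots> = (D * exp (- (real n * a))) * exp (real m * a)"
        by (simp add: j mult.assoc distrib_right flip: exp_add)
      also have "\<dots> \<le> (D * exp (- (real n * a)) + E) * exp (real m * a)" using E0 by simp
      finally show ?thesis .
    qed
  qed
qed

lemma slow_V: "\<omega> \<in> space S \<Longrightarrow> u \<in> V \<Longrightarrow> slow L \<omega> u"
  using qproj_eq_0_iff[OF V] mat_prod_mem_V by (intro slowI[of "L - 1" _ _ _ 0]) auto

definition slow_event :: "real \<Rightarrow> (real^'n) set \<Rightarrow> (nat \<Rightarrow> real^'n^'n) set" where
  "slow_event L W = {\<omega>\<in>space S. \<forall>u\<in>W. slow L \<omega> u}"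

lemma slow_event_span: "slow_event L (span B) = slow_event L B"
proof -
  have "(\<forall>u\<in>span B. slow L \<omega> u) \<longleftrightarrow> (\<forall>u\<in>B. slow L \<omega> u)" for \<omega>
    using span_minimal[OF _ subspace_slow, of B L \<omega>] by (auto intro: span_base)
  then show ?thesis by (simp add: slow_event_def)
qed

text \<open>Slow vectors form a subspace, so slowness on all of W is slowness on a finite basis,
  which replaces an uncountable quantifier by a finite one.\<close>

lemma slow_event_sets [measurable]:
  assumes "subspace W"
  shows "slow_event L W \<in> sets S"
proof -
  have "slow_event L W = slow_event L (onb W)"
    using slow_event_span[of L "onb W"] onb(5)[OF assms] by simp
  also have "\<dots> = {\<omega>\<in>space S. \<forall>u\<in>onb W. slow L \<omega> u}" by (simp add: slow_event_def)
  also have "\<dots> \<in> sets S" using onb(4)[OF assms] by (intro sets.sets_Collect_finite_All) auto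
  finally show ?thesis .
qed

lemma dim_mv_image:
  fixes A :: "real^'n^'n"
  assumes "Finite_Cartesian_Product.invertible A"
  shows "dim ((*v) A ` W) = dim (W :: (real^'n) set)"
proof (rule dim_image_eq)
  show "inj_on ((*v) A) (span W)"
  proof (rule inj_onI)
    fix x y assume "A *v x = A *v y"
    then have "A *v (x - y) = 0" by (simp add: matrix_vector_mult_diff_distrib)
    then show "x = y" using invertible_mv_eq_0[OF assms] by simp
  qed
qed (rule linear_mv)

lemma subspace_mv_image: "subspace W \<Longrightarrow> subspace ((*v) A ` (W :: (real^'n) set))"
  by (rule linear_subspace_image[OF linear_mv])

text \<open>The slow vectors of a single sequence form a random subspace; its almost sure part is
  found by two maximisations. First take the largest dimension k of a space that is slow with
  positive probability. Distinct spaces of dimension k are almost never slow together, since their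
  span would be larger, so a k-dimensional space W0 of largest probability exists. Maximality makes
  the conditional probability given the first n matrices constant, and the zero-one law raises it to
  1.\<close>

theorem slow_subspace_exists:
  obtains W where "subspace W" "AE \<omega> in S. \<forall>u\<in>W. slow L \<omega> u"
    "\<And>u. u \<notin> W \<Longrightarrow> AE \<omega> in S. \<not> slow L \<omega> u" "AE g in \<mu>. (*v) g ` W = W"
proof -
  define p where "p W = measure S (slow_event L W)" for W
  define Dims where "Dims = {dim W | W. subspace W \<and> p W > 0}"
  have finD: "finite Dims"
    by (rule finite_subset[of _ "{..DIM(real^'n)}"]) (auto simp: Dims_def intro: dim_subset_UNIV[THEN order_trans])
  have "p {0} = 1" unfolding p_def slow_event_def using P.prob_space by (simp add: slow_0)
  then have "dim {0 :: real^'n} \<in> Dims" unfolding Dims_def by (intro CollectI exI[of _ "{0}"]) auto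
  then have neD: "Dims \<noteq> {}" by blast
  define k where "k = Max Dims"
  have big: "p W = 0" if "subspace W" "dim W > k" for W
  proof (rule ccontr)
    assume "p W \<noteq> 0"
    then have "p W > 0" by (simp add: p_def zero_less_measure_iff)
    then have "dim W \<in> Dims" using that by (auto simp: Dims_def)
    then have "dim W \<le> k" unfolding k_def using finD by simp
    then show False using that by simp
  qed
  obtain W1 where W1: "subspace W1" "p W1 > 0" "dim W1 = k"
    using Max_in[OF finD neD] unfolding k_def[symmetric] by (auto simp: Dims_def)
  have span2: "slow_event L W \<inter> slow_event L W' = slow_event L (span (W \<union> W'))" for W W'
    unfolding slow_event_span by (auto simp: slow_event_def)
  have uniq: "W = W'" if "subspace W" "dim W = k" "subspace W'" "dim W' = k" "p (span (W \<union> W')) > 0" for W W'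
  proof -
    have "dim (span (W \<union> W')) \<le> k"
      using big[OF subspace_span, of "W \<union> W'"] that(5) by (rule_tac ccontr) simp
    then have d: "dim (span (W \<union> W')) \<le> dim W" "dim (span (W \<union> W')) \<le> dim W'" using that by simp_all
    have "W = span (W \<union> W')" by (rule subspace_dim_equal[OF that(1) subspace_span _ d(1)]) (auto intro: span_base)
    also have "\<dots> = W'" by (rule subspace_dim_equal[OF that(3) subspace_span _ d(2), symmetric]) (auto intro: span_base)
    finally show ?thesis .
  qed
  define \<F> where "\<F> = {W. subspace W \<and> dim W = k \<and> p W \<ge> p W1}"
  have finF: "finite \<F>"
  proof (rule ccontr)
    assume "infinite \<F>"
    \<comment> \<open>The slow events of distinct members of \<F> are almost surely disjoint and
      each has probability at least p W1, so fewer than N of them fit into total mass 1.\<close>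
    obtain N :: nat where N: "real N * p W1 > 1" using W1(2) ex_less_of_nat_mult by blast
    obtain G where G: "finite G" "card G = N" "G \<subseteq> \<F>"
      using infinite_arbitrarily_large[OF \<open>infinite \<F>\<close>] by blast
    have "real N * p W1 = (\<Sum>W\<in>G. p W1)" using G by simp
    also have "\<dots> \<le> (\<Sum>W\<in>G. p W)" using G by (intro sum_mono) (auto simp: \<F>_def)
    also have "\<dots> = measure S (\<Union>W\<in>G. slow_event L W)"
      unfolding p_def
    proof (rule measure_UNION_AE[symmetric, OF G(1)])
      show "slow_event L W \<in> fmeasurable S" if "W \<in> G" for W
        using that G by (intro fmeasurableI slow_event_sets) (auto simp: \<F>_def P.emeasure_eq_measure)
      show "pairwise (\<lambda>i j. AE x in S. x \<notin> slow_event L i \<or> x \<notin> slow_event L j) G"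
      proof (rule pairwiseI)
        fix W W' assume W: "W \<in> G" "W' \<in> G" "W \<noteq> W'"
        then have "\<not> p (span (W \<union> W')) > 0" using uniq G(3) by (auto simp: \<F>_def)
        then have "measure S (slow_event L (span (W \<union> W'))) = 0" by (simp add: p_def zero_less_measure_iff)
        then have "slow_event L (span (W \<union> W')) \<in> null_sets S"
          by (intro null_setsI slow_event_sets subspace_span) (simp add: P.emeasure_eq_measure)
        then show "AE x in S. x \<notin> slow_event L W \<or> x \<notin> slow_event L W'"
          unfolding span2[symmetric] by (rule AE_not_in[THEN eventually_mono]) auto
      qed
    qed
    also have "\<dots> \<le> 1" by simp
    finally show False using N by simp
  qed
  have W1F: "W1 \<in> \<F>" using W1 by (simp add: \<F>_def)
  obtain W0 where W0: "W0 \<in> \<F>" "\<And>W. W \<in> \<F> \<Longrightarrow> p W \<le> p W0"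
    using Max_in[of "p ` \<F>"] Max_ge[of "p ` \<F>"] finF W1F by (metis (no_types, lifting) empty_iff finite_imageI imageE imageI image_is_empty)
  have W0s: "subspace W0" "dim W0 = k" "p W0 > 0" using W0(1) W1(2) by (auto simp: \<F>_def)
  have max: "p W \<le> p W0" if "subspace W" "dim W = k" for W
    using W0 that W1F by (cases "p W \<ge> p W1") (auto simp: \<F>_def intro: order_trans[of _ "p W1"])
  let ?E = "slow_event L W0"
  have E[measurable]: "?E \<in> sets S" by (rule slow_event_sets[OF W0s(1)])
  \<comment> \<open>Given the first n matrices, slowness of W0 becomes slowness of its image for the
    remaining sequence. By maximality its conditional probability is at most p W0, while the mean
    over the first n matrices is exactly p W0.\<close>
  have comb: "{\<omega>'\<in>space S. comb_seq n \<omega> \<omega>' \<in> ?E} = slow_event L ((*v) (mat_prod \<omega> n) ` W0)" if \<omega>: "\<omega> \<in> space S" for n \<omega>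
  proof -
    have sp: "comb_seq n \<omega> \<omega>' \<in> space S" if "\<omega>' \<in> space S" for \<omega>'
      using that \<omega> by (auto simp: space_PiM PiE_iff split: split_comb_seq)
    have "mat_prod (comb_seq n \<omega> \<omega>') n = mat_prod \<omega> n" for \<omega>'
      using mat_prod_comb_seq[of n \<omega> \<omega>' 0] by simp
    then show ?thesis
      using sp by (auto simp: slow_event_def slow_shift[OF sp, of _ L _ n])
  qed
  have pS: "p ((*v) (mat_prod \<omega> n) ` W0) \<le> p W0" if "\<omega> \<in> space S" for n \<omega>
    using that W0s by (intro max subspace_mv_image) (simp_all add: dim_mv_image invertible_mat_prod)
  have AEn: "AE \<omega> in S. emeasure S {\<omega>'\<in>space S. comb_seq n \<omega> \<omega>' \<in> ?E} = emeasure S ?E" for n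
  proof (rule P.AE_eq_of_nn_integral_eq)
    show "(\<lambda>\<omega>. emeasure S {\<omega>'\<in>space S. comb_seq n \<omega> \<omega>' \<in> ?E}) \<in> borel_measurable S"
      by measurable
    show "(\<integral>\<^sup>+\<omega>. emeasure S {\<omega>'\<in>space S. comb_seq n \<omega> \<omega>' \<in> ?E} \<partial>S) = emeasure S ?E"
      by (rule emeasure_comb_seq[OF E, symmetric])
    show "AE \<omega> in S. emeasure S {\<omega>'\<in>space S. comb_seq n \<omega> \<omega>' \<in> ?E} \<le> emeasure S ?E"
      using AE_space
    proof eventually_elim
      case (elim \<omega>)
      show ?case unfolding comb[OF elim] using pS[OF elim, of n] by (simp add: P.emeasure_eq_measure p_def)
    qed
  qed (simp add: P.emeasure_eq_measure)
  have "emeasure S ?E = 0 \<or> emeasure S ?E = 1"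
    by (rule zero_one_law[OF E]) (use AEn in blast)
  then have one: "emeasure S ?E = 1" using W0s(3) by (auto simp: p_def P.emeasure_eq_measure)
  then have p1: "p W0 = 1" by (simp add: p_def P.emeasure_eq_measure)
  have AE0: "AE \<omega> in S. \<omega> \<in> ?E" using one by (subst P.AE_in_set_eq_1) (auto simp: P.emeasure_eq_measure)
  then have slow0: "AE \<omega> in S. \<forall>u\<in>W0. slow L \<omega> u" by eventually_elim (simp add: slow_event_def)
  \<comment> \<open>W0 is already almost surely slow; a vector u outside it that is slow with
    positive probability would make a space of dimension k + 1 slow with positive
    probability.\<close>
  have fast: "AE \<omega> in S. \<not> slow L \<omega> u" if u: "u \<notin> W0" for u
  proof -
    have "dim (insert u W0) = Suc k" using u W0s by (simp add: dim_insert span_eq_iff[THEN iffD2, OF W0s(1)])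
    then have "p (span (insert u W0)) = 0" by (intro big subspace_span) simp
    then have "slow_event L (span (insert u W0)) \<in> null_sets S"
      by (intro null_setsI slow_event_sets subspace_span) (simp add: P.emeasure_eq_measure p_def)
    then have "AE \<omega> in S. \<omega> \<notin> slow_event L (insert u W0)" unfolding slow_event_span by (rule AE_not_in)
    with AE0 show ?thesis by eventually_elim (auto simp: slow_event_def)
  qed
  have cn: "{\<omega>'\<in>space S. case_nat g \<omega>' \<in> ?E} = slow_event L ((*v) g ` W0)" if g: "g \<in> space \<mu>" for g
  proof -
    have sp: "case_nat g \<omega>' \<in> space S" if "\<omega>' \<in> space S" for \<omega>'
      using that g by (auto simp: space_PiM PiE_iff split: nat.split)
    have "mat_prod (case_nat g \<omega>') 1 = g" for \<omega>' using mat_prod_case_nat[of g \<omega>' 0] by simp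
    moreover have "seq_shift 1 (case_nat g \<omega>') = \<omega>'" for \<omega>' by (simp add: seq_shift_def)
    ultimately show ?thesis
      using sp by (auto simp: slow_event_def slow_shift[OF sp, of _ L _ 1] simp del: One_nat_def)
  qed
  interpret M: prob_space \<mu> by (rule M.prob_space_axioms)
  have "AE g in \<mu>. emeasure S {\<omega>'\<in>space S. case_nat g \<omega>' \<in> ?E} = emeasure S ?E"
  proof (rule M.AE_eq_of_nn_integral_eq)
    show "(\<lambda>g. emeasure S {\<omega>'\<in>space S. case_nat g \<omega>' \<in> ?E}) \<in> borel_measurable \<mu>"
      by measurable
    show "(\<integral>\<^sup>+g. emeasure S {\<omega>'\<in>space S. case_nat g \<omega>' \<in> ?E} \<partial>\<mu>) = emeasure S ?E"
      by (rule emeasure_case_nat[OF E, symmetric])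
    show "AE g in \<mu>. emeasure S {\<omega>'\<in>space S. case_nat g \<omega>' \<in> ?E} \<le> emeasure S ?E"
      unfolding one by (rule AE_I2) (simp add: P.emeasure_eq_measure)
  qed (simp add: P.emeasure_eq_measure)
  \<comment> \<open>For almost every g the image of W0 is slow with probability 1, hence
    simultaneously with W0, and \<open>uniq\<close> identifies the two spaces.\<close>
  then have inv: "AE g in \<mu>. (*v) g ` W0 = W0"
    using AE_space
  proof eventually_elim
    case (elim g)
    let ?W = "(*v) g ` W0"
    have W: "subspace ?W" "dim ?W = k"
      using W0s invertible elim(2) space_mu by (auto simp: subspace_mv_image dim_mv_image)
    have "emeasure S (slow_event L ?W) = 1" using elim(1) unfolding cn[OF elim(2)] one .
    then have "AE \<omega> in S. \<omega> \<in> slow_event L ?W"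
      using slow_event_sets[OF W(1)] by (subst P.AE_in_set_eq_1) (auto simp: P.emeasure_eq_measure)
    with AE0 have "AE \<omega> in S. \<omega> \<in> slow_event L (span (?W \<union> W0))"
      by eventually_elim (auto simp: span2[symmetric])
    then have "p (span (?W \<union> W0)) = 1"
      unfolding p_def by (subst (asm) P.AE_in_set_eq_1) (auto intro: slow_event_sets)
    then show ?case using uniq[OF W W0s(1,2)] by simp
  qed
  show ?thesis by (rule that[OF W0s(1) slow0 fast inv])
qed

end

section \<open>Moments with small exponents\<close>

lemma exp_le_quadratic:
  fixes x :: real
  assumes "\<bar>x\<bar> \<le> 1"
  shows "exp x \<le> 1 + x + x\<^sup>2"
proof (cases "x \<ge> 0")
  case True
  then show ?thesis using exp_bound[of x] assms by simp
next
  case False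
  define y where "y = - x"
  have y: "0 < y" "y \<le> 1" using False assms by (auto simp: y_def)
  have pos: "0 < 1 + y + y\<^sup>2 / 2" using y by (simp add: add_pos_nonneg)
  have "exp x = 1 / exp y" by (simp add: y_def exp_minus field_simps)
  also have "\<dots> \<le> 1 / (1 + y + y\<^sup>2 / 2)"
    using exp_lower_Taylor_quadratic[of y] y pos by (intro divide_left_mono) auto
  also have "\<dots> \<le> 1 - y + y\<^sup>2"
  proof -
    have "(1 + y + y\<^sup>2 / 2) * (1 - y + y\<^sup>2) = 1 + y\<^sup>2 / 2 + y ^ 3 / 2 + y ^ 4 / 2"
      by (simp add: field_simps power2_eq_square power3_eq_cube power4_eq_xxxx)
    also have "\<dots> \<ge> 1" using y by simp
    finally show ?thesis using pos by (simp add: pos_divide_le_eq mult.commute)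
  qed
  also have "\<dots> = 1 + x + x\<^sup>2" by (simp add: y_def)
  finally show ?thesis .
qed

lemma powr_add_le:
  fixes x y s :: real
  assumes "0 < s" "s \<le> 1" "0 \<le> x" "0 \<le> y"
  shows "(x + y) powr s \<le> x powr s + y powr s"
proof (cases "x + y = 0")
  case False
  then have t: "x + y > 0" using assms by simp
  have *: "z / (x + y) \<le> (z / (x + y)) powr s" if "0 \<le> z" "z \<le> x + y" for z
  proof (cases "z = 0")
    case False
    then have "(z / (x + y)) powr 1 \<le> (z / (x + y)) powr s"
      using that t assms by (intro powr_mono') auto
    then show ?thesis using that t by simp
  qed simp
  have "1 = x / (x + y) + y / (x + y)" using t by (simp add: add_divide_distrib[symmetric])
  also have "\<dots> \<le> (x / (x + y)) powr s + (y / (x + y)) powr s" using assms by (intro add_mono *) auto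
  also have "\<dots> = (x powr s + y powr s) / (x + y) powr s"
    using assms t by (simp add: powr_divide add_divide_distrib)
  finally show ?thesis using t by (simp add: pos_le_divide_eq)
qed (use assms in \<open>simp add: add_nonneg_eq_0_iff\<close>)

text \<open>In the expansion of exp to second order, the quadratic term is at most s^2 * b^2 \<le> s
  * d. So for small s the exponential moment sees the mean of Y up to the error d.\<close>

lemma (in prob_space) exp_moment_bound:
  fixes Y :: "'a \<Rightarrow> real"
  assumes Y[measurable]: "Y \<in> borel_measurable M" and bnd: "AE x in M. \<bar>Y x\<bar> \<le> b"
    and E: "expectation Y \<le> e" and s: "0 < s" "s * b \<le> 1" "s * b\<^sup>2 \<le> d"
  shows "expectation (\<lambda>x. exp (s * Y x)) \<le> exp (s * (e + d))"
proof -
  have int: "integrable M Y" using bnd by (intro integrable_const_bound[of _ b]) auto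
  have "expectation (\<lambda>x. exp (s * Y x)) \<le> expectation (\<lambda>x. 1 + s * Y x + s\<^sup>2 * b\<^sup>2)"
  proof (rule integral_mono_AE)
    show "AE x in M. exp (s * Y x) \<le> 1 + s * Y x + s\<^sup>2 * b\<^sup>2"
      using bnd
    proof eventually_elim
      case (elim x)
      have "\<bar>s * Y x\<bar> \<le> s * b" using elim s by (simp add: abs_mult)
      then have "\<bar>s * Y x\<bar> \<le> 1" using s by simp
      then have "exp (s * Y x) \<le> 1 + s * Y x + (s * Y x)\<^sup>2" by (rule exp_le_quadratic)
      also have "(s * Y x)\<^sup>2 \<le> s\<^sup>2 * b\<^sup>2"
        using elim by (simp add: power_mult_distrib mult_left_mono power2_le_iff_abs_le abs_le_square_iff[symmetric])
      finally show ?case by simp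
    qed
    show "integrable M (\<lambda>x. exp (s * Y x))"
    proof (rule integrable_const_bound[of _ "exp (s * b)"])
      show "AE x in M. norm (exp (s * Y x)) \<le> exp (s * b)"
        using bnd by eventually_elim (use s in \<open>auto simp: abs_le_iff\<close>)
    qed simp
  qed (use int in simp)
  also have "\<dots> = 1 + s * expectation Y + s\<^sup>2 * b\<^sup>2" using int by (simp add: prob_space)
  also have "\<dots> \<le> 1 + s * (e + d)"
  proof -
    have "s * expectation Y \<le> s * e" using E s by (intro mult_left_mono) auto
    moreover have "s\<^sup>2 * b\<^sup>2 \<le> s * d"
      using mult_left_mono[OF s(3), of s] s(1) by (simp add: power2_eq_square mult_ac)
    ultimately show ?thesis by (simp add: algebra_simps)
  qed
  also have "\<dots> \<le> exp (s * (e + d))" by (rule exp_ge_add_one_self)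
  finally show ?thesis .
qed

lemma exists_small_exponent:
  fixes b d :: real
  assumes "d > 0" "b \<ge> 0"
  obtains s0 where "0 < s0" "s0 \<le> 1" "\<And>s. 0 < s \<Longrightarrow> s \<le> s0 \<Longrightarrow> s * b \<le> 1 \<and> s * b\<^sup>2 \<le> d"
proof
  let ?s = "min 1 (min (1 / (b + 1)) (d / (b\<^sup>2 + 1)))"
  have p: "b + 1 > 0" "b\<^sup>2 + 1 > 0" using assms by (auto intro: add_nonneg_pos)
  show "0 < ?s" "?s \<le> 1" using p assms by auto
  fix s assume s: "0 < s" "s \<le> ?s"
  have "s * b \<le> s * (b + 1)" "s * b\<^sup>2 \<le> s * (b\<^sup>2 + 1)" using s by (auto intro: mult_left_mono)
  moreover have "s * (b + 1) \<le> 1" using s p by (simp add: pos_le_divide_eq[symmetric])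
  moreover have "s * (b\<^sup>2 + 1) \<le> d" using s p by (simp add: pos_le_divide_eq[symmetric])
  ultimately show "s * b \<le> 1 \<and> s * b\<^sup>2 \<le> d" by simp
qed

context random_product
begin

definition moment :: "(real^'n) set \<Rightarrow> real \<Rightarrow> nat \<Rightarrow> real^'n \<Rightarrow> ennreal" where
  "moment V s n u = (\<integral>\<^sup>+\<omega>. ennreal (norm (qproj V (mat_prod \<omega> n *v u)) powr s) \<partial>S)"

lemma moment_0: "moment V s 0 u = ennreal (norm (qproj V u) powr s)"
  by (simp add: moment_def P.emeasure_space_1)

lemma moment_add: "moment V s (m + n) u = (\<integral>\<^sup>+\<omega>. moment V s n (mat_prod \<omega> m *v u) \<partial>S)"
  unfolding moment_def
  by (subst nn_integral_comb_seq[where k = m]) (simp_all add: mat_prod_comb_seq matrix_vector_mul_assoc)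

lemma moment_Suc: "moment V s (Suc n) u = (\<integral>\<^sup>+g. moment V s n (g *v u) \<partial>\<mu>)"
  unfolding moment_def
  by (subst nn_integral_case_nat) (simp_all add: mat_prod_case_nat matrix_vector_mul_assoc del: mat_prod.simps)

lemma measurable_moment [measurable]: "moment V s n \<in> borel_measurable borel"
  unfolding moment_def by measurable

lemma AE_mat_prod_mem:
  assumes "AE g in \<mu>. \<forall>u\<in>X. g *v u \<in> X"
  shows "AE \<omega> in S. \<forall>n. \<forall>u\<in>X. mat_prod \<omega> n *v u \<in> X"
  using AE_all_coordinates[OF assms]
proof eventually_elim
  case (elim \<omega>)
  have "\<forall>u\<in>X. mat_prod \<omega> n *v u \<in> X" for n
    by (induction n) (use elim in \<open>auto simp: matrix_vector_mul_assoc[symmetric]\<close>)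
  then show ?case by blast
qed

text \<open>A Borel-Cantelli argument: weighted by exp (- s n a'), the s-th powers have summable
  means, so their sum is almost surely finite and bounds each of its terms.\<close>

lemma moment_bound_imp_growth:
  assumes s: "0 < s" and D: "\<And>n. moment {0} s n u \<le> ennreal (D * exp (s * real n * a))" and a: "a < a'"
  shows "AE \<omega> in S. \<exists>E. \<forall>n. norm (mat_prod \<omega> n *v u) \<le> E * exp (real n * a')"
proof -
  define f where "f n \<omega> = ennreal (norm (mat_prod \<omega> n *v u) powr s * exp (- (s * real n * a')))" for n \<omega>
  define q where "q = exp (- (s * (a' - a)))"
  have q: "0 < q" "q < 1" using s a by (auto simp: q_def)
  have D0: "\<bar>D\<bar> \<ge> 0" by simp
  have [measurable]: "f n \<in> borel_measurable S" for n unfolding f_def by measurable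
  have fn: "(\<integral>\<^sup>+\<omega>. f n \<omega> \<partial>S) \<le> ennreal (\<bar>D\<bar> * q ^ n)" for n
  proof -
    have "(\<integral>\<^sup>+\<omega>. f n \<omega> \<partial>S) = moment {0} s n u * ennreal (exp (- (s * real n * a')))"
      unfolding f_def moment_def by (simp add: ennreal_mult nn_integral_multc)
    also have "\<dots> \<le> ennreal (\<bar>D\<bar> * exp (s * real n * a)) * ennreal (exp (- (s * real n * a')))"
      by (intro mult_right_mono order_trans[OF D] ennreal_leI) (auto intro: mult_right_mono)
    also have "\<dots> = ennreal (\<bar>D\<bar> * (exp (s * real n * a) * exp (- (s * real n * a'))))"
      by (simp add: ennreal_mult[symmetric] mult.assoc)
    also have "exp (s * real n * a) * exp (- (s * real n * a')) = q ^ n"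
      by (simp add: q_def exp_add[symmetric] exp_of_nat_mult[symmetric] algebra_simps)
    finally show ?thesis .
  qed
  have "(\<integral>\<^sup>+\<omega>. (\<Sum>n. f n \<omega>) \<partial>S) = (\<Sum>n. \<integral>\<^sup>+\<omega>. f n \<omega> \<partial>S)" by (rule nn_integral_suminf) simp
  also have "\<dots> \<le> (\<Sum>n. ennreal (\<bar>D\<bar> * q ^ n))" by (intro suminf_le fn) auto
  also have "\<dots> = ennreal (\<Sum>n. \<bar>D\<bar> * q ^ n)"
    using q by (intro suminf_ennreal2) (auto intro!: summable_mult summable_geometric)
  also have "\<dots> < \<infinity>" by simp
  finally have "(\<integral>\<^sup>+\<omega>. (\<Sum>n. f n \<omega>) \<partial>S) \<noteq> \<infinity>" by simp
  then have "AE \<omega> in S. (\<Sum>n. f n \<omega>) \<noteq> \<infinity>" by (intro nn_integral_noteq_infinite) auto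
  then show ?thesis
  proof eventually_elim
    case (elim \<omega>)
    define T where "T = enn2real (\<Sum>n. f n \<omega>)"
    have T: "T \<ge> 0" by (simp add: T_def)
    have "norm (mat_prod \<omega> n *v u) \<le> T powr (1 / s) * exp (real n * a')" for n
    proof -
      have "f n \<omega> \<le> (\<Sum>n. f n \<omega>)" by (rule ennreal_suminf_lessD[THEN less_imp_le] sum_le_suminf[of "\<lambda>n. f n \<omega>" "{n}", simplified])
      also have "\<dots> = ennreal T" using elim by (simp add: T_def less_top)
      finally have "norm (mat_prod \<omega> n *v u) powr s * exp (- (s * real n * a')) \<le> T"
        unfolding f_def using T by simp
      then have "norm (mat_prod \<omega> n *v u) powr s * exp (- (s * real n * a')) * exp (s * real n * a') \<le> T * exp (s * real n * a')"
        by (rule mult_right_mono) simp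
      then have "norm (mat_prod \<omega> n *v u) powr s \<le> T * exp (s * real n * a')"
        by (simp add: mult.assoc exp_add[symmetric])
      then have "(norm (mat_prod \<omega> n *v u) powr s) powr (1 / s) \<le> (T * exp (s * real n * a')) powr (1 / s)"
        using s by (intro powr_mono2) auto
      also have "\<dots> = T powr (1 / s) * exp (real n * a')"
        using T s by (simp add: powr_mult exp_powr_real)
      finally show ?thesis using s by (simp add: powr_powr)
    qed
    then show ?case by blast
  qed
qed

end

context quotient_product
begin

lemma ln_pn_bound:
  assumes "\<omega> \<in> space S" "u \<notin> V"
  shows "\<bar>ln (pn (mat_prod \<omega> n *v u) / pn u)\<bar> \<le> ln KK * real n"
proof -
  have p: "0 < pn u" "0 < pn (mat_prod \<omega> n *v u)"
    using assms mat_prod_mem_V by (auto intro!: pn_pos simp del: zero_less_norm_iff)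
  have K: "KK ^ n > 0" using KK_pos by simp
  have l: "ln (KK ^ n) = ln KK * real n" using KK_pos by (simp add: ln_realpow mult.commute)
  have "pn (mat_prod \<omega> n *v u) / pn u \<le> KK ^ n"
    using pn_mat_prod(1)[OF assms(1), of n u] p by (simp add: pos_divide_le_eq)
  then have "ln (pn (mat_prod \<omega> n *v u) / pn u) \<le> ln (KK ^ n)" using p K by (subst ln_le_cancel_iff) auto
  moreover have "1 / KK ^ n \<le> pn (mat_prod \<omega> n *v u) / pn u"
    using pn_mat_prod(2)[OF assms(1), of u n] p K by (simp add: field_simps)
  then have "ln (1 / KK ^ n) \<le> ln (pn (mat_prod \<omega> n *v u) / pn u)" using p K by (subst ln_le_cancel_iff) auto
  moreover have "ln (1 / KK ^ n) = - ln (KK ^ n)" using K KK_pos by (subst ln_div) auto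
  ultimately show ?thesis unfolding l by linarith
qed

lemma moment_le_power:
  assumes "0 < s"
  shows "moment V s n u \<le> ennreal ((KK ^ n * pn u) powr s)"
proof -
  have "moment V s n u \<le> (\<integral>\<^sup>+\<omega>. ennreal ((KK ^ n * pn u) powr s) \<partial>S)"
    unfolding moment_def using assms
    by (intro nn_integral_mono ennreal_leI powr_mono2 pn_mat_prod) auto
  then show ?thesis by (simp add: P.emeasure_space_1)
qed

text \<open>At the single time m the bound on mean logarithms is converted by
  \<open>exp_moment_bound\<close>; since it holds for every starting vector in the invariant set X,
  it can be iterated over blocks of length m. X avoids \<open>V\<close> to keep the logarithms
  meaningful.\<close>

lemma moment_growth:
  assumes X: "AE g in \<mu>. \<forall>u\<in>X. g *v u \<in> X" "X \<inter> V = {}" and m: "m \<ge> 1"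
    and E: "\<And>u. u \<in> X \<Longrightarrow> P.expectation (\<lambda>\<omega>. ln (pn (mat_prod \<omega> m *v u) / pn u)) \<le> real m * a"
    and a: "a < a'"
  obtains s0 where "0 < s0" "s0 \<le> 1"
    "\<And>s. 0 < s \<Longrightarrow> s \<le> s0 \<Longrightarrow> \<exists>D\<ge>0. \<forall>n. \<forall>u\<in>X. moment V s n u \<le> ennreal (D * exp (s * real n * a') * pn u powr s)"
proof -
  define b where "b = ln KK * real m"
  have lnK: "ln KK \<ge> 0" using KK(1) by simp
  have b: "b \<ge> 0" using lnK by (simp add: b_def)
  obtain s0 where s0: "0 < s0" "s0 \<le> 1" "\<And>s. 0 < s \<Longrightarrow> s \<le> s0 \<Longrightarrow> s * b \<le> 1 \<and> s * b\<^sup>2 \<le> real m * (a' - a)"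
    using exists_small_exponent[of "real m * (a' - a)" b] a m b by auto
  have "\<exists>D\<ge>0. \<forall>n. \<forall>u\<in>X. moment V s n u \<le> ennreal (D * exp (s * real n * a') * pn u powr s)"
    if s: "0 < s" "s \<le> s0" for s
  proof -
    have step: "moment V s m u \<le> ennreal (exp (s * real m * a') * pn u powr s)" if u: "u \<in> X" for u
    proof -
      have uV: "u \<notin> V" using u X(2) by blast
      have pu: "pn u > 0" by (rule pn_pos[OF uV])
      let ?Y = "\<lambda>\<omega>. ln (pn (mat_prod \<omega> m *v u) / pn u)"
      have "P.expectation (\<lambda>\<omega>. exp (s * ?Y \<omega>)) \<le> exp (s * (real m * a + real m * (a' - a)))"
      proof (rule P.exp_moment_bound)
        show "AE \<omega> in S. \<bar>?Y \<omega>\<bar> \<le> b" unfolding b_def by (rule AE_I2) (rule ln_pn_bound[OF _ uV])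
      qed (use s s0(3) E[OF u] in auto)
      then have e: "P.expectation (\<lambda>\<omega>. exp (s * ?Y \<omega>)) \<le> exp (s * real m * a')" by (simp add: algebra_simps)
      have "moment V s m u = (\<integral>\<^sup>+\<omega>. ennreal (exp (s * ?Y \<omega>)) * ennreal (pn u powr s) \<partial>S)"
        unfolding moment_def
      proof (rule nn_integral_cong)
        fix \<omega> assume \<omega>: "\<omega> \<in> space S"
        have p: "pn (mat_prod \<omega> m *v u) > 0" using uV mat_prod_mem_V[OF \<omega>] by (intro pn_pos) simp
        have "pn (mat_prod \<omega> m *v u) powr s = exp (s * ?Y \<omega>) * pn u powr s"
          using p pu by (simp add: powr_def ln_div algebra_simps exp_add[symmetric])
        then show "ennreal (pn (mat_prod \<omega> m *v u) powr s) = ennreal (exp (s * ?Y \<omega>)) * ennreal (pn u powr s)"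
          by (simp add: ennreal_mult)
      qed
      also have "\<dots> = (\<integral>\<^sup>+\<omega>. ennreal (exp (s * ?Y \<omega>)) \<partial>S) * ennreal (pn u powr s)"
        by (rule nn_integral_multc) simp
      also have "(\<integral>\<^sup>+\<omega>. ennreal (exp (s * ?Y \<omega>)) \<partial>S) = ennreal (P.expectation (\<lambda>\<omega>. exp (s * ?Y \<omega>)))"
      proof (rule nn_integral_eq_integral)
        show "integrable S (\<lambda>\<omega>. exp (s * ?Y \<omega>))"
        proof (rule P.integrable_const_bound[of _ "exp (s * b)"])
          show "AE \<omega> in S. norm (exp (s * ?Y \<omega>)) \<le> exp (s * b)"
          proof (rule AE_I2)
            fix \<omega> assume "\<omega> \<in> space S"
            then show "norm (exp (s * ?Y \<omega>)) \<le> exp (s * b)"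
              using ln_pn_bound[of \<omega> u m] uV s unfolding b_def by (simp add: abs_le_iff del: ln_div)
          qed
        qed simp
      qed simp
      also have "\<dots> * ennreal (pn u powr s) \<le> ennreal (exp (s * real m * a')) * ennreal (pn u powr s)"
        using e by (intro mult_right_mono ennreal_leI) auto
      finally show ?thesis by (simp add: ennreal_mult)
    qed
    \<comment> \<open>Pays for the last incomplete block of fewer than m steps, where only the crude
      factor \<open>KK\<close> per step is known.\<close>
    define D where "D = exp (s * real m * (ln KK + \<bar>a'\<bar>))"
    have "\<forall>u\<in>X. moment V s n u \<le> ennreal (D * exp (s * real n * a') * pn u powr s)" for n
    proof (induction n rule: less_induct)
      case (less n)
      show ?case
      proof
        fix u assume u: "u \<in> X"
        show "moment V s n u \<le> ennreal (D * exp (s * real n * a') * pn u powr s)"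
        proof (cases "n < m")
          case True
          have "(KK ^ n * pn u) powr s = exp (s * real n * ln KK) * pn u powr s"
          proof -
            have "(KK ^ n) powr s = exp (s * real n * ln KK)"
              using KK_pos by (simp add: powr_def ln_realpow mult.assoc)
            then show ?thesis using KK_pos by (simp add: powr_mult)
          qed
          also have "\<dots> \<le> (D * exp (s * real n * a')) * pn u powr s"
          proof (rule mult_right_mono)
            have "s * real n * (ln KK - a') \<le> s * real n * (ln KK + \<bar>a'\<bar>)" using s by (intro mult_left_mono) auto
            also have "\<dots> \<le> s * real m * (ln KK + \<bar>a'\<bar>)" using s True lnK by (intro mult_right_mono mult_left_mono) auto
            finally show "exp (s * real n * ln KK) \<le> D * exp (s * real n * a')"
              unfolding D_def exp_add[symmetric] by (simp add: algebra_simps)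
          qed simp
          finally show ?thesis using moment_le_power[OF s(1), of n u] by (meson ennreal_leI order_trans)
        next
          case False
          then obtain j where j: "n = m + j" "j < n" using m by (metis add_diff_inverse_nat less_le_trans not_less diff_less zero_less_one)
          have "moment V s n u = (\<integral>\<^sup>+\<omega>. moment V s j (mat_prod \<omega> m *v u) \<partial>S)"
            unfolding j(1) by (rule moment_add)
          also have "\<dots> \<le> (\<integral>\<^sup>+\<omega>. ennreal (D * exp (s * real j * a')) * ennreal (pn (mat_prod \<omega> m *v u) powr s) \<partial>S)"
          proof (rule nn_integral_mono_AE)
            show "AE \<omega> in S. moment V s j (mat_prod \<omega> m *v u)
                \<le> ennreal (D * exp (s * real j * a')) * ennreal (pn (mat_prod \<omega> m *v u) powr s)"
              using AE_mat_prod_mem[OF X(1)]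
              by eventually_elim (use less.IH[OF j(2)] u in \<open>simp add: ennreal_mult[symmetric] D_def\<close>)
          qed
          also have "\<dots> = ennreal (D * exp (s * real j * a')) * moment V s m u"
            unfolding moment_def by (rule nn_integral_cmult) simp
          also have "\<dots> \<le> ennreal (D * exp (s * real j * a')) * ennreal (exp (s * real m * a') * pn u powr s)"
            by (intro mult_left_mono step u) simp
          also have "\<dots> = ennreal (D * exp (s * real n * a') * pn u powr s)"
            by (simp add: ennreal_mult[symmetric] D_def j(1) algebra_simps exp_add)
          finally show ?thesis .
        qed
      qed
    qed
    moreover have "D \<ge> 0" by (simp add: D_def)
    ultimately show ?thesis by blast
  qed
  then show ?thesis using that s0(1,2) by blast
qed

text \<open>The proof unrolls the off-diagonal block of the product.\<close>

lemma moment_block_triangular: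
  assumes s: "0 < s" "s \<le> 1" and D: "D \<ge> 0"
    and HV: "\<And>n x. x \<in> V \<Longrightarrow> moment {0} s n x \<le> ennreal (D * exp (s * real n * a) * norm x powr s)"
    and W: "subspace W" "V \<subseteq> W" "AE g in \<mu>. \<forall>u\<in>W. g *v u \<in> W"
    and HW: "\<And>n u. u \<in> W \<Longrightarrow> moment V s n u \<le> ennreal (D * exp (s * real n * a) * pn u powr s)"
    and a: "a < a'"
  obtains E where "E \<ge> 0" "\<And>n u. u \<in> W \<Longrightarrow> moment {0} s n u \<le> ennreal (E * exp (s * real n * a') * norm u powr s)"
proof -
  have split: "moment {0} s n (u + v) \<le> moment {0} s n u + moment {0} s n v" for n u v
  proof -
    have "moment {0} s n (u + v) \<le> (\<integral>\<^sup>+\<omega>. ennreal (norm (mat_prod \<omega> n *v u) powr s)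
        + ennreal (norm (mat_prod \<omega> n *v v) powr s) \<partial>S)"
      unfolding moment_def
    proof (rule nn_integral_mono)
      fix \<omega>
      have "norm (mat_prod \<omega> n *v (u + v)) powr s \<le> (norm (mat_prod \<omega> n *v u) + norm (mat_prod \<omega> n *v v)) powr s"
        using s by (intro powr_mono2) (auto simp: matrix_vector_right_distrib norm_triangle_ineq)
      also have "\<dots> \<le> norm (mat_prod \<omega> n *v u) powr s + norm (mat_prod \<omega> n *v v) powr s"
        using s by (intro powr_add_le) auto
      finally show "ennreal (norm (qproj {0} (mat_prod \<omega> n *v (u + v))) powr s)
          \<le> ennreal (norm (mat_prod \<omega> n *v u) powr s) + ennreal (norm (mat_prod \<omega> n *v v) powr s)"
        by (simp add: ennreal_leI flip: ennreal_plus)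
    qed
    also have "\<dots> = moment {0} s n u + moment {0} s n v"
      unfolding moment_def by (simp add: nn_integral_add)
    finally show ?thesis .
  qed
  \<comment> \<open>One application of g to a vector y orthogonal to \<open>V\<close> creates a
    component in \<open>V\<close> of norm at most 2 * KK * pn y. After j further steps its s-th
    moment is bounded by \<open>co j\<close> times pn y powr s.\<close>
  define C where "C = D * (2 * KK) powr s"
  have C: "C \<ge> 0" using D by (simp add: C_def)
  define co where "co j = ennreal (C * exp (s * real j * a))" for j
  have WP: "qproj V u \<in> W" if "u \<in> W" for u
    using subspace_diff[OF W(1) that, of "u - qproj V u"] diff_qproj_mem[OF V, of u] W(2) by auto
  \<comment> \<open>The k-th summand accounts for the component that falls into \<open>V\<close> at
    step k + 1: the class has moved k steps, and n - 1 - k steps inside \<open>V\<close> remain. The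
    contributions may be added because s \<le> 1 makes s-th powers subadditive.\<close>
  have key: "moment {0} s n y \<le> (\<Sum>k<n. co (n - 1 - k) * moment V s k y) + moment V s n y"
    if "y \<in> W" "qproj V y = y" for n y
    using that
  proof (induction n arbitrary: y)
    case 0
    then show ?case by (simp add: moment_0)
  next
    case (Suc n)
    have qq: "moment V s k (qproj V (g *v y)) = moment V s k (g *v y)" for k g
      unfolding moment_def by (intro nn_integral_cong) (simp add: qproj_mat_prod)
    have "moment {0} s (Suc n) y = (\<integral>\<^sup>+g. moment {0} s n (g *v y) \<partial>\<mu>)" by (rule moment_Suc)
    also have "\<dots> \<le> (\<integral>\<^sup>+g. (\<Sum>k<n. co (n - 1 - k) * moment V s k (g *v y)) + moment V s n (g *v y)
        + co n * ennreal (pn y powr s) \<partial>\<mu>)"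
    proof (rule nn_integral_mono_AE)
      show "AE g in \<mu>. moment {0} s n (g *v y) \<le> (\<Sum>k<n. co (n - 1 - k) * moment V s k (g *v y)) + moment V s n (g *v y)
        + co n * ennreal (pn y powr s)"
        using W(3) AE_space
      proof eventually_elim
        case (elim g)
        have g: "g \<in> \<Sigma>" using elim space_mu by simp
        define z where "z = qproj V (g *v y)"
        define v where "v = g *v y - z"
        have vV: "v \<in> V" unfolding v_def z_def by (rule diff_qproj_mem[OF V])
        have "norm v \<le> norm (g *v y) + norm z" unfolding v_def by (rule norm_triangle_ineq4)
        also have "norm z \<le> norm (g *v y)" unfolding z_def by (rule norm_qproj_le[OF V])
        also have "norm (g *v y) + norm (g *v y) \<le> 2 * KK * pn y" using KK(2)[OF g, of y] Suc.prems(2) by simp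
        finally have nv: "norm v \<le> 2 * KK * pn y" by simp
        have "moment {0} s n (g *v y) \<le> moment {0} s n z + moment {0} s n v"
          using split[of n z v] by (simp add: v_def)
        also have "moment {0} s n z \<le> (\<Sum>k<n. co (n - 1 - k) * moment V s k z) + moment V s n z"
          using elim(1) Suc.prems(1) unfolding z_def by (intro Suc.IH WP qproj_idem V) auto
        also have "moment {0} s n v \<le> co n * ennreal (pn y powr s)"
        proof -
          have "norm v powr s \<le> (2 * KK * pn y) powr s" using nv s by (intro powr_mono2) auto
          also have "\<dots> = (2 * KK) powr s * pn y powr s" using KK_pos by (simp add: powr_mult)
          finally have "D * exp (s * real n * a) * norm v powr s
              \<le> D * exp (s * real n * a) * ((2 * KK) powr s * pn y powr s)"
            using D by (intro mult_left_mono) auto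
          also have "\<dots> = C * exp (s * real n * a) * pn y powr s" by (simp add: C_def)
          finally have "moment {0} s n v \<le> ennreal (C * exp (s * real n * a) * pn y powr s)"
            by (intro order_trans[OF HV[OF vV]] ennreal_leI)
          then show ?thesis using C by (simp add: co_def ennreal_mult)
        qed
        finally show ?case by (simp add: z_def qq add_mono)
      qed
    qed
    also have "\<dots> = (\<Sum>k<n. co (n - 1 - k) * moment V s (Suc k) y) + moment V s (Suc n) y + co n * moment V s 0 y"
      by (simp add: nn_integral_add nn_integral_sum nn_integral_cmult moment_Suc[symmetric] moment_0 M.emeasure_space_1)
    also have "\<dots> = (\<Sum>k<Suc n. co (Suc n - 1 - k) * moment V s k y) + moment V s (Suc n) y"
      by (subst sum.lessThan_Suc_shift) (simp add: add_ac)
    finally show ?case .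
  qed
  \<comment> \<open>The n summands of equal size produce a factor n. It is absorbed by x \<le> exp x
    at x = n * \<theta>, and this is the cost of raising the rate from a to a'.\<close>
  define \<theta> where "\<theta> = s * (a' - a)"
  have \<theta>: "\<theta> > 0" using s a by (simp add: \<theta>_def)
  define B where "B = C * D * exp (- (s * a))"
  have B: "B \<ge> 0" using C D by (simp add: B_def)
  define B' where "B' = B / \<theta> + D"
  have B': "B' \<ge> 0" using B D \<theta> by (simp add: B'_def)
  have bound1: "moment {0} s n y \<le> ennreal (B' * exp (s * real n * a') * norm y powr s)"
    if y: "y \<in> W" "qproj V y = y" for n y
  proof -
    have pw: "moment V s k y \<le> ennreal (D * exp (s * real k * a) * norm y powr s)" for k
      using HW[OF y(1), of k] y(2) by simp
    have "moment {0} s n y \<le> (\<Sum>k<n. co (n - 1 - k) * moment V s k y) + moment V s n y"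
      by (rule key[OF y])
    also have "\<dots> \<le> (\<Sum>k<n. ennreal (B * exp (s * real n * a) * norm y powr s)) + ennreal (D * exp (s * real n * a) * norm y powr s)"
    proof (intro add_mono sum_mono pw)
      fix k assume "k \<in> {..<n}"
      then have k: "real (n - 1 - k) = real n - 1 - real k" by auto
      have "co (n - 1 - k) * moment V s k y \<le> co (n - 1 - k) * ennreal (D * exp (s * real k * a) * norm y powr s)"
        by (intro mult_left_mono pw) simp
      also have "\<dots> = ennreal (C * D * (exp (s * real (n - 1 - k) * a) * exp (s * real k * a)) * norm y powr s)"
        using C D by (simp add: co_def ennreal_mult[symmetric] mult_ac)
      also have "exp (s * real (n - 1 - k) * a) * exp (s * real k * a) = exp (- (s * a)) * exp (s * real n * a)"
        unfolding exp_add[symmetric] k by (simp add: algebra_simps)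
      finally show "co (n - 1 - k) * moment V s k y \<le> ennreal (B * exp (s * real n * a) * norm y powr s)"
        by (simp add: B_def mult.assoc)
    qed
    also have "\<dots> = ennreal ((real n * B + D) * exp (s * real n * a) * norm y powr s)"
      using B D by (simp add: ennreal_of_nat_eq_real_of_nat ennreal_mult[symmetric] ennreal_plus[symmetric] algebra_simps del: ennreal_plus)
    also have "\<dots> \<le> ennreal (B' * exp (s * real n * a') * norm y powr s)"
    proof (intro ennreal_leI mult_right_mono)
      have "real n * \<theta> \<le> exp (real n * \<theta>)" using exp_ge_add_one_self[of "real n * \<theta>"] by linarith
      then have "real n \<le> exp (real n * \<theta>) / \<theta>" using \<theta> by (simp add: pos_le_divide_eq)
      then have "real n * B \<le> exp (real n * \<theta>) / \<theta> * B" using B by (intro mult_right_mono)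
      moreover have "D \<le> D * exp (real n * \<theta>)" using D \<theta> by (simp add: mult_le_cancel_left1)
      ultimately have "real n * B + D \<le> B' * exp (real n * \<theta>)" by (simp add: B'_def algebra_simps)
      then have "(real n * B + D) * exp (s * real n * a) \<le> B' * exp (real n * \<theta>) * exp (s * real n * a)"
        by (intro mult_right_mono) auto
      also have "\<dots> = B' * exp (s * real n * a')"
        by (simp add: mult.assoc exp_add[symmetric] \<theta>_def algebra_simps)
      finally show "(real n * B + D) * exp (s * real n * a) \<le> B' * exp (s * real n * a')" .
    qed simp
    finally show ?thesis .
  qed
  show ?thesis
  proof (rule that[of "B' + D * 2 powr s"])
    show "0 \<le> B' + D * 2 powr s" using B' D by simp
    fix n u assume u: "u \<in> W"
    have nv: "norm (u - qproj V u) \<le> 2 * norm u"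
      using norm_triangle_ineq4[of u "qproj V u"] norm_qproj_le[OF V, of u] by simp
    have "moment {0} s n u \<le> moment {0} s n (qproj V u) + moment {0} s n (u - qproj V u)"
      using split[of n "qproj V u" "u - qproj V u"] by simp
    also have "\<dots> \<le> ennreal (B' * exp (s * real n * a') * norm (qproj V u) powr s)
        + ennreal (D * exp (s * real n * a) * norm (u - qproj V u) powr s)"
      by (intro add_mono bound1 WP u qproj_idem V HV diff_qproj_mem)
    also have "\<dots> \<le> ennreal (B' * exp (s * real n * a') * norm u powr s)
        + ennreal (D * exp (s * real n * a') * (2 powr s * norm u powr s))"
    proof (intro add_mono ennreal_leI mult_mono mult_left_mono powr_mono2)
      show "norm (u - qproj V u) powr s \<le> 2 powr s * norm u powr s"
        using nv s powr_mono2[of s "norm (u - qproj V u)" "2 * norm u"] by (simp add: powr_mult)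
    qed (use B' D s a norm_qproj_le[OF V] in \<open>auto intro!: mult_left_mono\<close>)
    also have "\<dots> = ennreal ((B' + D * 2 powr s) * exp (s * real n * a') * norm u powr s)"
      using B' D by (subst ennreal_plus[symmetric]) (auto simp: algebra_simps)
    finally show "moment {0} s n u \<le> ennreal ((B' + D * 2 powr s) * exp (s * real n * a') * norm u powr s)" .
  qed
qed

end

section \<open>From growth rates to moments on quotients\<close>

context random_product
begin

lemma growth_unique: "growth N a \<Longrightarrow> growth N b \<Longrightarrow> a = b"
  unfolding growth_def using LIMSEQ_unique by blast

lemma growth_expectation_less:
  assumes "growth N \<gamma>" "\<gamma> < a"
  obtains m where "m \<ge> 1" "P.expectation (\<lambda>\<omega>. ln (N (mat_prod \<omega> m))) \<le> real m * a"
proof -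
  have "(\<lambda>n. P.expectation (\<lambda>\<omega>. ln (N (mat_prod \<omega> n))) / real n) \<longlonglongrightarrow> \<gamma>"
    using assms by (simp add: growth_def)
  then have "\<forall>\<^sub>F n in sequentially. P.expectation (\<lambda>\<omega>. ln (N (mat_prod \<omega> n))) / real n < a"
    using assms(2) by (rule order_tendstoD)
  then obtain n0 where n0: "\<And>n. n \<ge> n0 \<Longrightarrow> P.expectation (\<lambda>\<omega>. ln (N (mat_prod \<omega> n))) / real n < a"
    by (auto simp: eventually_sequentially)
  show ?thesis
  proof (rule that[of "max 1 n0"])
    show "P.expectation (\<lambda>\<omega>. ln (N (mat_prod \<omega> (max 1 n0)))) \<le> real (max 1 n0) * a"
      using n0[of "max 1 n0"] by (simp add: field_simps)
  qed simp
qed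

lemma quotient_product_0: "quotient_product \<Sigma> \<mu> {0}"
  by unfold_locales auto

end

context quotient_product
begin

lemma pn_le_quot_norm:
  assumes W: "subspace W" "V \<subseteq> W"
  shows "\<And>u. u \<in> W \<Longrightarrow> \<omega> \<in> space S \<Longrightarrow> pn (mat_prod \<omega> n *v u) \<le> quot_norm V W (mat_prod \<omega> n) * pn u"
proof -
  fix u assume u: "u \<in> W" and \<omega>: "\<omega> \<in> space S"
  have "qproj V u \<in> W"
    using subspace_diff[OF W(1) u, of "u - qproj V u"] diff_qproj_mem[OF V, of u] W(2) by auto
  from quot_norm(1)[OF V W(1) this, of "mat_prod \<omega> n"]
  show "pn (mat_prod \<omega> n *v u) \<le> quot_norm V W (mat_prod \<omega> n) * pn u"
    by (simp add: qproj_mat_prod[OF \<omega>])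
qed

text \<open>Only finitely many basis vectors matter, and the maximum of finitely many rates below L
  is still below L. The operator norm on W / V is bounded through the basis, so a pointwise property
  becomes a strict inequality for the rate.\<close>

lemma slow_rate:
  assumes W: "subspace W" "V \<subseteq> W" "V \<noteq> W" and sl: "AE \<omega> in S. \<forall>u\<in>W. slow L \<omega> u"
    and gr: "growth (quot_norm V W) \<gamma>"
  shows "\<gamma> < L"
proof -
  have "AE \<omega> in S. (\<lambda>n. ln (quot_norm V W (mat_prod \<omega> n)) / real n) \<longlonglongrightarrow> \<gamma>"
    using gr by (simp add: growth_def)
  then have "AE \<omega> in S. \<gamma> < L" using sl AE_space
  proof eventually_elim
    case (elim \<omega>)
    have "\<exists>a D. a < L \<and> D \<ge> 0 \<and> (\<forall>m. pn (mat_prod \<omega> m *v b) \<le> D * exp (real m * a))" if "b \<in> onb W" for b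
      using elim(2) onb(1)[OF W(1)] that by (meson slowE subset_eq)
    then obtain a D where aD: "\<And>b. b \<in> onb W \<Longrightarrow> a b < L" "\<And>b. b \<in> onb W \<Longrightarrow> D b \<ge> 0"
      "\<And>b m. b \<in> onb W \<Longrightarrow> pn (mat_prod \<omega> m *v b) \<le> D b * exp (real m * a b)" by metis
    define a' where "a' = Max (insert (L - 1) (a ` onb W))"
    have fin: "finite (onb W)" by (rule onb(4)[OF W(1)])
    have a': "a' < L" "\<And>b. b \<in> onb W \<Longrightarrow> a b \<le> a'" unfolding a'_def using fin aD(1) by auto
    define D' where "D' = (\<Sum>b\<in>onb W. D b) + 1"
    have D': "D' > 0" unfolding D'_def using aD(2) by (intro add_nonneg_pos sum_nonneg) auto
    have bound: "quot_norm V W (mat_prod \<omega> m) \<le> D' * exp (real m * a')" for m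
      unfolding quot_norm(3)[OF V W(1)]
    proof (intro conjI ballI)
      fix x assume x: "x \<in> W"
      have "qproj W x = 0" using qproj_eq_0_iff[OF W(1)] x by simp
      then have "x = (\<Sum>b\<in>onb W. (x \<bullet> b) *\<^sub>R b)" by (simp add: qproj_def)
      then have "qproj V (mat_prod \<omega> m *v x) = qproj V (mat_prod \<omega> m *v (\<Sum>b\<in>onb W. (x \<bullet> b) *\<^sub>R b))" by simp
      also have "\<dots> = (\<Sum>b\<in>onb W. (x \<bullet> b) *\<^sub>R qproj V (mat_prod \<omega> m *v b))"
        by (simp add: linear_sum[OF linear_mv] linear_sum[OF linear_qproj] matrix_vector_mult_scaleR qproj_scale)
      also have "norm \<dots> \<le> (\<Sum>b\<in>onb W. norm x * (D b * exp (real m * a')))"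
      proof (rule sum_norm_le)
        fix b assume b: "b \<in> onb W"
        have "\<bar>x \<bullet> b\<bar> \<le> norm x" using Cauchy_Schwarz_ineq2[of x b] onb(3)[OF W(1) b] by simp
        moreover have "pn (mat_prod \<omega> m *v b) \<le> D b * exp (real m * a')"
          using aD(2)[OF b] a'(2)[OF b] by (intro order_trans[OF aD(3)[OF b]] mult_left_mono) (auto intro: mult_left_mono)
        ultimately show "norm ((x \<bullet> b) *\<^sub>R qproj V (mat_prod \<omega> m *v b)) \<le> norm x * (D b * exp (real m * a'))"
          by (simp add: mult_mono)
      qed
      also have "\<dots> = (\<Sum>b\<in>onb W. D b) * exp (real m * a') * norm x"
        by (simp add: sum_distrib_left[symmetric] sum_distrib_right[symmetric] mult_ac)
      also have "\<dots> \<le> D' * exp (real m * a') * norm x"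
        unfolding D'_def by (intro mult_right_mono) auto
      finally show "pn (mat_prod \<omega> m *v x) \<le> D' * exp (real m * a') * norm x" .
    qed (use D' in simp)
    obtain w where w: "w \<in> W" "w \<notin> V" using W by blast
    have pos: "quot_norm V W (mat_prod \<omega> m) > 0" for m
    proof -
      have "0 < pn (mat_prod \<omega> m *v w)" using mat_prod_mem_V[OF elim(3)] w by (intro pn_pos) simp
      also have "\<dots> \<le> quot_norm V W (mat_prod \<omega> m) * norm w" by (rule quot_norm(1)[OF V W(1) w(1)])
      finally show ?thesis using quot_norm(2)[OF V W(1)] by (metis less_eq_real_def mult_zero_left order_less_irrefl)
    qed
    have "(\<lambda>n. ln D' / real n + a') \<longlonglongrightarrow> 0 + a'"
      by (intro tendsto_intros lim_const_over_n)
    moreover have "\<forall>\<^sub>F n in sequentially. ln (quot_norm V W (mat_prod \<omega> n)) / real n \<le> ln D' / real n + a'"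
      using eventually_gt_at_top[of 0]
    proof eventually_elim
      case (elim n)
      have "ln (quot_norm V W (mat_prod \<omega> n)) \<le> ln (D' * exp (real n * a'))"
        using bound[of n] pos[of n] D' by (subst ln_le_cancel_iff) auto
      also have "\<dots> = ln D' + real n * a'" using D' by (simp add: ln_mult_pos)
      finally show ?case using elim by (simp add: field_simps)
    qed
    ultimately have "\<gamma> \<le> 0 + a'" using elim(1) by (intro tendsto_le[OF sequentially_bot])
    then show ?case using a' by simp
  qed
  then show ?thesis by (simp add: P.AE_const)
qed

text \<open>The operator norm dominates the growth of all vectors at once, which supplies the
  uniform bound on mean logarithms that \<open>moment_growth\<close> requires.\<close>

lemma growth_moment:
  assumes W: "subspace W" "V \<subseteq> W" "AE g in \<mu>. (*v) g ` W = W"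
    and gr: "growth (quot_norm V W) \<gamma>" and a: "\<gamma> < a"
  obtains s0 where "0 < s0" "s0 \<le> 1"
    "\<And>s. 0 < s \<Longrightarrow> s \<le> s0 \<Longrightarrow> \<exists>D\<ge>0. \<forall>n. \<forall>u\<in>W. moment V s n u \<le> ennreal (D * exp (s * real n * a) * pn u powr s)"
proof -
  obtain b where b: "\<gamma> < b" "b < a" using a dense by blast
  obtain m where m: "m \<ge> 1" "P.expectation (\<lambda>\<omega>. ln (quot_norm V W (mat_prod \<omega> m))) \<le> real m * b"
    using growth_expectation_less[OF gr b(1)] .
  have X: "AE g in \<mu>. \<forall>u\<in>W - V. g *v u \<in> W - V"
    using W(3) AE_space
  proof eventually_elim
    case (elim g)
    then show ?case using mv_mem_V space_mu by blast
  qed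
  have E: "P.expectation (\<lambda>\<omega>. ln (pn (mat_prod \<omega> m *v u) / pn u)) \<le> real m * b" if u: "u \<in> W - V" for u
  proof -
    have "P.expectation (\<lambda>\<omega>. ln (pn (mat_prod \<omega> m *v u) / pn u)) \<le> P.expectation (\<lambda>\<omega>. ln (quot_norm V W (mat_prod \<omega> m)))"
    proof (rule integral_mono_AE)
      show "integrable S (\<lambda>\<omega>. ln (pn (mat_prod \<omega> m *v u) / pn u))"
      proof (rule P.integrable_const_bound[of _ "ln KK * real m"])
        show "AE \<omega> in S. norm (ln (pn (mat_prod \<omega> m *v u) / pn u)) \<le> ln KK * real m"
          using ln_pn_bound[of _ u m] u by (intro AE_I2) (simp del: ln_div)
      qed simp
      show "integrable S (\<lambda>\<omega>. ln (quot_norm V W (mat_prod \<omega> m)))" using gr by (simp add: growth_def)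
      show "AE \<omega> in S. ln (pn (mat_prod \<omega> m *v u) / pn u) \<le> ln (quot_norm V W (mat_prod \<omega> m))"
      proof (rule AE_I2)
        fix \<omega> assume \<omega>: "\<omega> \<in> space S"
        have p: "pn u > 0" "pn (mat_prod \<omega> m *v u) > 0"
          using u mat_prod_mem_V[OF \<omega>] by (auto intro!: pn_pos simp del: zero_less_norm_iff)
        have "pn (mat_prod \<omega> m *v u) / pn u \<le> quot_norm V W (mat_prod \<omega> m)"
          using pn_le_quot_norm[OF W(1,2) _ \<omega>, of u m] u p by (simp add: pos_divide_le_eq)
        moreover have "0 < pn (mat_prod \<omega> m *v u) / pn u" using p by simp
        ultimately show "ln (pn (mat_prod \<omega> m *v u) / pn u) \<le> ln (quot_norm V W (mat_prod \<omega> m))"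
          by (subst ln_le_cancel_iff) linarith+
      qed
    qed
    then show ?thesis using m by simp
  qed
  obtain s0 where s0: "0 < s0" "s0 \<le> 1"
    "\<And>s. 0 < s \<Longrightarrow> s \<le> s0 \<Longrightarrow> \<exists>D\<ge>0. \<forall>n. \<forall>u\<in>W - V. moment V s n u \<le> ennreal (D * exp (s * real n * a) * pn u powr s)"
    by (rule moment_growth[OF X _ m(1) E b(2)]) auto
  have zero: "moment V s n u = 0" if "u \<in> V" for s n u
  proof -
    have "moment V s n u = (\<integral>\<^sup>+\<omega>. 0 \<partial>S)" unfolding moment_def
    proof (rule nn_integral_cong)
      fix \<omega> assume "\<omega> \<in> space S"
      then have "qproj V (mat_prod \<omega> n *v u) = 0" using mat_prod_mem_V that qproj_eq_0_iff[OF V] by blast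
      then show "ennreal (pn (mat_prod \<omega> n *v u) powr s) = 0" by simp
    qed
    then show ?thesis by simp
  qed
  show ?thesis
  proof (rule that[OF s0(1,2)])
    fix s :: real assume s: "0 < s" "s \<le> s0"
    obtain D where D: "D \<ge> 0" "\<forall>n. \<forall>u\<in>W - V. moment V s n u \<le> ennreal (D * exp (s * real n * a) * pn u powr s)"
      using s0(3)[OF s] by blast
    have "moment V s n u \<le> ennreal (D * exp (s * real n * a) * pn u powr s)" if "u \<in> W" for n u
      using D(2) that zero[of u s n] by (cases "u \<in> V") auto
    with D(1) show "\<exists>D\<ge>0. \<forall>n. \<forall>u\<in>W. moment V s n u \<le> ennreal (D * exp (s * real n * a) * pn u powr s)" by blast
  qed
qed

end

section \<open>The largest slow subspace\<close>

context random_product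
begin

text \<open>The last clause is the maximality of V, with growth measured in the whole space;
  \<open>slow_space_quotient\<close> transfers it to the quotient. A rate on V is recorded only for
  V \<noteq> {0}, since otherwise the norm on V vanishes and its logarithm carries no
  information.\<close>

definition slow_space :: "real \<Rightarrow> (real^'n) set \<Rightarrow> bool" where
  "slow_space L V \<longleftrightarrow> subspace V \<and> V \<noteq> UNIV \<and> (AE g in \<mu>. (*v) g ` V = V)
     \<and> (V \<noteq> {0} \<longrightarrow> (\<exists>\<gamma><L. growth (quot_norm {0} V) \<gamma>))
     \<and> (\<forall>u. u \<notin> V \<longrightarrow> (AE \<omega> in S. \<not> quotient_product.slow {0} L \<omega> u))"

lemma slow_space_exists:
  assumes n: "2 \<le> CARD('n)"
  obtains V where "slow_space (lyapunov 1 \<mu>) V"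
proof -
  let ?L = "lyapunov 1 \<mu>"
  interpret Z: quotient_product \<Sigma> \<mu> "{0}" by (rule quotient_product_0)
  obtain V where V: "subspace V" "AE \<omega> in S. \<forall>u\<in>V. Z.slow ?L \<omega> u"
    "\<And>u. u \<notin> V \<Longrightarrow> AE \<omega> in S. \<not> Z.slow ?L \<omega> u" "AE g in \<mu>. (*v) g ` V = V"
    using Z.slow_subspace_exists by blast
  have gr: "\<exists>\<gamma><?L. growth (quot_norm {0} V) \<gamma>" if ne: "V \<noteq> {0}"
  proof -
    have "{0} \<subseteq> V" using subspace_0[OF V(1)] by simp
    moreover have "AE g in \<mu>. (*v) g ` {0} = {0} \<and> (*v) g ` V = V" using V(4) by eventually_elim simp
    ultimately obtain \<gamma> where "growth (quot_norm {0} V) \<gamma>"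
      using quot_norm_growth[of "{0}" V] V(1) ne by auto
    moreover have "\<gamma> < ?L" using calculation V ne \<open>{0} \<subseteq> V\<close> by (intro Z.slow_rate[of V]) auto
    ultimately show ?thesis by blast
  qed
  have "V \<noteq> UNIV"
  proof
    assume U: "V = UNIV"
    then have "V \<noteq> {0}" using UNIV_not_singleton by metis
    then obtain \<gamma> where "\<gamma> < ?L" "growth (quot_norm {0} V) \<gamma>" using gr by blast
    then show False using growth_unique[OF _ onorm_growth[OF n]] U by auto
  qed
  then show ?thesis using that[of V] V gr unfolding slow_space_def by blast
qed

lemma slow_space_moment:
  assumes "slow_space L V"
  obtains a s0 where "a < L" "0 < s0" "s0 \<le> 1"
    "\<And>s. 0 < s \<Longrightarrow> s \<le> s0 \<Longrightarrow> \<exists>D\<ge>0. \<forall>n. \<forall>u\<in>V. moment {0} s n u \<le> ennreal (D * exp (s * real n * a) * norm u powr s)"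
proof (cases "V = {0}")
  case True
  show ?thesis
  proof (rule that[of "L - 1" 1])
    fix s :: real
    show "\<exists>D\<ge>0. \<forall>n. \<forall>u\<in>V. moment {0} s n u \<le> ennreal (D * exp (s * real n * (L - 1)) * norm u powr s)"
      by (intro exI[of _ 0]) (simp add: True moment_def)
  qed auto
next
  case False
  interpret Z: quotient_product \<Sigma> \<mu> "{0}" by (rule quotient_product_0)
  obtain \<gamma> where \<gamma>: "\<gamma> < L" "growth (quot_norm {0} V) \<gamma>" using assms False by (auto simp: slow_space_def)
  obtain a where a: "\<gamma> < a" "a < L" using \<gamma> dense by blast
  have V: "subspace V" "{0} \<subseteq> V" "AE g in \<mu>. (*v) g ` V = V"
    using assms subspace_0[of V] by (auto simp: slow_space_def)
  obtain s0 where s0: "0 < s0" "s0 \<le> 1"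
    "\<And>s. 0 < s \<Longrightarrow> s \<le> s0 \<Longrightarrow> \<exists>D\<ge>0. \<forall>n. \<forall>u\<in>V. moment {0} s n u \<le> ennreal (D * exp (s * real n * a) * norm (qproj {0} u) powr s)"
    using Z.growth_moment[OF V \<gamma>(2) a(1)] by blast
  then show ?thesis by (intro that[OF a(2) s0(1,2)]) simp
qed

end

text \<open>Projecting along \<open>V\<close> cannot hide fast growth. If the vectors slow modulo
  \<open>V\<close> formed a space W larger than \<open>V\<close>, the rates on \<open>V\<close> and
  on W / V would both be below L, and the block triangular estimate would make W slow in the whole
  space, against the maximality of \<open>V\<close>.\<close>

lemma (in quotient_product) slow_space_quotient:
  assumes sl: "slow_space L V" and u: "u \<notin> V"
  shows "AE \<omega> in S. \<not> slow L \<omega> u"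
proof -
  interpret Z: quotient_product \<Sigma> \<mu> "{0}" by (rule quotient_product_0)
  obtain W where W: "subspace W" "AE \<omega> in S. \<forall>u\<in>W. slow L \<omega> u"
    "\<And>u. u \<notin> W \<Longrightarrow> AE \<omega> in S. \<not> slow L \<omega> u" "AE g in \<mu>. (*v) g ` W = W"
    using slow_subspace_exists by blast
  have VW: "V \<subseteq> W"
  proof
    fix v assume v: "v \<in> V"
    show "v \<in> W"
    proof (rule ccontr)
      assume "v \<notin> W"
      from W(3)[OF this] AE_space have "AE \<omega> in S. False"
        by eventually_elim (use slow_V v in blast)
      then show False by simp
    qed
  qed
  have "W = V"
  proof (rule ccontr)
    assume ne: "W \<noteq> V"
    then obtain w where w: "w \<in> W" "w \<notin> V" using VW by blast
    have inv: "AE g in \<mu>. (*v) g ` V = V \<and> (*v) g ` W = W"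
      using W(4) AE_space by eventually_elim (use inv_V space_mu in auto)
    obtain \<gamma> where \<gamma>: "growth (quot_norm V W) \<gamma>"
      using quot_norm_growth[OF V W(1) VW _ inv] ne by blast
    have \<gamma>L: "\<gamma> < L" using slow_rate[OF W(1) VW _ W(2) \<gamma>] ne by blast
    obtain a s1 where a: "a < L" "0 < s1" "s1 \<le> 1"
      "\<And>s. 0 < s \<Longrightarrow> s \<le> s1 \<Longrightarrow> \<exists>D\<ge>0. \<forall>n. \<forall>u\<in>V. moment {0} s n u \<le> ennreal (D * exp (s * real n * a) * norm u powr s)"
      using slow_space_moment[OF sl] by blast
    \<comment> \<open>The start of a ladder of rates below L: b bounds moments both on
      \<open>V\<close> and on W / V, c adds the loss of \<open>moment_block_triangular\<close>, and
      c' the loss in passing from moments to almost sure growth.\<close>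
    obtain b where b: "max \<gamma> a < b" "b < L" using a \<gamma>L dense[of "max \<gamma> a" L] by auto
    obtain s2 where s2: "0 < s2" "s2 \<le> 1"
      "\<And>s. 0 < s \<Longrightarrow> s \<le> s2 \<Longrightarrow> \<exists>D\<ge>0. \<forall>n. \<forall>u\<in>W. moment V s n u \<le> ennreal (D * exp (s * real n * b) * pn u powr s)"
      using growth_moment[OF W(1) VW W(4) \<gamma>, of b] b by auto
    define s where "s = min s1 s2"
    have s: "0 < s" "s \<le> s1" "s \<le> s2" "s \<le> 1" using a s2 by (auto simp: s_def)
    obtain D1 where D1: "D1 \<ge> 0" "\<And>n u. u \<in> V \<Longrightarrow> moment {0} s n u \<le> ennreal (D1 * exp (s * real n * a) * norm u powr s)"
      using a(4)[OF s(1,2)] by blast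
    obtain D2 where D2: "D2 \<ge> 0" "\<And>n u. u \<in> W \<Longrightarrow> moment V s n u \<le> ennreal (D2 * exp (s * real n * b) * pn u powr s)"
      using s2(3)[OF s(1,3)] by blast
    define D where "D = max D1 D2"
    have D: "D \<ge> 0" "D1 \<le> D" "D2 \<le> D" using D1 by (auto simp: D_def)
    obtain c where c: "b < c" "c < L" using b dense by blast
    obtain E where E: "E \<ge> 0" "\<And>n u. u \<in> W \<Longrightarrow> moment {0} s n u \<le> ennreal (E * exp (s * real n * c) * norm u powr s)"
    proof (rule moment_block_triangular[OF s(1,4) D(1) _ W(1) VW _ _ c(1)])
      show "moment {0} s n x \<le> ennreal (D * exp (s * real n * b) * norm x powr s)" if "x \<in> V" for n x
        by (rule order_trans[OF D1(2)[OF that]])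
          (use s b D D1 in \<open>intro ennreal_leI mult_right_mono mult_mono; auto intro!: mult_left_mono\<close>)
      show "moment V s n u \<le> ennreal (D * exp (s * real n * b) * pn u powr s)" if "u \<in> W" for n u
        by (rule order_trans[OF D2(2)[OF that]])
          (use D in \<open>intro ennreal_leI mult_right_mono; auto\<close>)
      show "AE g in \<mu>. \<forall>u\<in>W. g *v u \<in> W" using W(4) by eventually_elim blast
    qed blast
    obtain c' where c': "c < c'" "c' < L" using c dense by blast
    have "AE \<omega> in S. \<exists>E. \<forall>n. norm (mat_prod \<omega> n *v w) \<le> E * exp (real n * c')"
    proof (rule moment_bound_imp_growth[OF s(1) _ c'(1)])
      show "moment {0} s n w \<le> ennreal (E * norm w powr s * exp (s * real n * c))" for n
        using E(2)[OF w(1), of n] by (simp add: mult_ac)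
    qed
    moreover have "AE \<omega> in S. \<not> Z.slow L \<omega> w" using sl w by (simp add: slow_space_def)
    ultimately have "AE \<omega> in S. False"
    proof eventually_elim
      case (elim \<omega>)
      then obtain E where "\<And>n. norm (mat_prod \<omega> n *v w) \<le> E * exp (real n * c')" by blast
      then have "Z.slow L \<omega> w" using c' by (intro Z.slowI[of c']) auto
      then show ?case using elim by simp
    qed
    then show False by simp
  qed
  then show ?thesis using W(3) u by simp
qed

subsection \<open>Uniform expansion in the quotient\<close>

lemma (in random_product) measurable_mat_prod_shift [measurable]:
  "(\<lambda>\<omega>. mat_prod (seq_shift i \<omega>) n) \<in> borel_measurable S"
  by (rule measurable_compose[OF measurable_seq_shift measurable_mat_prod])

context quotient_product
begin

definition lag :: "real \<Rightarrow> nat \<Rightarrow> real^'n \<Rightarrow> (nat \<Rightarrow> real^'n^'n) \<Rightarrow> bool" where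
  "lag c N u \<omega> \<longleftrightarrow> (\<forall>j\<in>{1..N}. pn (mat_prod \<omega> j *v u) \<le> pn u * exp (real j * c))"

lemma measurable_lag [measurable]: "Measurable.pred S (lag c N u)"
  unfolding lag_def by measurable

lemma lag_scale:
  assumes "\<omega> \<in> space S" "u \<notin> V"
  shows "lag c N ((1 / pn u) *\<^sub>R qproj V u) \<omega> \<longleftrightarrow> lag c N u \<omega>"
proof -
  have p: "pn u > 0" using assms(2) by (rule pn_pos)
  have "pn (mat_prod \<omega> j *v ((1 / pn u) *\<^sub>R qproj V u)) = pn (mat_prod \<omega> j *v u) / pn u" for j
    using qproj_mat_prod[OF assms(1), of j u] by (simp add: matrix_vector_mult_scaleR qproj_scale)
  moreover have "pn ((1 / pn u) *\<^sub>R qproj V u) = 1" using p by (simp add: qproj_scale qproj_idem[OF V])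
  ultimately show ?thesis using p by (simp add: lag_def pos_divide_le_eq mult.commute)
qed

text \<open>For a fixed u the events shrink to a null event, because u is almost surely not slow.
  The event depends only on the direction of u in the quotient; the directions form a compact set,
  and lowering the rate from L - \<epsilon> to L - 2 \<epsilon> makes the bound stable in a
  neighbourhood of each.\<close>

lemma lag_uniform:
  assumes fast: "\<And>u. u \<notin> V \<Longrightarrow> AE \<omega> in S. \<not> slow L \<omega> u" and \<epsilon>: "\<epsilon> > 0" and \<eta>: "\<eta> > 0"
  obtains N where "\<And>u. u \<notin> V \<Longrightarrow> emeasure S {\<omega>\<in>space S. lag (L - 2 * \<epsilon>) N u \<omega>} \<le> ennreal \<eta>"
proof -
  have pointwise: "\<exists>N. emeasure S {\<omega>\<in>space S. lag (L - \<epsilon>) N u \<omega>} < ennreal \<eta>" if u: "u \<notin> V" for u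
  proof -
    define B where "B N = {\<omega>\<in>space S. lag (L - \<epsilon>) N u \<omega>}" for N
    have [measurable]: "B N \<in> sets S" for N unfolding B_def by measurable
    have "(\<lambda>N. emeasure S (B N)) \<longlonglongrightarrow> emeasure S (\<Inter>N. B N)"
      by (rule Lim_emeasure_decseq) (auto simp: P.emeasure_eq_measure B_def decseq_def lag_def)
    moreover have "emeasure S (\<Inter>N. B N) = 0"
    proof -
      have "AE \<omega> in S. \<omega> \<notin> (\<Inter>N. B N)" using fast[OF u]
      proof eventually_elim
        case (elim \<omega>)
        obtain k :: nat where k: "1 / real (Suc k) < \<epsilon>" using \<epsilon> nat_approx_posE by blast
        obtain D :: nat where D: "pn u \<le> real D" using real_arch_simple by blast
        obtain m where m: "pn (mat_prod \<omega> m *v u) > real D * exp (real m * (L - 1 / real (Suc k)))"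
          using elim unfolding slow_def by (meson not_le)
        have "m \<noteq> 0"
        proof
          assume "m = 0" then show False using m D by simp
        qed
        have "pn u * exp (real m * (L - \<epsilon>)) \<le> real D * exp (real m * (L - 1 / real (Suc k)))"
          using D k by (intro mult_mono) (auto intro!: mult_left_mono)
        then have "\<not> lag (L - \<epsilon>) m u \<omega>" using m \<open>m \<noteq> 0\<close> by (auto simp: lag_def intro!: bexI[of _ m])
        then show ?case by (auto simp: B_def)
      qed
      then have "(\<Inter>N. B N) \<in> null_sets S" by (subst AE_iff_null_sets) auto
      then show ?thesis by (rule null_setsD1)
    qed
    ultimately have "(\<lambda>N. emeasure S (B N)) \<longlonglongrightarrow> 0" by simp
    then have "\<forall>\<^sub>F N in sequentially. emeasure S (B N) < ennreal \<eta>" using \<eta> by (intro order_tendstoD) auto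
    then show ?thesis by (auto simp: eventually_sequentially B_def)
  qed
  define Z where "Z = {u. norm u = 1 \<and> qproj V u = u}"
  have ZV: "u \<notin> V" if "u \<in> Z" for u using that qproj_eq_0_iff[OF V, of u] by (auto simp: Z_def)
  have "Z = sphere 0 1 \<inter> {u. qproj V u = u}" by (auto simp: Z_def)
  moreover have "closed {u. qproj V u = u}" by (intro closed_Collect_eq continuous_intros)
  ultimately have cZ: "compact Z" by (simp add: compact_Int_closed)
  have local: "\<exists>N \<theta>. \<theta> > 0 \<and> (\<forall>u'\<in>Z. dist u u' < \<theta> \<longrightarrow> emeasure S {\<omega>\<in>space S. lag (L - 2 * \<epsilon>) N u' \<omega>} \<le> ennreal \<eta>)"
    if u: "u \<in> Z" for u
  proof -
    obtain N where N: "emeasure S {\<omega>\<in>space S. lag (L - \<epsilon>) N u \<omega>} < ennreal \<eta>"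
      using pointwise[OF ZV[OF u]] by blast
    \<comment> \<open>The room at time j between the two rates. Its minimum over 1 \<le> j \<le> N,
      divided by the largest possible expansion \<open>KK ^ N\<close>, is the admissible
      perturbation of u.\<close>
    define d where "d j = exp (real j * (L - \<epsilon>)) - exp (real j * (L - 2 * \<epsilon>))" for j :: nat
    define c where "c = Min (insert 1 (d ` {1..N}))"
    have c: "c > 0" using \<epsilon> by (auto simp: c_def d_def)
    have cd: "c \<le> d j" if "j \<in> {1..N}" for j unfolding c_def using that by (intro Min_le) auto
    define \<theta> where "\<theta> = c / KK ^ N"
    have \<theta>: "\<theta> > 0" using c KK_pos by (simp add: \<theta>_def)
    have "emeasure S {\<omega>\<in>space S. lag (L - 2 * \<epsilon>) N u' \<omega>} \<le> ennreal \<eta>" if u': "u' \<in> Z" "dist u u' < \<theta>" for u'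
    proof -
      have "lag (L - \<epsilon>) N u \<omega>" if \<omega>: "\<omega> \<in> space S" and l: "lag (L - 2 * \<epsilon>) N u' \<omega>" for \<omega>
        unfolding lag_def
      proof
        fix j assume j: "j \<in> {1..N}"
        have "mat_prod \<omega> j *v u = mat_prod \<omega> j *v u' + mat_prod \<omega> j *v (u - u')"
          by (simp add: matrix_vector_mult_diff_distrib)
        then have "pn (mat_prod \<omega> j *v u) \<le> pn (mat_prod \<omega> j *v u') + pn (mat_prod \<omega> j *v (u - u'))"
          by (simp add: qproj_add norm_triangle_ineq)
        also have "pn (mat_prod \<omega> j *v u') \<le> exp (real j * (L - 2 * \<epsilon>))"
          using l j u' by (auto simp: lag_def Z_def)
        also have "pn (mat_prod \<omega> j *v (u - u')) \<le> KK ^ j * norm (u - u')"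
          using norm_qproj_le[OF V] norm_mat_prod(1)[OF \<omega>] order_trans by blast
        also have "\<dots> \<le> KK ^ N * \<theta>"
          using u' j KK(1) by (intro mult_mono power_increasing) (auto simp: dist_norm)
        also have "\<dots> = c" using KK_pos by (simp add: \<theta>_def)
        also have "c \<le> d j" by (rule cd[OF j])
        finally show "pn (mat_prod \<omega> j *v u) \<le> pn u * exp (real j * (L - \<epsilon>))"
          using u by (simp add: d_def Z_def)
      qed
      then have "emeasure S {\<omega>\<in>space S. lag (L - 2 * \<epsilon>) N u' \<omega>} \<le> emeasure S {\<omega>\<in>space S. lag (L - \<epsilon>) N u \<omega>}"
        by (intro emeasure_mono) auto
      then show ?thesis using N by simp
    qed
    with \<theta> show ?thesis by blast
  qed
  then have "\<forall>u\<in>Z. \<exists>p. snd p > 0 \<and> (\<forall>u'\<in>Z. dist u u' < snd p \<longrightarrow>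
      emeasure S {\<omega>\<in>space S. lag (L - 2 * \<epsilon>) (fst p) u' \<omega>} \<le> ennreal \<eta>)"
    by simp
  from bchoice[OF this] obtain p where p: "\<forall>u\<in>Z. snd (p u) > 0 \<and> (\<forall>u'\<in>Z. dist u u' < snd (p u) \<longrightarrow>
      emeasure S {\<omega>\<in>space S. lag (L - 2 * \<epsilon>) (fst (p u)) u' \<omega>} \<le> ennreal \<eta>)" ..
  define N where "N u = fst (p u)" for u
  define \<theta> where "\<theta> u = snd (p u)" for u
  have N\<theta>: "\<And>u. u \<in> Z \<Longrightarrow> \<theta> u > 0"
    "\<And>u u'. u \<in> Z \<Longrightarrow> u' \<in> Z \<Longrightarrow> dist u u' < \<theta> u \<Longrightarrow> emeasure S {\<omega>\<in>space S. lag (L - 2 * \<epsilon>) (N u) u' \<omega>} \<le> ennreal \<eta>"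
    using p by (simp_all add: N_def \<theta>_def)
  have "\<exists>C'\<subseteq>Z. finite C' \<and> Z \<subseteq> (\<Union>c\<in>C'. ball c (\<theta> c))"
    by (rule compactE_image[OF cZ, of Z "\<lambda>c. ball c (\<theta> c)"]) (use N\<theta>(1) in auto)
  then obtain C' where C': "C' \<subseteq> Z" "finite C'" "Z \<subseteq> (\<Union>c\<in>C'. ball c (\<theta> c))" by blast
  define M where "M = Max (insert 0 (N ` C'))"
  show ?thesis
  proof (rule that[of M])
    fix u assume u: "u \<notin> V"
    define y where "y = (1 / pn u) *\<^sub>R qproj V u"
    have p: "pn u > 0" by (rule pn_pos[OF u])
    have y: "y \<in> Z" unfolding Z_def y_def using p by (simp add: qproj_scale qproj_idem[OF V])
    then obtain c where c: "c \<in> C'" "dist c y < \<theta> c" using C' by auto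
    have NM: "N c \<le> M" unfolding M_def using C' c by simp
    have "{\<omega>\<in>space S. lag (L - 2 * \<epsilon>) M u \<omega>} \<subseteq> {\<omega>\<in>space S. lag (L - 2 * \<epsilon>) (N c) y \<omega>}"
    proof clarify
      fix \<omega> assume "\<omega> \<in> space S" "lag (L - 2 * \<epsilon>) M u \<omega>"
      then show "lag (L - 2 * \<epsilon>) (N c) y \<omega>" unfolding y_def using NM
        by (subst lag_scale[OF _ u]) (auto simp: lag_def)
    qed
    then have "emeasure S {\<omega>\<in>space S. lag (L - 2 * \<epsilon>) M u \<omega>} \<le> emeasure S {\<omega>\<in>space S. lag (L - 2 * \<epsilon>) (N c) y \<omega>}"
      by (intro emeasure_mono) auto
    also have "\<dots> \<le> ennreal \<eta>" using c C' y by (intro N\<theta>) auto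
    finally show "emeasure S {\<omega>\<in>space S. lag (L - 2 * \<epsilon>) M u \<omega>} \<le> ennreal \<eta>" .
  qed
qed

text \<open>The orbit bound is applied to the skew product that moves the vector and shifts the
  sequence, with f the negative logarithmic growth. A time is bad only if the current direction
  lags, and by \<open>lag_uniform\<close> this has small probability whatever the direction. Unlike
  an almost sure limit, the result is uniform in u.\<close>

theorem uniform_expansion:
  assumes fast: "\<And>u. u \<notin> V \<Longrightarrow> AE \<omega> in S. \<not> slow L \<omega> u" and \<epsilon>: "\<epsilon> > 0"
  obtains C where "\<And>n u. u \<notin> V \<Longrightarrow> real n * (L - \<epsilon>) - C \<le> P.expectation (\<lambda>\<omega>. ln (pn (mat_prod \<omega> n *v u) / pn u))"
proof -
  \<comment> \<open>Minus the target rate. The loss \<epsilon> is split into 2 \<epsilon> / 3 from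
    \<open>lag_uniform\<close> and (C - c) * \<eta> = \<epsilon> / 3 from the bad times.\<close>
  define c where "c = - (L - 2 * (\<epsilon> / 3))"
  define C where "C = ln KK + \<bar>c\<bar> + 1"
  have lnK: "ln KK \<ge> 0" using KK(1) by simp
  have Cc: "C - c > 0" using lnK by (simp add: C_def)
  define \<eta> where "\<eta> = \<epsilon> / 3 / (C - c)"
  have \<eta>: "\<eta> > 0" using \<epsilon> Cc by (simp add: \<eta>_def)
  have \<epsilon>3: "\<epsilon> / 3 > 0" using \<epsilon> by simp
  obtain N where N: "\<And>u. u \<notin> V \<Longrightarrow> emeasure S {\<omega>\<in>space S. lag (L - 2 * (\<epsilon> / 3)) N u \<omega>} \<le> ennreal \<eta>"
    using lag_uniform[OF fast \<epsilon>3 \<eta>] by blast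
  define T where "T s = (snd s 0 *v fst s, seq_shift 1 (snd s))" for s :: "(real^'n) \<times> (nat \<Rightarrow> real^'n^'n)"
  define f where "f n s = - ln (pn (mat_prod (snd s) n *v fst s) / pn (fst s))" for n s
  define Y where "Y = (UNIV - V) \<times> space S"
  have Tn: "(T ^^ n) (u, \<omega>) = (mat_prod \<omega> n *v u, seq_shift n \<omega>)" for n u \<omega>
    by (induction n) (simp_all add: T_def matrix_vector_mul_assoc seq_shift_add, simp add: seq_shift_def)
  have TY: "T s \<in> Y" if "s \<in> Y" for s
    using that mv_mem_V seq_shift_space by (auto simp: T_def Y_def space_S)
  have pos: "pn (mat_prod \<omega> n *v u) > 0" if "u \<notin> V" "\<omega> \<in> space S" for u \<omega> n
    using that mat_prod_mem_V by (intro pn_pos) simp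
  have fsub: "f (n + m) s \<le> f n s + f m ((T ^^ n) s)" if sY: "s \<in> Y" for n m s
  proof -
    obtain u \<omega> where s: "s = (u, \<omega>)" "u \<notin> V" "\<omega> \<in> space S" using sY by (auto simp: Y_def)
    have p: "pn u > 0" "pn (mat_prod \<omega> n *v u) > 0" "pn (mat_prod \<omega> (n + m) *v u) > 0"
      using pos s pn_pos[OF s(2)] by blast+
    have "mat_prod (seq_shift n \<omega>) m *v (mat_prod \<omega> n *v u) = mat_prod \<omega> (n + m) *v u"
      by (simp add: mat_prod_add matrix_vector_mul_assoc)
    then show ?thesis unfolding s(1) f_def Tn using p by (simp add: ln_div)
  qed
  have fb: "f n s \<le> C * real n" if s: "s \<in> Y" for n s
  proof -
    have "f n s \<le> ln KK * real n"
      using ln_pn_bound[of "snd s" "fst s" n] s unfolding f_def by (auto simp: Y_def abs_le_iff)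
    also have "\<dots> \<le> C * real n" by (intro mult_right_mono) (auto simp: C_def)
    finally show ?thesis .
  qed
  have bad: "\<not> (\<exists>j\<in>{1..N}. f j ((T ^^ i) (u, \<omega>)) \<le> real j * c) \<Longrightarrow> lag (L - 2 * (\<epsilon> / 3)) N (mat_prod \<omega> i *v u) (seq_shift i \<omega>)"
    if u: "u \<notin> V" and \<omega>: "\<omega> \<in> space S" for i u \<omega>
    unfolding lag_def
  proof
    assume b: "\<not> (\<exists>j\<in>{1..N}. f j ((T ^^ i) (u, \<omega>)) \<le> real j * c)"
    fix j assume j: "j \<in> {1..N}"
    let ?x = "mat_prod \<omega> i *v u" and ?y = "mat_prod (seq_shift i \<omega>) j *v (mat_prod \<omega> i *v u)"
    have xV: "?x \<notin> V" using mat_prod_mem_V[OF \<omega>] u by simp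
    have p: "pn ?x > 0" "pn ?y > 0" using pos[OF u \<omega>] pos[OF xV seq_shift_space[OF \<omega>]] by blast+
    have "\<not> f j ((T ^^ i) (u, \<omega>)) \<le> real j * c" using b j by blast
    then have "ln (pn ?y / pn ?x) < real j * (L - 2 * (\<epsilon> / 3))" unfolding f_def Tn c_def mult_minus_right by simp
    then have "pn ?y / pn ?x < exp (real j * (L - 2 * (\<epsilon> / 3)))"
      using p by (metis divide_pos_pos exp_less_cancel_iff exp_ln)
    then show "pn ?y \<le> pn ?x * exp (real j * (L - 2 * (\<epsilon> / 3)))" using p by (simp add: pos_divide_less_eq mult.commute)
  qed
  show ?thesis
  proof (rule that[of "real N * (C - c)"])
    fix n u assume u: "u \<notin> V"
    define B where "B i = {\<omega>\<in>space S. lag (L - 2 * (\<epsilon> / 3)) N (mat_prod \<omega> i *v u) (seq_shift i \<omega>)}" for i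
    have B[measurable]: "B i \<in> sets S" for i
    proof -
      have m1: "(\<lambda>\<omega>. pn (mat_prod \<omega> i *v u)) \<in> borel_measurable S" by measurable
      have m2: "(\<lambda>\<omega>. pn (mat_prod (seq_shift i \<omega>) j *v (mat_prod \<omega> i *v u))) \<in> borel_measurable S" for j
      proof -
        have "(\<lambda>\<omega>. mat_prod (seq_shift i \<omega>) j *v (mat_prod \<omega> i *v u)) \<in> borel_measurable S"
          by (intro borel_measurable_mv measurable_mat_prod_shift measurable_mat_prod borel_measurable_const)
        from measurable_compose[OF measurable_compose[OF this measurable_qproj] borel_measurable_norm] show ?thesis .
      qed
      show ?thesis unfolding B_def lag_def
        by (intro sets.sets_Collect_finite_All borel_measurable_le m2 borel_measurable_times m1 borel_measurable_const) simp
    qed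
    \<comment> \<open>The Markov property: given the first i matrices the remaining sequence is
      fresh, and the uniform bound applies to the direction reached at time i.\<close>
    have PB: "measure S (B i) \<le> \<eta>" for i
    proof -
      have "emeasure S (B i) = (\<integral>\<^sup>+\<omega>. emeasure S {\<omega>'\<in>space S. comb_seq i \<omega> \<omega>' \<in> B i} \<partial>S)"
        by (rule emeasure_comb_seq) simp
      also have "\<dots> \<le> (\<integral>\<^sup>+\<omega>. ennreal \<eta> \<partial>S)"
      proof (rule nn_integral_mono)
        fix \<omega> assume \<omega>: "\<omega> \<in> space S"
        have "comb_seq i \<omega> \<omega>' \<in> space S" if "\<omega>' \<in> space S" for \<omega>'
          using that \<omega> by (auto simp: space_PiM PiE_iff split: split_comb_seq)
        then have "{\<omega>'\<in>space S. comb_seq i \<omega> \<omega>' \<in> B i} = {\<omega>'\<in>space S. lag (L - 2 * (\<epsilon> / 3)) N (mat_prod \<omega> i *v u) \<omega>'}"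
          using mat_prod_comb_seq[of i \<omega> _ 0] by (auto simp: B_def)
        then show "emeasure S {\<omega>'\<in>space S. comb_seq i \<omega> \<omega>' \<in> B i} \<le> ennreal \<eta>"
          using N[of "mat_prod \<omega> i *v u"] mat_prod_mem_V[OF \<omega>] u by simp
      qed
      also have "\<dots> = ennreal \<eta>" by (simp add: P.emeasure_space_1)
      finally show ?thesis using \<eta> by (simp add: P.emeasure_eq_measure)
    qed
    define g where "g \<omega> = (\<Sum>i<n. indicator (B i) \<omega> :: real)" for \<omega>
    have gi: "integrable S g" unfolding g_def
      by (intro Bochner_Integration.integrable_sum) (auto simp: integrable_indicator_iff P.emeasure_eq_measure)
    have "P.expectation g = (\<Sum>i<n. measure S (B i))"
      unfolding g_def by (subst Bochner_Integration.integral_sum)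
        (auto simp: integrable_indicator_iff P.emeasure_eq_measure)
    also have "\<dots> \<le> (\<Sum>i<n. \<eta>)" by (intro sum_mono PB)
    finally have Eg: "P.expectation g \<le> real n * \<eta>" by simp
    let ?F = "\<lambda>\<omega>. ln (pn (mat_prod \<omega> n *v u) / pn u)"
    have intF: "integrable S ?F"
    proof (rule P.integrable_const_bound[of _ "ln KK * real n"])
      show "AE \<omega> in S. norm (?F \<omega>) \<le> ln KK * real n"
        using ln_pn_bound[of _ u n] u by (intro AE_I2) (simp del: ln_div)
    qed simp
    have "P.expectation (\<lambda>\<omega>. - ?F \<omega>) \<le> P.expectation (\<lambda>\<omega>. c * real n + (C - c) * g \<omega> + real N * (C - c))"
    proof (rule integral_mono)
      fix \<omega> assume \<omega>: "\<omega> \<in> space S"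
      have "{i. i < n \<and> \<not> (\<exists>j\<in>{1..N}. f j ((T ^^ i) (u, \<omega>)) \<le> real j * c)} \<subseteq> {i\<in>{..<n}. \<omega> \<in> B i}"
        using bad[OF u \<omega>] \<omega> by (auto simp: B_def)
      then have "card {i. i < n \<and> \<not> (\<exists>j\<in>{1..N}. f j ((T ^^ i) (u, \<omega>)) \<le> real j * c)} \<le> card {i\<in>{..<n}. \<omega> \<in> B i}"
        by (intro card_mono) auto
      also have "real (card {i\<in>{..<n}. \<omega> \<in> B i}) = g \<omega>"
        by (simp add: g_def indicator_def sum.If_cases Int_def)
      finally have "(C - c) * real (card {i. i < n \<and> \<not> (\<exists>j\<in>{1..N}. f j ((T ^^ i) (u, \<omega>)) \<le> real j * c)}) \<le> (C - c) * g \<omega>"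
        using Cc by (intro mult_left_mono) auto
      moreover have "f n (u, \<omega>) \<le> c * real n + (C - c) * real (card {i. i < n \<and> \<not> (\<exists>j\<in>{1..N}. f j ((T ^^ i) (u, \<omega>)) \<le> real j * c)}) + real N * (C - c)"
        using u \<omega> Cc by (intro subadditive_orbit_bound[of Y T f C c, OF TY fsub fb]) (auto simp: Y_def)
      ultimately show "- ?F \<omega> \<le> c * real n + (C - c) * g \<omega> + real N * (C - c)"
        by (simp add: f_def)
    qed (use intF gi in auto)
    also have "\<dots> = c * real n + (C - c) * P.expectation g + real N * (C - c)"
      using gi by (simp add: P.prob_space)
    also have "\<dots> \<le> c * real n + (C - c) * (real n * \<eta>) + real N * (C - c)"
      using Eg Cc by (intro order_refl add_mono mult_left_mono) auto
    also have "(C - c) * (real n * \<eta>) = real n * ((C - c) * \<eta>)" by simp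
    also have "(C - c) * \<eta> = \<epsilon> / 3"
    proof -
      have "x * (e / x) = e" if "x > 0" for x e :: real using that by simp
      from this[OF Cc] show ?thesis unfolding \<eta>_def .
    qed
    finally have "- P.expectation ?F \<le> c * real n + real n * (\<epsilon> / 3) + real N * (C - c)" by simp
    then show "real n * (L - \<epsilon>) - real N * (C - c) \<le> P.expectation ?F"
      by (simp add: c_def algebra_simps)
  qed
qed

end

subsection \<open>Adapted functions and contraction of directions\<close>

context random_product
begin

text \<open>The witness is the weighted sum of the averages of \<open>h\<close> over the first \<open>m\<close> steps.\<close>

lemma adapted_function:
  fixes act :: "real^'n^'n \<Rightarrow> 'x::metric_space \<Rightarrow> 'x" and h :: "'x \<Rightarrow> real"
  assumes act1: "\<And>x. act (mat 1) x = x" and actm: "\<And>A B x. act (A ** B) x = act A (act B x)"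
    and X: "\<And>g x. g \<in> \<Sigma> \<Longrightarrow> x \<in> X \<Longrightarrow> act g x \<in> X"
    and cont: "\<And>g. g \<in> \<Sigma> \<Longrightarrow> continuous_on X (act g)"
    and meas: "\<And>x n. x \<in> X \<Longrightarrow> (\<lambda>\<omega>. h (act (mat_prod \<omega> n) x)) \<in> borel_measurable S"
    and h: "continuous_on X h" "\<And>x. x \<in> X \<Longrightarrow> 0 \<le> h x"
    and K: "\<And>g x. g \<in> \<Sigma> \<Longrightarrow> x \<in> X \<Longrightarrow> h (act g x) \<le> K * h x" "K \<ge> 1"
    and m: "m \<ge> 1" and \<kappa>: "\<kappa> > 0"
    and E: "\<And>x. x \<in> X \<Longrightarrow> P.expectation (\<lambda>\<omega>. h (act (mat_prod \<omega> m) x)) \<le> \<kappa> ^ m * h x"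
  obtains \<eta> C where "continuous_on X \<eta>" "C \<ge> 1" "\<And>x. x \<in> X \<Longrightarrow> h x \<le> \<eta> x" "\<And>x. x \<in> X \<Longrightarrow> \<eta> x \<le> C * h x"
    "\<And>x. x \<in> X \<Longrightarrow> (\<integral>g. \<eta> (act g x) \<partial>\<mu>) \<le> \<kappa> * \<eta> x"
proof -
  define H where "H j x = P.expectation (\<lambda>\<omega>. h (act (mat_prod \<omega> j) x))" for j x
  have prodX: "act (mat_prod \<omega> j) x \<in> X" if "\<omega> \<in> space S" "x \<in> X" for \<omega> j x
    using that X by (induction j) (auto simp: act1 actm space_S)
  have contS: "continuous_on X (act (mat_prod \<omega> j))" if \<omega>: "\<omega> \<in> space S" for \<omega> j
  proof (induction j)
    case 0
    then show ?case by (simp add: act1)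
  next
    case (Suc j)
    have "continuous_on X (\<lambda>x. act (\<omega> j) (act (mat_prod \<omega> j) x))"
      using prodX[OF \<omega>] \<omega> by (intro continuous_on_compose2[OF cont Suc]) (auto simp: space_S)
    then show ?case by (simp add: actm)
  qed
  have hb: "h (act (mat_prod \<omega> j) x) \<le> K ^ j * h x" if "\<omega> \<in> space S" "x \<in> X" for \<omega> j x
  proof (induction j)
    case (Suc j)
    have "h (act (\<omega> j) (act (mat_prod \<omega> j) x)) \<le> K * h (act (mat_prod \<omega> j) x)"
      using that prodX by (intro K) (auto simp: space_S)
    also have "\<dots> \<le> K * (K ^ j * h x)" using Suc K by (intro mult_left_mono) auto
    finally show ?case by (simp add: actm mult.assoc)
  qed (simp add: act1)
  have int: "integrable S (\<lambda>\<omega>. h (act (mat_prod \<omega> j) x))" if "x \<in> X" for j x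
    using that hb h(2) prodX
    by (intro P.integrable_const_bound[of _ "K ^ j * h x"] AE_I2 meas) auto
  have H0: "H 0 x = h x" for x by (simp add: H_def act1 P.prob_space)
  have Hnn: "0 \<le> H j x" if "x \<in> X" for j x
    unfolding H_def using h(2) prodX that by (intro integral_nonneg_AE AE_I2) auto
  have Hle: "H j x \<le> K ^ j * h x" if "x \<in> X" for j x
  proof -
    have "H j x \<le> P.expectation (\<lambda>_. K ^ j * h x)"
      unfolding H_def using that hb by (intro integral_mono int) auto
    then show ?thesis by (simp add: P.prob_space)
  qed
  have HS: "(\<integral>g. H j (act g x) \<partial>\<mu>) = H (Suc j) x" if "x \<in> X" for j x
    unfolding H_def by (subst integral_case_nat[OF int[OF that]])
      (simp add: mat_prod_case_nat actm del: mat_prod.simps)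
  have Hcont: "continuous_on X (H j)" for j
    unfolding continuous_on_sequentially
  proof (intro allI ballI impI; elim conjE)
    fix x a assume a: "a \<in> X" and xX: "\<forall>n. x n \<in> X" and lim: "x \<longlonglongrightarrow> a"
    have hx: "(\<lambda>n. h (x n)) \<longlonglongrightarrow> h a"
      using h(1) a xX lim unfolding continuous_on_sequentially comp_def by blast
    then obtain B where B: "\<And>n. \<bar>h (x n)\<bar> \<le> B"
      using convergent_imp_Bseq[of "\<lambda>n. h (x n)"] by (auto simp: convergent_def Bseq_def)
    have "(\<lambda>n. H j (x n)) \<longlonglongrightarrow> H j a"
      unfolding H_def
    proof (rule integral_dominated_convergence[where w = "\<lambda>_. K ^ j * B"])
      show "AE \<omega> in S. (\<lambda>n. h (act (mat_prod \<omega> j) (x n))) \<longlonglongrightarrow> h (act (mat_prod \<omega> j) a)"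
      proof (rule AE_I2)
        fix \<omega> assume \<omega>: "\<omega> \<in> space S"
        have "continuous_on X (\<lambda>x. h (act (mat_prod \<omega> j) x))"
          using prodX[OF \<omega>] by (intro continuous_on_compose2[OF h(1) contS[OF \<omega>]]) auto
        then show "(\<lambda>n. h (act (mat_prod \<omega> j) (x n))) \<longlonglongrightarrow> h (act (mat_prod \<omega> j) a)"
          using a xX lim unfolding continuous_on_sequentially comp_def by blast
      qed
      show "AE \<omega> in S. norm (h (act (mat_prod \<omega> j) (x n))) \<le> K ^ j * B" for n
      proof (rule AE_I2)
        fix \<omega> assume \<omega>: "\<omega> \<in> space S"
        have "h (act (mat_prod \<omega> j) (x n)) \<le> K ^ j * h (x n)" using hb \<omega> xX by blast
        also have "\<dots> \<le> K ^ j * B" using B[of n] K by (intro mult_left_mono) auto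
        finally show "norm (h (act (mat_prod \<omega> j) (x n))) \<le> K ^ j * B"
          using h(2) prodX \<omega> xX by simp
      qed
    qed (use meas a xX in auto)
    then show "(H j \<circ> x) \<longlonglongrightarrow> H j a" by (simp add: comp_def)
  qed
  define \<eta> where "\<eta> x = (\<Sum>j<m. H j x / \<kappa> ^ j)" for x
  show ?thesis
  proof (rule that)
    show "continuous_on X \<eta>" unfolding \<eta>_def
      using \<kappa> by (intro continuous_intros Hcont) auto
    show "h x \<le> \<eta> x" if x: "x \<in> X" for x
    proof -
      have "H 0 x / \<kappa> ^ 0 \<le> \<eta> x"
        unfolding \<eta>_def using m Hnn[OF x] \<kappa> by (intro member_le_sum) auto
      then show ?thesis by (simp add: H0)
    qed
    define C where "C = (\<Sum>j<m. K ^ j / \<kappa> ^ j) + 1"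
    show "C \<ge> 1" unfolding C_def using K \<kappa> by (simp add: sum_nonneg)
    show "\<eta> x \<le> C * h x" if x: "x \<in> X" for x
    proof -
      have "\<eta> x \<le> (\<Sum>j<m. K ^ j / \<kappa> ^ j * h x)"
        unfolding \<eta>_def using Hle[OF x] \<kappa> by (intro sum_mono) (simp add: divide_right_mono)
      also have "\<dots> = (\<Sum>j<m. K ^ j / \<kappa> ^ j) * h x" by (simp add: sum_distrib_right)
      also have "\<dots> \<le> C * h x" unfolding C_def using h(2)[OF x] by (intro mult_right_mono) auto
      finally show ?thesis .
    qed
    show "(\<integral>g. \<eta> (act g x) \<partial>\<mu>) \<le> \<kappa> * \<eta> x" if x: "x \<in> X" for x
    proof -
      have iH: "integrable \<mu> (\<lambda>g. H j (act g x))" for j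
      proof -
        have "integrable (\<mu> \<Otimes>\<^sub>M S) (\<lambda>z. h (act (mat_prod (case_nat (fst z) (snd z)) (Suc j)) x))"
          using int[OF x, of "Suc j"]
          by (subst (asm) PiM_iter[symmetric], subst (asm) integrable_distr_eq)
            (use meas[OF x, of "Suc j"] in \<open>simp_all add: case_prod_beta del: mat_prod.simps\<close>)
        then have "integrable \<mu> (\<lambda>g. \<integral>\<omega>. h (act (mat_prod (case_nat g \<omega>) (Suc j)) x) \<partial>S)"
        proof -
          interpret pair_sigma_finite \<mu> S ..
          assume "integrable (\<mu> \<Otimes>\<^sub>M S) (\<lambda>z. h (act (mat_prod (case_nat (fst z) (snd z)) (Suc j)) x))"
          from integrable_fst'[OF this] show ?thesis by (simp del: mat_prod.simps)
        qed
        then show ?thesis by (simp add: H_def mat_prod_case_nat actm del: mat_prod.simps)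
      qed
      have "(\<integral>g. \<eta> (act g x) \<partial>\<mu>) = (\<Sum>j<m. H (Suc j) x / \<kappa> ^ j)"
        unfolding \<eta>_def using iH by (simp add: HS[OF x])
      also have "\<dots> = \<kappa> * (\<Sum>j<m. H (Suc j) x / \<kappa> ^ Suc j)"
        using \<kappa> by (simp add: sum_distrib_left)
      \<comment> \<open>Averaging over one step shifts the index. The term that enters, H m /
        \<kappa>^m, is at most the term h that leaves, by the assumption at time m; so the shifted
        sum does not exceed \<eta>.\<close>
      also have "(\<Sum>j<m. H (Suc j) x / \<kappa> ^ Suc j) = \<eta> x + H m x / \<kappa> ^ m - H 0 x / \<kappa> ^ 0"
      proof -
        have "H 0 x / \<kappa> ^ 0 + (\<Sum>j<m. H (Suc j) x / \<kappa> ^ Suc j) = (\<Sum>j<Suc m. H j x / \<kappa> ^ j)"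
          by (subst sum.lessThan_Suc_shift) simp
        also have "\<dots> = \<eta> x + H m x / \<kappa> ^ m" by (simp add: \<eta>_def)
        finally show ?thesis by simp
      qed
      also have "\<dots> \<le> \<eta> x"
        using E[OF x] \<kappa> by (simp add: H0 H_def[of m] pos_divide_le_eq mult.commute)
      finally show ?thesis using \<kappa> by simp
    qed
  qed
qed

text \<open>A moment bound with a constant, valid for all n, is not visibly stable under
  perturbation of the measure. Replacing the norm by an equivalent function trades it for a one-step
  inequality without constant, which is stable in total variation.\<close>

lemma slow_space_adapted:
  assumes sl: "slow_space L V" and inv: "\<And>g. g \<in> \<Sigma> \<Longrightarrow> (*v) g ` V = V"
  obtains a s0 where "a < L" "0 < s0" "s0 \<le> 1"
    "\<And>s. 0 < s \<Longrightarrow> s \<le> s0 \<Longrightarrow> \<exists>\<eta> C. continuous_on V \<eta> \<and> C \<ge> 1 \<and>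
      (\<forall>x\<in>V. norm x powr s \<le> \<eta> x \<and> \<eta> x \<le> C * norm x powr s \<and> (\<integral>g. \<eta> (g *v x) \<partial>\<mu>) \<le> exp (s * a) * \<eta> x)"
proof -
  have V: "subspace V" using sl by (simp add: slow_space_def)
  obtain b s0 where b: "b < L" "0 < s0" "s0 \<le> 1"
    "\<And>s. 0 < s \<Longrightarrow> s \<le> s0 \<Longrightarrow> \<exists>D\<ge>0. \<forall>n. \<forall>u\<in>V. moment {0} s n u \<le> ennreal (D * exp (s * real n * b) * norm u powr s)"
    using slow_space_moment[OF sl] by blast
  obtain a where a: "b < a" "a < L" using b dense by blast
  show ?thesis
  proof (rule that[OF a(2) b(2,3)])
    fix s assume s: "0 < s" "s \<le> s0"
    obtain D where D: "D \<ge> 0" "\<And>n u. u \<in> V \<Longrightarrow> moment {0} s n u \<le> ennreal (D * exp (s * real n * b) * norm u powr s)"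
      using b(4)[OF s] by blast
    define t where "t = s * (a - b)"
    have t: "t > 0" using s a by (simp add: t_def)
    \<comment> \<open>The slack t per step beats the constant D: D \<le> m * t \<le> exp (m *
      t).\<close>
    obtain m0 :: nat where "D / t < real m0" using reals_Archimedean2 by blast
    then obtain m :: nat where m: "m \<ge> 1" "D \<le> real m * t" using t
      by (intro that[of "Suc m0"]) (simp_all add: field_simps)
    have "D * exp (s * real m * b) \<le> exp (s * a) ^ m"
    proof -
      have "D \<le> exp (real m * t)" using m exp_ge_add_one_self[of "real m * t"] by linarith
      then have "D * exp (s * real m * b) \<le> exp (real m * t) * exp (s * real m * b)" by (intro mult_right_mono) auto
      also have "\<dots> = exp (s * a) ^ m"
        unfolding exp_add[symmetric] exp_of_nat_mult[symmetric] t_def by (simp add: algebra_simps)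
      finally show ?thesis .
    qed
    then have E: "P.expectation (\<lambda>\<omega>. norm (mat_prod \<omega> m *v x) powr s) \<le> exp (s * a) ^ m * norm x powr s" if x: "x \<in> V" for x
    proof -
      have i: "integrable S (\<lambda>\<omega>. norm (mat_prod \<omega> m *v x) powr s)"
        using s norm_mat_prod(1)
        by (intro P.integrable_const_bound[of _ "(KK ^ m * norm x) powr s"] AE_I2) (auto intro!: powr_mono2)
      have "ennreal (P.expectation (\<lambda>\<omega>. norm (mat_prod \<omega> m *v x) powr s)) = moment {0} s m x"
        unfolding moment_def by (subst nn_integral_eq_integral) (use i in auto)
      also have "\<dots> \<le> ennreal (D * exp (s * real m * b) * norm x powr s)" by (rule D(2)[OF x])
      finally have "P.expectation (\<lambda>\<omega>. norm (mat_prod \<omega> m *v x) powr s) \<le> D * exp (s * real m * b) * norm x powr s"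
        using D(1) by simp
      also have "\<dots> \<le> exp (s * a) ^ m * norm x powr s" using \<open>D * exp (s * real m * b) \<le> exp (s * a) ^ m\<close>
        by (intro mult_right_mono) auto
      finally show ?thesis .
    qed
    obtain \<eta> C where \<eta>: "continuous_on V \<eta>" "C \<ge> 1" "\<And>x. x \<in> V \<Longrightarrow> norm x powr s \<le> \<eta> x"
      "\<And>x. x \<in> V \<Longrightarrow> \<eta> x \<le> C * norm x powr s" "\<And>x. x \<in> V \<Longrightarrow> (\<integral>g. \<eta> (g *v x) \<partial>\<mu>) \<le> exp (s * a) * \<eta> x"
    proof (rule adapted_function[where act = "\<lambda>A x. A *v x" and h = "\<lambda>x. norm x powr s" and X = V
          and K = "KK powr s" and m = m and \<kappa> = "exp (s * a)"])
      show "g *v x \<in> V" if "g \<in> \<Sigma>" "x \<in> V" for g x using inv[OF that(1)] that(2) by blast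
      show "continuous_on V (\<lambda>x. norm x powr s)" using s by (intro continuous_on_powr' continuous_intros) auto
      show "norm (g *v x) powr s \<le> KK powr s * norm x powr s" if "g \<in> \<Sigma>" for g x
        using powr_mono2[OF _ _ KK(2)[OF that, of x], of s] s KK_pos by (simp add: powr_mult)
      show "KK powr s \<ge> 1" using KK(1) s by (intro ge_one_powr_ge_zero) auto
    qed (use m E in \<open>auto simp: matrix_vector_mul_assoc intro!: continuous_intros\<close>)
    then show "\<exists>\<eta> C. continuous_on V \<eta> \<and> C \<ge> 1 \<and>
      (\<forall>x\<in>V. norm x powr s \<le> \<eta> x \<and> \<eta> x \<le> C * norm x powr s \<and> (\<integral>g. \<eta> (g *v x) \<partial>\<mu>) \<le> exp (s * a) * \<eta> x)" by blast
  qed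
qed

end

section \<open>Angles between directions in the quotient\<close>

context quotient_product
begin

text \<open>The sine of the angle between the classes of u and v, a distance between directions that
  is well defined for u, v outside \<open>V\<close>.\<close>

definition gap :: "real^'n \<Rightarrow> real^'n \<Rightarrow> real" where
  "gap u v = area (qproj V u) (qproj V v) / (pn u * pn v)"

lemma gap_nonneg [simp]: "0 \<le> gap u v"
  by (simp add: gap_def)

lemma gap_le_1: "gap u v \<le> 1"
  unfolding gap_def by (rule order_trans[OF divide_right_mono[OF area_le]]) simp_all

lemma gap_same [simp]: "gap u u = 0"
  by (simp add: gap_def)

lemma area_mat_le:
  assumes "\<omega> \<in> space S"
  shows "area (qproj V (mat_prod \<omega> n *v u)) (qproj V (mat_prod \<omega> n *v v))
      \<le> area_norm (mat_prod \<omega> n) * area (qproj V u) (qproj V v)"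
proof -
  let ?A = "mat_prod \<omega> n"
  have "area (qproj V (?A *v u)) (qproj V (?A *v v))
      = area (qproj V (?A *v qproj V u)) (qproj V (?A *v qproj V v))"
    by (simp add: qproj_mat_prod[OF assms])
  also have "\<dots> \<le> 1 * 1 * area (?A *v qproj V u) (?A *v qproj V v)"
    using norm_qproj_le[OF V] by (intro area_linear_le linear_qproj) auto
  also have "\<dots> \<le> area_norm ?A * area (qproj V u) (qproj V v)" using area_norm(1) by simp
  finally show ?thesis .
qed

text \<open>Two factors \<open>KK\<close> come from the area, and two from the norms in the
  denominator.\<close>

lemma gap_mv:
  assumes "g \<in> \<Sigma>" "u \<notin> V" "v \<notin> V"
  shows "gap (g *v u) (g *v v) \<le> KK ^ 4 * gap u v"
proof -
  have lin: "linear (\<lambda>x. qproj V (g *v x))" using linear_compose[OF linear_mv linear_qproj] by (simp add: o_def)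
  have b: "norm (qproj V (g *v x)) \<le> KK * norm x" for x
    using norm_qproj_le[OF V] KK(2)[OF assms(1)] order_trans by blast
  have p: "pn u > 0" "pn v > 0" "pn (g *v u) > 0" "pn (g *v v) > 0"
    using assms mv_mem_V by (auto intro!: pn_pos simp del: zero_less_norm_iff)
  have "area (qproj V (g *v u)) (qproj V (g *v v)) = area (qproj V (g *v qproj V u)) (qproj V (g *v qproj V v))"
    using qproj_mv_qproj[OF V inv_V[OF assms(1)]] by simp
  also have "\<dots> \<le> KK * KK * area (qproj V u) (qproj V v)"
    by (rule area_linear_le[OF lin b b])
  finally have a: "area (qproj V (g *v u)) (qproj V (g *v v)) \<le> KK * KK * area (qproj V u) (qproj V v)" .
  have "pn u * pn v \<le> (KK * pn (g *v u)) * (KK * pn (g *v v))"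
    using pn_mv(2)[OF assms(1)] KK_pos by (intro mult_mono) auto
  then have d: "pn u * pn v / (KK * KK) \<le> pn (g *v u) * pn (g *v v)"
    using KK_pos by (simp add: field_simps)
  have "gap (g *v u) (g *v v) \<le> KK * KK * area (qproj V u) (qproj V v) / (pn u * pn v / (KK * KK))"
    unfolding gap_def using a d p KK_pos by (intro frac_le) auto
  also have "\<dots> = KK ^ 4 * gap u v" using KK_pos by (simp add: gap_def power4_eq_xxxx mult_ac)
  finally show ?thesis .
qed

lemma continuous_on_gap:
  "continuous_on ((UNIV - V) \<times> (UNIV - V)) (\<lambda>p. gap (fst p) (snd p))"
  unfolding gap_def area_def
  using qproj_eq_0_iff[OF V] by (intro continuous_intros) auto

lemma measurable_gap [measurable]:
  assumes [measurable]: "f \<in> borel_measurable M" "g \<in> borel_measurable M"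
  shows "(\<lambda>x. gap (f x) (g x)) \<in> borel_measurable M"
  unfolding gap_def area_def by measurable

lemma ln_area_norm_bound:
  assumes n: "2 \<le> CARD('n)" and \<omega>: "\<omega> \<in> space S"
  shows "0 < area_norm (mat_prod \<omega> m)" "\<bar>ln (area_norm (mat_prod \<omega> m))\<bar> \<le> 2 * real m * ln KK"
proof -
  let ?A = "mat_prod \<omega> m"
  have up: "area_norm ?A \<le> KK ^ m * KK ^ m"
    unfolding area_norm(3) using KK_pos norm_mat_prod(1)[OF \<omega>] by (auto intro!: area_linear_le linear_mv)
  obtain i j :: 'n where ij: "i \<noteq> j" using n by (metis (full_types) card_2_iff' ex_card UNIV_I)
  define e :: "'n \<Rightarrow> real^'n" where "e k = axis k 1" for k
  let ?f = "\<lambda>x. matrix_inv ?A *v x"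
  have inv: "?A *v ?f x = x" for x
    using invertible_mat_prod[OF \<omega>, of m] by (simp add: matrix_vector_mul_assoc matrix_inv_right)
  have fb: "norm (?f x) \<le> KK ^ m * norm x" for x using norm_mat_prod(2)[OF \<omega>, of "?f x" m] inv[of x] by simp
  have "1 = area (e i) (e j)" using ij by (simp add: area_orthogonal e_def inner_axis_axis)
  also have "\<dots> = area (?A *v ?f (e i)) (?A *v ?f (e j))" by (simp add: inv)
  also have "\<dots> \<le> area_norm ?A * area (?f (e i)) (?f (e j))" by (rule area_norm(1))
  also have "area (?f (e i)) (?f (e j)) \<le> KK ^ m * KK ^ m * area (e i) (e j)"
    by (rule area_linear_le[OF linear_mv fb fb])
  also have "area (e i) (e j) = 1" using ij by (simp add: area_orthogonal e_def inner_axis_axis)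
  finally have lo: "1 \<le> area_norm ?A * (KK ^ m * KK ^ m)" using area_norm(2)[of ?A] by (simp add: mult_left_mono)
  have K2: "KK ^ m * KK ^ m > 0" using KK_pos by simp
  show pos: "0 < area_norm ?A" using lo area_norm(2)[of ?A] by (metis less_eq_real_def mult_zero_left not_one_le_zero)
  have l: "ln (KK ^ m * KK ^ m) = 2 * real m * ln KK"
    using KK_pos by (simp add: ln_mult_pos ln_realpow)
  have "ln (area_norm ?A) \<le> ln (KK ^ m * KK ^ m)" using up pos K2 by (subst ln_le_cancel_iff) auto
  moreover have "0 \<le> ln (area_norm ?A * (KK ^ m * KK ^ m))" using lo by simp
  then have "0 \<le> ln (area_norm ?A) + ln (KK ^ m * KK ^ m)" using pos K2 by (simp only: ln_mult_pos)
  ultimately show "\<bar>ln (area_norm ?A)\<bar> \<le> 2 * real m * ln KK" unfolding l by linarith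
qed

text \<open>The gap is multiplied by at most exp R, where R compares the growth of areas with that
  of two vectors. Its mean over m steps is about m (L1 + L2) - 2 m L1 = - m (L1 - L2), uniformly in
  the pair by \<open>uniform_expansion\<close>. A small power of the gap then contracts on average
  at time m, and an adapted function makes this a one-step contraction.\<close>

theorem gap_contraction:
  assumes n: "2 \<le> CARD('n)" and sl: "slow_space (lyapunov 1 \<mu>) V" and l: "lyapunov 2 \<mu> < lyapunov 1 \<mu>"
  obtains \<rho> \<alpha> \<kappa> C where "0 < \<alpha>" "\<alpha> \<le> 1" "0 < \<kappa>" "\<kappa> < 1" "C \<ge> 1"
    "continuous_on ((UNIV - V) \<times> (UNIV - V)) \<rho>"
    "\<And>u v. u \<notin> V \<Longrightarrow> v \<notin> V \<Longrightarrow> gap u v powr \<alpha> \<le> \<rho> (u, v)"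
    "\<And>u v. u \<notin> V \<Longrightarrow> v \<notin> V \<Longrightarrow> \<rho> (u, v) \<le> C * gap u v powr \<alpha>"
    "\<And>u v. u \<notin> V \<Longrightarrow> v \<notin> V \<Longrightarrow> (\<integral>g. \<rho> (g *v u, g *v v) \<partial>\<mu>) \<le> \<kappa> * \<rho> (u, v)"
proof -
  define L1 where "L1 = lyapunov 1 \<mu>"
  define L2 where "L2 = lyapunov 2 \<mu>"
  \<comment> \<open>Three errors \<epsilon> per step occur, one from the areas and two from the
    norms. Of the drift - 6 m \<epsilon> there remains - 3 m \<epsilon> + 2 C, which the choice of
    n1 pushes below - 1.\<close>
  define \<epsilon> where "\<epsilon> = (L1 - L2) / 6"
  have \<epsilon>: "\<epsilon> > 0" using l by (simp add: \<epsilon>_def L1_def L2_def)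
  obtain C where C: "\<And>n u. u \<notin> V \<Longrightarrow> real n * (L1 - \<epsilon>) - C \<le> P.expectation (\<lambda>\<omega>. ln (pn (mat_prod \<omega> n *v u) / pn u))"
    using uniform_expansion[OF slow_space_quotient[OF sl[folded L1_def]] \<epsilon>] by blast
  have ag: "growth area_norm (L1 + L2)" using area_growth[OF n] by (simp add: L1_def L2_def)
  then have "(\<lambda>n. P.expectation (\<lambda>\<omega>. ln (area_norm (mat_prod \<omega> n))) / real n) \<longlonglongrightarrow> L1 + L2"
    by (simp add: growth_def)
  then have "\<forall>\<^sub>F n in sequentially. P.expectation (\<lambda>\<omega>. ln (area_norm (mat_prod \<omega> n))) / real n < L1 + L2 + \<epsilon>"
    using \<epsilon> by (intro order_tendstoD) auto
  then obtain n0 where n0: "\<And>n. n \<ge> n0 \<Longrightarrow> P.expectation (\<lambda>\<omega>. ln (area_norm (mat_prod \<omega> n))) / real n < L1 + L2 + \<epsilon>"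
    by (auto simp: eventually_sequentially)
  obtain n1 :: nat where n1: "(2 * \<bar>C\<bar> + 1) / \<epsilon> < real n1" using reals_Archimedean2 by blast
  define m where "m = max 1 (max n0 n1)"
  have m: "m \<ge> 1" "m \<ge> n0" "m \<ge> n1" by (auto simp: m_def)
  have Eq: "P.expectation (\<lambda>\<omega>. ln (area_norm (mat_prod \<omega> m))) \<le> real m * (L1 + L2 + \<epsilon>)"
    using n0[OF m(2)] m(1) by (simp add: field_simps)
  have mC: "2 * \<bar>C\<bar> + 1 \<le> real m * \<epsilon>"
  proof -
    have "(2 * \<bar>C\<bar> + 1) / \<epsilon> \<le> real m" using n1 m(3) by linarith
    then show ?thesis using \<epsilon> by (simp add: pos_divide_le_eq)
  qed
  define R where "R u v \<omega> = ln (area_norm (mat_prod \<omega> m)) - ln (pn (mat_prod \<omega> m *v u) / pn u) - ln (pn (mat_prod \<omega> m *v v) / pn v)"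
    for u v \<omega>
  define b where "b = 4 * real m * ln KK"
  have b: "b \<ge> 0" using KK(1) by (simp add: b_def)
  have Rm[measurable]: "R u v \<in> borel_measurable S" for u v unfolding R_def by measurable
  have Rb: "\<bar>R u v \<omega>\<bar> \<le> b" if "u \<notin> V" "v \<notin> V" "\<omega> \<in> space S" for u v \<omega>
    using ln_pn_bound[OF that(3,1), of m] ln_pn_bound[OF that(3,2), of m] ln_area_norm_bound(2)[OF n that(3), of m]
    unfolding R_def b_def mult.commute[of "ln KK"] by (simp only: mult.assoc)
  have iln: "integrable S (\<lambda>\<omega>. ln (pn (mat_prod \<omega> m *v u) / pn u))" if "u \<notin> V" for u
    using ln_pn_bound[OF _ that, of _ m]
    by (intro P.integrable_const_bound[of _ "ln KK * real m"] AE_I2) (simp_all del: ln_div)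
  have ER: "P.expectation (R u v) \<le> - 1" if "u \<notin> V" "v \<notin> V" for u v
  proof -
    have "P.expectation (R u v) = P.expectation (\<lambda>\<omega>. ln (area_norm (mat_prod \<omega> m)))
        - P.expectation (\<lambda>\<omega>. ln (pn (mat_prod \<omega> m *v u) / pn u)) - P.expectation (\<lambda>\<omega>. ln (pn (mat_prod \<omega> m *v v) / pn v))"
      unfolding R_def using ag iln[OF that(1)] iln[OF that(2)] by (simp add: growth_def)
    also have "\<dots> \<le> real m * (L1 + L2 + \<epsilon>) - (real m * (L1 - \<epsilon>) - C) - (real m * (L1 - \<epsilon>) - C)"
      using Eq C[OF that(1), of m] C[OF that(2), of m] by linarith
    also have "\<dots> = - (3 * (real m * \<epsilon>)) + 2 * C" by (simp add: \<epsilon>_def field_simps)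
    also have "\<dots> \<le> - 1" using mC abs_ge_self[of C] by linarith
    finally show ?thesis .
  qed
  obtain \<alpha> where \<alpha>: "0 < \<alpha>" "\<alpha> \<le> 1" "\<alpha> * b \<le> 1" "\<alpha> * b\<^sup>2 \<le> 1 / 2"
    using exists_small_exponent[of "1/2" b] b by (metis half_gt_zero_iff order_refl zero_less_one)
  \<comment> \<open>The m-th root of exp (\<alpha> * (- 1 + 1 / 2)), the moment bound for a mean of
    at most - 1 with error 1 / 2.\<close>
  define \<kappa> where "\<kappa> = exp (- (\<alpha> / 2 / real m))"
  have \<kappa>: "0 < \<kappa>" "\<kappa> < 1" using \<alpha> m by (auto simp: \<kappa>_def)
  have \<kappa>m: "\<kappa> ^ m = exp (\<alpha> * (- 1 + 1 / 2))"
    unfolding \<kappa>_def exp_of_nat_mult[symmetric] using m by simp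
  have EE: "P.expectation (\<lambda>\<omega>. gap (mat_prod \<omega> m *v u) (mat_prod \<omega> m *v v) powr \<alpha>) \<le> \<kappa> ^ m * gap u v powr \<alpha>"
    if uv: "u \<notin> V" "v \<notin> V" for u v
  proof -
    have le: "gap (mat_prod \<omega> m *v u) (mat_prod \<omega> m *v v) powr \<alpha> \<le> exp (\<alpha> * R u v \<omega>) * gap u v powr \<alpha>"
      if \<omega>: "\<omega> \<in> space S" for \<omega>
    proof -
      let ?A = "mat_prod \<omega> m"
      have p: "pn u > 0" "pn v > 0" "pn (?A *v u) > 0" "pn (?A *v v) > 0"
        using uv mat_prod_mem_V[OF \<omega>] by (auto intro!: pn_pos simp del: zero_less_norm_iff)
      have q: "area_norm ?A > 0" by (rule ln_area_norm_bound(1)[OF n \<omega>])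
      have eR: "exp (R u v \<omega>) = area_norm ?A / (pn (?A *v u) / pn u) / (pn (?A *v v) / pn v)"
        unfolding R_def exp_diff using p q by (subst exp_ln, simp)+ simp
      have "gap (?A *v u) (?A *v v) \<le> area_norm ?A * area (qproj V u) (qproj V v) / (pn (?A *v u) * pn (?A *v v))"
        unfolding gap_def using p area_mat_le[OF \<omega>] by (intro divide_right_mono) auto
      also have "\<dots> = exp (R u v \<omega>) * gap u v" unfolding eR gap_def using p by simp
      finally have "gap (?A *v u) (?A *v v) powr \<alpha> \<le> (exp (R u v \<omega>) * gap u v) powr \<alpha>"
        using \<alpha> by (intro powr_mono2) auto
      also have "\<dots> = exp (\<alpha> * R u v \<omega>) * gap u v powr \<alpha>"
        by (simp add: powr_mult exp_powr_real mult.commute)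
      finally show ?thesis .
    qed
    have iexp: "integrable S (\<lambda>\<omega>. exp (\<alpha> * R u v \<omega>))"
    proof (rule P.integrable_const_bound[of _ "exp (\<alpha> * b)"])
      show "AE \<omega> in S. norm (exp (\<alpha> * R u v \<omega>)) \<le> exp (\<alpha> * b)"
        using Rb[OF uv] \<alpha> by (intro AE_I2) (auto simp: abs_le_iff)
    qed simp
    have "P.expectation (\<lambda>\<omega>. gap (mat_prod \<omega> m *v u) (mat_prod \<omega> m *v v) powr \<alpha>)
        \<le> P.expectation (\<lambda>\<omega>. exp (\<alpha> * R u v \<omega>) * gap u v powr \<alpha>)"
    proof (rule integral_mono)
      show "integrable S (\<lambda>\<omega>. gap (mat_prod \<omega> m *v u) (mat_prod \<omega> m *v v) powr \<alpha>)"
        using \<alpha> gap_le_1 powr_mono2[of \<alpha> _ 1]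
        by (intro P.integrable_const_bound[of _ 1] AE_I2) auto
    qed (use iexp le in auto)
    also have "\<dots> = P.expectation (\<lambda>\<omega>. exp (\<alpha> * R u v \<omega>)) * gap u v powr \<alpha>" by simp
    also have "\<dots> \<le> \<kappa> ^ m * gap u v powr \<alpha>"
      unfolding \<kappa>m using Rb[OF uv] ER[OF uv] \<alpha>
      by (intro mult_right_mono P.exp_moment_bound[where b = b]) auto
    finally show ?thesis .
  qed
  let ?X = "(UNIV - V) \<times> (UNIV - V)"
  obtain \<rho> C where \<rho>: "continuous_on ?X \<rho>" "C \<ge> 1" "\<And>x. x \<in> ?X \<Longrightarrow> gap (fst x) (snd x) powr \<alpha> \<le> \<rho> x"
    "\<And>x. x \<in> ?X \<Longrightarrow> \<rho> x \<le> C * gap (fst x) (snd x) powr \<alpha>"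
    "\<And>x. x \<in> ?X \<Longrightarrow> (\<integral>g. \<rho> (g *v fst x, g *v snd x) \<partial>\<mu>) \<le> \<kappa> * \<rho> x"
  proof (rule adapted_function[where act = "\<lambda>A x. (A *v fst x, A *v snd x)" and h = "\<lambda>x. gap (fst x) (snd x) powr \<alpha>"
        and X = ?X and K = "(KK ^ 4) powr \<alpha>" and m = m and \<kappa> = \<kappa>])
    show "(g *v fst x, g *v snd x) \<in> ?X" if "g \<in> \<Sigma>" "x \<in> ?X" for g x using that mv_mem_V by auto
    show "continuous_on ?X (\<lambda>x. (g *v fst x, g *v snd x))" for g by (intro continuous_intros)
    show "continuous_on ?X (\<lambda>x. gap (fst x) (snd x) powr \<alpha>)"
      using \<alpha> by (intro continuous_on_powr' continuous_on_gap continuous_intros) auto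
    show "gap (fst (g *v fst x, g *v snd x)) (snd (g *v fst x, g *v snd x)) powr \<alpha> \<le> (KK ^ 4) powr \<alpha> * gap (fst x) (snd x) powr \<alpha>"
      if "g \<in> \<Sigma>" "x \<in> ?X" for g x
      using powr_mono2[OF _ _ gap_mv[OF that(1), of "fst x" "snd x"], of \<alpha>] that \<alpha> KK_pos by (auto simp: powr_mult)
    show "(KK ^ 4) powr \<alpha> \<ge> 1" using KK(1) \<alpha> by (intro ge_one_powr_ge_zero one_le_power) auto
    show "P.expectation (\<lambda>\<omega>. gap (fst (mat_prod \<omega> m *v fst x, mat_prod \<omega> m *v snd x)) (snd (mat_prod \<omega> m *v fst x, mat_prod \<omega> m *v snd x)) powr \<alpha>)
        \<le> \<kappa> ^ m * gap (fst x) (snd x) powr \<alpha>" if "x \<in> ?X" for x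
      using EE[of "fst x" "snd x"] that by auto
  qed (use m \<kappa> in \<open>auto simp: matrix_vector_mul_assoc\<close>)
  show ?thesis
    using \<rho>(3,4,5)[of "(u, v)" for u v] by (intro that[OF \<alpha>(1,2) \<kappa> \<rho>(2,1)]) auto
qed

end

subsection \<open>Integration of continuous functions against complex measures\<close>

lemma complex_measure_Un:
  assumes \<nu>: "\<nu> \<in> complex_measures M" and AB: "A \<in> sets M" "B \<in> sets M" "A \<inter> B = {}"
  shows "\<nu> (A \<union> B) = \<nu> A + \<nu> B"
proof -
  have "\<forall>A::nat \<Rightarrow> _. range A \<subseteq> sets M \<longrightarrow> disjoint_family A \<longrightarrow> (\<lambda>n. \<nu> (A n)) sums \<nu> (\<Union>n. A n)"
    using \<nu> by (simp add: complex_measures_def)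
  moreover have "range (binaryset A B) \<subseteq> sets M" using AB by (simp add: range_binaryset_eq)
  moreover have "disjoint_family (binaryset A B)"
    using AB(3) by (auto simp: disjoint_family_on_def binaryset_def)
  ultimately have "(\<lambda>n. \<nu> (binaryset A B n)) sums \<nu> (\<Union>n. binaryset A B n)" by blast
  then have "(\<lambda>n. \<nu> (binaryset A B n)) sums \<nu> (A \<union> B)" by (simp add: UN_binaryset_eq)
  moreover have "(\<lambda>n. \<nu> (binaryset A B n)) sums (\<nu> A + \<nu> B)"
    using \<nu> by (intro binaryset_sums) (simp add: complex_measures_def)
  ultimately show ?thesis by (rule sums_unique2)
qed

lemma complex_measure_empty: "\<nu> \<in> complex_measures M \<Longrightarrow> \<nu> {} = 0"
  by (simp add: complex_measures_def)

lemma complex_measure_Union: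
  assumes \<nu>: "\<nu> \<in> complex_measures M" and Q: "finite Q" "Q \<subseteq> sets M" "disjoint Q"
  shows "\<nu> (\<Union>Q) = (\<Sum>B\<in>Q. \<nu> B)"
  using Q
proof (induction Q rule: finite_induct)
  case (insert B Q)
  have "\<nu> (B \<union> \<Union>Q) = \<nu> B + \<nu> (\<Union>Q)"
  proof (rule complex_measure_Un[OF \<nu>])
    show "B \<inter> \<Union>Q = {}" using insert.prems(2) insert.hyps(2) by (auto simp: disjoint_def)
  qed (use insert in auto)
  then show ?case using insert by (simp add: disjoint_def)
qed (simp add: complex_measure_empty[OF \<nu>])

lemma complex_measure_split:
  assumes \<nu>: "\<nu> \<in> complex_measures M" and Q: "finite Q" "Q \<subseteq> sets M" "partition_on (space M) Q"
    and A: "A \<in> sets M"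
  shows "\<nu> A = (\<Sum>B\<in>Q. \<nu> (A \<inter> B))"
proof -
  have dQ: "disjoint Q" using Q(3) by (simp add: partition_on_def)
  have "A = \<Union>((\<inter>) A ` Q)"
    using sets.sets_into_space[OF A] Q(3) by (auto simp: partition_on_def)
  then have "\<nu> A = \<nu> (\<Union>((\<inter>) A ` Q))" by simp
  also have "\<dots> = (\<Sum>B\<in>(\<inter>) A ` Q. \<nu> B)"
    using Q A dQ by (intro complex_measure_Union[OF \<nu>]) (auto simp: disjoint_def)
  also have "\<dots> = (\<Sum>B\<in>Q. \<nu> (A \<inter> B))"
  proof (subst sum.reindex_nontrivial[OF Q(1)])
    fix B B' assume "B \<in> Q" "B' \<in> Q" "B \<noteq> B'" "A \<inter> B = A \<inter> B'"
    then have "A \<inter> B = {}" using dQ by (auto simp: disjoint_def)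
    then show "\<nu> (A \<inter> B) = 0" using complex_measure_empty[OF \<nu>] by simp
  qed simp
  finally show ?thesis .
qed

lemma tv_norm_nonneg [simp]: "0 \<le> tv_norm M \<nu>"
  by (simp add: tv_norm_def)

lemma sum_cmod_le_tv_norm:
  assumes \<nu>: "\<nu> \<in> complex_measures M" and P: "finite P" "partition_on (space M) P" "P \<subseteq> sets M"
  shows "(\<Sum>A\<in>P. cmod (\<nu> A)) \<le> tv_norm M \<nu>"
proof -
  have fin: "total_variation M \<nu> < \<infinity>" using \<nu> by (simp add: complex_measures_def)
  have "ennreal (\<Sum>A\<in>P. cmod (\<nu> A)) = (\<Sum>A\<in>P. ennreal (cmod (\<nu> A)))" by simp
  also have "\<dots> \<le> total_variation M \<nu>" by (rule variation_sum_le[OF P])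
  also have "\<dots> = ennreal (tv_norm M \<nu>)" using fin by (simp add: tv_norm_def less_top)
  finally show ?thesis by simp
qed

text \<open>The nonempty intersections form a common refinement, and each of them determines its
  pair of cells. Empty intersections have measure 0 and are removed because a partition excludes the
  empty set.\<close>

lemma sum_cmod_refinement_le:
  assumes \<nu>: "\<nu> \<in> complex_measures M" and P: "finite P" "partition_on (space M) P" "P \<subseteq> sets M"
    and Q: "finite Q" "partition_on (space M) Q" "Q \<subseteq> sets M"
  shows "(\<Sum>A\<in>P. \<Sum>B\<in>Q. cmod (\<nu> (A \<inter> B))) \<le> tv_norm M \<nu>"
proof -
  let ?i = "\<lambda>(A, B). A \<inter> B"
  define R where "R = ?i ` (P \<times> Q) - {{}}"
  have dP: "disjoint P" "disjoint Q" "\<Union>P = space M" "\<Union>Q = space M"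
    using P(2) Q(2) by (auto simp: partition_on_def)
  have uniq: "A = A'" if "A \<in> P" "A' \<in> P" "x \<in> A" "x \<in> A'" for A A' x
    using dP(1) that by (auto simp: disjoint_def)
  have uniq': "B = B'" if "B \<in> Q" "B' \<in> Q" "x \<in> B" "x \<in> B'" for B B' x
    using dP(2) that by (auto simp: disjoint_def)
  have "(\<Sum>A\<in>P. \<Sum>B\<in>Q. cmod (\<nu> (A \<inter> B))) = (\<Sum>p\<in>P \<times> Q. cmod (\<nu> (?i p)))"
    by (simp add: sum.cartesian_product case_prod_beta)
  also have "\<dots> = (\<Sum>C\<in>?i ` (P \<times> Q). cmod (\<nu> C))"
  proof (subst sum.reindex_nontrivial)
    fix p p' assume pp: "p \<in> P \<times> Q" "p' \<in> P \<times> Q" "p \<noteq> p'" "?i p = ?i p'"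
    have "?i p = {}"
    proof (rule ccontr)
      assume "?i p \<noteq> {}"
      then obtain x where x: "x \<in> ?i p" by blast
      obtain A B A' B' where AB: "p = (A, B)" "p' = (A', B')" by (metis prod.exhaust)
      have "x \<in> A" "x \<in> B" "x \<in> A'" "x \<in> B'" using x pp(4) by (auto simp: AB)
      moreover have "A \<in> P" "B \<in> Q" "A' \<in> P" "B' \<in> Q" using pp(1,2) by (auto simp: AB)
      ultimately have "A = A'" "B = B'" using uniq uniq' by blast+
      then show False using pp(3) by (simp add: AB)
    qed
    then show "cmod (\<nu> (?i p)) = 0" using complex_measure_empty[OF \<nu>] by simp
  qed (use P Q in auto)
  also have "\<dots> = (\<Sum>C\<in>R. cmod (\<nu> C))"
    unfolding R_def using P Q complex_measure_empty[OF \<nu>] by (intro sum.mono_neutral_right) auto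
  also have "\<dots> \<le> tv_norm M \<nu>"
  proof (rule sum_cmod_le_tv_norm[OF \<nu>])
    show "finite R" unfolding R_def using P Q by auto
    show "R \<subseteq> sets M" unfolding R_def using P Q by auto
    show "partition_on (space M) R"
      unfolding partition_on_def
    proof (intro conjI)
      show "\<Union>R = space M"
      proof (intro equalityI subsetI)
        fix x assume "x \<in> space M"
        then obtain A B where "A \<in> P" "x \<in> A" "B \<in> Q" "x \<in> B" using dP by (metis UnionE)
        then show "x \<in> \<Union>R" unfolding R_def by (intro UnionI[of "A \<inter> B"]) auto
      qed (use dP in \<open>auto simp: R_def\<close>)
      show "disjoint R"
        unfolding disjoint_def R_def using uniq uniq' by fastforce
    qed (simp add: R_def)
  qed
  finally show ?thesis .
qed

text \<open>Finitely many balls of radius e / 2 cover the compact set; points are put into the same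
  cell when they lie in the same balls.\<close>

lemma finite_partition_exists:
  fixes \<Sigma> :: "'a::metric_space set"
  assumes \<Sigma>: "compact \<Sigma>" and e: "0 < e"
  shows "\<exists>P. finite P \<and> partition_on \<Sigma> P \<and> P \<subseteq> sets (borel_of \<Sigma>) \<and> (\<forall>A\<in>P. \<forall>x\<in>A. \<forall>y\<in>A. dist x y < e)"
proof -
  obtain F where F: "finite F" "\<Sigma> \<subseteq> (\<Union>x\<in>F. ball x (e/2))"
    using \<Sigma> e unfolding compact_eq_totally_bounded by (metis half_gt_zero)
  define J where "J x = {i\<in>F. x \<in> ball i (e/2)}" for x
  define P where "P = (\<lambda>I. {x\<in>\<Sigma>. J x = I}) ` Pow F - {{}}"
  have "finite P" unfolding P_def using F by auto
  moreover have "partition_on \<Sigma> P"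
    unfolding partition_on_def
  proof (intro conjI)
    show "\<Union>P = \<Sigma>"
    proof (intro equalityI subsetI)
      fix x assume "x \<in> \<Sigma>"
      then show "x \<in> \<Union>P" unfolding P_def
        by (intro UnionI[of "{y\<in>\<Sigma>. J y = J x}"]) (auto simp: J_def)
    qed (auto simp: P_def)
    show "disjoint P" by (auto simp: disjoint_def P_def)
  qed (simp add: P_def)
  moreover have "P \<subseteq> sets (borel_of \<Sigma>)"
  proof
    fix A assume "A \<in> P"
    then obtain I where I: "I \<subseteq> F" "A = {x\<in>\<Sigma>. J x = I}" by (auto simp: P_def)
    have "J x = I \<longleftrightarrow> (\<forall>i\<in>F. x \<in> (if i \<in> I then ball i (e/2) else - ball i (e/2)))" for x
      using I(1) by (auto simp: J_def split: if_splits)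
    then have "{x. J x = I} = (\<Inter>i\<in>F. if i \<in> I then ball i (e/2) else - ball i (e/2))"
      by (intro set_eqI) (simp only: mem_Collect_eq INT_iff)
    also have "\<dots> \<in> sets borel"
    proof (cases "F = {}")
      case False
      then show ?thesis by (intro sets.finite_INT F) auto
    qed simp
    finally have "\<Sigma> \<inter> {x. J x = I} \<in> sets (borel_of \<Sigma>)" by (auto simp: sets_restrict_space)
    moreover have "A = \<Sigma> \<inter> {x. J x = I}" unfolding I(2) by blast
    ultimately show "A \<in> sets (borel_of \<Sigma>)" by simp
  qed
  moreover have "dist x y < e" if "A \<in> P" "x \<in> A" "y \<in> A" for A x y
  proof -
    have xy: "J x = J y" "x \<in> \<Sigma>" using that by (auto simp: P_def)
    then obtain i where "i \<in> J x" using F(2) by (auto simp: J_def)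
    then have "dist i x < e/2" "dist i y < e/2" using xy(1) by (auto simp: J_def)
    then show ?thesis by (metis dist_triangle_half_r)
  qed
  ultimately show ?thesis by blast
qed

definition mesh :: "'a::metric_space set \<Rightarrow> nat \<Rightarrow> 'a set set" where
  "mesh \<Sigma> k = (SOME P. finite P \<and> partition_on \<Sigma> P \<and> P \<subseteq> sets (borel_of \<Sigma>)
     \<and> (\<forall>A\<in>P. \<forall>x\<in>A. \<forall>y\<in>A. dist x y < 1 / real (Suc k)))"

lemma mesh:
  fixes \<Sigma> :: "'a::metric_space set"
  assumes "compact \<Sigma>"
  shows "finite (mesh \<Sigma> k)" "partition_on \<Sigma> (mesh \<Sigma> k)" "mesh \<Sigma> k \<subseteq> sets (borel_of \<Sigma>)"
    "\<And>A x y. A \<in> mesh \<Sigma> k \<Longrightarrow> x \<in> A \<Longrightarrow> y \<in> A \<Longrightarrow> dist x y < 1 / real (Suc k)"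
  using someI_ex[OF finite_partition_exists[OF assms, of "1 / real (Suc k)"], folded mesh_def] by auto

definition pt :: "'a set \<Rightarrow> 'a" where "pt A = (SOME x. x \<in> A)"

lemma pt_mem: "A \<noteq> {} \<Longrightarrow> pt A \<in> A"
  unfolding pt_def by (rule someI_ex) blast

definition riemann :: "'a::metric_space set \<Rightarrow> nat \<Rightarrow> ('a set \<Rightarrow> complex) \<Rightarrow> ('a \<Rightarrow> complex) \<Rightarrow> complex" where
  "riemann \<Sigma> k \<nu> f = (\<Sum>A\<in>mesh \<Sigma> k. \<nu> A * f (pt A))"

text \<open>Complex measures are bare set functions and only continuous integrands occur, so the
  integral is a limit of Riemann sums along one fixed sequence of partitions. Linearity in the
  integrand and in the measure is then inherited from finite sums.\<close>

definition cint :: "'a::metric_space set \<Rightarrow> ('a set \<Rightarrow> complex) \<Rightarrow> ('a \<Rightarrow> complex) \<Rightarrow> complex" where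
  "cint \<Sigma> \<nu> f = lim (\<lambda>k. riemann \<Sigma> k \<nu> f)"

section \<open>Riemann sums against complex measures\<close>

locale compact_base =
  fixes \<Sigma> :: "'a::metric_space set"
  assumes compact_base: "compact \<Sigma>"
begin

lemmas mesh = mesh[OF compact_base]

lemma space_base: "space (borel_of \<Sigma>) = \<Sigma>"
  by (simp add: space_restrict_space)

lemma pt_mesh: "A \<in> mesh \<Sigma> k \<Longrightarrow> pt A \<in> A" "A \<in> mesh \<Sigma> k \<Longrightarrow> pt A \<in> \<Sigma>"
proof -
  assume A: "A \<in> mesh \<Sigma> k"
  then have "A \<noteq> {}" using mesh(2)[of k] by (auto simp: partition_on_def)
  then show "pt A \<in> A" by (rule pt_mem)
  then show "pt A \<in> \<Sigma>" using mesh(2)[of k] A by (auto simp: partition_on_def)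
qed

text \<open>Both sums are rewritten over the common refinement. The two sample points belonging to a
  nonempty intersection are close, so uniform continuity and the total variation bound the
  difference.\<close>

lemma riemann_Cauchy:
  assumes \<nu>: "\<nu> \<in> cmeas \<Sigma>" and f: "continuous_on \<Sigma> f"
  shows "Cauchy (\<lambda>k. riemann \<Sigma> k \<nu> f)"
proof (rule metric_CauchyI)
  fix e :: real assume e: "0 < e"
  have \<nu>': "\<nu> \<in> complex_measures (borel_of \<Sigma>)" using \<nu> by (simp add: cmeas_def)
  define \<epsilon> where "\<epsilon> = e / (tv \<Sigma> \<nu> + 1) / 2"
  have t: "tv \<Sigma> \<nu> + 1 > 0" using tv_norm_nonneg[of "borel_of \<Sigma>" \<nu>] by linarith
  have \<epsilon>: "\<epsilon> > 0" using e t by (simp add: \<epsilon>_def)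
  have "uniformly_continuous_on \<Sigma> f" using f compact_base by (rule compact_uniformly_continuous)
  then obtain d where d: "d > 0" "\<And>x y. x \<in> \<Sigma> \<Longrightarrow> y \<in> \<Sigma> \<Longrightarrow> dist y x < d \<Longrightarrow> dist (f y) (f x) < \<epsilon>"
    using \<epsilon> unfolding uniformly_continuous_on_def by metis
  obtain N :: nat where N: "1 / real (Suc N) < d / 2" using d(1) nat_approx_posE half_gt_zero by metis
  show "\<exists>N. \<forall>k\<ge>N. \<forall>l\<ge>N. dist (riemann \<Sigma> k \<nu> f) (riemann \<Sigma> l \<nu> f) < e"
  proof (intro exI[of _ N] allI impI)
    fix k l assume kl: "k \<ge> N" "l \<ge> N"
    let ?P = "mesh \<Sigma> k" and ?Q = "mesh \<Sigma> l"
    have "1 / real (Suc k) \<le> 1 / real (Suc N)" "1 / real (Suc l) \<le> 1 / real (Suc N)"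
      using kl by (auto intro!: divide_left_mono)
    then have small: "1 / real (Suc k) < d / 2" "1 / real (Suc l) < d / 2" using N by linarith+
    have "riemann \<Sigma> k \<nu> f = (\<Sum>A\<in>?P. \<Sum>B\<in>?Q. \<nu> (A \<inter> B) * f (pt A))"
      unfolding riemann_def
    proof (rule sum.cong[OF refl])
      fix A assume "A \<in> ?P"
      then have "\<nu> A = (\<Sum>B\<in>?Q. \<nu> (A \<inter> B))"
        using mesh(3)[of k] mesh(1-3)[of l] by (intro complex_measure_split[OF \<nu>']) (auto simp: space_base)
      then show "\<nu> A * f (pt A) = (\<Sum>B\<in>?Q. \<nu> (A \<inter> B) * f (pt A))" by (simp add: sum_distrib_right)
    qed
    moreover have "riemann \<Sigma> l \<nu> f = (\<Sum>A\<in>?P. \<Sum>B\<in>?Q. \<nu> (A \<inter> B) * f (pt B))"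
      unfolding riemann_def
    proof (subst sum.swap, rule sum.cong[OF refl])
      fix B assume "B \<in> ?Q"
      then have "\<nu> B = (\<Sum>A\<in>?P. \<nu> (B \<inter> A))"
        using mesh(3)[of l] mesh(1-3)[of k] by (intro complex_measure_split[OF \<nu>']) (auto simp: space_base)
      then show "\<nu> B * f (pt B) = (\<Sum>A\<in>?P. \<nu> (A \<inter> B) * f (pt B))"
        by (simp add: sum_distrib_right Int_commute)
    qed
    ultimately have "riemann \<Sigma> k \<nu> f - riemann \<Sigma> l \<nu> f = (\<Sum>A\<in>?P. \<Sum>B\<in>?Q. \<nu> (A \<inter> B) * (f (pt A) - f (pt B)))"
      by (simp add: sum_subtractf[symmetric] right_diff_distrib)
    also have "cmod \<dots> \<le> (\<Sum>A\<in>?P. \<Sum>B\<in>?Q. cmod (\<nu> (A \<inter> B)) * \<epsilon>)"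
    proof (intro sum_norm_le)
      fix A B assume AB: "A \<in> ?P" "B \<in> ?Q"
      show "cmod (\<nu> (A \<inter> B) * (f (pt A) - f (pt B))) \<le> cmod (\<nu> (A \<inter> B)) * \<epsilon>"
      proof (cases "A \<inter> B = {}")
        case True
        then show ?thesis using complex_measure_empty[OF \<nu>'] by simp
      next
        case False
        then obtain x where x: "x \<in> A" "x \<in> B" by blast
        have "dist (pt A) x < d / 2" "dist (pt B) x < d / 2"
          using mesh(4)[OF AB(1) pt_mesh(1)[OF AB(1)] x(1)] mesh(4)[OF AB(2) pt_mesh(1)[OF AB(2)] x(2)] small by linarith+
        then have "dist (pt A) (pt B) < d" by (rule dist_triangle_half_l)
        then have "dist (f (pt A)) (f (pt B)) < \<epsilon>" using pt_mesh(2) AB by (intro d(2)) auto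
        then show ?thesis unfolding norm_mult by (intro mult_left_mono) (auto simp: dist_norm)
      qed
    qed
    also have "\<dots> = (\<Sum>A\<in>?P. \<Sum>B\<in>?Q. cmod (\<nu> (A \<inter> B))) * \<epsilon>"
      by (simp add: sum_distrib_right)
    also have "\<dots> \<le> tv \<Sigma> \<nu> * \<epsilon>"
      using mesh(1-3)[of k] mesh(1-3)[of l] \<epsilon>
      by (intro mult_right_mono sum_cmod_refinement_le[OF \<nu>']) (auto simp: space_base)
    also have "\<dots> < (tv \<Sigma> \<nu> + 1) * (2 * \<epsilon>)"
      using \<epsilon> tv_norm_nonneg[of "borel_of \<Sigma>" \<nu>] by (intro mult_strict_mono') auto
    also have "\<dots> = e"
    proof -
      have "x * (2 * (e / x / 2)) = e" if "x > 0" for x :: real using that by simp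
      from this[OF t] show ?thesis unfolding \<epsilon>_def .
    qed
    finally show "dist (riemann \<Sigma> k \<nu> f) (riemann \<Sigma> l \<nu> f) < e" by (simp add: dist_norm)
  qed
qed

lemma cint_tendsto:
  assumes "\<nu> \<in> cmeas \<Sigma>" "continuous_on \<Sigma> f"
  shows "(\<lambda>k. riemann \<Sigma> k \<nu> f) \<longlonglongrightarrow> cint \<Sigma> \<nu> f"
  using riemann_Cauchy[OF assms] unfolding cint_def
  by (simp add: Cauchy_convergent_iff convergent_LIMSEQ_iff)

lemma cint_add:
  assumes "\<nu> \<in> cmeas \<Sigma>" "continuous_on \<Sigma> f" "continuous_on \<Sigma> g"
  shows "cint \<Sigma> \<nu> (\<lambda>x. f x + g x) = cint \<Sigma> \<nu> f + cint \<Sigma> \<nu> g"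
proof (rule LIMSEQ_unique[OF cint_tendsto])
  have "(\<lambda>k. riemann \<Sigma> k \<nu> f + riemann \<Sigma> k \<nu> g) \<longlonglongrightarrow> cint \<Sigma> \<nu> f + cint \<Sigma> \<nu> g"
    using assms by (intro tendsto_add cint_tendsto)
  then show "(\<lambda>k. riemann \<Sigma> k \<nu> (\<lambda>x. f x + g x)) \<longlonglongrightarrow> cint \<Sigma> \<nu> f + cint \<Sigma> \<nu> g"
    by (simp add: riemann_def distrib_left sum.distrib)
qed (use assms in \<open>auto intro: continuous_intros\<close>)

lemma cint_cmult:
  assumes "\<nu> \<in> cmeas \<Sigma>" "continuous_on \<Sigma> f"
  shows "cint \<Sigma> \<nu> (\<lambda>x. c * f x) = c * cint \<Sigma> \<nu> f"
proof (rule LIMSEQ_unique[OF cint_tendsto])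
  have "(\<lambda>k. c * riemann \<Sigma> k \<nu> f) \<longlonglongrightarrow> c * cint \<Sigma> \<nu> f"
    using assms by (intro tendsto_mult_left cint_tendsto)
  then show "(\<lambda>k. riemann \<Sigma> k \<nu> (\<lambda>x. c * f x)) \<longlonglongrightarrow> c * cint \<Sigma> \<nu> f"
    by (simp add: riemann_def sum_distrib_left mult_ac)
qed (use assms in \<open>auto intro: continuous_intros\<close>)

lemma cint_diff:
  assumes "\<nu> \<in> cmeas \<Sigma>" "continuous_on \<Sigma> f" "continuous_on \<Sigma> g"
  shows "cint \<Sigma> \<nu> (\<lambda>x. f x - g x) = cint \<Sigma> \<nu> f - cint \<Sigma> \<nu> g"
  using cint_add[OF assms(1,2), of "\<lambda>x. (- 1) * g x"] cint_cmult[OF assms(1,3), of "- 1"] assms(3)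
  by (simp add: continuous_on_minus)

lemma cint_measure_add:
  assumes "\<nu> \<in> cmeas \<Sigma>" "\<kappa> \<in> cmeas \<Sigma>" "continuous_on \<Sigma> f"
  shows "cint \<Sigma> (\<nu> + \<kappa>) f = cint \<Sigma> \<nu> f + cint \<Sigma> \<kappa> f"
proof -
  have "(\<lambda>k. riemann \<Sigma> k \<nu> f + riemann \<Sigma> k \<kappa> f) \<longlonglongrightarrow> cint \<Sigma> \<nu> f + cint \<Sigma> \<kappa> f"
    using assms by (intro tendsto_add cint_tendsto)
  then have "(\<lambda>k. riemann \<Sigma> k (\<nu> + \<kappa>) f) \<longlonglongrightarrow> cint \<Sigma> \<nu> f + cint \<Sigma> \<kappa> f"
    by (simp add: riemann_def distrib_right sum.distrib)
  then show ?thesis unfolding cint_def[of _ "\<nu> + \<kappa>"] by (rule limI)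
qed

lemma cint_measure_scale:
  assumes "\<nu> \<in> cmeas \<Sigma>" "continuous_on \<Sigma> f"
  shows "cint \<Sigma> (\<lambda>A. c * \<nu> A) f = c * cint \<Sigma> \<nu> f"
proof -
  have "(\<lambda>k. c * riemann \<Sigma> k \<nu> f) \<longlonglongrightarrow> c * cint \<Sigma> \<nu> f"
    using assms by (intro tendsto_mult_left cint_tendsto)
  then have "(\<lambda>k. riemann \<Sigma> k (\<lambda>A. c * \<nu> A) f) \<longlonglongrightarrow> c * cint \<Sigma> \<nu> f"
    by (simp add: riemann_def sum_distrib_left mult_ac)
  then show ?thesis unfolding cint_def[of _ "\<lambda>A. c * \<nu> A"] by (rule limI)
qed

lemma cint_cong: "(\<And>x. x \<in> \<Sigma> \<Longrightarrow> f x = g x) \<Longrightarrow> cint \<Sigma> \<nu> f = cint \<Sigma> \<nu> g"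
  unfolding cint_def riemann_def using pt_mesh(2) by (intro arg_cong[of _ _ lim] ext sum.cong) auto

lemma cint_const:
  assumes "\<nu> \<in> cmeas \<Sigma>"
  shows "cint \<Sigma> \<nu> (\<lambda>_. c) = c * \<nu> \<Sigma>"
proof -
  have \<nu>': "\<nu> \<in> complex_measures (borel_of \<Sigma>)" using assms by (simp add: cmeas_def)
  have "\<nu> \<Sigma> = (\<Sum>A\<in>mesh \<Sigma> k. \<nu> A)" for k
  proof -
    have "\<Union>(mesh \<Sigma> k) = \<Sigma>" "disjoint (mesh \<Sigma> k)" using mesh(2)[of k] by (simp_all add: partition_on_def)
    then show ?thesis using complex_measure_Union[OF \<nu>' mesh(1,3), of k] by simp
  qed
  then have "riemann \<Sigma> k \<nu> (\<lambda>_. c) = c * \<nu> \<Sigma>" for k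
    by (simp add: riemann_def sum_distrib_left[symmetric] mult.commute[of _ c])
  then show ?thesis unfolding cint_def by simp
qed

lemma cint_bound:
  assumes \<nu>: "\<nu> \<in> cmeas \<Sigma>" and f: "continuous_on \<Sigma> f" "\<And>x. x \<in> \<Sigma> \<Longrightarrow> cmod (f x) \<le> B" and B: "0 \<le> B"
  shows "cmod (cint \<Sigma> \<nu> f) \<le> tv \<Sigma> \<nu> * B"
proof (rule LIMSEQ_le_const2[OF tendsto_norm[OF cint_tendsto[OF \<nu> f(1)]]])
  have \<nu>': "\<nu> \<in> complex_measures (borel_of \<Sigma>)" using \<nu> by (simp add: cmeas_def)
  have "cmod (riemann \<Sigma> k \<nu> f) \<le> tv \<Sigma> \<nu> * B" for k
  proof -
    have "cmod (riemann \<Sigma> k \<nu> f) \<le> (\<Sum>A\<in>mesh \<Sigma> k. cmod (\<nu> A) * B)"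
      unfolding riemann_def norm_mult[symmetric]
      by (rule sum_norm_le) (use f(2) pt_mesh(2) in \<open>auto simp: norm_mult intro!: mult_left_mono\<close>)
    also have "\<dots> = (\<Sum>A\<in>mesh \<Sigma> k. cmod (\<nu> A)) * B" by (simp add: sum_distrib_right)
    also have "\<dots> \<le> tv \<Sigma> \<nu> * B"
      using mesh(1-3)[of k] B by (intro mult_right_mono sum_cmod_le_tv_norm[OF \<nu>']) (auto simp: space_base)
    finally show ?thesis .
  qed
  then show "\<exists>N. \<forall>k\<ge>N. cmod (riemann \<Sigma> k \<nu> f) \<le> tv \<Sigma> \<nu> * B" by blast
qed

lemma continuous_integrable:
  fixes f :: "'a \<Rightarrow> real"
  assumes \<mu>: "\<mu> \<in> Prob \<Sigma>" and f: "continuous_on \<Sigma> f"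
  shows "integrable \<mu> f"
proof -
  interpret prob_space \<mu> using \<mu> by (simp add: Prob_def)
  have sp: "space \<mu> = \<Sigma>" using \<mu> sets_eq_imp_space_eq[of \<mu> "borel_of \<Sigma>"] by (simp add: Prob_def space_base)
  have "bounded (f ` \<Sigma>)" using compact_continuous_image[OF f compact_base] by (rule compact_imp_bounded)
  then obtain B where "\<And>x. x \<in> \<Sigma> \<Longrightarrow> \<bar>f x\<bar> \<le> B" unfolding bounded_iff by auto
  moreover have "f \<in> borel_measurable \<mu>"
    using \<mu> borel_measurable_continuous_on_restrict[OF f]
    by (subst measurable_cong_sets[of \<mu> "borel_of \<Sigma>"]) (simp_all add: Prob_def)
  ultimately show ?thesis by (intro integrable_const_bound[of _ B] AE_I2) (simp_all add: sp)
qed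

lemma cint_prob:
  fixes f :: "'a \<Rightarrow> real"
  assumes \<mu>: "\<mu> \<in> Prob \<Sigma>" and f: "continuous_on \<Sigma> f"
  shows "cint \<Sigma> (cm_of \<mu>) (\<lambda>x. of_real (f x)) = of_real (\<integral>x. f x \<partial>\<mu>)"
proof (rule LIMSEQ_unique[OF cint_tendsto])
  show "cm_of \<mu> \<in> cmeas \<Sigma>" using cm_of_in_cmeas1[OF \<mu>] by (simp add: cmeas1_def)
  show "continuous_on \<Sigma> (\<lambda>x. complex_of_real (f x))" by (intro continuous_intros f)
  interpret prob_space \<mu> using \<mu> by (simp add: Prob_def)
  have sp: "space \<mu> = \<Sigma>" using \<mu> sets_eq_imp_space_eq[of \<mu> "borel_of \<Sigma>"] by (simp add: Prob_def space_base)
  have st: "sets \<mu> = sets (borel_of \<Sigma>)" using \<mu> by (simp add: Prob_def)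
  have fi: "integrable \<mu> f" by (rule continuous_integrable[OF \<mu> f])
  define g where "g k x = (\<Sum>A\<in>mesh \<Sigma> k. indicator A x * f (pt A))" for k x
  have mi: "A \<in> sets \<mu>" if "A \<in> mesh \<Sigma> k" for A k using mesh(3)[of k] that st by auto
  have gi: "integrable \<mu> (g k)" for k unfolding g_def
    using mi by (intro Bochner_Integration.integrable_sum integrable_mult_left)
      (auto simp: integrable_indicator_iff emeasure_eq_measure)
  have Eg: "(\<integral>x. g k x \<partial>\<mu>) = (\<Sum>A\<in>mesh \<Sigma> k. measure \<mu> A * f (pt A))" for k
    unfolding g_def using mi by (subst Bochner_Integration.integral_sum)
      (auto simp: integrable_indicator_iff emeasure_eq_measure intro!: sum.cong)
  have gk: "g k x = f (pt A)" if A: "A \<in> mesh \<Sigma> k" "x \<in> A" for k A x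
  proof -
    have "indicator B x * f (pt B) = (if B = A then f (pt A) else 0)" if "B \<in> mesh \<Sigma> k" for B
      using mesh(2)[of k] that A by (auto simp: indicator_def partition_on_def disjoint_def)
    then have "g k x = (\<Sum>B\<in>mesh \<Sigma> k. if B = A then f (pt A) else 0)" unfolding g_def by (intro sum.cong) auto
    then show ?thesis using mesh(1)[of k] A by simp
  qed
  have "(\<lambda>k. \<integral>x. g k x \<partial>\<mu>) \<longlonglongrightarrow> (\<integral>x. f x \<partial>\<mu>)"
  proof (rule LIMSEQ_I)
    fix e :: real assume e: "0 < e"
    have "uniformly_continuous_on \<Sigma> f" using f compact_base by (rule compact_uniformly_continuous)
    then obtain d where d: "d > 0" "\<And>x y. x \<in> \<Sigma> \<Longrightarrow> y \<in> \<Sigma> \<Longrightarrow> dist y x < d \<Longrightarrow> dist (f y) (f x) < e / 2"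
      using e unfolding uniformly_continuous_on_def by (metis half_gt_zero)
    obtain N :: nat where N: "1 / real (Suc N) < d" using d(1) nat_approx_posE by metis
    show "\<exists>N. \<forall>k\<ge>N. norm ((\<integral>x. g k x \<partial>\<mu>) - (\<integral>x. f x \<partial>\<mu>)) < e"
    proof (intro exI[of _ N] allI impI)
      fix k assume k: "k \<ge> N"
      have "1 / real (Suc k) \<le> 1 / real (Suc N)" using k by (auto intro!: divide_left_mono)
      then have small: "1 / real (Suc k) < d" using N by linarith
      have close: "\<bar>g k x - f x\<bar> \<le> e / 2" if x: "x \<in> \<Sigma>" for x
      proof -
        obtain A where A: "A \<in> mesh \<Sigma> k" "x \<in> A" using mesh(2)[of k] x by (auto simp: partition_on_def)
        have "dist (pt A) x < d" using mesh(4)[OF A(1) pt_mesh(1)[OF A(1)] A(2)] small by linarith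
        then have "dist (f (pt A)) (f x) < e / 2" using pt_mesh(2)[OF A(1)] x by (intro d(2))
        then show ?thesis using gk[OF A] by (simp add: dist_real_def)
      qed
      have "norm ((\<integral>x. g k x \<partial>\<mu>) - (\<integral>x. f x \<partial>\<mu>)) = \<bar>\<integral>x. g k x - f x \<partial>\<mu>\<bar>"
        using gi fi by simp
      also have "\<dots> \<le> (\<integral>x. \<bar>g k x - f x\<bar> \<partial>\<mu>)" by (rule integral_abs_bound)
      also have "\<dots> \<le> (\<integral>x. e / 2 \<partial>\<mu>)"
        using gi fi close by (intro integral_mono) (auto simp: sp)
      also have "\<dots> < e" using e by (simp add: prob_space)
      finally show "norm ((\<integral>x. g k x \<partial>\<mu>) - (\<integral>x. f x \<partial>\<mu>)) < e" .
    qed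
  qed
  then have "(\<lambda>k. complex_of_real (\<integral>x. g k x \<partial>\<mu>)) \<longlonglongrightarrow> of_real (\<integral>x. f x \<partial>\<mu>)" by (rule tendsto_of_real)
  then show "(\<lambda>k. riemann \<Sigma> k (cm_of \<mu>) (\<lambda>x. of_real (f x))) \<longlonglongrightarrow> of_real (\<integral>x. f x \<partial>\<mu>)"
    unfolding Eg by (simp add: riemann_def cm_of_def)
qed

text \<open>In contrast to \<open>cint_bound\<close>, the pointwise bound is averaged instead of
  being replaced by its supremum. This lets the contraction on average of
  \<open>\<rho>_contr\<close> act on complex-valued functions.\<close>

lemma cint_prob_bound:
  assumes \<mu>: "\<mu> \<in> Prob \<Sigma>" and f: "continuous_on \<Sigma> f" and g: "continuous_on \<Sigma> g"
    and le: "\<And>x. x \<in> \<Sigma> \<Longrightarrow> cmod (f x) \<le> g x"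
  shows "cmod (cint \<Sigma> (cm_of \<mu>) f) \<le> (\<integral>x. g x \<partial>\<mu>)"
proof -
  have c: "cm_of \<mu> \<in> cmeas \<Sigma>" using cm_of_in_cmeas1[OF \<mu>] by (simp add: cmeas1_def)
  have "(\<lambda>k. cmod (riemann \<Sigma> k (cm_of \<mu>) f)) \<longlonglongrightarrow> cmod (cint \<Sigma> (cm_of \<mu>) f)"
    by (intro tendsto_norm cint_tendsto c f)
  moreover have "(\<lambda>k. Re (riemann \<Sigma> k (cm_of \<mu>) (\<lambda>x. of_real (g x)))) \<longlonglongrightarrow> Re (cint \<Sigma> (cm_of \<mu>) (\<lambda>x. of_real (g x)))"
    by (intro tendsto_Re cint_tendsto c continuous_intros g)
  moreover have "cmod (riemann \<Sigma> k (cm_of \<mu>) f) \<le> Re (riemann \<Sigma> k (cm_of \<mu>) (\<lambda>x. of_real (g x)))" for k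
  proof -
    have "cmod (riemann \<Sigma> k (cm_of \<mu>) f) \<le> (\<Sum>A\<in>mesh \<Sigma> k. measure \<mu> A * g (pt A))"
      unfolding riemann_def
      by (rule sum_norm_le) (use le pt_mesh(2) in \<open>auto simp: norm_mult cm_of_def intro!: mult_left_mono\<close>)
    also have "\<dots> = Re (riemann \<Sigma> k (cm_of \<mu>) (\<lambda>x. of_real (g x)))" by (simp add: riemann_def cm_of_def)
    finally show ?thesis .
  qed
  ultimately have "cmod (cint \<Sigma> (cm_of \<mu>) f) \<le> Re (cint \<Sigma> (cm_of \<mu>) (\<lambda>x. of_real (g x)))"
    by (intro tendsto_le[OF sequentially_bot]) auto
  then show ?thesis by (simp add: cint_prob[OF \<mu> g])
qed

end

subsection \<open>Transfer operators of complex measures\<close>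

lemma tv_norm_triangle:
  assumes "\<nu> \<in> complex_measures M" "\<kappa> \<in> complex_measures M"
  shows "tv_norm M \<nu> \<le> tv_norm M (\<nu> - \<kappa>) + tv_norm M \<kappa>"
proof -
  have d: "\<nu> - \<kappa> \<in> complex_measures M" by (rule diff_in_complex_measures[OF assms])
  have "total_variation M \<nu> = total_variation M ((\<nu> - \<kappa>) - (0 - \<kappa>))" by simp
  also have "\<dots> \<le> total_variation M (\<nu> - \<kappa>) + total_variation M (0 - \<kappa>)" by (rule total_variation_diff)
  also have "total_variation M (0 - \<kappa>) = total_variation M \<kappa>"
    using total_variation_minus_commute[of M 0 \<kappa>] by simp
  finally have "total_variation M \<nu> \<le> total_variation M (\<nu> - \<kappa>) + total_variation M \<kappa>" .
  moreover have "total_variation M \<kappa> < \<infinity>" "total_variation M (\<nu> - \<kappa>) < \<infinity>"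
    using assms(2) d by (simp_all add: complex_measures_def)
  ultimately show ?thesis unfolding tv_norm_def
    by (subst enn2real_plus[symmetric]) (auto intro!: enn2real_mono)
qed

text \<open>A family of functions on \<open>X\<close> is controlled by its Lipschitz constants with respect to \<open>\<rho>\<close>,
  for which the transfer operator of \<open>\<mu>0\<close> is a contraction.\<close>

locale transfer = compact_base \<Sigma> for \<Sigma> :: "(real^'n^'n) set" +
  fixes \<mu>0 :: "(real^'n^'n) measure" and X :: "(real^'n) set" and \<rho> :: "(real^'n) \<times> (real^'n) \<Rightarrow> real"
    and \<Psi> :: "real^'n^'n \<Rightarrow> real^'n \<Rightarrow> real" and K \<kappa> M C :: real and u0 :: "real^'n"
  assumes \<mu>0: "\<mu>0 \<in> Prob \<Sigma>" and u0: "u0 \<in> X"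
    and act: "\<And>g u. g \<in> \<Sigma> \<Longrightarrow> u \<in> X \<Longrightarrow> g *v u \<in> X"
    and \<rho>_cont: "continuous_on (X \<times> X) \<rho>"
    and \<rho>_nonneg: "\<And>u v. u \<in> X \<Longrightarrow> v \<in> X \<Longrightarrow> 0 \<le> \<rho> (u, v)"
    and \<rho>_refl: "\<And>u. u \<in> X \<Longrightarrow> \<rho> (u, u) = 0"
    and \<rho>_le: "\<And>u v. u \<in> X \<Longrightarrow> v \<in> X \<Longrightarrow> \<rho> (u, v) \<le> M"
    and \<rho>_act: "\<And>g u v. g \<in> \<Sigma> \<Longrightarrow> u \<in> X \<Longrightarrow> v \<in> X \<Longrightarrow> \<rho> (g *v u, g *v v) \<le> K * \<rho> (u, v)"
    and \<rho>_contr: "\<And>u v. u \<in> X \<Longrightarrow> v \<in> X \<Longrightarrow> (\<integral>g. \<rho> (g *v u, g *v v) \<partial>\<mu>0) \<le> \<kappa> * \<rho> (u, v)"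
    and K: "1 \<le> K" and \<kappa>: "0 < \<kappa>" "\<kappa> < 1" and M: "0 \<le> M" and C: "0 \<le> C"
    and \<Psi>_cont: "\<And>u. u \<in> X \<Longrightarrow> continuous_on \<Sigma> (\<lambda>g. \<Psi> g u)"
    and \<Psi>_lip: "\<And>g u v. g \<in> \<Sigma> \<Longrightarrow> u \<in> X \<Longrightarrow> v \<in> X \<Longrightarrow> \<bar>\<Psi> g u - \<Psi> g v\<bar> \<le> C * \<rho> (u, v)"
    and \<Psi>_le: "\<And>g u. g \<in> \<Sigma> \<Longrightarrow> u \<in> X \<Longrightarrow> \<bar>\<Psi> g u\<bar> \<le> C"
begin

text \<open>The midpoint between the contraction factor of \<mu>0 and 1: half of the room is spent
  on perturbing the measure.\<close>

definition \<theta> :: real where "\<theta> = (1 + \<kappa>) / 2"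

lemma \<theta>: "0 < \<theta>" "\<theta> < 1" "\<kappa> < \<theta>"
  using \<kappa> by (auto simp: \<theta>_def)

definition lip :: "real \<Rightarrow> (real^'n \<Rightarrow> complex) \<Rightarrow> bool" where
  "lip L \<phi> \<longleftrightarrow> 0 \<le> L \<and> (\<forall>u\<in>X. \<forall>v\<in>X. cmod (\<phi> u - \<phi> v) \<le> L * \<rho> (u, v))"

definition Q :: "((real^'n^'n) set \<Rightarrow> complex) \<Rightarrow> (real^'n \<Rightarrow> complex) \<Rightarrow> real^'n \<Rightarrow> complex" where
  "Q \<nu> \<phi> u = cint \<Sigma> \<nu> (\<lambda>g. \<phi> (g *v u))"

definition psi :: "((real^'n^'n) set \<Rightarrow> complex) \<Rightarrow> real^'n \<Rightarrow> complex" where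
  "psi \<nu> u = cint \<Sigma> \<nu> (\<lambda>g. of_real (\<Psi> g u))"

text \<open>Integration against \<nu> - \<mu>0 contributes at most K * tv to the Lipschitz factor,
  so under this condition the factor \<kappa> of \<mu>0 becomes at most \<theta> < 1.\<close>

definition good :: "((real^'n^'n) set \<Rightarrow> complex) \<Rightarrow> bool" where
  "good \<nu> \<longleftrightarrow> \<nu> \<in> cmeas1 \<Sigma> \<and> K * tv \<Sigma> (\<nu> - cm_of \<mu>0) \<le> \<theta> - \<kappa>"

lemma lipD: "lip L \<phi> \<Longrightarrow> u \<in> X \<Longrightarrow> v \<in> X \<Longrightarrow> cmod (\<phi> u - \<phi> v) \<le> L * \<rho> (u, v)"
  by (simp add: lip_def)

lemma lip_nonneg: "lip L \<phi> \<Longrightarrow> 0 \<le> L"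
  by (simp add: lip_def)

lemma lip_le_M: "lip L \<phi> \<Longrightarrow> u \<in> X \<Longrightarrow> v \<in> X \<Longrightarrow> cmod (\<phi> u - \<phi> v) \<le> L * M"
  using lipD[of L \<phi> u v] \<rho>_le[of u v] mult_left_mono[of "\<rho> (u, v)" M L] lip_nonneg[of L \<phi>] by linarith

lemma lip_mono: "lip L \<phi> \<Longrightarrow> L \<le> L' \<Longrightarrow> lip L' \<phi>"
  unfolding lip_def using \<rho>_nonneg mult_right_mono by (meson order_trans)

lemma lip_add:
  assumes "lip L \<phi>" "lip L' \<phi>'"
  shows "lip (L + L') (\<lambda>u. \<phi> u + \<phi>' u)"
  unfolding lip_def
proof (intro conjI ballI)
  show "0 \<le> L + L'" using assms by (simp add: lip_def)
  fix u v assume uv: "u \<in> X" "v \<in> X"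
  have "cmod (\<phi> u + \<phi>' u - (\<phi> v + \<phi>' v)) \<le> cmod (\<phi> u - \<phi> v) + cmod (\<phi>' u - \<phi>' v)"
    by (rule norm_diff_triangle_ineq)
  also have "\<dots> \<le> L * \<rho> (u, v) + L' * \<rho> (u, v)" using assms uv by (intro add_mono lipD)
  finally show "cmod (\<phi> u + \<phi>' u - (\<phi> v + \<phi>' v)) \<le> (L + L') * \<rho> (u, v)" by (simp add: distrib_right)
qed

lemma lip_cmult: "lip L \<phi> \<Longrightarrow> lip (cmod c * L) (\<lambda>u. c * \<phi> u)"
  unfolding lip_def right_diff_distrib[symmetric] norm_mult by (auto simp: mult.assoc intro!: mult_left_mono)

lemma lip_const: "lip 0 (\<lambda>_. c)"
  by (simp add: lip_def)

lemma lip_continuous: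
  assumes \<phi>: "lip L \<phi>" and u: "u \<in> X"
  shows "continuous_on \<Sigma> (\<lambda>g. \<phi> (g *v u))"
  unfolding continuous_on_def
proof
  fix g' assume g': "g' \<in> \<Sigma>"
  have "continuous_on \<Sigma> (\<lambda>g. \<rho> (g *v u, g' *v u))"
    using act u g' by (intro continuous_on_compose2[OF \<rho>_cont] continuous_intros) auto
  then have "((\<lambda>g. \<rho> (g *v u, g' *v u)) \<longlongrightarrow> 0) (at g' within \<Sigma>)"
    using g' \<rho>_refl[OF act[OF g' u]] unfolding continuous_on_def by metis
  then have *: "((\<lambda>g. L * \<rho> (g *v u, g' *v u)) \<longlongrightarrow> 0) (at g' within \<Sigma>)"
    by (rule tendsto_mult_right_zero)
  have "((\<lambda>g. \<phi> (g *v u) - \<phi> (g' *v u)) \<longlongrightarrow> 0) (at g' within \<Sigma>)"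
    by (rule Lim_null_comparison[OF _ *])
      (use lipD[OF \<phi>] act u g' in \<open>auto simp: eventually_at_filter\<close>)
  then show "((\<lambda>g. \<phi> (g *v u)) \<longlongrightarrow> \<phi> (g' *v u)) (at g' within \<Sigma>)" by (simp add: Lim_null[symmetric])
qed

lemma cmeas1_cmeas: "\<nu> \<in> cmeas1 \<Sigma> \<Longrightarrow> \<nu> \<in> cmeas \<Sigma>" "\<nu> \<in> cmeas1 \<Sigma> \<Longrightarrow> \<nu> \<Sigma> = 1"
  by (simp_all add: cmeas1_def)

lemma cmeas0_cmeas: "\<nu> \<in> cmeas0 \<Sigma> \<Longrightarrow> \<nu> \<in> cmeas \<Sigma>" "\<nu> \<in> cmeas0 \<Sigma> \<Longrightarrow> \<nu> \<Sigma> = 0"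
  by (simp_all add: cmeas0_def)

lemma good_cmeas: "good \<nu> \<Longrightarrow> \<nu> \<in> cmeas \<Sigma>" "good \<nu> \<Longrightarrow> \<nu> \<Sigma> = 1" "good \<nu> \<Longrightarrow> \<nu> \<in> cmeas1 \<Sigma>"
  by (simp_all add: good_def cmeas1_def)

lemma good_\<mu>0: "good (cm_of \<mu>0)"
  using cm_of_in_cmeas1[OF \<mu>0] \<theta> by (simp add: good_def tv_norm_def total_variation_zero[unfolded zero_fun_def] zero_fun_def)

lemma Q_diff:
  assumes "\<nu> \<in> cmeas \<Sigma>" "lip L \<phi>" "u \<in> X" "v \<in> X"
  shows "Q \<nu> \<phi> u - Q \<nu> \<phi> v = cint \<Sigma> \<nu> (\<lambda>g. \<phi> (g *v u) - \<phi> (g *v v))"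
  unfolding Q_def using assms lip_continuous by (subst cint_diff) auto

lemma Q_lip_any:
  assumes h: "h \<in> cmeas \<Sigma>" and \<phi>: "lip L \<phi>"
  shows "lip (tv \<Sigma> h * K * L) (Q h \<phi>)"
  unfolding lip_def
proof (intro conjI ballI)
  have L: "0 \<le> L" using \<phi> by (rule lip_nonneg)
  show "0 \<le> tv \<Sigma> h * K * L" using K L by simp
  fix u v assume uv: "u \<in> X" "v \<in> X"
  have "cmod (cint \<Sigma> h (\<lambda>g. \<phi> (g *v u) - \<phi> (g *v v))) \<le> tv \<Sigma> h * (L * (K * \<rho> (u, v)))"
  proof (rule cint_bound[OF h])
    show "continuous_on \<Sigma> (\<lambda>g. \<phi> (g *v u) - \<phi> (g *v v))"
      using lip_continuous[OF \<phi>] uv by (intro continuous_intros) auto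
    show "cmod (\<phi> (g *v u) - \<phi> (g *v v)) \<le> L * (K * \<rho> (u, v))" if "g \<in> \<Sigma>" for g
      using act[OF that] uv L by (intro order_trans[OF lipD[OF \<phi>]] mult_left_mono \<rho>_act that) auto
  qed (use L K \<rho>_nonneg[OF uv] in auto)
  then show "cmod (Q h \<phi> u - Q h \<phi> v) \<le> tv \<Sigma> h * K * L * \<rho> (u, v)"
    by (simp add: Q_diff[OF h \<phi> uv] mult_ac)
qed

lemma Q_lip:
  assumes \<nu>: "good \<nu>" and \<phi>: "lip L \<phi>"
  shows "lip (\<theta> * L) (Q \<nu> \<phi>)"
  unfolding lip_def
proof (intro conjI ballI)
  have L: "0 \<le> L" using \<phi> by (rule lip_nonneg)
  show "0 \<le> \<theta> * L" using \<theta> L by simp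
  fix u v assume uv: "u \<in> X" "v \<in> X"
  let ?\<Delta> = "\<lambda>g. \<phi> (g *v u) - \<phi> (g *v v)"
  have c\<Delta>: "continuous_on \<Sigma> ?\<Delta>" using lip_continuous[OF \<phi>] uv by (intro continuous_intros) auto
  let ?m = "cm_of \<mu>0"
  have m: "?m \<in> cmeas1 \<Sigma>" by (rule cm_of_in_cmeas1[OF \<mu>0])
  have d: "\<nu> - ?m \<in> cmeas \<Sigma>" using diff_in_cmeas0[OF good_cmeas(3)[OF \<nu>] m] by (simp add: cmeas0_def)
  have "Q \<nu> \<phi> u - Q \<nu> \<phi> v = cint \<Sigma> (?m + (\<nu> - ?m)) ?\<Delta>"
    by (simp add: Q_diff[OF good_cmeas(1)[OF \<nu>] \<phi> uv])
  also have "\<dots> = cint \<Sigma> ?m ?\<Delta> + cint \<Sigma> (\<nu> - ?m) ?\<Delta>"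
    by (rule cint_measure_add[OF cmeas1_cmeas(1)[OF m] d c\<Delta>])
  finally have "cmod (Q \<nu> \<phi> u - Q \<nu> \<phi> v) \<le> cmod (cint \<Sigma> ?m ?\<Delta>) + cmod (cint \<Sigma> (\<nu> - ?m) ?\<Delta>)"
    by (simp add: norm_triangle_ineq)
  also have "cmod (cint \<Sigma> ?m ?\<Delta>) \<le> (\<integral>g. L * \<rho> (g *v u, g *v v) \<partial>\<mu>0)"
  proof (rule cint_prob_bound[OF \<mu>0 c\<Delta>])
    show "continuous_on \<Sigma> (\<lambda>g. L * \<rho> (g *v u, g *v v))"
      using act uv by (intro continuous_intros continuous_on_compose2[OF \<rho>_cont]) auto
  qed (use lipD[OF \<phi>] act uv in auto)
  also have "\<dots> \<le> L * (\<kappa> * \<rho> (u, v))" using \<rho>_contr[OF uv] L by (simp add: mult_left_mono)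
  also have "cmod (cint \<Sigma> (\<nu> - ?m) ?\<Delta>) \<le> tv \<Sigma> (\<nu> - ?m) * K * L * \<rho> (u, v)"
    using lipD[OF Q_lip_any[OF d \<phi>] uv] by (simp add: Q_diff[OF d \<phi> uv])
  also have "tv \<Sigma> (\<nu> - ?m) * K * L * \<rho> (u, v) \<le> (\<theta> - \<kappa>) * (L * \<rho> (u, v))"
    using \<nu> L \<rho>_nonneg[OF uv] unfolding good_def by (simp add: mult.assoc mult.commute[of _ K] mult.left_commute[of _ K] mult_right_mono flip: mult.assoc)
  also have "L * (\<kappa> * \<rho> (u, v)) + (\<theta> - \<kappa>) * (L * \<rho> (u, v)) = \<theta> * L * \<rho> (u, v)" by (simp add: algebra_simps)
  finally show "cmod (Q \<nu> \<phi> u - Q \<nu> \<phi> v) \<le> \<theta> * L * \<rho> (u, v)" by simp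
qed

lemma Q_cong: "(\<And>u. u \<in> X \<Longrightarrow> \<phi> u = \<phi>' u) \<Longrightarrow> u \<in> X \<Longrightarrow> Q \<nu> \<phi> u = Q \<nu> \<phi>' u"
  unfolding Q_def using act by (intro cint_cong) auto

lemma Q_add:
  assumes "\<nu> \<in> cmeas \<Sigma>" "lip L \<phi>" "lip L' \<phi>'" "u \<in> X"
  shows "Q \<nu> (\<lambda>u. \<phi> u + \<phi>' u) u = Q \<nu> \<phi> u + Q \<nu> \<phi>' u"
  unfolding Q_def using assms lip_continuous by (subst cint_add) auto

lemma Q_cmult:
  assumes "\<nu> \<in> cmeas \<Sigma>" "lip L \<phi>" "u \<in> X"
  shows "Q \<nu> (\<lambda>u. c * \<phi> u) u = c * Q \<nu> \<phi> u"
  unfolding Q_def using assms lip_continuous by (subst cint_cmult) auto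

lemma Q_const: "\<nu> \<in> cmeas \<Sigma> \<Longrightarrow> Q \<nu> (\<lambda>_. c) u = c * \<nu> \<Sigma>"
  unfolding Q_def by (rule cint_const)

text \<open>A constant may be subtracted from \<phi> before integrating, so only the oscillation L *
  M enters and not the size of \<phi>. Total mass 1 gives control of the increments of the iterates,
  total mass 0 gives \<open>Q_bound0\<close>.\<close>

lemma Q_minus_value:
  assumes \<nu>: "\<nu> \<in> cmeas \<Sigma>" and \<phi>: "lip L \<phi>" and uw: "u \<in> X" "w \<in> X"
  shows "cmod (Q \<nu> \<phi> u - \<phi> w * \<nu> \<Sigma>) \<le> tv \<Sigma> \<nu> * (L * M)"
proof -
  have "Q \<nu> \<phi> u - \<phi> w * \<nu> \<Sigma> = cint \<Sigma> \<nu> (\<lambda>g. \<phi> (g *v u) - \<phi> w)"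
    unfolding Q_def using \<nu> lip_continuous[OF \<phi> uw(1)] by (subst cint_diff) (auto simp: cint_const)
  also have "cmod \<dots> \<le> tv \<Sigma> \<nu> * (L * M)"
    using lip_continuous[OF \<phi> uw(1)] lip_le_M[OF \<phi>] act uw lip_nonneg[OF \<phi>] M
    by (intro cint_bound[OF \<nu>] continuous_intros) auto
  finally show ?thesis .
qed

lemma Q_bound0: "h \<in> cmeas0 \<Sigma> \<Longrightarrow> lip L \<phi> \<Longrightarrow> u \<in> X \<Longrightarrow> cmod (Q h \<phi> u) \<le> tv \<Sigma> h * (L * M)"
  using Q_minus_value[of h L \<phi> u u] by (simp add: cmeas0_cmeas)

lemma psi_bound: "\<nu> \<in> cmeas \<Sigma> \<Longrightarrow> u \<in> X \<Longrightarrow> cmod (psi \<nu> u) \<le> tv \<Sigma> \<nu> * C"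
  unfolding psi_def using \<Psi>_cont \<Psi>_le C by (intro cint_bound continuous_intros) auto

lemma psi_lip:
  assumes \<nu>: "\<nu> \<in> cmeas \<Sigma>"
  shows "lip (tv \<Sigma> \<nu> * C) (psi \<nu>)"
  unfolding lip_def
proof (intro conjI ballI)
  show "0 \<le> tv \<Sigma> \<nu> * C" using C by simp
  fix u v assume uv: "u \<in> X" "v \<in> X"
  have "psi \<nu> u - psi \<nu> v = cint \<Sigma> \<nu> (\<lambda>g. of_real (\<Psi> g u) - of_real (\<Psi> g v))"
    unfolding psi_def using \<nu> \<Psi>_cont uv by (subst cint_diff) (auto intro!: continuous_intros)
  also have "cmod \<dots> \<le> tv \<Sigma> \<nu> * (C * \<rho> (u, v))"
    using \<Psi>_cont \<Psi>_lip uv C \<rho>_nonneg[OF uv]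
    by (intro cint_bound[OF \<nu>] continuous_intros) (auto simp flip: of_real_diff)
  finally show "cmod (psi \<nu> u - psi \<nu> v) \<le> tv \<Sigma> \<nu> * C * \<rho> (u, v)" by (simp add: mult.assoc)
qed

lemma psi_add: "\<nu> \<in> cmeas \<Sigma> \<Longrightarrow> \<nu>' \<in> cmeas \<Sigma> \<Longrightarrow> u \<in> X \<Longrightarrow> psi (\<nu> + \<nu>') u = psi \<nu> u + psi \<nu>' u"
  unfolding psi_def using \<Psi>_cont by (intro cint_measure_add continuous_intros) auto

lemma psi_scale: "\<nu> \<in> cmeas \<Sigma> \<Longrightarrow> u \<in> X \<Longrightarrow> psi (\<lambda>A. c * \<nu> A) u = c * psi \<nu> u"
  unfolding psi_def using \<Psi>_cont by (intro cint_measure_scale continuous_intros) auto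

lemma Q_measure_add:
  "\<nu> \<in> cmeas \<Sigma> \<Longrightarrow> \<nu>' \<in> cmeas \<Sigma> \<Longrightarrow> lip L \<phi> \<Longrightarrow> u \<in> X \<Longrightarrow> Q (\<nu> + \<nu>') \<phi> u = Q \<nu> \<phi> u + Q \<nu>' \<phi> u"
  unfolding Q_def using lip_continuous by (intro cint_measure_add) auto

lemma Q_measure_scale: "\<nu> \<in> cmeas \<Sigma> \<Longrightarrow> lip L \<phi> \<Longrightarrow> u \<in> X \<Longrightarrow> Q (\<lambda>A. c * \<nu> A) \<phi> u = c * Q \<nu> \<phi> u"
  unfolding Q_def using lip_continuous by (intro cint_measure_scale) auto

section \<open>The invariant functional and the resolvent\<close>

abbreviation It :: "((real^'n^'n) set \<Rightarrow> complex) \<Rightarrow> nat \<Rightarrow> (real^'n \<Rightarrow> complex) \<Rightarrow> real^'n \<Rightarrow> complex" where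
  "It \<nu> m \<equiv> (Q \<nu> ^^ m)"

lemma It_lip: "good \<nu> \<Longrightarrow> lip L \<phi> \<Longrightarrow> lip (\<theta> ^ m * L) (It \<nu> m \<phi>)"
proof (induction m)
  case (Suc m)
  then show ?case using Q_lip[of \<nu> "\<theta> ^ m * L" "It \<nu> m \<phi>"] by (simp add: mult.assoc)
qed simp

lemma It_cong: "(\<And>u. u \<in> X \<Longrightarrow> \<phi> u = \<phi>' u) \<Longrightarrow> u \<in> X \<Longrightarrow> It \<nu> m \<phi> u = It \<nu> m \<phi>' u"
proof (induction m arbitrary: u)
  case (Suc m)
  then show ?case using Q_cong[of "It \<nu> m \<phi>" "It \<nu> m \<phi>'"] by simp
qed simp

lemma It_add:
  assumes \<nu>: "good \<nu>" and \<phi>: "lip L \<phi>" "lip L' \<phi>'" and u: "u \<in> X"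
  shows "It \<nu> m (\<lambda>u. \<phi> u + \<phi>' u) u = It \<nu> m \<phi> u + It \<nu> m \<phi>' u"
  using u
proof (induction m arbitrary: u)
  case (Suc m)
  have "Q \<nu> (It \<nu> m (\<lambda>u. \<phi> u + \<phi>' u)) u = Q \<nu> (\<lambda>u. It \<nu> m \<phi> u + It \<nu> m \<phi>' u) u"
    using Suc by (intro Q_cong) auto
  also have "\<dots> = Q \<nu> (It \<nu> m \<phi>) u + Q \<nu> (It \<nu> m \<phi>') u"
    by (rule Q_add[OF good_cmeas(1)[OF \<nu>] It_lip[OF \<nu> \<phi>(1)] It_lip[OF \<nu> \<phi>(2)] Suc.prems])
  finally show ?case by simp
qed simp

lemma It_cmult:
  assumes \<nu>: "good \<nu>" and \<phi>: "lip L \<phi>" and u: "u \<in> X"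
  shows "It \<nu> m (\<lambda>u. c * \<phi> u) u = c * It \<nu> m \<phi> u"
  using u
proof (induction m arbitrary: u)
  case (Suc m)
  have "Q \<nu> (It \<nu> m (\<lambda>u. c * \<phi> u)) u = Q \<nu> (\<lambda>u. c * It \<nu> m \<phi> u) u"
    using Suc by (intro Q_cong) auto
  also have "\<dots> = c * Q \<nu> (It \<nu> m \<phi>) u"
    by (rule Q_cmult[OF good_cmeas(1)[OF \<nu>] It_lip[OF \<nu> \<phi>] Suc.prems])
  finally show ?case by simp
qed simp

lemma summable_\<theta>: "summable (\<lambda>m. \<theta> ^ m * c)"
  using \<theta> by (intro summable_mult2 summable_geometric) auto

lemma suminf_\<theta>: "(\<Sum>m. \<theta> ^ m * c) = c / (1 - \<theta>)"
  using \<theta> by (subst suminf_mult2[symmetric]) (auto intro: summable_geometric simp: suminf_geometric)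

text \<open>For a probability measure this is integration against the stationary measure. For
  complex \<nu> the limit of the iterates takes its place, and \<open>It_pi\<close> shows that it is
  the same from every starting point.\<close>

definition pi :: "((real^'n^'n) set \<Rightarrow> complex) \<Rightarrow> (real^'n \<Rightarrow> complex) \<Rightarrow> complex" where
  "pi \<nu> \<phi> = lim (\<lambda>m. It \<nu> m \<phi> u0)"

text \<open>The increments of the iterates at u0 sum to at most L times tv * M / (1 - \<theta>), and
  moving from u0 to another point costs L * M.\<close>

definition pc :: "((real^'n^'n) set \<Rightarrow> complex) \<Rightarrow> real" where
  "pc \<nu> = M + tv \<Sigma> \<nu> * M / (1 - \<theta>)"

lemma pc_nonneg: "0 \<le> pc \<nu>"
  using M \<theta> by (simp add: pc_def)

lemma It_pi:
  assumes \<nu>: "good \<nu>" and \<phi>: "lip L \<phi>"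
  shows "u \<in> X \<Longrightarrow> (\<lambda>m. It \<nu> m \<phi> u) \<longlonglongrightarrow> pi \<nu> \<phi>" and "u \<in> X \<Longrightarrow> cmod (pi \<nu> \<phi> - \<phi> u) \<le> L * pc \<nu>"
proof -
  define d where "d m = It \<nu> (Suc m) \<phi> u0 - It \<nu> m \<phi> u0" for m
  have db: "cmod (d m) \<le> \<theta> ^ m * (tv \<Sigma> \<nu> * L * M)" for m
    using Q_minus_value[OF good_cmeas(1)[OF \<nu>] It_lip[OF \<nu> \<phi>, of m] u0 u0] good_cmeas(2)[OF \<nu>]
    by (simp add: d_def mult_ac)
  have sd: "summable (\<lambda>m. cmod (d m))" by (rule summable_comparison_test'[OF summable_\<theta>]) (use db in auto)
  have tel: "(\<Sum>i<m. d i) = It \<nu> m \<phi> u0 - \<phi> u0" for m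
    unfolding d_def by (subst sum_lessThan_telescope) simp
  have "(\<lambda>m. (\<Sum>i<m. d i) + \<phi> u0) \<longlonglongrightarrow> suminf d + \<phi> u0"
    by (intro tendsto_add summable_LIMSEQ summable_norm_cancel[OF sd] tendsto_const)
  then have l0: "(\<lambda>m. It \<nu> m \<phi> u0) \<longlonglongrightarrow> suminf d + \<phi> u0" by (simp add: tel)
  then have pi: "pi \<nu> \<phi> = suminf d + \<phi> u0" unfolding pi_def by (rule limI)
  have "cmod (suminf d) \<le> (\<Sum>m. cmod (d m))" by (rule summable_norm[OF sd])
  also have "\<dots> \<le> (\<Sum>m. \<theta> ^ m * (tv \<Sigma> \<nu> * L * M))" by (intro suminf_le db sd summable_\<theta>)
  also have "\<dots> = tv \<Sigma> \<nu> * L * M / (1 - \<theta>)" by (rule suminf_\<theta>)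
  finally have b0: "cmod (pi \<nu> \<phi> - \<phi> u0) \<le> tv \<Sigma> \<nu> * L * M / (1 - \<theta>)" by (simp add: pi)
  {
    assume u: "u \<in> X"
    have "(\<lambda>m. \<theta> ^ m * L * M) \<longlonglongrightarrow> 0 * L * M" using \<theta> by (intro tendsto_intros LIMSEQ_realpow_zero) auto
    then have *: "(\<lambda>m. \<theta> ^ m * L * M) \<longlonglongrightarrow> 0" by simp
    have "(\<lambda>m. It \<nu> m \<phi> u - It \<nu> m \<phi> u0) \<longlonglongrightarrow> 0"
      by (rule Lim_null_comparison[OF _ *]) (use lip_le_M[OF It_lip[OF \<nu> \<phi>] u u0] in simp)
    from tendsto_add[OF this l0] show "(\<lambda>m. It \<nu> m \<phi> u) \<longlonglongrightarrow> pi \<nu> \<phi>" by (simp add: pi)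
  }
  {
    assume u: "u \<in> X"
    have "cmod (pi \<nu> \<phi> - \<phi> u) \<le> cmod (pi \<nu> \<phi> - \<phi> u0) + cmod (\<phi> u0 - \<phi> u)"
      by (metis norm_diff_triangle_le order_refl)
    also have "\<dots> \<le> tv \<Sigma> \<nu> * L * M / (1 - \<theta>) + L * M" by (intro add_mono b0 lip_le_M[OF \<phi>] u u0)
    finally show "cmod (pi \<nu> \<phi> - \<phi> u) \<le> L * pc \<nu>" by (simp add: pc_def algebra_simps)
  }
qed

lemma pi_bound: "good \<nu> \<Longrightarrow> lip L \<phi> \<Longrightarrow> cmod (\<phi> u0) \<le> B \<Longrightarrow> cmod (pi \<nu> \<phi>) \<le> B + L * pc \<nu>"
  using It_pi(2)[of \<nu> L \<phi> u0, OF _ _ u0] norm_triangle_sub[of "pi \<nu> \<phi>" "\<phi> u0"] by fastforce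

lemma pi_cong: "(\<And>u. u \<in> X \<Longrightarrow> \<phi> u = \<phi>' u) \<Longrightarrow> pi \<nu> \<phi> = pi \<nu> \<phi>'"
  unfolding pi_def using It_cong[of \<phi> \<phi>' u0 _ \<nu>] u0 by simp

lemma pi_add:
  assumes "good \<nu>" "lip L \<phi>" "lip L' \<phi>'"
  shows "pi \<nu> (\<lambda>u. \<phi> u + \<phi>' u) = pi \<nu> \<phi> + pi \<nu> \<phi>'"
  using It_pi(1)[OF assms(1) lip_add[OF assms(2,3)] u0] tendsto_add[OF It_pi(1)[OF assms(1,2) u0] It_pi(1)[OF assms(1,3) u0]]
  by (simp add: It_add[OF assms u0] LIMSEQ_unique)

lemma pi_cmult:
  assumes "good \<nu>" "lip L \<phi>"
  shows "pi \<nu> (\<lambda>u. c * \<phi> u) = c * pi \<nu> \<phi>"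
  using It_pi(1)[OF assms(1) lip_cmult[OF assms(2), of c] u0] tendsto_mult_left[OF It_pi(1)[OF assms(1,2) u0], of c]
  by (simp add: It_cmult[OF assms u0] LIMSEQ_unique)

lemma pi_const: "good \<nu> \<Longrightarrow> pi \<nu> (\<lambda>_. c) = c"
  using It_pi(2)[OF _ lip_const u0, of \<nu> c] by simp

lemma pi_Q:
  assumes "good \<nu>" "lip L \<phi>"
  shows "pi \<nu> (Q \<nu> \<phi>) = pi \<nu> \<phi>"
proof -
  have "(\<lambda>m. It \<nu> (Suc m) \<phi> u0) \<longlonglongrightarrow> pi \<nu> \<phi>" by (rule LIMSEQ_Suc[OF It_pi(1)[OF assms u0]])
  moreover have "(\<lambda>m. It \<nu> m (Q \<nu> \<phi>) u0) \<longlonglongrightarrow> pi \<nu> (Q \<nu> \<phi>)" by (rule It_pi(1)[OF assms(1) Q_lip[OF assms] u0])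
  ultimately show ?thesis by (simp add: funpow_swap1 LIMSEQ_unique)
qed

text \<open>The Neumann series of 1 - Q fails to converge in general because Q fixes constants;
  subtracting the value at u0 removes this obstruction.\<close>

definition R :: "((real^'n^'n) set \<Rightarrow> complex) \<Rightarrow> (real^'n \<Rightarrow> complex) \<Rightarrow> real^'n \<Rightarrow> complex" where
  "R \<nu> \<phi> u = (\<Sum>m. It \<nu> m \<phi> u - It \<nu> m \<phi> u0)"

lemma R_summable:
  assumes \<nu>: "good \<nu>" and \<phi>: "lip L \<phi>" and uv: "u \<in> X" "v \<in> X"
  shows "summable (\<lambda>m. cmod (It \<nu> m \<phi> u - It \<nu> m \<phi> v))"
    "(\<Sum>m. cmod (It \<nu> m \<phi> u - It \<nu> m \<phi> v)) \<le> L / (1 - \<theta>) * \<rho> (u, v)"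
proof -
  have b: "cmod (It \<nu> m \<phi> u - It \<nu> m \<phi> v) \<le> \<theta> ^ m * (L * \<rho> (u, v))" for m
    using lipD[OF It_lip[OF \<nu> \<phi>] uv] by (simp add: mult.assoc)
  show s: "summable (\<lambda>m. cmod (It \<nu> m \<phi> u - It \<nu> m \<phi> v))"
    by (rule summable_comparison_test'[OF summable_\<theta>]) (use b in auto)
  have "(\<Sum>m. cmod (It \<nu> m \<phi> u - It \<nu> m \<phi> v)) \<le> (\<Sum>m. \<theta> ^ m * (L * \<rho> (u, v)))"
    by (intro suminf_le b s summable_\<theta>)
  then show "(\<Sum>m. cmod (It \<nu> m \<phi> u - It \<nu> m \<phi> v)) \<le> L / (1 - \<theta>) * \<rho> (u, v)" by (simp add: suminf_\<theta>)
qed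

lemma R_lip:
  assumes \<nu>: "good \<nu>" and \<phi>: "lip L \<phi>"
  shows "lip (L / (1 - \<theta>)) (R \<nu> \<phi>)"
  unfolding lip_def
proof (intro conjI ballI)
  show "0 \<le> L / (1 - \<theta>)" using lip_nonneg[OF \<phi>] \<theta> by simp
  fix u v assume uv: "u \<in> X" "v \<in> X"
  have "R \<nu> \<phi> u - R \<nu> \<phi> v = (\<Sum>m. It \<nu> m \<phi> u - It \<nu> m \<phi> v)"
    unfolding R_def using R_summable(1)[OF \<nu> \<phi> _ u0] uv
    by (subst suminf_diff) (auto intro: summable_norm_cancel)
  also have "cmod \<dots> \<le> (\<Sum>m. cmod (It \<nu> m \<phi> u - It \<nu> m \<phi> v))" by (rule summable_norm[OF R_summable(1)[OF \<nu> \<phi> uv]])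
  also have "\<dots> \<le> L / (1 - \<theta>) * \<rho> (u, v)" by (rule R_summable(2)[OF \<nu> \<phi> uv])
  finally show "cmod (R \<nu> \<phi> u - R \<nu> \<phi> v) \<le> L / (1 - \<theta>) * \<rho> (u, v)" .
qed

lemma R_cong: "(\<And>u. u \<in> X \<Longrightarrow> \<phi> u = \<phi>' u) \<Longrightarrow> u \<in> X \<Longrightarrow> R \<nu> \<phi> u = R \<nu> \<phi>' u"
  unfolding R_def using It_cong[of \<phi> \<phi>' _ _ \<nu>] u0 by simp

lemma R_add:
  assumes "good \<nu>" "lip L \<phi>" "lip L' \<phi>'" "u \<in> X"
  shows "R \<nu> (\<lambda>u. \<phi> u + \<phi>' u) u = R \<nu> \<phi> u + R \<nu> \<phi>' u"
  unfolding R_def using R_summable(1)[OF assms(1,2,4) u0] R_summable(1)[OF assms(1,3,4) u0]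
  by (subst suminf_add) (auto simp: It_add[OF assms(1-3)] assms(4) u0 algebra_simps intro: summable_norm_cancel)

lemma R_cmult:
  assumes "good \<nu>" "lip L \<phi>" "u \<in> X"
  shows "R \<nu> (\<lambda>u. c * \<phi> u) u = c * R \<nu> \<phi> u"
  unfolding R_def using R_summable(1)[OF assms(1-3) u0]
  by (subst suminf_mult[symmetric]) (auto simp: It_cmult[OF assms(1,2)] assms(3) u0 right_diff_distrib intro: summable_norm_cancel)

text \<open>\<open>R\<close> is the resolvent at 1, modulo constants.\<close>

lemma R_resolvent:
  assumes \<nu>: "good \<nu>" and \<phi>: "lip L \<phi>" and u: "u \<in> X"
  shows "R \<nu> \<phi> u - Q \<nu> (R \<nu> \<phi>) u = \<phi> u - pi \<nu> \<phi>"
proof -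
  define RN where "RN N v = (\<Sum>m<N. It \<nu> m \<phi> v + (- It \<nu> m \<phi> u0))" for N v
  have lm: "lip (\<theta> ^ m * L + 0) (\<lambda>v. It \<nu> m \<phi> v + (- It \<nu> m \<phi> u0))" for m
    by (intro lip_add It_lip \<nu> \<phi> lip_const)
  have RNl: "\<exists>L'. lip L' (RN N)" for N
  proof (induction N)
    case 0
    then show ?case using lip_const[of 0] by (auto simp: RN_def)
  next
    case (Suc N)
    then obtain L' where "lip L' (RN N)" by blast
    from lip_add[OF this lm[of N]] show ?case by (auto simp: RN_def)
  qed
  have QRN: "Q \<nu> (RN N) u = (\<Sum>m<N. It \<nu> (Suc m) \<phi> u - It \<nu> m \<phi> u0)" for N
  proof (induction N)
    case 0
    have "RN 0 = (\<lambda>_. 0)" by (simp add: RN_def fun_eq_iff)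
    then show ?case by (simp add: Q_const[OF good_cmeas(1)[OF \<nu>]])
  next
    case (Suc N)
    obtain L' where L': "lip L' (RN N)" using RNl by blast
    have "Q \<nu> (RN (Suc N)) u = Q \<nu> (\<lambda>v. RN N v + (It \<nu> N \<phi> v + (- It \<nu> N \<phi> u0))) u"
      by (rule arg_cong[of _ _ "\<lambda>f. Q \<nu> f u"]) (simp add: RN_def fun_eq_iff)
    also have "\<dots> = Q \<nu> (RN N) u + Q \<nu> (\<lambda>v. It \<nu> N \<phi> v + (- It \<nu> N \<phi> u0)) u"
      by (rule Q_add[OF good_cmeas(1)[OF \<nu>] L' lm u])
    also have "Q \<nu> (\<lambda>v. It \<nu> N \<phi> v + (- It \<nu> N \<phi> u0)) u = Q \<nu> (It \<nu> N \<phi>) u + Q \<nu> (\<lambda>_. - It \<nu> N \<phi> u0) u"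
      by (rule Q_add[OF good_cmeas(1)[OF \<nu>] It_lip[OF \<nu> \<phi>] lip_const u])
    finally show ?case using Suc by (simp add: Q_const[OF good_cmeas(1)[OF \<nu>]] good_cmeas(2)[OF \<nu>])
  qed
  \<comment> \<open>The estimate is uniform in v, so that convergence of the partial sums survives
    the integration inside Q.\<close>
  have tail: "cmod (R \<nu> \<phi> v - RN N v) \<le> \<theta> ^ N * (L * M / (1 - \<theta>))" if v: "v \<in> X" for v N
  proof -
    have s: "summable (\<lambda>m. cmod (It \<nu> m \<phi> v - It \<nu> m \<phi> u0))" by (rule R_summable(1)[OF \<nu> \<phi> v u0])
    have "R \<nu> \<phi> v - RN N v = (\<Sum>m. It \<nu> (m + N) \<phi> v - It \<nu> (m + N) \<phi> u0)"
      unfolding R_def RN_def using suminf_split_initial_segment[OF summable_norm_cancel[OF s], of N] by simp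
    also have "cmod \<dots> \<le> (\<Sum>m. cmod (It \<nu> (m + N) \<phi> v - It \<nu> (m + N) \<phi> u0))"
      by (rule summable_norm) (rule summable_ignore_initial_segment[OF s])
    also have "\<dots> \<le> (\<Sum>m. \<theta> ^ m * (\<theta> ^ N * L * M))"
    proof (intro suminf_le summable_ignore_initial_segment[OF s] summable_\<theta>)
      show "cmod (It \<nu> (m + N) \<phi> v - It \<nu> (m + N) \<phi> u0) \<le> \<theta> ^ m * (\<theta> ^ N * L * M)" for m
        using lip_le_M[OF It_lip[OF \<nu> \<phi>, of "m + N"] v u0] by (simp add: power_add mult.assoc)
    qed
    also have "\<dots> = \<theta> ^ N * (L * M / (1 - \<theta>))" by (simp add: suminf_\<theta>)
    finally show ?thesis .
  qed
  have z: "(\<lambda>N. \<theta> ^ N * c) \<longlonglongrightarrow> 0" for c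
    using tendsto_mult_left_zero[OF LIMSEQ_realpow_zero[of \<theta>]] \<theta> by simp
  have l1: "(\<lambda>N. RN N u) \<longlonglongrightarrow> R \<nu> \<phi> u"
  proof (rule Lim_transform_eq[THEN iffD1, OF _ tendsto_const])
    show "(\<lambda>N. R \<nu> \<phi> u - RN N u) \<longlonglongrightarrow> 0"
      by (rule Lim_null_comparison[OF always_eventually[OF allI[OF tail[OF u]]] z])
  qed
  have l2: "(\<lambda>N. Q \<nu> (RN N) u) \<longlonglongrightarrow> Q \<nu> (R \<nu> \<phi>) u"
  proof (rule Lim_transform_eq[THEN iffD1, OF _ tendsto_const])
    show "(\<lambda>N. Q \<nu> (R \<nu> \<phi>) u - Q \<nu> (RN N) u) \<longlonglongrightarrow> 0"
    proof (rule Lim_null_comparison[OF _ z[of "tv \<Sigma> \<nu> * (L * M / (1 - \<theta>))"]])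
      have "cmod (Q \<nu> (R \<nu> \<phi>) u - Q \<nu> (RN N) u) \<le> \<theta> ^ N * (tv \<Sigma> \<nu> * (L * M / (1 - \<theta>)))" for N
      proof -
        obtain L' where L': "lip L' (RN N)" using RNl by blast
        have c: "continuous_on \<Sigma> (\<lambda>g. R \<nu> \<phi> (g *v u))" "continuous_on \<Sigma> (\<lambda>g. RN N (g *v u))"
          using lip_continuous[OF R_lip[OF \<nu> \<phi>] u] lip_continuous[OF L' u] by auto
        have "Q \<nu> (R \<nu> \<phi>) u - Q \<nu> (RN N) u = cint \<Sigma> \<nu> (\<lambda>g. R \<nu> \<phi> (g *v u) - RN N (g *v u))"
          unfolding Q_def by (rule cint_diff[symmetric, OF good_cmeas(1)[OF \<nu>] c])
        also have "cmod \<dots> \<le> tv \<Sigma> \<nu> * (\<theta> ^ N * (L * M / (1 - \<theta>)))"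
          using c tail act u \<theta> lip_nonneg[OF \<phi>] M
          by (intro cint_bound[OF good_cmeas(1)[OF \<nu>]] continuous_intros) auto
        finally show ?thesis by (simp add: mult_ac)
      qed
      then show "\<forall>\<^sub>F N in sequentially. cmod (Q \<nu> (R \<nu> \<phi>) u - Q \<nu> (RN N) u) \<le> \<theta> ^ N * (tv \<Sigma> \<nu> * (L * M / (1 - \<theta>)))"
        by simp
    qed
  qed
  have "RN N u - Q \<nu> (RN N) u = \<phi> u - It \<nu> N \<phi> u" for N
  proof -
    have "RN N u - Q \<nu> (RN N) u = (\<Sum>m<N. It \<nu> m \<phi> u - It \<nu> (Suc m) \<phi> u)"
      unfolding QRN RN_def sum_subtractf[symmetric] by (rule sum.cong) simp_all
    also have "\<dots> = \<phi> u - It \<nu> N \<phi> u" by (subst sum_lessThan_telescope') simp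
    finally show ?thesis .
  qed
  then have "(\<lambda>N. \<phi> u - It \<nu> N \<phi> u) \<longlonglongrightarrow> R \<nu> \<phi> u - Q \<nu> (R \<nu> \<phi>) u"
    using tendsto_diff[OF l1 l2] by simp
  moreover have "(\<lambda>N. \<phi> u - It \<nu> N \<phi> u) \<longlonglongrightarrow> \<phi> u - pi \<nu> \<phi>"
    by (intro tendsto_diff tendsto_const It_pi(1)[OF \<nu> \<phi> u])
  ultimately show ?thesis by (rule LIMSEQ_unique)
qed

text \<open>Apply the functional of \<nu>' to the identity R - Q \<nu> R = \<phi> - pi \<nu> \<phi>.
  Writing Q \<nu> as Q \<nu>' minus the operator of the difference, the invariance of the functional
  under Q \<nu>' cancels R and leaves only the difference term.\<close>

lemma pi_perturb:
  assumes \<nu>: "good \<nu>" and \<nu>': "good \<nu>'" and \<phi>: "lip L \<phi>"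
  shows "pi \<nu>' \<phi> = pi \<nu> \<phi> + pi \<nu>' (Q (\<nu>' - \<nu>) (R \<nu> \<phi>))"
proof -
  define h where "h = \<nu>' - \<nu>"
  have h: "h \<in> cmeas \<Sigma>"
    unfolding h_def using diff_in_cmeas0[OF good_cmeas(3)[OF \<nu>'] good_cmeas(3)[OF \<nu>]] by (simp add: cmeas0_def)
  let ?f = "R \<nu> \<phi>"
  have f: "lip (L / (1 - \<theta>)) ?f" by (rule R_lip[OF \<nu> \<phi>])
  have hf: "lip (tv \<Sigma> h * K * (L / (1 - \<theta>))) (Q h ?f)" by (rule Q_lip_any[OF h f])
  have pt: "?f u + pi \<nu> \<phi> = (Q \<nu>' ?f u + \<phi> u) + (- 1) * Q h ?f u" if u: "u \<in> X" for u
  proof -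
    have "\<nu>' = \<nu> + h" by (simp add: h_def)
    then have "Q \<nu>' ?f u = Q \<nu> ?f u + Q h ?f u"
      using Q_measure_add[OF good_cmeas(1)[OF \<nu>] h f u] by simp
    then show ?thesis using R_resolvent[OF \<nu> \<phi> u] by (simp add: algebra_simps)
  qed
  have "pi \<nu>' ?f + pi \<nu> \<phi> = pi \<nu>' (\<lambda>u. ?f u + pi \<nu> \<phi>)"
    by (simp add: pi_add[OF \<nu>' f lip_const] pi_const[OF \<nu>'])
  also have "\<dots> = pi \<nu>' (\<lambda>u. (Q \<nu>' ?f u + \<phi> u) + (- 1) * Q h ?f u)" by (rule pi_cong[OF pt])
  also have "\<dots> = pi \<nu>' (\<lambda>u. Q \<nu>' ?f u + \<phi> u) + pi \<nu>' (\<lambda>u. (- 1) * Q h ?f u)"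
    by (rule pi_add[OF \<nu>' lip_add[OF Q_lip[OF \<nu>' f] \<phi>] lip_cmult[OF hf]])
  also have "\<dots> = pi \<nu>' ?f + pi \<nu>' \<phi> + (- 1) * pi \<nu>' (Q h ?f)"
    by (simp only: pi_add[OF \<nu>' Q_lip[OF \<nu>' f] \<phi>] pi_cmult[OF \<nu>' hf] pi_Q[OF \<nu>' f])
  finally show ?thesis unfolding h_def[symmetric] by simp
qed

end

subsection \<open>Bounded multilinear maps and power series\<close>

text \<open>The arguments are exchanged one at a time. Consecutive hybrids of v and w differ in one
  slot, where additivity turns the difference of values into a value at w k - v k, and the bound
  applies.\<close>

lemma bounded_multilinear_continuous:
  fixes T :: "(nat \<Rightarrow> 'b \<Rightarrow> complex) \<Rightarrow> complex"
  assumes MS: "Metric_space E (norm_dist N)" and diff: "\<And>x y. x \<in> E \<Longrightarrow> y \<in> E \<Longrightarrow> x - y \<in> E"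
    and N: "\<And>x. 0 \<le> N x" "\<And>x y. x \<in> E \<Longrightarrow> y \<in> E \<Longrightarrow> N x \<le> N (x - y) + N y"
    and add: "\<And>v i x y. v \<in> {..<n} \<rightarrow>\<^sub>E E \<Longrightarrow> i < n \<Longrightarrow> x \<in> E \<Longrightarrow> y \<in> E \<Longrightarrow>
      T (v(i := x + y)) = T (v(i := x)) + T (v(i := y))"
    and bound: "\<And>v. v \<in> {..<n} \<rightarrow>\<^sub>E E \<Longrightarrow> cmod (T v) \<le> D * (\<Prod>j<n. N (v j))" and D: "0 \<le> D"
  shows "continuous_map (product_topology (\<lambda>_. norm_topology E N) {..<n}) euclidean T"
proof -
  interpret Metric_space E "norm_dist N" by (rule MS)
  have top: "topspace (product_topology (\<lambda>_. norm_topology E N) {..<n}) = {..<n} \<rightarrow>\<^sub>E E"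
    by (simp add: norm_topology_def)
  have "\<exists>U. openin (product_topology (\<lambda>_. norm_topology E N) {..<n}) U \<and> v \<in> U \<and> (\<forall>w\<in>U. T w \<in> ball (T v) \<epsilon>)"
    if v: "v \<in> {..<n} \<rightarrow>\<^sub>E E" and \<epsilon>: "\<epsilon> > 0" for v \<epsilon>
  proof -
    define B where "B = (\<Sum>j<n. N (v j)) + 1"
    have B1: "1 \<le> B" unfolding B_def using N(1) by (simp add: sum_nonneg)
    have vB: "N (v j) + 1 \<le> B" if "j < n" for j
      unfolding B_def using member_le_sum[of j "{..<n}" "\<lambda>j. N (v j)"] N(1) that by simp
    define c where "c = real n * (D * B ^ n) + 1"
    have c: "c > 0" unfolding c_def using D B1 by (simp add: add_nonneg_pos)
    define \<eta> where "\<eta> = min 1 (\<epsilon> / c)"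
    have \<eta>: "\<eta> > 0" "\<eta> \<le> 1" using \<epsilon> c by (auto simp: \<eta>_def)
    define U where "U = (\<Pi>\<^sub>E j\<in>{..<n}. mball (v j) \<eta>)"
    have "openin (product_topology (\<lambda>_. norm_topology E N) {..<n}) U"
      unfolding U_def norm_topology_def by (subst openin_PiE) auto
    moreover have "v \<in> U" unfolding U_def using v \<eta> by (auto simp: PiE_iff)
    moreover have "T w \<in> ball (T v) \<epsilon>" if w: "w \<in> U" for w
    proof -
      have wE: "w \<in> {..<n} \<rightarrow>\<^sub>E E" using w by (auto simp: U_def PiE_iff)
      have close: "N (w j - v j) < \<eta>" if "j < n" for j
      proof -
        have "w j \<in> mball (v j) \<eta>" using PiE_mem[OF w[unfolded U_def], of j] that by simp
        then have "norm_dist N (v j) (w j) < \<eta>" by (simp only: in_mball)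
        then have "norm_dist N (w j) (v j) < \<eta>" by (simp only: commute[of "w j" "v j"])
        then show ?thesis by (simp only: norm_dist_def)
      qed
      have wB: "N (w j) \<le> B" if "j < n" for j
        using N(2)[of "w j" "v j"] close[OF that] vB[OF that] \<eta> v wE that by (auto simp: PiE_iff)
      define hyb where "hyb k = (\<lambda>j\<in>{..<n}. if j < k then w j else v j)" for k
      have hybE: "hyb k \<in> {..<n} \<rightarrow>\<^sub>E E" for k using v wE by (auto simp: hyb_def PiE_iff)
      have h0: "hyb 0 = v" using v by (auto simp: hyb_def PiE_iff extensional_def fun_eq_iff)
      have hn: "hyb n = w" using wE by (auto simp: hyb_def PiE_iff extensional_def fun_eq_iff)
      have step: "cmod (T (hyb (Suc k)) - T (hyb k)) \<le> D * B ^ n * \<eta>" if k: "k < n" for k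
      proof -
        have e1: "hyb (Suc k) = (hyb k)(k := (w k - v k) + v k)"
          using k by (auto simp: hyb_def fun_eq_iff less_Suc_eq)
        have e2: "hyb k = (hyb k)(k := v k)" using k by (auto simp: hyb_def fun_eq_iff)
        have kE: "w k \<in> E" "v k \<in> E" using v wE k by (auto simp: PiE_iff)
        have "T (hyb (Suc k)) = T ((hyb k)(k := w k - v k)) + T (hyb k)"
          using add[OF hybE k diff[OF kE] kE(2), of k] e1 e2 by simp
        then have "cmod (T (hyb (Suc k)) - T (hyb k)) = cmod (T ((hyb k)(k := w k - v k)))" by simp
        also have "\<dots> \<le> D * (\<Prod>j<n. N (((hyb k)(k := w k - v k)) j))"
          using hybE[of k] diff[OF kE] k by (intro bound) (auto simp: PiE_iff extensional_def)
        finally have T: "cmod (T (hyb (Suc k)) - T (hyb k)) \<le> D * (\<Prod>j<n. N (((hyb k)(k := w k - v k)) j))" .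
        have "(\<Prod>j<n. N (((hyb k)(k := w k - v k)) j)) = N (w k - v k) * (\<Prod>j\<in>{..<n} - {k}. N (hyb k j))"
          using k by (subst prod.remove[of _ k]) auto
        also have "\<dots> \<le> \<eta> * (\<Prod>j\<in>{..<n} - {k}. B)"
        proof (intro mult_mono prod_mono conjI N(1) prod_nonneg)
          show "N (hyb k j) \<le> B" if "j \<in> {..<n} - {k}" for j
            using that wB vB[of j] by (auto simp: hyb_def)
        qed (use close[OF k] \<eta> N(1) in auto)
        also have "\<dots> \<le> \<eta> * B ^ n"
          using B1 \<eta> k by (intro mult_left_mono) (auto intro!: power_increasing)
        finally have "D * (\<Prod>j<n. N (((hyb k)(k := w k - v k)) j)) \<le> D * (\<eta> * B ^ n)"
          using D by (rule mult_left_mono)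
        with T show ?thesis by (simp add: mult_ac)
      qed
      have "T w - T v = (\<Sum>k<n. T (hyb (Suc k)) - T (hyb k))"
        by (subst sum_lessThan_telescope) (simp add: h0 hn)
      also have "cmod \<dots> \<le> (\<Sum>k<n. D * B ^ n * \<eta>)" by (intro sum_norm_le step) simp
      also have "\<dots> = real n * (D * B ^ n) * \<eta>" by simp
      also have "\<dots> < c * \<eta>" unfolding c_def using \<eta> by (simp add: distrib_right)
      also have "\<dots> \<le> \<epsilon>" using c \<epsilon> by (simp add: \<eta>_def min_def field_simps)
      finally show ?thesis by (simp add: dist_norm norm_minus_commute)
    qed
    ultimately show ?thesis by blast
  qed
  then have "continuous_map (product_topology (\<lambda>_. norm_topology E N) {..<n}) Met_TC.mtopology T"
    unfolding Met_TC.continuous_map_to_metric top by simp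
  then show ?thesis by simp
qed

text \<open>The terms of the perturbation series depend on the order of their arguments, while
  holomorphy is defined by symmetric maps. Averaging over permutations preserves linearity in each
  slot and the bound.\<close>

lemma symmetrization_cont_sym_multilinear:
  fixes T :: "(nat \<Rightarrow> 'b \<Rightarrow> complex) \<Rightarrow> complex"
  assumes MS: "Metric_space E (norm_dist N)" and diff: "\<And>x y. x \<in> E \<Longrightarrow> y \<in> E \<Longrightarrow> x - y \<in> E"
    and N: "\<And>x. 0 \<le> N x" "\<And>x y. x \<in> E \<Longrightarrow> y \<in> E \<Longrightarrow> N x \<le> N (x - y) + N y"
    and add: "\<And>v i x y. (\<And>j. j < n \<Longrightarrow> v j \<in> E) \<Longrightarrow> i < n \<Longrightarrow> x \<in> E \<Longrightarrow> y \<in> E \<Longrightarrow>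
      T (v(i := x + y)) = T (v(i := x)) + T (v(i := y))"
    and scale: "\<And>v i x c. (\<And>j. j < n \<Longrightarrow> v j \<in> E) \<Longrightarrow> i < n \<Longrightarrow> x \<in> E \<Longrightarrow>
      T (v(i := (\<lambda>b. c * x b))) = c * T (v(i := x))"
    and bound: "\<And>v. (\<And>j. j < n \<Longrightarrow> v j \<in> E) \<Longrightarrow> cmod (T v) \<le> D * (\<Prod>j<n. N (v j))" and D: "0 \<le> D"
  shows "cont_sym_multilinear E N n (\<lambda>v. (\<Sum>p | p permutes {..<n}. T (v \<circ> p)) / fact n)"
proof -
  let ?P = "{p. p permutes {..<n}}"
  define S where "S v = (\<Sum>p\<in>?P. T (v \<circ> p)) / fact n" for v
  have upd: "(v(i := z)) \<circ> p = (v \<circ> p)(inv p i := z)" if "p permutes {..<n}" for v :: "nat \<Rightarrow> 'b \<Rightarrow> complex" and i z p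
    using permutes_inverses[OF that] by (auto simp: fun_eq_iff)
  have inv_less: "inv p i < n" if "p permutes {..<n}" "i < n" for p i
    using permutes_in_image[OF permutes_inv[OF that(1)], of i] that(2) by simp
  have vp: "(v \<circ> p) j \<in> E" if "v \<in> {..<n} \<rightarrow>\<^sub>E E" "p permutes {..<n}" "j < n" for v p j
    using permutes_in_image[OF that(2), of j] that by (auto simp: PiE_iff)
  have Sadd: "S (v(i := x + y)) = S (v(i := x)) + S (v(i := y))"
    if v: "v \<in> {..<n} \<rightarrow>\<^sub>E E" and i: "i < n" and xy: "x \<in> E" "y \<in> E" for v i x y
  proof -
    have "T (v(i := x + y) \<circ> p) = T (v(i := x) \<circ> p) + T (v(i := y) \<circ> p)" if "p \<in> ?P" for p
    proof -
      have p: "p permutes {..<n}" using that by simp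
      show ?thesis unfolding upd[OF p] by (rule add[OF vp[OF v p] inv_less[OF p i] xy])
    qed
    then show ?thesis by (simp add: S_def sum.distrib add_divide_distrib)
  qed
  have Sscale: "S (v(i := (\<lambda>b. c * x b))) = c * S (v(i := x))"
    if v: "v \<in> {..<n} \<rightarrow>\<^sub>E E" and i: "i < n" and x: "x \<in> E" for v i x c
  proof -
    have "T (v(i := (\<lambda>b. c * x b)) \<circ> p) = c * T (v(i := x) \<circ> p)" if "p \<in> ?P" for p
    proof -
      have p: "p permutes {..<n}" using that by simp
      show ?thesis unfolding upd[OF p] by (rule scale[OF vp[OF v p] inv_less[OF p i] x])
    qed
    then show ?thesis by (simp add: S_def sum_distrib_left)
  qed
  have Ssym: "S (v \<circ> q) = S v" if "q permutes {..<n}" for v q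
    unfolding S_def using setum_permutations_compose_left[OF that, of "\<lambda>p. T (v \<circ> p)"] by (simp add: o_assoc)
  have Sbound: "cmod (S v) \<le> D * (\<Prod>j<n. N (v j))" if v: "v \<in> {..<n} \<rightarrow>\<^sub>E E" for v
  proof -
    have "cmod (\<Sum>p\<in>?P. T (v \<circ> p)) \<le> (\<Sum>p\<in>?P. D * (\<Prod>j<n. N (v j)))"
    proof (rule sum_norm_le)
      fix p assume "p \<in> ?P"
      then have p: "p permutes {..<n}" by simp
      have "cmod (T (v \<circ> p)) \<le> D * (\<Prod>j<n. N ((v \<circ> p) j))" by (rule bound[OF vp[OF v p]])
      also have "(\<Prod>j<n. N ((v \<circ> p) j)) = (\<Prod>j<n. N (v j))"
        using prod.permute[OF p, of "\<lambda>j. N (v j)"] by (simp add: o_def)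
      finally show "cmod (T (v \<circ> p)) \<le> D * (\<Prod>j<n. N (v j))" .
    qed
    also have "\<dots> = fact n * (D * (\<Prod>j<n. N (v j)))" by (simp add: card_permutations[OF refl])
    finally show ?thesis by (simp add: S_def norm_divide divide_le_eq mult.commute)
  qed
  have "continuous_map (product_topology (\<lambda>_. norm_topology E N) {..<n}) euclidean S"
    using MS diff N Sadd Sbound D by (rule bounded_multilinear_continuous)
  then show ?thesis unfolding cont_sym_multilinear_def S_def[symmetric]
    using Sadd Sscale Ssym by blast
qed

section \<open>The perturbation series of the top rate\<close>

context transfer
begin

text \<open>The term of the series in the directions h1, ..., hn is Q h1 R Q h2 R ... applied to Q
  hn R psi + psi hn. The innermost factor has an extra summand because the integrand psi depends
  linearly on the measure too.\<close>

primrec Tl :: "((real^'n^'n) set \<Rightarrow> complex) \<Rightarrow> ((real^'n^'n) set \<Rightarrow> complex) list \<Rightarrow> real^'n \<Rightarrow> complex" where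
  "Tl \<nu> [] = psi \<nu>"
| "Tl \<nu> (h # hs) = (\<lambda>u. Q h (R \<nu> (Tl \<nu> hs)) u + (if hs = [] then psi h u else 0))"

text \<open>The cost of one more direction h, per unit of its variation: R divides by 1 - \<theta>,
  the operator of h contributes K to the Lipschitz constant or M to the supremum, and 1 pays for the
  summand psi h. The summand 1 in \<open>c0\<close> ensures C \<le> \<open>c0\<close>, which makes
  the last payment possible.\<close>

definition A :: real where "A = (K + M) / (1 - \<theta>) + 1"

definition c0 :: "((real^'n^'n) set \<Rightarrow> complex) \<Rightarrow> real" where "c0 \<nu> = C * (tv \<Sigma> \<nu> + 1)"

lemma A_nonneg: "0 \<le> A" and c0_nonneg: "0 \<le> c0 \<nu>"
  using K M \<theta> C by (simp_all add: A_def c0_def)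

lemma Tl_bounds:
  assumes \<nu>: "good \<nu>" and hs: "set hs \<subseteq> cmeas0 \<Sigma>"
  shows "lip (c0 \<nu> * (\<Prod>h\<leftarrow>hs. A * tv \<Sigma> h)) (Tl \<nu> hs)
    \<and> (\<forall>u\<in>X. cmod (Tl \<nu> hs u) \<le> c0 \<nu> * (\<Prod>h\<leftarrow>hs. A * tv \<Sigma> h))"
  using hs
proof (induction hs)
  case Nil
  have "tv \<Sigma> \<nu> * C \<le> c0 \<nu>" using C by (simp add: c0_def algebra_simps)
  then show ?case
    using psi_lip[OF good_cmeas(1)[OF \<nu>]] psi_bound[OF good_cmeas(1)[OF \<nu>]]
    by (auto intro: lip_mono order_trans)
next
  case (Cons h hs)
  define c where "c = c0 \<nu> * (\<Prod>h\<leftarrow>hs. A * tv \<Sigma> h)"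
  have h: "h \<in> cmeas0 \<Sigma>" and hs: "set hs \<subseteq> cmeas0 \<Sigma>" using Cons.prems by auto
  have l: "lip c (Tl \<nu> hs)" unfolding c_def using Cons.IH[OF hs] by blast
  have c: "0 \<le> c" by (rule lip_nonneg[OF l])
  have lR: "lip (c / (1 - \<theta>)) (R \<nu> (Tl \<nu> hs))" by (rule R_lip[OF \<nu> l])
  have Cc: "hs = [] \<Longrightarrow> C \<le> c" using C by (simp add: c_def c0_def algebra_simps)
  have th: "0 \<le> tv \<Sigma> h" by simp
  have target: "c0 \<nu> * (\<Prod>h\<leftarrow>h # hs. A * tv \<Sigma> h) = tv \<Sigma> h * (c * A)" by (simp add: c_def mult_ac)
  have le1: "tv \<Sigma> h * K * (c / (1 - \<theta>)) + (if hs = [] then tv \<Sigma> h * C else 0) \<le> tv \<Sigma> h * (c * A)"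
  proof -
    have "K * (c / (1 - \<theta>)) + (if hs = [] then C else 0) \<le> c * (K / (1 - \<theta>)) + c"
      using Cc c by (auto simp: mult.commute[of K])
    also have "\<dots> \<le> c * A" using c M \<theta> by (simp add: A_def add_divide_distrib distrib_left)
    finally have "tv \<Sigma> h * (K * (c / (1 - \<theta>)) + (if hs = [] then C else 0)) \<le> tv \<Sigma> h * (c * A)"
      using th by (rule mult_left_mono)
    then show ?thesis by (auto simp: algebra_simps split: if_splits)
  qed
  have le2: "tv \<Sigma> h * (c / (1 - \<theta>) * M) + (if hs = [] then tv \<Sigma> h * C else 0) \<le> tv \<Sigma> h * (c * A)"
  proof -
    have "c / (1 - \<theta>) * M + (if hs = [] then C else 0) \<le> c * (M / (1 - \<theta>)) + c"
      using Cc c by auto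
    also have "\<dots> \<le> c * A" using c K \<theta> by (simp add: A_def add_divide_distrib distrib_left)
    finally have "tv \<Sigma> h * (c / (1 - \<theta>) * M + (if hs = [] then C else 0)) \<le> tv \<Sigma> h * (c * A)"
      using th by (rule mult_left_mono)
    then show ?thesis by (auto simp: algebra_simps split: if_splits)
  qed
  have "lip (tv \<Sigma> h * K * (c / (1 - \<theta>)) + (if hs = [] then tv \<Sigma> h * C else 0)) (Tl \<nu> (h # hs))"
    unfolding Tl.simps
    using Q_lip_any[OF cmeas0_cmeas(1)[OF h] lR] psi_lip[OF cmeas0_cmeas(1)[OF h]] lip_const
    by (intro lip_add) auto
  then have "lip (tv \<Sigma> h * (c * A)) (Tl \<nu> (h # hs))" using le1 by (rule lip_mono)
  moreover have "cmod (Tl \<nu> (h # hs) u) \<le> tv \<Sigma> h * (c * A)" if u: "u \<in> X" for u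
  proof -
    have "cmod (Tl \<nu> (h # hs) u) \<le> tv \<Sigma> h * (c / (1 - \<theta>) * M) + (if hs = [] then tv \<Sigma> h * C else 0)"
      unfolding Tl.simps using Q_bound0[OF h lR u] psi_bound[OF cmeas0_cmeas(1)[OF h] u]
      by (intro order_trans[OF norm_triangle_ineq] add_mono) auto
    then show ?thesis using le2 by simp
  qed
  ultimately show ?case unfolding target by blast
qed

lemmas Tl_lip = Tl_bounds[THEN conjunct1] and Tl_le = Tl_bounds[THEN conjunct2, THEN bspec]

lemma Tl_add:
  assumes \<nu>: "good \<nu>" and sets: "set xs \<subseteq> cmeas0 \<Sigma>" "set ys \<subseteq> cmeas0 \<Sigma>" "x \<in> cmeas0 \<Sigma>" "y \<in> cmeas0 \<Sigma>"
    and u: "u \<in> X"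
  shows "Tl \<nu> (xs @ (x + y) # ys) u = Tl \<nu> (xs @ x # ys) u + Tl \<nu> (xs @ y # ys) u"
  using sets(1) u
proof (induction xs arbitrary: u)
  case Nil
  have "lip (c0 \<nu> * (\<Prod>h\<leftarrow>ys. A * tv \<Sigma> h) / (1 - \<theta>)) (R \<nu> (Tl \<nu> ys))" by (rule R_lip[OF \<nu> Tl_lip[OF \<nu> sets(2)]])
  from Q_measure_add[OF cmeas0_cmeas(1)[OF sets(3)] cmeas0_cmeas(1)[OF sets(4)] this Nil(2)]
  have a: "Q (x + y) (R \<nu> (Tl \<nu> ys)) u = Q x (R \<nu> (Tl \<nu> ys)) u + Q y (R \<nu> (Tl \<nu> ys)) u" .
  have b: "psi (x + y) u = psi x u + psi y u"
    by (rule psi_add[OF cmeas0_cmeas(1)[OF sets(3)] cmeas0_cmeas(1)[OF sets(4)] Nil(2)])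
  show ?case unfolding append_Nil Tl.simps a b by simp
next
  case (Cons h xs)
  have h: "h \<in> cmeas \<Sigma>" and xs: "set xs \<subseteq> cmeas0 \<Sigma>" using Cons.prems by (auto simp: cmeas0_cmeas)
  have ne: "xs @ z # ys \<noteq> []" for z by simp
  have s: "set (xs @ x # ys) \<subseteq> cmeas0 \<Sigma>" "set (xs @ y # ys) \<subseteq> cmeas0 \<Sigma>" using xs sets by auto
  note l = Tl_lip[OF \<nu> s(1)] Tl_lip[OF \<nu> s(2)]
  have "R \<nu> (Tl \<nu> (xs @ (x + y) # ys)) v = R \<nu> (Tl \<nu> (xs @ x # ys)) v + R \<nu> (Tl \<nu> (xs @ y # ys)) v" if v: "v \<in> X" for v
  proof -
    have "R \<nu> (Tl \<nu> (xs @ (x + y) # ys)) v = R \<nu> (\<lambda>u. Tl \<nu> (xs @ x # ys) u + Tl \<nu> (xs @ y # ys) u) v"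
      by (rule R_cong[OF Cons.IH[OF xs] v])
    then show ?thesis using R_add[OF \<nu> l v] by simp
  qed
  then have "Q h (R \<nu> (Tl \<nu> (xs @ (x + y) # ys))) u
      = Q h (\<lambda>v. R \<nu> (Tl \<nu> (xs @ x # ys)) v + R \<nu> (Tl \<nu> (xs @ y # ys)) v) u"
    by (intro Q_cong Cons.prems)
  also have "\<dots> = Q h (R \<nu> (Tl \<nu> (xs @ x # ys))) u + Q h (R \<nu> (Tl \<nu> (xs @ y # ys))) u"
    by (rule Q_add[OF h R_lip[OF \<nu> l(1)] R_lip[OF \<nu> l(2)] Cons.prems(2)])
  finally show ?case unfolding append_Cons Tl.simps if_not_P[OF ne] add_0_right .
qed

lemma Tl_scale:
  assumes \<nu>: "good \<nu>" and sets: "set xs \<subseteq> cmeas0 \<Sigma>" "set ys \<subseteq> cmeas0 \<Sigma>" "x \<in> cmeas0 \<Sigma>"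
    and u: "u \<in> X"
  shows "Tl \<nu> (xs @ (\<lambda>b. c * x b) # ys) u = c * Tl \<nu> (xs @ x # ys) u"
  using sets(1) u
proof (induction xs arbitrary: u)
  case Nil
  have "lip (c0 \<nu> * (\<Prod>h\<leftarrow>ys. A * tv \<Sigma> h) / (1 - \<theta>)) (R \<nu> (Tl \<nu> ys))" by (rule R_lip[OF \<nu> Tl_lip[OF \<nu> sets(2)]])
  from Q_measure_scale[OF cmeas0_cmeas(1)[OF sets(3)] this Nil(2), of c]
    psi_scale[OF cmeas0_cmeas(1)[OF sets(3)] Nil(2), of c]
  show ?case by (simp add: distrib_left)
next
  case (Cons h xs)
  have h: "h \<in> cmeas \<Sigma>" and xs: "set xs \<subseteq> cmeas0 \<Sigma>" using Cons.prems by (auto simp: cmeas0_cmeas)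
  have ne: "xs @ z # ys \<noteq> []" for z by simp
  have s: "set (xs @ x # ys) \<subseteq> cmeas0 \<Sigma>" using xs sets by auto
  note l = Tl_lip[OF \<nu> s]
  have "R \<nu> (Tl \<nu> (xs @ (\<lambda>b. c * x b) # ys)) v = c * R \<nu> (Tl \<nu> (xs @ x # ys)) v" if v: "v \<in> X" for v
  proof -
    have "R \<nu> (Tl \<nu> (xs @ (\<lambda>b. c * x b) # ys)) v = R \<nu> (\<lambda>u. c * Tl \<nu> (xs @ x # ys) u) v"
      by (rule R_cong[OF Cons.IH[OF xs] v])
    then show ?thesis using R_cmult[OF \<nu> l v] by simp
  qed
  then have "Q h (R \<nu> (Tl \<nu> (xs @ (\<lambda>b. c * x b) # ys))) u = Q h (\<lambda>v. c * R \<nu> (Tl \<nu> (xs @ x # ys)) v) u"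
    by (intro Q_cong Cons.prems)
  also have "\<dots> = c * Q h (R \<nu> (Tl \<nu> (xs @ x # ys))) u"
    by (rule Q_cmult[OF h R_lip[OF \<nu> l] Cons.prems(2)])
  finally show ?case unfolding append_Cons Tl.simps if_not_P[OF ne] add_0_right .
qed

definition coef :: "((real^'n^'n) set \<Rightarrow> complex) \<Rightarrow> nat \<Rightarrow> (nat \<Rightarrow> (real^'n^'n) set \<Rightarrow> complex) \<Rightarrow> complex" where
  "coef \<nu> n v = pi \<nu> (Tl \<nu> (map v [0..<n]))"

text \<open>Furstenberg's formula: the stationary mean of the expected logarithmic growth in one
  step.\<close>

definition top :: "((real^'n^'n) set \<Rightarrow> complex) \<Rightarrow> complex" where
  "top \<nu> = pi \<nu> (psi \<nu>)"

lemma pi_Tl_bound: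
  assumes "good \<nu>" "good \<nu>'" "set hs \<subseteq> cmeas0 \<Sigma>"
  shows "cmod (pi \<nu>' (Tl \<nu> hs)) \<le> c0 \<nu> * (1 + pc \<nu>') * (\<Prod>h\<leftarrow>hs. A * tv \<Sigma> h)"
  using pi_bound[OF assms(2) Tl_lip[OF assms(1,3)] Tl_le[OF assms(1,3) u0]]
  by (simp add: algebra_simps)

lemma tv_triangle: "x \<in> cmeas \<Sigma> \<Longrightarrow> y \<in> cmeas \<Sigma> \<Longrightarrow> tv \<Sigma> x \<le> tv \<Sigma> (x - y) + tv \<Sigma> y"
  unfolding cmeas_def by (rule tv_norm_triangle)

lemma tv_commute: "tv \<Sigma> (x - y) = tv \<Sigma> (y - x)"
  unfolding tv_norm_def by (subst total_variation_minus_commute) simp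

lemma cmeas0_diff: "x \<in> cmeas0 \<Sigma> \<Longrightarrow> y \<in> cmeas0 \<Sigma> \<Longrightarrow> x - y \<in> cmeas0 \<Sigma>"
  by (auto simp: cmeas0_def cmeas_def intro: diff_in_complex_measures)

lemma map_fun_upd_upt: "i < n \<Longrightarrow> map (v(i := z)) [0..<n] = map v [0..<i] @ z # map v [Suc i..<n]"
proof -
  assume i: "i < n"
  have "[0..<n] = [0..<i] @ i # [Suc i..<n]"
    using i upt_add_eq_append[of 0 i "n - i"] by (simp add: upt_conv_Cons)
  then show ?thesis by simp
qed

lemma coef_cont_sym_multilinear:
  assumes \<nu>: "good \<nu>"
  shows "cont_sym_multilinear (cmeas0 \<Sigma>) (tv \<Sigma>) n (\<lambda>v. (\<Sum>p | p permutes {..<n}. coef \<nu> n (v \<circ> p)) / fact n)"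
proof (rule symmetrization_cont_sym_multilinear[OF Metric_space_cmeas0 cmeas0_diff])
  show "tv \<Sigma> x \<le> tv \<Sigma> (x - y) + tv \<Sigma> y" if "x \<in> cmeas0 \<Sigma>" "y \<in> cmeas0 \<Sigma>" for x y
    using that by (intro tv_triangle cmeas0_cmeas)
  show "0 \<le> c0 \<nu> * (1 + pc \<nu>) * A ^ n" using c0_nonneg pc_nonneg A_nonneg by simp
  have s: "set (map v [0..<i]) \<subseteq> cmeas0 \<Sigma>" "set (map v [Suc i..<n]) \<subseteq> cmeas0 \<Sigma>"
    if "\<And>j. j < n \<Longrightarrow> v j \<in> cmeas0 \<Sigma>" "i < n" for v i using that by auto
  have l: "lip (c0 \<nu> * (\<Prod>h\<leftarrow>map v [0..<i] @ z # map v [Suc i..<n]. A * tv \<Sigma> h)) (Tl \<nu> (map v [0..<i] @ z # map v [Suc i..<n]))"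
    if "\<And>j. j < n \<Longrightarrow> v j \<in> cmeas0 \<Sigma>" "i < n" "z \<in> cmeas0 \<Sigma>" for v i z
    using that by (intro Tl_lip[OF \<nu>]) auto
  show "coef \<nu> n (v(i := x + y)) = coef \<nu> n (v(i := x)) + coef \<nu> n (v(i := y))"
    if v: "\<And>j. j < n \<Longrightarrow> v j \<in> cmeas0 \<Sigma>" and i: "i < n" and x: "x \<in> cmeas0 \<Sigma>" and y: "y \<in> cmeas0 \<Sigma>" for v i x y
    unfolding coef_def map_fun_upd_upt[OF i]
    using pi_cong[OF Tl_add[OF \<nu> s[OF v i] x y]] pi_add[OF \<nu> l[OF v i x] l[OF v i y]] by simp
  show "coef \<nu> n (v(i := (\<lambda>b. c * x b))) = c * coef \<nu> n (v(i := x))"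
    if v: "\<And>j. j < n \<Longrightarrow> v j \<in> cmeas0 \<Sigma>" and i: "i < n" and x: "x \<in> cmeas0 \<Sigma>" for v i x c
    unfolding coef_def map_fun_upd_upt[OF i]
    using pi_cong[OF Tl_scale[OF \<nu> s[OF v i] x]] pi_cmult[OF \<nu> l[OF v i x]] by simp
next
  fix v :: "nat \<Rightarrow> (real^'n^'n) set \<Rightarrow> complex"
  assume v: "\<And>j. j < n \<Longrightarrow> v j \<in> cmeas0 \<Sigma>"
  have "cmod (coef \<nu> n v) \<le> c0 \<nu> * (1 + pc \<nu>) * (\<Prod>h\<leftarrow>map v [0..<n]. A * tv \<Sigma> h)"
    unfolding coef_def using v by (intro pi_Tl_bound \<nu>) auto
  also have "(\<Prod>h\<leftarrow>map v [0..<n]. A * tv \<Sigma> h) = (\<Prod>j<n. A * tv \<Sigma> (v j))"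
    by (induction n) simp_all
  also have "\<dots> = A ^ n * (\<Prod>j<n. tv \<Sigma> (v j))" by (simp add: prod.distrib)
  finally show "cmod (coef \<nu> n v) \<le> c0 \<nu> * (1 + pc \<nu>) * A ^ n * (\<Prod>j<n. tv \<Sigma> (v j))" by (simp add: mult.assoc)
qed simp_all

lemma top_perturb:
  assumes \<nu>: "good \<nu>" and \<nu>': "good \<nu>'"
  shows "top \<nu>' = top \<nu> + pi \<nu>' (Tl \<nu> [\<nu>' - \<nu>])"
proof -
  define h where "h = \<nu>' - \<nu>"
  have h: "h \<in> cmeas \<Sigma>" "\<nu> + h = \<nu>'"
    unfolding h_def using diff_in_cmeas0[OF good_cmeas(3)[OF \<nu>'] good_cmeas(3)[OF \<nu>]] by (simp_all add: cmeas0_def)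
  note l = psi_lip[OF good_cmeas(1)[OF \<nu>]] psi_lip[OF h(1)]
  have "top \<nu>' = pi \<nu>' (\<lambda>u. psi \<nu> u + psi h u)"
    unfolding top_def using psi_add[OF good_cmeas(1)[OF \<nu>] h(1)] by (intro pi_cong) (simp add: h(2))
  also have "\<dots> = pi \<nu>' (psi \<nu>) + pi \<nu>' (psi h)" by (rule pi_add[OF \<nu>' l])
  also have "pi \<nu>' (psi \<nu>) = top \<nu> + pi \<nu>' (Q h (R \<nu> (psi \<nu>)))"
    using pi_perturb[OF \<nu> \<nu>' l(1)] by (simp only: top_def h_def)
  also have "top \<nu> + pi \<nu>' (Q h (R \<nu> (psi \<nu>))) + pi \<nu>' (psi h) = top \<nu> + pi \<nu>' (\<lambda>u. Q h (R \<nu> (psi \<nu>)) u + psi h u)"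
    by (simp only: pi_add[OF \<nu>' Q_lip_any[OF h(1) R_lip[OF \<nu> l(1)]] l(2)] add.assoc)
  also have "(\<lambda>u. Q h (R \<nu> (psi \<nu>)) u + psi h u) = Tl \<nu> [h]" by simp
  finally show ?thesis by (simp only: h_def)
qed

text \<open>Each substitution of \<open>pi_perturb\<close> splits off one term evaluated with \<nu>
  and leaves the next one evaluated with \<nu>'. This remainder is bounded by a fixed constant for
  \<nu>' times a power of A * tv, so it tends to 0.\<close>

lemma top_series:
  assumes \<nu>: "good \<nu>" and \<nu>': "good \<nu>'" and small: "A * tv \<Sigma> (\<nu>' - \<nu>) < 1"
  shows "(\<lambda>n. coef \<nu> n (\<lambda>_. \<nu>' - \<nu>)) sums top \<nu>'"
proof -
  define h where "h = \<nu>' - \<nu>"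
  have h: "h \<in> cmeas0 \<Sigma>" unfolding h_def by (rule diff_in_cmeas0[OF good_cmeas(3)[OF \<nu>'] good_cmeas(3)[OF \<nu>]])
  have cf: "coef \<nu> n (\<lambda>_. h) = pi \<nu> (Tl \<nu> (replicate n h))" for n
    by (simp add: coef_def map_replicate_const)
  have partial: "top \<nu>' = (\<Sum>n<Suc N. coef \<nu> n (\<lambda>_. h)) + pi \<nu>' (Tl \<nu> (replicate (Suc N) h))" for N
  proof (induction N)
    case 0
    have "(\<Sum>n<Suc 0. coef \<nu> n (\<lambda>_. h)) = top \<nu>" by (simp add: cf top_def)
    moreover have "replicate (Suc 0) h = [h]" by simp
    ultimately show ?case using top_perturb[OF \<nu> \<nu>', folded h_def] by (simp only:)
  next
    case (Suc N)
    have s: "set (replicate (Suc N) h) \<subseteq> cmeas0 \<Sigma>" using h by auto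
    have "pi \<nu>' (Tl \<nu> (replicate (Suc N) h)) = pi \<nu> (Tl \<nu> (replicate (Suc N) h)) + pi \<nu>' (Q h (R \<nu> (Tl \<nu> (replicate (Suc N) h))))"
      unfolding h_def by (rule pi_perturb[OF \<nu> \<nu>' Tl_lip[OF \<nu> s[unfolded h_def]]])
    also have "Q h (R \<nu> (Tl \<nu> (replicate (Suc N) h))) = Tl \<nu> (replicate (Suc (Suc N)) h)"
      by (simp add: fun_eq_iff)
    finally show ?case using Suc by (simp add: cf del: replicate_Suc)
  qed
  have "(\<lambda>N. pi \<nu>' (Tl \<nu> (replicate (Suc N) h))) \<longlonglongrightarrow> 0"
  proof (rule Lim_null_comparison)
    have "cmod (pi \<nu>' (Tl \<nu> (replicate (Suc N) h))) \<le> c0 \<nu> * (1 + pc \<nu>') * (A * tv \<Sigma> h) ^ Suc N" for N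
    proof -
      have s: "set (replicate (Suc N) h) \<subseteq> cmeas0 \<Sigma>" using h by auto
      show ?thesis using pi_Tl_bound[OF \<nu> \<nu>' s] by (simp del: replicate_Suc power_Suc)
    qed
    then show "\<forall>\<^sub>F N in sequentially. cmod (pi \<nu>' (Tl \<nu> (replicate (Suc N) h))) \<le> c0 \<nu> * (1 + pc \<nu>') * (A * tv \<Sigma> h) ^ Suc N"
      by simp
    have "(\<lambda>N. (A * tv \<Sigma> h) ^ N) \<longlonglongrightarrow> 0"
      using small A_nonneg by (intro LIMSEQ_realpow_zero) (auto simp: h_def)
    then show "(\<lambda>N. c0 \<nu> * (1 + pc \<nu>') * (A * tv \<Sigma> h) ^ Suc N) \<longlonglongrightarrow> 0"
      by (intro tendsto_mult_right_zero LIMSEQ_Suc)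
  qed
  then have "(\<lambda>N. top \<nu>' - pi \<nu>' (Tl \<nu> (replicate (Suc N) h))) \<longlonglongrightarrow> top \<nu>' - 0" by (intro tendsto_diff tendsto_const)
  moreover have "top \<nu>' - pi \<nu>' (Tl \<nu> (replicate (Suc N) h)) = (\<Sum>n<Suc N. coef \<nu> n (\<lambda>_. h))" for N
    using partial[of N] by (simp del: replicate_Suc)
  ultimately have "(\<lambda>N. \<Sum>n<Suc N. coef \<nu> n (\<lambda>_. h)) \<longlonglongrightarrow> top \<nu>'" by simp
  then have "(\<lambda>N. \<Sum>n<N. coef \<nu> n (\<lambda>_. h)) \<longlonglongrightarrow> top \<nu>'" by (rule LIMSEQ_imp_Suc)
  then show ?thesis unfolding sums_def h_def .
qed

definition nbhd :: "real \<Rightarrow> ((real^'n^'n) set \<Rightarrow> complex) set" where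
  "nbhd r = Metric_space.mball (cmeas1 \<Sigma>) (norm_dist (tv \<Sigma>)) (cm_of \<mu>0) r"

lemma nbhd_iff: "\<nu> \<in> nbhd r \<longleftrightarrow> \<nu> \<in> cmeas1 \<Sigma> \<and> tv \<Sigma> (\<nu> - cm_of \<mu>0) < r"
  unfolding nbhd_def Metric_space.in_mball[OF Metric_space_cmeas1] norm_dist_def
  using cm_of_in_cmeas1[OF \<mu>0] tv_commute by auto

lemma openin_nbhd: "openin (norm_topology (cmeas1 \<Sigma>) (tv \<Sigma>)) (nbhd r)"
  unfolding nbhd_def norm_topology_def by (rule Metric_space.openin_mball[OF Metric_space_cmeas1])

lemma good_nbhd: "r \<le> (\<theta> - \<kappa>) / K \<Longrightarrow> \<nu> \<in> nbhd r \<Longrightarrow> good \<nu>"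
proof -
  assume r: "r \<le> (\<theta> - \<kappa>) / K" and \<nu>: "\<nu> \<in> nbhd r"
  have "tv \<Sigma> (\<nu> - cm_of \<mu>0) \<le> (\<theta> - \<kappa>) / K" using \<nu> r by (simp add: nbhd_iff)
  then have "K * tv \<Sigma> (\<nu> - cm_of \<mu>0) \<le> \<theta> - \<kappa>" using K by (simp add: pos_le_divide_eq mult.commute)
  then show "good \<nu>" using \<nu> by (simp add: good_def nbhd_iff)
qed

lemma cmeas1_add: "x \<in> cmeas0 \<Sigma> \<Longrightarrow> cm_of \<mu>0 + x \<in> cmeas1 \<Sigma>"
proof -
  assume x: "x \<in> cmeas0 \<Sigma>"
  have m: "cm_of \<mu>0 \<in> cmeas1 \<Sigma>" by (rule cm_of_in_cmeas1[OF \<mu>0])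
  let ?c = "complex_measures (borel_of \<Sigma>)"
  have c: "cm_of \<mu>0 \<in> ?c" "x \<in> ?c" using m x by (auto simp: cmeas1_def cmeas0_def cmeas_def)
  have "cm_of \<mu>0 - ((x - x) - x) \<in> ?c" by (intro diff_in_complex_measures c)
  moreover have "cm_of \<mu>0 - ((x - x) - x) = cm_of \<mu>0 + x" by simp
  ultimately show ?thesis using m x by (simp add: cmeas1_def cmeas0_def cmeas_def)
qed

theorem top_holomorphic:
  assumes r: "0 < r" "r \<le> (\<theta> - \<kappa>) / K"
  shows "holomorphic_in_affine (cm_of \<mu>0) (cmeas0 \<Sigma>) (tv \<Sigma>) (nbhd r) top"
proof -
  interpret M0: Metric_space "cmeas0 \<Sigma>" "norm_dist (tv \<Sigma>)" by (rule Metric_space_cmeas0)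
  let ?m = "cm_of \<mu>0"
  have m: "?m \<in> cmeas1 \<Sigma>" by (rule cm_of_in_cmeas1[OF \<mu>0])
  have zero: "0 \<in> cmeas0 \<Sigma>" using diff_in_cmeas0[OF m m] by simp
  have U: "(\<lambda>x. x - ?m) ` nbhd r = M0.mball 0 r"
  proof (intro equalityI subsetI)
    fix y assume "y \<in> (\<lambda>x. x - ?m) ` nbhd r"
    then obtain x where x: "x \<in> cmeas1 \<Sigma>" "tv \<Sigma> (x - ?m) < r" "y = x - ?m" by (auto simp: nbhd_iff)
    then show "y \<in> M0.mball 0 r"
      unfolding M0.in_mball norm_dist_def using zero diff_in_cmeas0[OF x(1) m] tv_commute[of 0 y] by simp
  next
    fix y assume y: "y \<in> M0.mball 0 r"
    then have "?m + y \<in> nbhd r"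
      unfolding nbhd_iff M0.in_mball norm_dist_def using cmeas1_add[of y] tv_commute[of 0 y] by simp
    then have "(?m + y) - ?m \<in> (\<lambda>x. x - ?m) ` nbhd r" by (rule imageI)
    then show "y \<in> (\<lambda>x. x - ?m) ` nbhd r" by simp
  qed
  have mem: "?m + x \<in> nbhd r" if "x \<in> M0.mball 0 r" for x
    unfolding nbhd_iff using that cmeas1_add[of x] tv_commute[of 0 x] by (simp add: norm_dist_def)
  show ?thesis
    unfolding holomorphic_in_affine_def holomorphic_in_def U
  proof (intro conjI ballI)
    show "openin (norm_topology (cmeas0 \<Sigma>) (tv \<Sigma>)) (M0.mball 0 r)"
      unfolding norm_topology_def by (rule M0.openin_mball)
    fix a assume a: "a \<in> M0.mball 0 r"
    let ?\<nu> = "?m + a"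
    have \<nu>: "good ?\<nu>" using mem[OF a] r(2) good_nbhd by blast
    \<comment> \<open>The series is recentred at \<mu>0 + a. Its radius 1 / (A + 1) does not depend
      on a; the first bound keeps the ball inside the neighbourhood.\<close>
    define r' where "r' = min (r - norm_dist (tv \<Sigma>) 0 a) (1 / (A + 1))"
    have r': "r' > 0" using a A_nonneg by (simp add: r'_def)
    let ?T = "\<lambda>n v. (\<Sum>p | p permutes {..<n}. coef ?\<nu> n (v \<circ> p)) / fact n"
    have sub: "M0.mball a r' \<subseteq> M0.mball 0 r"
    proof
      fix x assume x: "x \<in> M0.mball a r'"
      have "norm_dist (tv \<Sigma>) 0 x \<le> norm_dist (tv \<Sigma>) 0 a + norm_dist (tv \<Sigma>) a x"
        using x zero by (intro M0.triangle) auto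
      also have "\<dots> < r" using x by (simp add: r'_def)
      finally show "x \<in> M0.mball 0 r" using x zero by simp
    qed
    have ser: "(\<lambda>n. ?T n (\<lambda>i\<in>{..<n}. x - a)) sums top (?m + x)" if x: "x \<in> M0.mball a r'" for x
    proof -
      have \<nu>': "good (?m + x)" using mem x sub r(2) good_nbhd by blast
      have d: "(?m + x) - ?\<nu> = x - a" by simp
      have "tv \<Sigma> (x - a) < 1 / (A + 1)" using x tv_commute[of a x] by (simp add: r'_def norm_dist_def)
      then have "(A + 1) * tv \<Sigma> (x - a) < 1" using A_nonneg by (simp add: pos_less_divide_eq mult.commute)
      then have "A * tv \<Sigma> ((?m + x) - ?\<nu>) < 1"
        unfolding d using tv_norm_nonneg[of "borel_of \<Sigma>" "x - a"] by (simp add: distrib_right del: tv_norm_nonneg)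
      from top_series[OF \<nu> \<nu>' this] have "(\<lambda>n. coef ?\<nu> n (\<lambda>_. x - a)) sums top (?m + x)" unfolding d .
      \<comment> \<open>On the diagonal all permuted terms coincide, so symmetrisation does not
        change the value.\<close>
      moreover have "?T n (\<lambda>i\<in>{..<n}. x - a) = coef ?\<nu> n (\<lambda>_. x - a)" for n
      proof -
        have "coef ?\<nu> n ((\<lambda>i\<in>{..<n}. x - a) \<circ> p) = coef ?\<nu> n (\<lambda>_. x - a)" if "p permutes {..<n}" for p
        proof -
          have "map ((\<lambda>i\<in>{..<n}. x - a) \<circ> p) [0..<n] = map (\<lambda>_. x - a) [0..<n]"
            using permutes_in_image[OF that] by (intro map_cong) auto
          then show ?thesis unfolding coef_def by (rule arg_cong)
        qed
        then have "(\<Sum>p | p permutes {..<n}. coef ?\<nu> n ((\<lambda>i\<in>{..<n}. x - a) \<circ> p))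
            = (\<Sum>p | p permutes {..<n}. coef ?\<nu> n (\<lambda>_. x - a))" by (intro sum.cong) auto
        also have "\<dots> = fact n * coef ?\<nu> n (\<lambda>_. x - a)" by (simp add: card_permutations[OF refl])
        finally show ?thesis by simp
      qed
      ultimately show ?thesis by simp
    qed
    show "\<exists>r'>0. \<exists>T. M0.mball a r' \<subseteq> M0.mball 0 r \<and> (\<forall>n. cont_sym_multilinear (cmeas0 \<Sigma>) (tv \<Sigma>) n (T n))
        \<and> (\<forall>x\<in>M0.mball a r'. (\<lambda>n. T n (\<lambda>i\<in>{..<n}. x - a)) sums top (?m + x))"
      using r' sub coef_cont_sym_multilinear[OF \<nu>] ser by (intro exI[of _ r'] conjI exI[of _ ?T]) auto
  qed
qed

lemma pi_It: "good \<nu> \<Longrightarrow> lip L \<phi> \<Longrightarrow> pi \<nu> (It \<nu> k \<phi>) = pi \<nu> \<phi>"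
proof (induction k)
  case (Suc k)
  then show ?case using pi_Q[OF Suc.prems(1) It_lip[OF Suc.prems]] by simp
qed simp

lemma It_psi_top:
  assumes "good \<nu>" "u \<in> X"
  shows "cmod (It \<nu> k (psi \<nu>) u - top \<nu>) \<le> \<theta> ^ k * (tv \<Sigma> \<nu> * C) * pc \<nu>"
  using It_pi(2)[OF assms(1) It_lip[OF assms(1) psi_lip[OF good_cmeas(1)[OF assms(1)]]] assms(2)]
    pi_It[OF assms(1) psi_lip[OF good_cmeas(1)[OF assms(1)]]]
  by (simp add: top_def norm_minus_commute)

lemma top_lipschitz:
  assumes "good \<nu>" "good \<nu>'"
  shows "cmod (top \<nu>' - top \<nu>) \<le> c0 \<nu> * (1 + pc \<nu>') * (A * tv \<Sigma> (\<nu>' - \<nu>))"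
proof -
  have "set [\<nu>' - \<nu>] \<subseteq> cmeas0 \<Sigma>" using diff_in_cmeas0[OF good_cmeas(3)[OF assms(2)] good_cmeas(3)[OF assms(1)]] by simp
  from pi_Tl_bound[OF assms this] show ?thesis using top_perturb[OF assms] by simp
qed

end

subsection \<open>Identification of the Lyapunov exponent\<close>

text \<open>The recursion makes b n the sum of the first n iterates of psi, and these converge
  geometrically to the top rate. The deviation from n times this rate is therefore bounded
  independently of n and u.\<close>

lemma (in transfer) log_sum:
  fixes b :: "nat \<Rightarrow> real^'n \<Rightarrow> real"
  assumes \<mu>: "\<mu> \<in> Prob \<Sigma>" and good: "good (cm_of \<mu>)"
    and b0: "\<And>u. u \<in> X \<Longrightarrow> b 0 u = 0"
    and bS: "\<And>n u. u \<in> X \<Longrightarrow> b (Suc n) u = (\<integral>g. \<Psi> g u + b n (g *v u) \<partial>\<mu>)"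
    and u: "u \<in> X"
  shows "cmod (of_real (b n u) - of_nat n * top (cm_of \<mu>)) \<le> tv \<Sigma> (cm_of \<mu>) * C * pc (cm_of \<mu>) / (1 - \<theta>)"
proof -
  let ?\<nu> = "cm_of \<mu>"
  have c: "?\<nu> \<in> cmeas \<Sigma>" by (rule good_cmeas(1)[OF good])
  define s where "s n u = (\<Sum>k<n. It ?\<nu> k (psi ?\<nu>) u)" for n u
  note l = It_lip[OF good psi_lip[OF c]]
  have ls: "\<exists>L. lip L (s n)" for n
  proof (induction n)
    case 0
    then show ?case using lip_const[of 0] by (auto simp: s_def)
  next
    case (Suc n)
    then obtain L where "lip L (s n)" by blast
    from lip_add[OF this l[of n]] show ?case by (auto simp: s_def)
  qed
  have Qs: "Q ?\<nu> (s n) u = (\<Sum>k<n. It ?\<nu> (Suc k) (psi ?\<nu>) u)" if u: "u \<in> X" for n u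
  proof (induction n)
    case 0
    have "s 0 = (\<lambda>_. 0)" by (simp add: s_def fun_eq_iff)
    then show ?case by (simp add: Q_const[OF c])
  next
    case (Suc n)
    obtain L where L: "lip L (s n)" using ls by blast
    have "s (Suc n) = (\<lambda>u. s n u + It ?\<nu> n (psi ?\<nu>) u)" by (simp add: s_def fun_eq_iff)
    then show ?case using Q_add[OF c L l u] Suc by simp
  qed
  have bs: "of_real (b n u) = s n u" if "u \<in> X" for n u
    using that
  proof (induction n arbitrary: u)
    case 0
    then show ?case by (simp add: b0 s_def)
  next
    case (Suc n)
    note u = Suc.prems
    obtain L where L: "lip L (s n)" using ls by blast
    \<comment> \<open>Continuity of b n is not assumed; the induction hypothesis supplies it by
      identifying b n with a Lipschitz function.\<close>
    have "continuous_on \<Sigma> (\<lambda>g. Re (s n (g *v u)))" by (intro continuous_intros lip_continuous[OF L u])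
    then have cb: "continuous_on \<Sigma> (\<lambda>g. b n (g *v u))"
      by (rule continuous_on_eq) (use Suc.IH act u in \<open>simp flip: Suc.IH\<close>)
    have cp: "continuous_on \<Sigma> (\<lambda>g. \<Psi> g u)" by (rule \<Psi>_cont[OF u])
    have "of_real (b (Suc n) u) = complex_of_real (\<integral>g. \<Psi> g u \<partial>\<mu>) + of_real (\<integral>g. b n (g *v u) \<partial>\<mu>)"
      unfolding bS[OF u] using continuous_integrable[OF \<mu> cp] continuous_integrable[OF \<mu> cb] by simp
    also have "complex_of_real (\<integral>g. \<Psi> g u \<partial>\<mu>) = psi ?\<nu> u"
      unfolding psi_def by (rule cint_prob[OF \<mu> cp, symmetric])
    also have "complex_of_real (\<integral>g. b n (g *v u) \<partial>\<mu>) = cint \<Sigma> ?\<nu> (\<lambda>g. of_real (b n (g *v u)))"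
      by (rule cint_prob[OF \<mu> cb, symmetric])
    also have "\<dots> = Q ?\<nu> (s n) u"
      unfolding Q_def using Suc.IH act u by (intro cint_cong) auto
    also have "psi ?\<nu> u + Q ?\<nu> (s n) u = s (Suc n) u"
      unfolding Qs[OF u] s_def by (subst sum.lessThan_Suc_shift) simp
    finally show ?case .
  qed
  have "of_real (b n u) - of_nat n * top ?\<nu> = (\<Sum>k<n. It ?\<nu> k (psi ?\<nu>) u - top ?\<nu>)"
    unfolding bs[OF u] s_def by (simp add: sum_subtractf)
  also have "cmod \<dots> \<le> (\<Sum>k<n. \<theta> ^ k * (tv \<Sigma> ?\<nu> * C * pc ?\<nu>))"
    by (intro sum_norm_le) (use It_psi_top[OF good u] in \<open>simp add: mult.assoc\<close>)
  also have "\<dots> \<le> (\<Sum>k. \<theta> ^ k * (tv \<Sigma> ?\<nu> * C * pc ?\<nu>))"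
    using \<theta> C pc_nonneg by (intro sum_le_suminf summable_\<theta>) auto
  finally show ?thesis by (simp add: suminf_\<theta>)
qed

text \<open>Moment bounds on \<open>V\<close> and on the quotient can be combined only for the same
  exponent, so the larger one must be lowered. A pointwise inequality with c the given bound
  replaces Jensen's inequality, at the price of the factor 2.\<close>

lemma (in random_product) moment_smaller_exponent:
  assumes s: "0 < s'" "s' \<le> s" and D: "D > 0"
    and b: "moment {0} s n x \<le> ennreal (D * exp (s * real n * a) * norm x powr s)"
  shows "moment {0} s' n x \<le> ennreal (2 * D powr (s' / s) * exp (s' * real n * a) * norm x powr s')"
proof (cases "x = 0")
  case True
  then show ?thesis by (simp add: moment_def)
next
  case False
  define c where "c = D * exp (s * real n * a) * norm x powr s"
  have c: "c > 0" unfolding c_def using D False by simp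
  define p where "p = s' / s"
  have p: "0 < p" "p \<le> 1" using s by (auto simp: p_def)
  have cp: "c powr p = D powr p * exp (s' * real n * a) * norm x powr s'"
    using D s by (simp add: c_def p_def powr_mult powr_powr exp_powr_real)
  have pt: "y powr s' \<le> c powr p + c powr p / c * y powr s" if "y \<ge> 0" for y :: real
  proof -
    have y: "y powr s' = (y powr s) powr p" using s by (simp add: powr_powr p_def)
    show ?thesis
    proof (cases "y powr s \<le> c")
      case True
      then have "(y powr s) powr p \<le> c powr p" using p by (intro powr_mono2) auto
      moreover have "0 \<le> c powr p / c * y powr s" using c by simp
      ultimately show ?thesis using y by linarith
    next
      case False
      then have "(y powr s / c) powr p \<le> (y powr s / c) powr 1" using c p by (intro powr_mono) auto
      then have "(y powr s) powr p / c powr p \<le> y powr s / c" using c False by (simp add: powr_divide)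
      then have "(y powr s) powr p \<le> c powr p / c * y powr s" using c by (simp add: field_simps)
      then show ?thesis using y powr_ge_zero[of c p] by linarith
    qed
  qed
  have "moment {0} s' n x \<le> (\<integral>\<^sup>+\<omega>. ennreal (c powr p) + ennreal (c powr p / c) * ennreal (norm (mat_prod \<omega> n *v x) powr s) \<partial>S)"
    unfolding moment_def
  proof (rule nn_integral_mono)
    fix \<omega>
    show "ennreal (norm (qproj {0} (mat_prod \<omega> n *v x)) powr s')
        \<le> ennreal (c powr p) + ennreal (c powr p / c) * ennreal (norm (mat_prod \<omega> n *v x) powr s)"
      using pt[of "norm (mat_prod \<omega> n *v x)"] c by (simp add: ennreal_mult[symmetric] ennreal_leI flip: ennreal_plus)
  qed
  also have "\<dots> = ennreal (c powr p) + ennreal (c powr p / c) * moment {0} s n x"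
    by (simp add: nn_integral_add nn_integral_cmult moment_def P.emeasure_space_1)
  also have "\<dots> \<le> ennreal (c powr p) + ennreal (c powr p / c) * ennreal c"
    using b by (intro add_left_mono mult_left_mono) (auto simp: c_def)
  also have "\<dots> = ennreal (2 * c powr p)" using c by (simp add: ennreal_mult[symmetric] flip: ennreal_plus)
  finally have "moment {0} s' n x \<le> ennreal (2 * c powr p)" .
  then show ?thesis unfolding cp by (simp only: p_def mult.assoc)
qed

section \<open>Mean logarithmic growth and the top exponent\<close>

context quotient_product
begin

definition log_mean :: "nat \<Rightarrow> real^'n \<Rightarrow> real" where
  "log_mean n u = P.expectation (\<lambda>\<omega>. ln (pn (mat_prod \<omega> n *v u) / pn u))"

lemma log_integrable:
  assumes "u \<notin> V"
  shows "integrable S (\<lambda>\<omega>. ln (pn (mat_prod \<omega> n *v u) / pn u))"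
  using ln_pn_bound[OF _ assms, of _ n]
  by (intro P.integrable_const_bound[of _ "ln KK * real n"] AE_I2) (simp_all del: ln_div)

lemma log_mean_Suc:
  assumes u: "u \<notin> V"
  shows "log_mean (Suc n) u = (\<integral>g. ln (pn (g *v u) / pn u) + log_mean n (g *v u) \<partial>\<mu>)"
proof -
  have "log_mean (Suc n) u = (\<integral>g. \<integral>\<omega>. ln (pn (mat_prod \<omega> n *v (g *v u)) / pn u) \<partial>S \<partial>\<mu>)"
    unfolding log_mean_def by (subst integral_case_nat[OF log_integrable[OF u]])
      (simp add: mat_prod_case_nat matrix_vector_mul_assoc del: mat_prod.simps)
  also have "\<dots> = (\<integral>g. ln (pn (g *v u) / pn u) + log_mean n (g *v u) \<partial>\<mu>)"
  proof (rule Bochner_Integration.integral_cong[OF refl])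
    fix g assume "g \<in> space \<mu>"
    then have g: "g \<in> \<Sigma>" by (simp add: space_mu)
    have gu: "g *v u \<notin> V" using mv_mem_V[OF g] u by simp
    have "(\<integral>\<omega>. ln (pn (mat_prod \<omega> n *v (g *v u)) / pn u) \<partial>S)
        = (\<integral>\<omega>. ln (pn (g *v u) / pn u) + ln (pn (mat_prod \<omega> n *v (g *v u)) / pn (g *v u)) \<partial>S)"
    proof (rule Bochner_Integration.integral_cong[OF refl])
      fix \<omega> assume \<omega>: "\<omega> \<in> space S"
      have "pn u > 0" "pn (g *v u) > 0" "pn (mat_prod \<omega> n *v (g *v u)) > 0"
        using u gu mat_prod_mem_V[OF \<omega>] by (auto intro!: pn_pos simp del: zero_less_norm_iff)
      then show "ln (pn (mat_prod \<omega> n *v (g *v u)) / pn u)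
          = ln (pn (g *v u) / pn u) + ln (pn (mat_prod \<omega> n *v (g *v u)) / pn (g *v u))"
        by (simp add: ln_div)
    qed
    also have "\<dots> = ln (pn (g *v u) / pn u) + log_mean n (g *v u)"
      unfolding log_mean_def using log_integrable[OF gu, of n] by (simp add: P.prob_space)
    finally show "(\<integral>\<omega>. ln (pn (mat_prod \<omega> n *v (g *v u)) / pn u) \<partial>S) = ln (pn (g *v u) / pn u) + log_mean n (g *v u)" .
  qed
  finally show ?thesis .
qed

lemma log_mean_0: "log_mean 0 u = 0"
  by (simp add: log_mean_def)

text \<open>Projecting and evaluating at a single vector can only lose against the operator norm;
  the constant ln (norm u / pn u) disappears after division by n.\<close>

lemma log_mean_le_lyapunov:
  assumes n: "2 \<le> CARD('n)" and u: "u \<notin> V" and lim: "(\<lambda>n. log_mean n u / real n) \<longlonglongrightarrow> F"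
  shows "F \<le> lyapunov 1 \<mu>"
proof -
  let ?N = "quot_norm {0} UNIV :: real^'n^'n \<Rightarrow> real"
  have gr: "growth ?N (lyapunov 1 \<mu>)" by (rule onorm_growth[OF n])
  define d where "d = ln (norm u / pn u)"
  have pu: "pn u > 0" by (rule pn_pos[OF u])
  have nu: "norm u > 0" using u subspace_0[OF V] by auto
  have le: "log_mean n u \<le> P.expectation (\<lambda>\<omega>. ln (?N (mat_prod \<omega> n))) + d" for n
  proof -
    have "log_mean n u \<le> P.expectation (\<lambda>\<omega>. ln (?N (mat_prod \<omega> n)) + d)"
      unfolding log_mean_def
    proof (rule integral_mono[OF log_integrable[OF u]])
      show "integrable S (\<lambda>\<omega>. ln (?N (mat_prod \<omega> n)) + d)" using gr by (simp add: growth_def)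
      fix \<omega> assume \<omega>: "\<omega> \<in> space S"
      let ?A = "mat_prod \<omega> n"
      have p: "pn (?A *v u) > 0" using u mat_prod_mem_V[OF \<omega>] by (intro pn_pos) simp
      have q: "pn (?A *v u) \<le> ?N ?A * norm u"
        using quot_norm(1)[of "{0}" UNIV u ?A] norm_qproj_le[OF V, of "?A *v u"] by simp
      have N: "?N ?A > 0"
        using p q quot_norm(2)[of "{0}" UNIV ?A] by (cases "?N ?A = 0") auto
      have "ln (pn (?A *v u)) \<le> ln (?N ?A * norm u)" using p q N nu by (subst ln_le_cancel_iff) auto
      then show "ln (pn (?A *v u) / pn u) \<le> ln (?N ?A) + d"
        unfolding d_def using p pu N nu by (simp add: ln_div ln_mult_pos)
    qed
    also have "\<dots> = P.expectation (\<lambda>\<omega>. ln (?N (mat_prod \<omega> n))) + d"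
      using gr by (simp add: growth_def P.prob_space)
    finally show ?thesis .
  qed
  have "(\<lambda>n. P.expectation (\<lambda>\<omega>. ln (?N (mat_prod \<omega> n))) / real n + d / real n) \<longlonglongrightarrow> lyapunov 1 \<mu> + 0"
    using gr by (intro tendsto_add lim_const_over_n) (simp add: growth_def)
  moreover have "log_mean n u / real n \<le> P.expectation (\<lambda>\<omega>. ln (?N (mat_prod \<omega> n))) / real n + d / real n" for n
    using divide_right_mono[OF le[of n], of "real n"] by (simp add: add_divide_distrib)
  ultimately have "F \<le> lyapunov 1 \<mu> + 0"
    using lim by (intro LIMSEQ_le) auto
  then show ?thesis by simp
qed

text \<open>If the exponent exceeded F, moments would grow more slowly than it allows both in the
  quotient, by the bound on \<open>log_mean\<close>, and on \<open>V\<close>, by assumption. The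
  block triangular estimate makes every vector slow, against \<open>slow_rate\<close>. Nothing about
  the slow space of the measure itself enters.\<close>

lemma lyapunov_le_of_moments:
  assumes n: "2 \<le> CARD('n)"
    and up: "\<And>n u. u \<notin> V \<Longrightarrow> log_mean n u \<le> real n * F + B"
    and s: "0 < s" "s \<le> 1" and D: "D > 0" and aF: "a < F"
    and HV: "\<And>n x. x \<in> V \<Longrightarrow> moment {0} s n x \<le> ennreal (D * exp (s * real n * a) * norm x powr s)"
  shows "lyapunov 1 \<mu> \<le> F"
proof (rule ccontr)
  define \<gamma> where "\<gamma> = lyapunov 1 \<mu>"
  assume "\<not> lyapunov 1 \<mu> \<le> F"
  then have "F < \<gamma>" by (simp add: \<gamma>_def)
  \<comment> \<open>Rates between F and \<gamma>, one for each loss: b0 absorbs the constant B, b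
    the passage to moments, b1 the block triangular estimate, b2 the passage to almost sure
    growth.\<close>
  then obtain b0 where b0: "F < b0" "b0 < \<gamma>" using dense by blast
  obtain b where b: "b0 < b" "b < \<gamma>" using b0 dense by blast
  obtain b1 where b1: "b < b1" "b1 < \<gamma>" using b dense by blast
  obtain b2 where b2: "b1 < b2" "b2 < \<gamma>" using b1 dense by blast
  obtain m0 :: nat where "\<bar>B\<bar> / (b0 - F) < real m0" using reals_Archimedean2 by blast
  then have "\<bar>B\<bar> < real m0 * (b0 - F)" using b0 by (simp add: pos_divide_less_eq)
  also have "\<dots> \<le> real (Suc m0) * (b0 - F)" using b0 by (intro mult_right_mono) auto
  finally have m: "B \<le> real (Suc m0) * (b0 - F)" by linarith
  have E: "P.expectation (\<lambda>\<omega>. ln (pn (mat_prod \<omega> (Suc m0) *v u) / pn u)) \<le> real (Suc m0) * b0" if "u \<in> UNIV - V" for u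
    using up[of u "Suc m0"] that m unfolding log_mean_def right_diff_distrib by auto
  have X: "AE g in \<mu>. \<forall>u\<in>UNIV - V. g *v u \<in> UNIV - V"
    using AE_space by eventually_elim (use mv_mem_V space_mu in auto)
  obtain s1 where s1: "0 < s1" "s1 \<le> 1"
    "\<And>s. 0 < s \<Longrightarrow> s \<le> s1 \<Longrightarrow> \<exists>D\<ge>0. \<forall>n. \<forall>u\<in>UNIV - V. moment V s n u \<le> ennreal (D * exp (s * real n * b) * pn u powr s)"
    by (rule moment_growth[OF X _ _ E b(1)]) auto
  define t where "t = min s s1"
  have t: "0 < t" "t \<le> s" "t \<le> s1" "t \<le> 1" using s s1 by (auto simp: t_def)
  obtain D1 where D1: "D1 \<ge> 0" "\<And>n u. u \<in> UNIV - V \<Longrightarrow> moment V t n u \<le> ennreal (D1 * exp (t * real n * b) * pn u powr t)"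
    using s1(3)[OF t(1,3)] by blast
  define D2 where "D2 = 2 * D powr (t / s)"
  define D' where "D' = max D1 D2"
  have D': "D' \<ge> 0" "D1 \<le> D'" "D2 \<le> D'" using D1 by (auto simp: D'_def)
  have D2: "D2 \<ge> 0" by (simp add: D2_def)
  have ab: "a < b" using aF b0 b by linarith
  have zero: "moment V t n u = 0" if "u \<in> V" for n u
  proof -
    have "moment V t n u = (\<integral>\<^sup>+\<omega>. 0 \<partial>S)" unfolding moment_def
    proof (rule nn_integral_cong)
      fix \<omega> assume "\<omega> \<in> space S"
      then have "qproj V (mat_prod \<omega> n *v u) = 0" using mat_prod_mem_V that qproj_eq_0_iff[OF V] by blast
      then show "ennreal (pn (mat_prod \<omega> n *v u) powr t) = 0" by simp
    qed
    then show ?thesis by simp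
  qed
  obtain G where G: "G \<ge> 0" "\<And>n u. u \<in> UNIV \<Longrightarrow> moment {0} t n u \<le> ennreal (G * exp (t * real n * b1) * norm u powr t)"
  proof (rule moment_block_triangular[OF t(1,4) D'(1) _ subspace_UNIV subset_UNIV _ _ b1(1)])
    show "moment {0} t n x \<le> ennreal (D' * exp (t * real n * b) * norm x powr t)" if x: "x \<in> V" for n x
    proof (rule order_trans[OF moment_smaller_exponent[OF t(1,2) D HV[OF x]]])
      have "exp (t * real n * a) \<le> exp (t * real n * b)" using t ab by (simp add: mult_left_mono)
      then show "ennreal (2 * D powr (t / s) * exp (t * real n * a) * norm x powr t) \<le> ennreal (D' * exp (t * real n * b) * norm x powr t)"
        using D'(3) D' D2 unfolding D2_def[symmetric] by (intro ennreal_leI mult_right_mono mult_mono) auto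
    qed
    show "moment V t n u \<le> ennreal (D' * exp (t * real n * b) * pn u powr t)" for n u
    proof (cases "u \<in> V")
      case False
      then show ?thesis using D1(2)[of u n] D'(2)
        by (intro order_trans[OF D1(2)] ennreal_leI mult_right_mono) auto
    qed (simp add: zero)
  qed auto
  interpret Z: quotient_product \<Sigma> \<mu> "{0}" by (rule quotient_product_0)
  have slow1: "AE \<omega> in S. Z.slow \<gamma> \<omega> u" for u
  proof -
    have "AE \<omega> in S. \<exists>E. \<forall>n. norm (mat_prod \<omega> n *v u) \<le> E * exp (real n * b2)"
    proof (rule moment_bound_imp_growth[OF t(1) _ b2(1)])
      show "moment {0} t n u \<le> ennreal (G * norm u powr t * exp (t * real n * b1))" for n
        using G(2)[of u n] by (simp add: mult_ac)
    qed
    then show ?thesis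
    proof eventually_elim
      case (elim \<omega>)
      then obtain E where "\<And>n. norm (mat_prod \<omega> n *v u) \<le> E * exp (real n * b2)" by blast
      then show ?case using b2 by (intro Z.slowI[of b2]) auto
    qed
  qed
  have fin: "finite (onb (UNIV :: (real^'n) set))" and sp: "span (onb (UNIV :: (real^'n) set)) = UNIV"
    using onb[OF subspace_UNIV] by auto
  have "AE \<omega> in S. \<forall>u\<in>onb UNIV. Z.slow \<gamma> \<omega> u" using fin slow1 by (intro AE_finite_allI) auto
  then have "AE \<omega> in S. \<forall>u\<in>UNIV. Z.slow \<gamma> \<omega> u"
  proof eventually_elim
    case (elim \<omega>)
    then have "span (onb UNIV) \<subseteq> {u. Z.slow \<gamma> \<omega> u}" by (intro span_minimal Z.subspace_slow) auto
    then show ?case unfolding sp by blast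
  qed
  then have "\<gamma> < \<gamma>"
    using UNIV_not_singleton[of "0::real^'n"] onorm_growth[OF n]
    by (intro Z.slow_rate[OF subspace_UNIV]) (auto simp: \<gamma>_def)
  then show False by simp
qed

lemma abs_ln_diff_le:
  fixes x y c :: real
  assumes "x \<ge> c" "y \<ge> c" "c > 0"
  shows "\<bar>ln x - ln y\<bar> \<le> \<bar>x - y\<bar> / c"
proof -
  have *: "ln x - ln y \<le> \<bar>x - y\<bar> / c" if "x \<ge> c" "y \<ge> c" for x y :: real
  proof -
    have p: "x > 0" "y > 0" using that assms(3) by auto
    have "ln x - ln y = ln (x / y)" using p by (simp add: ln_div)
    also have "\<dots> \<le> x / y - 1" using p by (intro ln_le_minus_one) simp
    also have "\<dots> = (x - y) / y" using p by (simp add: diff_divide_distrib)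
    also have "\<dots> \<le> \<bar>x - y\<bar> / c" using that assms(3) by (intro frac_le) auto
    finally show ?thesis .
  qed
  from *[OF assms(1,2)] *[OF assms(2,1)] show ?thesis by (simp add: abs_le_iff abs_minus_commute)
qed

text \<open>For unit representatives the gap is the area, which bounds their distance up to sign,
  and a sign does not affect the norm of an image. The factor 2 comes from that distance, one
  \<open>KK\<close> from the action of g, and one from the logarithm, as the images have length at
  least 1 / KK.\<close>

lemma ln_pn_lipschitz:
  assumes g: "g \<in> \<Sigma>" and uv: "u \<notin> V" "v \<notin> V"
  shows "\<bar>ln (pn (g *v u) / pn u) - ln (pn (g *v v) / pn v)\<bar> \<le> 2 * KK\<^sup>2 * gap u v"
proof -
  define a b where "a = (1 / pn u) *\<^sub>R qproj V u" and "b = (1 / pn v) *\<^sub>R qproj V v"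
  have p: "pn u > 0" "pn v > 0" by (auto intro!: pn_pos uv simp del: zero_less_norm_iff)
  have un: "norm a = 1" "norm b = 1" using p by (simp_all add: a_def b_def)
  have ar: "area a b = gap u v" using p by (simp add: a_def b_def area_scale gap_def)
  have pna: "pn (g *v a) = pn (g *v u) / pn u" "pn (g *v b) = pn (g *v v) / pn v"
    using qproj_mv_qproj[OF V inv_V[OF g]] by (simp_all add: a_def b_def matrix_vector_mult_scaleR qproj_scale)
  have pa: "pn a = 1" "pn b = 1" using p by (simp_all add: a_def b_def qproj_scale qproj_idem[OF V])
  have lo: "1 / KK \<le> pn (g *v a)" "1 / KK \<le> pn (g *v b)"
    using pn_mv(2)[OF g, of a] pn_mv(2)[OF g, of b] pa KK_pos by (simp_all add: pos_divide_le_eq mult.commute)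
  have diff: "\<bar>pn (g *v a) - pn (g *v b)\<bar> \<le> KK * (2 * gap u v)"
  proof -
    have sq: "x \<le> 2 * gap u v" if "x\<^sup>2 \<le> 2 * (gap u v)\<^sup>2" "x \<ge> 0" for x :: real
    proof (rule power2_le_imp_le)
      have "2 * (gap u v)\<^sup>2 \<le> (2 * gap u v)\<^sup>2" by (simp add: power_mult_distrib)
      then show "x\<^sup>2 \<le> (2 * gap u v)\<^sup>2" using that by linarith
    qed simp
    have b: "pn (g *v w) \<le> KK * norm w" for w
      using norm_qproj_le[OF V] KK(2)[OF g] order_trans by blast
    consider "(norm (a - b))\<^sup>2 \<le> 2 * (gap u v)\<^sup>2" | "(norm (a + b))\<^sup>2 \<le> 2 * (gap u v)\<^sup>2"
      using area_eq_0_unit[OF un] ar by auto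
    then show ?thesis
    proof cases
      case 1
      have "\<bar>pn (g *v a) - pn (g *v b)\<bar> \<le> norm (qproj V (g *v a) - qproj V (g *v b))" by (rule norm_triangle_ineq3)
      also have "\<dots> = pn (g *v (a - b))" by (simp add: matrix_vector_mult_diff_distrib qproj_diff)
      also have "\<dots> \<le> KK * norm (a - b)" by (rule b)
      also have "\<dots> \<le> KK * (2 * gap u v)" using sq[OF 1] KK_pos by (intro mult_left_mono) auto
      finally show ?thesis .
    next
      case 2
      have "\<bar>pn (g *v a) - pn (g *v b)\<bar> \<le> norm (qproj V (g *v a) + qproj V (g *v b))"
        using norm_triangle_ineq3[of "qproj V (g *v a)" "- qproj V (g *v b)"] by simp
      also have "\<dots> = pn (g *v (a + b))" by (simp add: matrix_vector_right_distrib qproj_add)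
      also have "\<dots> \<le> KK * norm (a + b)" by (rule b)
      also have "\<dots> \<le> KK * (2 * gap u v)" using sq[OF 2] KK_pos by (intro mult_left_mono) auto
      finally show ?thesis .
    qed
  qed
  have "\<bar>ln (pn (g *v a)) - ln (pn (g *v b))\<bar> \<le> \<bar>pn (g *v a) - pn (g *v b)\<bar> / (1 / KK)"
    using lo KK_pos by (intro abs_ln_diff_le) auto
  also have "\<dots> \<le> KK * (2 * gap u v) / (1 / KK)" using diff KK_pos by (intro divide_right_mono) auto
  also have "\<dots> = 2 * KK\<^sup>2 * gap u v" by (simp add: power2_eq_square)
  finally show ?thesis unfolding pna .
qed

lemma transfer_exists:
  assumes n: "2 \<le> CARD('n)" and sl: "slow_space (lyapunov 1 \<mu>) V" and l: "lyapunov 2 \<mu> < lyapunov 1 \<mu>"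
  obtains \<rho> K \<kappa> M C u0 where "transfer \<Sigma> \<mu> (UNIV - V) \<rho> (\<lambda>g u. ln (pn (g *v u) / pn u)) K \<kappa> M C u0"
proof (rule gap_contraction[OF n sl l])
  fix \<alpha> \<kappa> C \<rho> assume \<rho>: "0 < \<alpha>" "\<alpha> \<le> 1" "0 < \<kappa>" "\<kappa> < 1" "C \<ge> 1"
    "continuous_on ((UNIV - V) \<times> (UNIV - V)) \<rho>"
    "\<And>u v. u \<notin> V \<Longrightarrow> v \<notin> V \<Longrightarrow> gap u v powr \<alpha> \<le> \<rho> (u, v)"
    "\<And>u v. u \<notin> V \<Longrightarrow> v \<notin> V \<Longrightarrow> \<rho> (u, v) \<le> C * gap u v powr \<alpha>"
    "\<And>u v. u \<notin> V \<Longrightarrow> v \<notin> V \<Longrightarrow> (\<integral>g. \<rho> (g *v u, g *v v) \<partial>\<mu>) \<le> \<kappa> * \<rho> (u, v)"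
  obtain u0 where u0: "u0 \<notin> V" using sl by (auto simp: slow_space_def)
  define K where "K = C * (KK ^ 4) powr \<alpha>"
  \<comment> \<open>One constant for two requirements on the one-step growth: 2 * KK^2 for its
    Lipschitz bound and ln KK for its size.\<close>
  define C1 where "C1 = 2 * KK\<^sup>2 + ln KK"
  have lnK: "ln KK \<ge> 0" using KK(1) by simp
  have pw: "(KK ^ 4) powr \<alpha> \<ge> 1" using KK(1) \<rho>(1) by (intro ge_one_powr_ge_zero one_le_power) auto
  have gapw: "gap u v powr \<alpha> \<le> 1" for u v
  proof -
    have "gap u v powr \<alpha> \<le> 1 powr \<alpha>"
      using \<rho>(1) gap_le_1[of u v] gap_nonneg[of u v] by (intro powr_mono2) (auto simp del: gap_nonneg)
    then show ?thesis by simp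
  qed
  have "transfer \<Sigma> \<mu> (UNIV - V) \<rho> (\<lambda>g u. ln (pn (g *v u) / pn u)) K \<kappa> C C1 u0"
  proof (unfold_locales; (elim DiffE)?)
    show "compact \<Sigma>" by (rule compact)
    show "\<mu> \<in> Prob \<Sigma>" by (rule \<mu>)
    show "u0 \<in> UNIV - V" using u0 by simp
    show "g *v u \<in> UNIV - V" if "g \<in> \<Sigma>" "u \<notin> V" for g u using mv_mem_V that by simp
    show "continuous_on ((UNIV - V) \<times> (UNIV - V)) \<rho>" by (rule \<rho>)
    show "0 \<le> \<rho> (u, v)" if "u \<notin> V" "v \<notin> V" for u v
      using \<rho>(7)[OF that] by (rule order_trans[rotated]) simp
    show "\<rho> (u, u) = 0" if "u \<notin> V" for u
      using \<rho>(7)[OF that that] \<rho>(8)[OF that that] \<rho>(1) by simp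
    show "\<rho> (u, v) \<le> C" if "u \<notin> V" "v \<notin> V" for u v
      using order_trans[OF \<rho>(8)[OF that] mult_left_le[OF gapw]] \<rho>(5) by simp
    show "\<rho> (g *v u, g *v v) \<le> K * \<rho> (u, v)" if "g \<in> \<Sigma>" "u \<notin> V" "v \<notin> V" for g u v
    proof -
      have "\<rho> (g *v u, g *v v) \<le> C * gap (g *v u) (g *v v) powr \<alpha>" using that mv_mem_V by (intro \<rho>) auto
      also have "\<dots> \<le> C * (KK ^ 4 * gap u v) powr \<alpha>"
        using \<rho>(1,5) gap_mv[OF that] by (intro mult_left_mono powr_mono2) auto
      also have "\<dots> = K * gap u v powr \<alpha>" using KK_pos by (simp add: powr_mult K_def)
      also have "\<dots> \<le> K * \<rho> (u, v)" unfolding K_def using \<rho>(5) \<rho>(7)[OF that(2,3)] by (intro mult_left_mono) auto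
      finally show ?thesis .
    qed
    show "(\<integral>g. \<rho> (g *v u, g *v v) \<partial>\<mu>) \<le> \<kappa> * \<rho> (u, v)" if "u \<notin> V" "v \<notin> V" for u v
      by (rule \<rho>(9)[OF that])
    show "1 \<le> K" unfolding K_def using mult_mono[OF \<rho>(5) pw] \<rho>(5) by simp
    show "0 \<le> C1" using lnK by (simp add: C1_def)
    show "continuous_on \<Sigma> (\<lambda>g. ln (pn (g *v u) / pn u))" if u: "u \<notin> V" for u
      using mv_mem_V pn_pos u qproj_eq_0_iff[OF V] by (intro continuous_intros) auto
    show "\<bar>ln (pn (g *v u) / pn u) - ln (pn (g *v v) / pn v)\<bar> \<le> C1 * \<rho> (u, v)"
      if "g \<in> \<Sigma>" "u \<notin> V" "v \<notin> V" for g u v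
    proof -
      \<comment> \<open>The gap is at most 1 and \<alpha> \<le> 1, so a Lipschitz bound in terms of
        the gap is also one in terms of \<rho>.\<close>
      have "gap u v \<le> gap u v powr \<alpha>"
      proof (cases "gap u v = 0")
        case False
        then have "gap u v powr 1 \<le> gap u v powr \<alpha>" using \<rho>(2) gap_le_1 gap_nonneg[of u v] by (intro powr_mono') auto
        then show ?thesis using gap_nonneg[of u v] by (simp del: gap_nonneg)
      qed simp
      then have "gap u v \<le> \<rho> (u, v)" using \<rho>(7)[OF that(2,3)] by linarith
      then have "2 * KK\<^sup>2 * gap u v \<le> C1 * \<rho> (u, v)"
        unfolding C1_def using lnK by (intro mult_mono) auto
      then show ?thesis using ln_pn_lipschitz[OF that] by linarith
    qed
    show "\<bar>ln (pn (g *v u) / pn u)\<bar> \<le> C1" if "g \<in> \<Sigma>" "u \<notin> V" for g u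
    proof -
      have sp: "(\<lambda>_. g) \<in> space S" using that by (simp add: space_S)
      have "\<bar>ln (pn (g *v u) / pn u)\<bar> \<le> ln KK" using ln_pn_bound[OF sp that(2), of 1] by simp
      also have "\<dots> \<le> C1" by (simp add: C1_def)
      finally show ?thesis .
    qed
  qed (use \<rho> in auto)
  then show thesis by (rule that)
qed

end

lemma (in compact_base) integral_perturb:
  fixes f :: "'a \<Rightarrow> real"
  assumes \<mu>: "\<mu> \<in> Prob \<Sigma>" "\<mu>' \<in> Prob \<Sigma>" and f: "continuous_on \<Sigma> f"
    and B: "\<And>x. x \<in> \<Sigma> \<Longrightarrow> \<bar>f x\<bar> \<le> B" "0 \<le> B"
  shows "(\<integral>x. f x \<partial>\<mu>') \<le> (\<integral>x. f x \<partial>\<mu>) + tv \<Sigma> (cm_of \<mu>' - cm_of \<mu>) * B"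
proof -
  let ?f = "\<lambda>x. complex_of_real (f x)" and ?d = "cm_of \<mu>' - cm_of \<mu>"
  have c: "cm_of \<mu> \<in> cmeas \<Sigma>" "?d \<in> cmeas \<Sigma>"
    using cm_of_in_cmeas1[OF \<mu>(1)] diff_in_cmeas0[OF cm_of_in_cmeas1[OF \<mu>(2)] cm_of_in_cmeas1[OF \<mu>(1)]]
    by (simp_all only: cmeas1_def cmeas0_def mem_Collect_eq)
  have cf: "continuous_on \<Sigma> ?f" by (intro continuous_intros f)
  have "cm_of \<mu>' = cm_of \<mu> + ?d" by (rule ext) simp
  then have "cint \<Sigma> (cm_of \<mu>') ?f = cint \<Sigma> (cm_of \<mu>) ?f + cint \<Sigma> ?d ?f"
    using cint_measure_add[OF c cf] by (simp only:)
  then have "cint \<Sigma> ?d ?f = cint \<Sigma> (cm_of \<mu>') ?f - cint \<Sigma> (cm_of \<mu>) ?f" by (metis add_diff_cancel_left')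
  also have "\<dots> = of_real ((\<integral>x. f x \<partial>\<mu>') - (\<integral>x. f x \<partial>\<mu>))"
    by (simp only: of_real_diff cint_prob[OF \<mu>(1) f] cint_prob[OF \<mu>(2) f])
  finally have "cint \<Sigma> ?d ?f = of_real ((\<integral>x. f x \<partial>\<mu>') - (\<integral>x. f x \<partial>\<mu>))" .
  moreover have "cmod (cint \<Sigma> ?d ?f) \<le> tv \<Sigma> ?d * B" using B by (intro cint_bound c cf) auto
  ultimately have "cmod (of_real ((\<integral>x. f x \<partial>\<mu>') - (\<integral>x. f x \<partial>\<mu>))) \<le> tv \<Sigma> ?d * B" by (simp only:)
  then have "\<bar>(\<integral>x. f x \<partial>\<mu>') - (\<integral>x. f x \<partial>\<mu>)\<bar> \<le> tv \<Sigma> ?d * B" by (simp only: norm_of_real)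
  then show ?thesis by linarith
qed

section \<open>Stability of moments and invariance of the slow space\<close>

context random_product
begin

lemma moment_le_adapted:
  assumes inv: "\<And>g x. g \<in> \<Sigma> \<Longrightarrow> x \<in> V \<Longrightarrow> g *v x \<in> V"
    and \<eta>: "continuous_on V \<eta>" "\<And>x. x \<in> V \<Longrightarrow> norm x powr s \<le> \<eta> x"
      "\<And>x. x \<in> V \<Longrightarrow> (\<integral>g. \<eta> (g *v x) \<partial>\<mu>) \<le> exp c * \<eta> x"
    and x: "x \<in> V"
  shows "moment {0} s n x \<le> ennreal (exp (real n * c) * \<eta> x)"
  using x
proof (induction n arbitrary: x)
  case 0
  then show ?case using \<eta>(2) by (simp add: moment_0 ennreal_leI)
next
  case (Suc n)
  interpret B: compact_base \<Sigma> by unfold_locales (rule compact)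
  have pos: "0 \<le> \<eta> y" if "y \<in> V" for y using \<eta>(2)[OF that] by (rule order_trans[rotated]) simp
  have "continuous_on \<Sigma> (\<lambda>g. \<eta> (g *v x))"
    using inv Suc.prems by (intro continuous_on_compose2[OF \<eta>(1)] continuous_intros) auto
  then have int: "integrable \<mu> (\<lambda>g. \<eta> (g *v x))" by (rule B.continuous_integrable[OF \<mu>])
  have "moment {0} s (Suc n) x \<le> (\<integral>\<^sup>+g. ennreal (exp (real n * c) * \<eta> (g *v x)) \<partial>\<mu>)"
    unfolding moment_Suc by (intro nn_integral_mono Suc.IH inv Suc.prems) (simp add: space_mu)
  also have "\<dots> = ennreal (\<integral>g. exp (real n * c) * \<eta> (g *v x) \<partial>\<mu>)"
    using int pos inv Suc.prems by (intro nn_integral_eq_integral AE_I2) (auto simp: space_mu)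
  also have "\<dots> \<le> ennreal (exp (real (Suc n) * c) * \<eta> x)"
    using \<eta>(3)[OF Suc.prems]
    by (intro ennreal_leI) (simp add: distrib_right exp_add mult.assoc add.commute)
  finally show ?case .
qed

text \<open>For fixed v in V the condition that h moves v out of V is open in h. A single g in the
  support satisfying it would give the condition positive measure.\<close>

lemma supp_invariant:
  assumes supp: "supp \<mu> = \<Sigma>" and V: "subspace V" "AE g in \<mu>. (*v) g ` V = V" and g: "g \<in> \<Sigma>"
  shows "(*v) g ` V = V"
proof -
  interpret Z: quotient_product \<Sigma> \<mu> "{0}" by (rule quotient_product_0)
  have "g *v v \<in> V" if v: "v \<in> V" for v
  proof (rule ccontr)
    assume nv: "g *v v \<notin> V"
    define U where "U = {h :: real^'n^'n. h *v v \<notin> V}"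
    have "continuous_on UNIV (\<lambda>h :: real^'n^'n. h *v v)" by (intro continuous_intros)
    then have "open ((\<lambda>h :: real^'n^'n. h *v v) -` (- V))"
      using closed_subspace[OF V(1)] by (intro open_vimage) auto
    then have "open U" by (simp add: U_def vimage_def)
    moreover have "g \<in> U" using nv by (simp add: U_def)
    ultimately have "emeasure \<mu> (U \<inter> space \<mu>) > 0" using supp g by (auto simp: supp_def)
    moreover have "AE h in \<mu>. \<not> h \<in> U" using V(2) by eventually_elim (use v in \<open>auto simp: U_def\<close>)
    then have "emeasure \<mu> {h \<in> space \<mu>. h \<in> U} = 0" by (rule emeasure_eq_0_AE)
    ultimately show False by (simp add: Collect_conj_eq Int_commute)
  qed
  then have "(*v) g ` V \<subseteq> V" by blast
  moreover have "dim ((*v) g ` V) = dim V" using invertible g by (intro Z.dim_mv_image) auto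
  ultimately show ?thesis using V(1) by (intro subspace_dim_equal Z.subspace_mv_image) auto
qed

lemma quasi_irreducible_slow_space:
  assumes "quasi_irreducible \<mu>" "slow_space (lyapunov 1 \<mu>) V"
  shows "V = {0}"
proof (rule ccontr)
  assume ne: "V \<noteq> {0}"
  then obtain \<gamma> where "\<gamma> < lyapunov 1 \<mu>" "growth (quot_norm {0} V) \<gamma>" using assms(2) by (auto simp: slow_space_def)
  then have "lyapunov_restr V \<mu> < lyapunov 1 \<mu>" using lyapunov_restr_eqI by simp
  moreover have "invariant_subspace \<mu> V" "V \<noteq> UNIV" using assms(2) by (auto simp: slow_space_def invariant_subspace_def)
  ultimately show False using assms(1) ne by (auto simp: quasi_irreducible_def)
qed

end

text \<open>The mean logarithms are real and stay within bounded distance of n times the top rate,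
  so n times its imaginary part is bounded and the rate is real.\<close>

lemma (in transfer) top_log_mean:
  assumes q: "quotient_product \<Sigma> \<mu> V" and X: "X = UNIV - V"
    and \<Psi>: "\<And>g u. \<Psi> g u = ln (norm (qproj V (g *v u)) / norm (qproj V u))"
    and good: "good (cm_of \<mu>)"
  obtains F B where "top (cm_of \<mu>) = of_real F"
    "\<And>n u. u \<notin> V \<Longrightarrow> \<bar>quotient_product.log_mean \<mu> V n u - real n * F\<bar> \<le> B"
    "\<And>u. u \<notin> V \<Longrightarrow> (\<lambda>n. quotient_product.log_mean \<mu> V n u / real n) \<longlonglongrightarrow> F"
proof -
  interpret q: quotient_product \<Sigma> \<mu> V by (rule q)
  let ?t = "top (cm_of \<mu>)"
  define B where "B = tv \<Sigma> (cm_of \<mu>) * C * pc (cm_of \<mu>) / (1 - \<theta>)"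
  have b: "cmod (of_real (q.log_mean n u) - of_nat n * ?t) \<le> B" if "u \<notin> V" for n u
    unfolding B_def
  proof (rule log_sum[OF q.\<mu> good])
    show "q.log_mean (Suc n) u = (\<integral>g. \<Psi> g u + q.log_mean n (g *v u) \<partial>\<mu>)" if "u \<in> X" for n u
      unfolding \<Psi> using that by (intro q.log_mean_Suc) (simp add: X)
  qed (use that in \<open>simp_all add: X q.log_mean_0\<close>)
  have "Im ?t = 0"
  proof (rule ccontr)
    assume "Im ?t \<noteq> 0"
    then obtain n :: nat where "B < real n * \<bar>Im ?t\<bar>" using ex_less_of_nat_mult[of "\<bar>Im ?t\<bar>" B] by auto
    moreover have "\<bar>Im (of_real (q.log_mean n u0) - of_nat n * ?t)\<bar> \<le> B"
      using b[of u0 n] u0 X by (intro order_trans[OF abs_Im_le_cmod]) auto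
    ultimately show False by (simp add: abs_mult)
  qed
  then have t: "?t = of_real (Re ?t)" by (simp add: complex_eq_iff)
  have bound: "\<bar>q.log_mean n u - real n * Re ?t\<bar> \<le> B" if "u \<notin> V" for n u
    using order_trans[OF abs_Re_le_cmod b[OF that, of n]] by simp
  have "(\<lambda>n. q.log_mean n u / real n) \<longlonglongrightarrow> Re ?t" if u: "u \<notin> V" for u
  proof -
    have le: "norm (q.log_mean n u / real n - Re ?t) \<le> B / real n" if "n > 0" for n
    proof -
      have "q.log_mean n u / real n - Re ?t = (q.log_mean n u - real n * Re ?t) / real n"
        using that by (simp add: field_simps)
      then show ?thesis using divide_right_mono[OF bound[OF u, of n], of "real n"] by simp
    qed
    have "(\<lambda>n. q.log_mean n u / real n - Re ?t) \<longlonglongrightarrow> 0"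
      by (rule Lim_null_comparison[OF _ lim_const_over_n[of B]])
        (use le in \<open>auto simp: eventually_sequentially intro!: exI[of _ 1]\<close>)
    then show ?thesis by (simp add: Lim_null[symmetric])
  qed
  with t bound show ?thesis by (rule that)
qed

theorem (in quotient_product) lyapunov_analytic:
  assumes n: "2 \<le> CARD('n)" and sl: "slow_space (lyapunov 1 \<mu>) V" and l: "lyapunov 2 \<mu> < lyapunov 1 \<mu>"
  shows "real_analytic_near \<Sigma> \<mu> (lyapunov 1)"
proof (rule transfer_exists[OF n sl l])
  fix \<rho> K \<kappa> M C u0
  assume "transfer \<Sigma> \<mu> (UNIV - V) \<rho> (\<lambda>g u. ln (pn (g *v u) / pn u)) K \<kappa> M C u0"
  then interpret T: transfer \<Sigma> \<mu> "UNIV - V" \<rho> "\<lambda>g u. ln (pn (g *v u) / pn u)" K \<kappa> M C u0 .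
  define L where "L = lyapunov 1 \<mu>"
  have u0: "u0 \<notin> V" using T.u0 by simp
  obtain a s where a: "a < L" and s: "0 < s" "s \<le> 1"
    and "\<exists>\<eta> C. continuous_on V \<eta> \<and> C \<ge> 1 \<and>
      (\<forall>x\<in>V. norm x powr s \<le> \<eta> x \<and> \<eta> x \<le> C * norm x powr s \<and> (\<integral>g. \<eta> (g *v x) \<partial>\<mu>) \<le> exp (s * a) * \<eta> x)"
    using slow_space_adapted[OF sl inv_V] unfolding L_def by (metis order_refl)
  then obtain \<eta> D where \<eta>: "continuous_on V \<eta>" and D: "D \<ge> 1"
    and "\<forall>x\<in>V. norm x powr s \<le> \<eta> x \<and> \<eta> x \<le> D * norm x powr s \<and> (\<integral>g. \<eta> (g *v x) \<partial>\<mu>) \<le> exp (s * a) * \<eta> x"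
    by blast
  then have \<eta>lo: "\<And>x. x \<in> V \<Longrightarrow> norm x powr s \<le> \<eta> x" and \<eta>up: "\<And>x. x \<in> V \<Longrightarrow> \<eta> x \<le> D * norm x powr s"
    and \<eta>int: "\<And>x. x \<in> V \<Longrightarrow> (\<integral>g. \<eta> (g *v x) \<partial>\<mu>) \<le> exp (s * a) * \<eta> x" by auto
  obtain a1 where a1: "a < a1" "a1 < L" using a dense by blast
  \<comment> \<open>For \<mu> itself the inequality L \<le> F comes from
    \<open>uniform_expansion\<close>. For nearby measures, whose own slow space is unknown, moments
    on \<open>V\<close> take over this role.\<close>
  have top: "T.top (cm_of \<mu>) = of_real L"
  proof -
    obtain F B where F: "T.top (cm_of \<mu>) = of_real F" "\<And>n u. u \<notin> V \<Longrightarrow> \<bar>log_mean n u - real n * F\<bar> \<le> B"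
      "\<And>u. u \<notin> V \<Longrightarrow> (\<lambda>n. log_mean n u / real n) \<longlonglongrightarrow> F"
      by (rule T.top_log_mean[OF _ refl refl T.good_\<mu>0]) (unfold_locales, blast)
    have "F \<le> L" unfolding L_def by (rule log_mean_le_lyapunov[OF n u0 F(3)[OF u0]])
    moreover have "L \<le> F"
    proof (rule field_le_epsilon)
      fix e :: real assume e: "0 < e"
      obtain C' where C': "\<And>n u. u \<notin> V \<Longrightarrow> real n * (L - e) - C' \<le> log_mean n u"
        using uniform_expansion[OF slow_space_quotient[OF sl] e] unfolding L_def log_mean_def by blast
      show "L \<le> F + e"
      proof (rule ccontr)
        assume "\<not> L \<le> F + e"
        then have "0 < L - e - F" by simp
        then obtain m :: nat where "B + C' < real m * (L - e - F)" using ex_less_of_nat_mult by blast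
        moreover have "real m * (L - e) - C' \<le> real m * F + B" using C'[OF u0, of m] F(2)[OF u0, of m] by linarith
        ultimately show False by (simp add: algebra_simps)
      qed
    qed
    ultimately show ?thesis using F(1) by simp
  qed
  \<comment> \<open>p bounds \<open>T.pc\<close> on the whole neighbourhood, and E is the resulting
    Lipschitz constant of the top rate at \<mu>. G bounds \<eta> at g x relative to norm x powr s,
    and d is the room between the one-step factors for the rates a and a1.\<close>
  define p where "p = M + (tv \<Sigma> (cm_of \<mu>) + 1) * M / (1 - T.\<theta>)"
  define E where "E = T.c0 (cm_of \<mu>) * (1 + p) * T.A"
  define G where "G = D * KK powr s"
  define d where "d = exp (s * a1) - exp (s * a)"
  have p: "0 \<le> p" unfolding p_def using T.M T.\<theta> by simp
  have E: "0 \<le> E" unfolding E_def using T.c0_nonneg T.A_nonneg p by simp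
  have G: "0 < G" unfolding G_def using D KK_pos by simp
  have d: "0 < d" unfolding d_def using a1 s by simp
  \<comment> \<open>The four bounds ensure in turn: the variation grows by at most 1; the operators
    still contract; the one-step inequality on \<open>V\<close> survives with the rate a1; the top
    rate stays above a1.\<close>
  define r where "r = min (min 1 ((T.\<theta> - \<kappa>) / K)) (min (d / G) ((L - a1) / (E + 1)))"
  have r: "0 < r" unfolding r_def using T.\<theta> T.K G d E a1 by simp
  have r1: "r \<le> 1" "r \<le> (T.\<theta> - \<kappa>) / K" "r \<le> d / G" "r \<le> (L - a1) / (E + 1)" by (auto simp: r_def)
  have rG: "r * G \<le> d" using r1(3) G by (simp add: pos_le_divide_eq)
  have "r * (E + 1) \<le> L - a1" using r1(4) E by (simp add: pos_le_divide_eq)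
  then have rE: "E * r < L - a1" using r by (simp add: algebra_simps)
  show ?thesis
    unfolding real_analytic_near_def
  proof (intro exI[of _ "T.nbhd r"] exI[of _ T.top] conjI ballI impI)
    show "openin (norm_topology (cmeas1 \<Sigma>) (tv \<Sigma>)) (T.nbhd r)" by (rule T.openin_nbhd)
    show "cm_of \<mu> \<in> T.nbhd r"
      using cm_of_in_cmeas1[OF \<mu>] r
      by (simp add: T.nbhd_iff tv_norm_def total_variation_zero[unfolded zero_fun_def] zero_fun_def)
    show "holomorphic_in_affine (cm_of \<mu>) (cmeas0 \<Sigma>) (tv \<Sigma>) (T.nbhd r) T.top"
      by (rule T.top_holomorphic[OF r r1(2)])
    fix \<mu>' assume \<mu>': "\<mu>' \<in> Prob \<Sigma>" "cm_of \<mu>' \<in> T.nbhd r"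
    \<comment> \<open>Legitimate for every probability measure on \<Sigma>, since all of \<Sigma>
      preserves \<open>V\<close>.\<close>
    interpret Q: quotient_product \<Sigma> \<mu>' V
      by unfold_locales (use \<mu>' V inv_V in auto)
    have good: "T.good (cm_of \<mu>')" by (rule T.good_nbhd[OF r1(2) \<mu>'(2)])
    define \<delta> where "\<delta> = tv \<Sigma> (cm_of \<mu>' - cm_of \<mu>)"
    have \<delta>: "0 \<le> \<delta>" "\<delta> < r" using \<mu>'(2) by (simp_all add: \<delta>_def T.nbhd_iff)
    obtain F B where F: "T.top (cm_of \<mu>') = of_real F" "\<And>n u. u \<notin> V \<Longrightarrow> \<bar>Q.log_mean n u - real n * F\<bar> \<le> B"
      "\<And>u. u \<notin> V \<Longrightarrow> (\<lambda>n. Q.log_mean n u / real n) \<longlonglongrightarrow> F"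
      by (rule T.top_log_mean[OF _ refl refl good]) (unfold_locales, blast)
    have "a1 < F"
    proof -
      have "tv \<Sigma> (cm_of \<mu>') \<le> \<delta> + tv \<Sigma> (cm_of \<mu>)"
        unfolding \<delta>_def using T.good_cmeas(1)[OF good] T.good_cmeas(1)[OF T.good_\<mu>0] by (rule T.tv_triangle)
      then have "tv \<Sigma> (cm_of \<mu>') \<le> tv \<Sigma> (cm_of \<mu>) + 1" using \<delta> r1(1) by linarith
      then have pc: "T.pc (cm_of \<mu>') \<le> p"
        unfolding T.pc_def p_def using T.M T.\<theta> by (intro add_mono divide_right_mono mult_right_mono) auto
      have "cmod (T.top (cm_of \<mu>') - T.top (cm_of \<mu>)) \<le> T.c0 (cm_of \<mu>) * (1 + T.pc (cm_of \<mu>')) * (T.A * \<delta>)"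
        unfolding \<delta>_def by (rule T.top_lipschitz[OF T.good_\<mu>0 good])
      also have "\<dots> \<le> T.c0 (cm_of \<mu>) * (1 + p) * (T.A * r)"
        using pc p \<delta> r T.c0_nonneg T.A_nonneg by (intro mult_mono mult_left_mono add_left_mono mult_nonneg_nonneg) auto
      also have "\<dots> = E * r" by (simp add: E_def)
      finally have "\<bar>F - L\<bar> \<le> E * r" unfolding F(1) top by (simp flip: of_real_diff)
      then show ?thesis using rE by linarith
    qed
    have lower: "F \<le> lyapunov 1 \<mu>'" by (rule Q.log_mean_le_lyapunov[OF n u0 F(3)[OF u0]])
    have int: "(\<integral>g. \<eta> (g *v x) \<partial>\<mu>') \<le> exp (s * a1) * \<eta> x" if x: "x \<in> V" for x
    proof -
      have gx: "g *v x \<in> V" if "g \<in> \<Sigma>" for g using mv_mem_V[OF that] x by simp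
      define B' where "B' = G * norm x powr s"
      have "\<bar>\<eta> (g *v x)\<bar> \<le> B'" if g: "g \<in> \<Sigma>" for g
      proof -
        have "0 \<le> \<eta> (g *v x)" using \<eta>lo[OF gx[OF g]] by (rule order_trans[rotated]) simp
        moreover have "\<eta> (g *v x) \<le> D * norm (g *v x) powr s" by (rule \<eta>up[OF gx[OF g]])
        moreover have "norm (g *v x) powr s \<le> (KK * norm x) powr s" using s KK(2)[OF g] by (intro powr_mono2) auto
        then have "D * norm (g *v x) powr s \<le> D * (KK * norm x) powr s" using D by (intro mult_left_mono) auto
        moreover have "D * (KK * norm x) powr s = B'" using KK_pos by (simp add: B'_def G_def powr_mult)
        ultimately show ?thesis by linarith
      qed
      moreover have "continuous_on \<Sigma> (\<lambda>g. \<eta> (g *v x))"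
        using gx by (intro continuous_on_compose2[OF \<eta>] continuous_intros) auto
      moreover have "0 \<le> B'" unfolding B'_def using G by simp
      ultimately have "(\<integral>g. \<eta> (g *v x) \<partial>\<mu>') \<le> (\<integral>g. \<eta> (g *v x) \<partial>\<mu>) + \<delta> * B'"
        unfolding \<delta>_def by (intro T.integral_perturb[OF \<mu> \<mu>'(1)]) auto
      moreover have "\<delta> * B' \<le> d * \<eta> x"
      proof -
        have "\<delta> * B' \<le> (r * G) * norm x powr s"
          unfolding B'_def mult.assoc[symmetric] using \<delta> G by (intro mult_right_mono) auto
        also have "\<dots> \<le> d * \<eta> x" using rG d \<eta>lo[OF x] by (intro mult_mono) auto
        finally show ?thesis .
      qed
      ultimately have "(\<integral>g. \<eta> (g *v x) \<partial>\<mu>') \<le> exp (s * a) * \<eta> x + d * \<eta> x" using \<eta>int[OF x] by linarith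
      then show ?thesis by (simp add: d_def algebra_simps)
    qed
    \<comment> \<open>Moments on \<open>V\<close> grow at most at the rate a1 < F, with constants
      independent of n, so growth inside \<open>V\<close> cannot raise the exponent above the rate
      of the quotient.\<close>
    have "lyapunov 1 \<mu>' \<le> F"
    proof (rule Q.lyapunov_le_of_moments[OF n _ s _ \<open>a1 < F\<close>])
      show "Q.log_mean n u \<le> real n * F + B" if "u \<notin> V" for n u using F(2)[OF that, of n] by linarith
      show "0 < D" using D by simp
      show "Q.moment {0} s n x \<le> ennreal (D * exp (s * real n * a1) * norm x powr s)" if x: "x \<in> V" for n x
      proof -
        have "Q.moment {0} s n x \<le> ennreal (exp (real n * (s * a1)) * \<eta> x)"
          using mv_mem_V by (intro Q.moment_le_adapted[OF _ \<eta> \<eta>lo int x]) auto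
        also have "\<dots> \<le> ennreal (exp (real n * (s * a1)) * (D * norm x powr s))"
          using \<eta>up[OF x] by (intro ennreal_leI mult_left_mono) auto
        finally show ?thesis by (simp add: mult_ac)
      qed
    qed
    then show "T.top (cm_of \<mu>') = of_real (lyapunov 1 \<mu>')" using lower F(1) by simp
  qed
qed

theorem theorem1p1:
  fixes \<Sigma> :: "(real^'n^'n) set" and \<mu>0 :: "(real^'n^'n) measure"
  assumes "2 \<le> CARD('n)"
    and "compact \<Sigma>"
    and "\<Sigma> \<subseteq> {g. invertible g}"
    and "\<mu>0 \<in> Prob \<Sigma>"
    and "lyapunov 1 \<mu>0 > lyapunov 2 \<mu>0"
  shows "(quasi_irreducible \<mu>0 \<longrightarrow> real_analytic_near \<Sigma> \<mu>0 (lyapunov 1)) \<and>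
         (supp \<mu>0 = \<Sigma> \<longrightarrow> real_analytic_near \<Sigma> \<mu>0 (lyapunov 1))"
proof -
  interpret random_product \<Sigma> \<mu>0 using assms by unfold_locales auto
  obtain V where sl: "slow_space (lyapunov 1 \<mu>0) V" using slow_space_exists[OF assms(1)] by blast
  have analytic: "real_analytic_near \<Sigma> \<mu>0 (lyapunov 1)" if inv: "\<And>g. g \<in> \<Sigma> \<Longrightarrow> (*v) g ` V = V"
  proof -
    interpret quotient_product \<Sigma> \<mu>0 V
      by unfold_locales (use sl inv in \<open>auto simp: slow_space_def\<close>)
    show ?thesis by (rule lyapunov_analytic[OF assms(1) sl assms(5)])
  qed
  have "real_analytic_near \<Sigma> \<mu>0 (lyapunov 1)" if "quasi_irreducible \<mu>0"
    by (rule analytic) (simp add: quasi_irreducible_slow_space[OF that sl])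
  moreover have "real_analytic_near \<Sigma> \<mu>0 (lyapunov 1)" if "supp \<mu>0 = \<Sigma>"
    using supp_invariant[OF that] sl by (intro analytic) (auto simp: slow_space_def)
  ultimately show ?thesis by blast
qed

end
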